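(* Let $\alpha>0$. Let $(c_j)_{j\in\mathbb{N}}$ be a sequence of real numbers with $\sum_{j=1}^\infty |c_j|<\infty$ and let $(\lambda_j)_{j\in\mathbb{N}}$ be a bounded sequence of real numbers attaining its bounds. Extend both sequences to $\mathbb{Z}\setminus\{0\}$ by $c_{-j}:=c_j$ and $\lambda_{-j}:=-\lambda_j$. Let $z\in\mathbb{R}$ satisfy $$-\frac{1}{6}\sqrt{\frac{\pi\alpha}{2}}\le z\le \frac{1}{6}\sqrt{\frac{\pi\alpha}{2}}.$$ Define $$\tilde F_{z,\alpha}(s):=\sum_{j\neq 0} c_j\,\pi^{-(s+i\lambda_j)}\Gamma(s+i\lambda_j)\,\zeta_\alpha(s+i\lambda_j)\left\{ {}_1F_1\!\left(\tfrac{\alpha}{2}-s-i\lambda_j;\tfrac{\alpha}{2};\tfrac{z^2}{4}\right)+{}_1F_1\!\left(\tfrac{\alpha}{2}-\overline{s}+i\lambda_j;\tfrac{\alpha}{2};\tfrac{z^2}{4}\right)\right\},$$ and let $N_{\alpha,z}(T)$ be the number of zeros of $\tilde F_{z,\alpha}$ of the form $s=\frac{\alpha}{4}+it$ with $0\le t\le T$. Then there exists $c>0$ such that $$\liminf_{T\to\infty}\frac{N_{\alpha,z}(T)}{\sqrt{T}/\log T}\ge c.$$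
   Context: For $x>0$ let $\theta(x)=\sum_{n\in\mathbb{Z}}e^{-\pi n^2 x}$. For $\alpha>0$, the arithmetical function $r_\alpha(n)$ is defined by the expansion $\theta(x)^\alpha-1=\sum_{n=1}^\infty r_\alpha(n)e^{-\pi n x}$ ($x>0$, and by analytic continuation for $\mathrm{Re}(x)>0$). The Dirichlet series $\zeta_\alpha(s)=\sum_{n\ge1} r_\alpha(n)n^{-s}$ converges for $\mathrm{Re}(s)$ sufficiently large and extends meromorphically to $\mathbb{C}$, its only singularity being a simple pole at $s=\alpha/2$; it satisfies $\eta_\alpha(s)=\eta_\alpha(\frac{\alpha}{2}-s)$ where $\eta_\alpha(s)=\pi^{-s}\Gamma(s)\zeta_\alpha(s)$. ${}_1F_1(a;c;w)=\sum_{n\ge0}\frac{(a)_n}{(c)_n}\frac{w^n}{n!}$ is Kummer's confluent hypergeometric function. *)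

theory Defs
  imports "HOL-Complex_Analysis.Complex_Analysis"
begin

definition theta :: "real \<Rightarrow> real" where
  "theta x = (\<Sum>\<^sub>\<infinity>n\<in>(UNIV :: int set). exp (- pi * (of_int n)\<^sup>2 * x))"

(* The coefficients are determined by the expansion for n >= 1; the normalisation r 0 = 0
   (there is no constant term) makes the sequence unique and lets sums start at 0. *)
definition r_alpha :: "real \<Rightarrow> nat \<Rightarrow> real" where
  "r_alpha \<alpha> = (THE r. r 0 = 0 \<and>
     (\<forall>x>0. (\<lambda>n. r n * exp (- pi * real n * x)) sums (theta x powr \<alpha> - 1)))"

(* The Dirichlet series continued to the complex plane minus its pole alpha/2. At the pole
   the value is set to 0, so that the continuation is unique as a total function.
   The term n = 0 of the series vanishes because r_alpha alpha 0 = 0. *)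
definition zeta_alpha :: "real \<Rightarrow> complex \<Rightarrow> complex" where
  "zeta_alpha \<alpha> = (THE f. f holomorphic_on (- {of_real (\<alpha> / 2)}) \<and> f (of_real (\<alpha> / 2)) = 0 \<and>
     (\<exists>\<sigma>. \<forall>s. Re s > \<sigma> \<longrightarrow>
        (\<lambda>n. of_real (r_alpha \<alpha> n) * of_nat n powr (- s)) sums f s))"

definition kummer_1F1 :: "complex \<Rightarrow> complex \<Rightarrow> complex \<Rightarrow> complex" where
  "kummer_1F1 a c w = (\<Sum>n. pochhammer a n / pochhammer c n * w ^ n / fact n)"

(* Extensions of a sequence indexed by j = 1, 2, ... to the nonzero integers; the values
   at 0 are never used. *)
definition even_ext :: "(nat \<Rightarrow> real) \<Rightarrow> int \<Rightarrow> real" where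
  "even_ext c j = c (nat \<bar>j\<bar>)"

definition odd_ext :: "(nat \<Rightarrow> real) \<Rightarrow> int \<Rightarrow> real" where
  "odd_ext l j = (if j > 0 then l (nat j) else - l (nat (- j)))"

definition F_tilde ::
  "(nat \<Rightarrow> real) \<Rightarrow> (nat \<Rightarrow> real) \<Rightarrow> real \<Rightarrow> real \<Rightarrow> complex \<Rightarrow> complex" where
  "F_tilde c l z \<alpha> s = (\<Sum>\<^sub>\<infinity>j\<in>-{0 :: int}.
     (let w = \<i> * of_real (odd_ext l j) in
       of_real (even_ext c j) * of_real pi powr (- (s + w)) * Gamma (s + w)
         * zeta_alpha \<alpha> (s + w)
         * (kummer_1F1 (of_real (\<alpha> / 2) - s - w) (of_real (\<alpha> / 2)) (of_real (z\<^sup>2 / 4))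
          + kummer_1F1 (of_real (\<alpha> / 2) - cnj s + w) (of_real (\<alpha> / 2)) (of_real (z\<^sup>2 / 4)))))"

(* Distinct zeros, counted in the extended naturals: F_tilde may vanish identically
   (for instance if all c j are 0), and then the count is infinite rather than the
   value 0 that card gives for an infinite set. *)
definition N_zeros ::
  "(nat \<Rightarrow> real) \<Rightarrow> (nat \<Rightarrow> real) \<Rightarrow> real \<Rightarrow> real \<Rightarrow> real \<Rightarrow> enat" where
  "N_zeros c l z \<alpha> T =
     (let Z = {s. F_tilde c l z \<alpha> s = 0 \<and>
                  (\<exists>t. 0 \<le> t \<and> t \<le> T \<and> s = of_real (\<alpha> / 4) + \<i> * of_real t)}
      in if finite Z then enat (card Z) else \<infinity>)"

end

theory Submission
  imports Defs "HOL-Probability.Characteristic_Functions" "HOL-Real_Asymp.Real_Asymp"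
begin

text \<open>
  On the line \<open>s = \<alpha>/4 + i t\<close> the summand with index \<open>j\<close> is \<open>c\<^sub>j \<Phi> (t + \<lambda>\<^sub>j)\<close>, where \<open>\<Phi>\<close> is the product
  of the completed zeta function \<open>\<Xi>\<close> and of the sum of two conjugate Kummer values; so \<open>F\<close> is real,
  continuous and even in \<open>t\<close>.  The function \<open>\<Xi>\<close> is the Fourier transform of
  \<open>e\<^bsup>\<alpha>v/4\<^esup> \<theta>(e\<^sup>v)\<^sup>\<alpha> - e\<^bsup>\<alpha>v/4\<^esup> - e\<^bsup>-\<alpha>v/4\<^esup>\<close>, which continues to the strip \<open>|Im v| < \<pi>/2\<close>.  Since \<open>\<theta>\<close>
  vanishes to infinite order at \<open>i\<close>, at height \<open>\<pi>/2 - \<delta>\<close> only the two exponentials survive, up to an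
  error of size \<open>exp (- \<pi>\<alpha> / (12 \<delta>))\<close>.  Differentiating the inversion formula, the integral of
  \<open>F(t) P(t) exp ((\<pi>/2 - \<delta>) t)\<close> for a polynomial \<open>P\<close> is governed by the values of \<open>P\<close> at the points
  \<open>\<plusminus> i \<alpha>/4 - \<lambda>\<^sub>j\<close>, which stay bounded.  The Kummer factor is a series in such polynomials; it
  costs at most \<open>exp (8 y / \<delta>)\<close> with \<open>y = z\<^sup>2/4\<close>, and this is dominated because \<open>y \<le> \<pi>\<alpha>/288\<close>.

  Suppose that \<open>F\<close> has \<open>K\<close> zeros in \<open>[0, T]\<close>.  Let the even polynomial \<open>P\<close> change sign with \<open>F\<close> on
  \<open>[-T, T]\<close> and have in addition a zero of order \<open>2 (K + m)\<close> at \<open>0\<close>.  Then \<open>F P\<close> has constant sign on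
  \<open>[-T, T]\<close>, so that its integral is at least the contribution of a window away from \<open>0\<close>, whereas the
  values of \<open>P\<close> at the bounded points are smaller than those on the window by a factor of order \<open>4\<^bsup>-m\<^esup>\<close>.
  The degree of \<open>P\<close> is about \<open>4 K\<close>, and for \<open>\<delta>\<close> of order \<open>T\<^bsup>-1/2\<^esup>\<close> all error terms tend to \<open>0\<close> as long as
  \<open>K log T\<close> is less than a small multiple of \<open>T\<^bsup>1/2\<^esup>\<close>.
\<close>

section \<open>Integral transforms and contour shifts\<close>

text \<open>The exponent \<alpha> is an arbitrary positive real, so theta needs a holomorphic
  logarithm on the whole unit disc; this is why its zero-freeness is proved before anything else.
  The constants form a budget counted in units of 1/\<delta>. On the disc of radius \<delta>/4 about
  the base point, theta is a small difference of size exp(-pi/(10 \<delta>)) times a square root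
  that is charged exp(pi/(60 \<delta>)); 1/10 - 1/60 is the 1/12. Of pi \<alpha>/12 the Kummer
  factor may spend one third, and 8 y \<le> pi \<alpha>/36 is the bound on y. Another third pays for
  the polynomial, the last is left as decay. The scale \<delta> ~ T^(-1/2) arises because the part
  of the integral beyond T decays only like exp(-\<delta> T/8), while the Kummer factor grows
  exponentially in 1/\<delta>: \<delta> T has to dominate 1/\<delta>. A polynomial of degree D costs
  at most a fixed power of T to the D, which gives the logarithm. P must be even because the sign of
  F P is needed on both sides of 0; F itself is even.\<close>

lemma power_div_fact_le_exp:
  fixes x :: real
  assumes "x \<ge> 0"
  shows "x ^ k / fact k \<le> exp x"
proof -
  have "(\<lambda>n. x ^ n / fact n) sums exp x"
    using exp_converges[of x] by (simp add: field_simps)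
  thus ?thesis
    using sum_le_suminf[of "\<lambda>n. x ^ n / fact n" "{k}"] assms by (auto simp: sums_iff)
qed

text \<open>All partial sums of the exponential series, taken in absolute values, stay below
  \<open>exp (r * \<bar>u\<bar>)\<close>; this single majorant justifies exchanging sum and
  integral. The integral thus becomes a power series in \<open>h\<close> whose coefficients are the
  moments of \<open>f\<close>.\<close>

lemma exp_moment_sums:
  fixes f :: "real \<Rightarrow> complex"
  assumes meas: "f \<in> borel_measurable borel"
    and int: "integrable lborel (\<lambda>u. norm (f u) * exp (r * \<bar>u\<bar>))"
    and h: "norm h \<le> r"
  shows "(\<lambda>k. h ^ k / fact k * (LINT u|lborel. f u * of_real u ^ k))
           sums (LINT u|lborel. f u * exp (h * of_real u))"
proof -
  define F where "F = (\<lambda>k u. f u * of_real u ^ k * (h ^ k / fact k))"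
  have r: "r \<ge> 0" using h norm_ge_zero order_trans by blast
  have term_bound: "norm (F k u) \<le> norm (f u) * ((norm h * \<bar>u\<bar>) ^ k / fact k)" for k u
    by (simp add: F_def norm_mult norm_divide norm_power power_mult_distrib mult_ac)
  have exp_bound: "exp (norm h * \<bar>u\<bar>) \<le> exp (r * \<bar>u\<bar>)" for u
    using h by (simp add: mult_right_mono)
  have meas': "(\<lambda>u. F k u) \<in> borel_measurable lborel" for k
    unfolding F_def using meas by measurable
  have intF: "integrable lborel (F k)" for k
  proof (rule Bochner_Integration.integrable_bound[OF int meas'])
    have "norm (F k u) \<le> norm (norm (f u) * exp (r * \<bar>u\<bar>))" for u
    proof -
      have "norm (F k u) \<le> norm (f u) * exp (norm h * \<bar>u\<bar>)"
        by (rule order_trans[OF term_bound mult_left_mono[OF power_div_fact_le_exp]]) auto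
      also have "\<dots> \<le> norm (f u) * exp (r * \<bar>u\<bar>)"
        using exp_bound by (intro mult_left_mono) auto
      finally show ?thesis by simp
    qed
    thus "AE x in lborel. norm (F k x) \<le> norm (norm (f x) * exp (r * \<bar>x\<bar>))" by simp
  qed
  have norm_sums: "(\<lambda>k. norm (f u) * ((norm h * \<bar>u\<bar>) ^ k / fact k)) sums
      (norm (f u) * exp (norm h * \<bar>u\<bar>))" for u
    using sums_mult[OF exp_converges[of "norm h * \<bar>u\<bar>"], of "norm (f u)"] by (simp add: field_simps)
  have normF: "(\<lambda>k. norm (F k u)) sums (norm (f u) * exp (norm h * \<bar>u\<bar>))" for u
  proof -
    have "norm (F k u) = norm (f u) * ((norm h * \<bar>u\<bar>) ^ k / fact k)" for k
      by (simp add: F_def norm_mult norm_divide norm_power power_mult_distrib mult_ac)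
    thus ?thesis using norm_sums by simp
  qed
  have "summable (\<lambda>k. LINT u|lborel. norm (F k u))"
  proof (rule bounded_imp_summable)
    fix n
    have "(\<Sum>k\<le>n. LINT u|lborel. norm (F k u)) = (LINT u|lborel. (\<Sum>k\<le>n. norm (F k u)))"
      using intF by (subst Bochner_Integration.integral_sum) auto
    also have "\<dots> \<le> (LINT u|lborel. norm (f u) * exp (r * \<bar>u\<bar>))"
    proof (rule integral_mono[OF _ int])
      show "integrable lborel (\<lambda>u. \<Sum>k\<le>n. norm (F k u))" using intF by auto
      fix u
      have "(\<Sum>k\<le>n. norm (F k u)) \<le> norm (f u) * exp (norm h * \<bar>u\<bar>)"
        using sum_le_suminf[of "\<lambda>k. norm (F k u)" "{..n}"] normF[of u] by (auto simp: sums_iff)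
      also have "\<dots> \<le> norm (f u) * exp (r * \<bar>u\<bar>)"
        using exp_bound by (intro mult_left_mono) auto
      finally show "(\<Sum>k\<le>n. norm (F k u)) \<le> norm (f u) * exp (r * \<bar>u\<bar>)" .
    qed
    finally show "(\<Sum>k\<le>n. LINT u|lborel. norm (F k u)) \<le> (LINT u|lborel. norm (f u) * exp (r * \<bar>u\<bar>))" .
  qed auto
  hence "(\<lambda>k. integral\<^sup>L lborel (F k)) sums (LINT u|lborel. (\<Sum>k. F k u))"
    using intF normF by (intro sums_integral) (auto simp: sums_iff)
  also have "(\<lambda>u. \<Sum>k. F k u) = (\<lambda>u. f u * exp (h * of_real u))"
  proof
    fix u :: real
    have "(\<lambda>k. f u * ((h * of_real u) ^ k /\<^sub>R fact k)) sums (f u * exp (h * of_real u))"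
      by (intro sums_mult exp_converges)
    also have "(\<lambda>k. f u * ((h * of_real u) ^ k /\<^sub>R fact k)) = (\<lambda>k. F k u)"
      by (auto simp: F_def scaleR_conv_of_real power_mult_distrib field_simps fun_eq_iff)
    finally show "(\<Sum>k. F k u) = f u * exp (h * of_real u)" by (simp add: sums_iff)
  qed
  also have "(\<lambda>k. integral\<^sup>L lborel (F k)) = (\<lambda>k. h ^ k / fact k * (LINT u|lborel. f u * of_real u ^ k))"
    unfolding F_def by (subst integral_mult_left_zero) (simp add: mult.commute fun_eq_iff)
  finally show ?thesis .
qed

lemma exp_transform_holomorphic:
  fixes f :: "real \<Rightarrow> complex"
  assumes meas: "f \<in> borel_measurable borel"
    and int: "\<And>r. integrable lborel (\<lambda>u. norm (f u) * exp (r * \<bar>u\<bar>))"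
  shows "(\<lambda>s. LINT u|lborel. f u * exp (s * of_real u)) holomorphic_on UNIV"
proof -
  define a where "a = (\<lambda>k. (LINT u|lborel. f u * of_real u ^ k) / fact k)"
  have "(\<lambda>n. a n * (w - 0) ^ n) sums (LINT u|lborel. f u * exp (w * of_real u))"
    if "w \<in> ball 0 R" for w R
    using exp_moment_sums[OF meas int[of "norm w"], of w] by (simp add: a_def field_simps)
  hence "(\<lambda>s. LINT u|lborel. f u * exp (s * of_real u)) holomorphic_on ball 0 R" for R
    by (rule power_series_holomorphic)
  hence "(\<lambda>s. LINT u|lborel. f u * exp (s * of_real u)) field_differentiable at z" for z
    by (rule holomorphic_on_imp_differentiable_at[of _ "ball 0 (norm z + 1)"]) auto
  thus ?thesis
    unfolding holomorphic_on_def by (blast intro: field_differentiable_at_within)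
qed

section \<open>Cauchy estimates, uniqueness of power series, moments as derivatives\<close>

lemma norm_higher_deriv_le:
  fixes f :: "complex \<Rightarrow> complex"
  assumes "f holomorphic_on S" "open S" "cball v \<rho> \<subseteq> S" "\<rho> > 0"
    and "\<And>z. z \<in> cball v \<rho> \<Longrightarrow> norm (f z) \<le> B"
  shows "norm ((deriv ^^ k) f v) \<le> fact k * B / \<rho> ^ k"
proof (rule Cauchy_inequality)
  show "f holomorphic_on ball v \<rho>" using assms by (meson ball_subset_cball holomorphic_on_subset order_trans)
  show "continuous_on (cball v \<rho>) f"
    using assms holomorphic_on_imp_continuous_on holomorphic_on_subset by blast
qed (use assms in \<open>auto simp: dist_norm\<close>)

text \<open>Zeros of a nonzero power series are isolated. Vanishing is assumed at positive reals
  only, since facts about theta are first known at real nomes, and the type covers real and complex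
  coefficients alike.\<close>

lemma powser_eq_0:
  fixes a :: "nat \<Rightarrow> 'a::{real_normed_field,banach}"
  assumes "r > 0"
    and conv: "\<And>x. norm x < r \<Longrightarrow> summable (\<lambda>n. a n * x ^ n)"
    and zero: "\<And>x. 0 < x \<Longrightarrow> x < r \<Longrightarrow> (\<Sum>n. a n * of_real x ^ n) = 0"
  shows "a n = 0"
proof (rule ccontr)
  assume an: "a n \<noteq> 0"
  \<comment> \<open>\<open>powser_0_nonzero\<close> concerns functions that vanish at 0. The
    constant term is therefore split off, and is shown to be 0 by letting x tend to 0 from the
    right.\<close>
  define f where "f = (\<lambda>x. (\<Sum>n. a n * x ^ n) - a 0)"
  define b where "b = (\<lambda>n. if n = 0 then 0 else a n)"
  have sb: "(\<lambda>n. b n * (x - 0) ^ n) sums f x" if "norm (x - 0) < r" for x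
  proof -
    have "(\<lambda>n. a n * x ^ n) sums (\<Sum>n. a n * x ^ n)"
      using conv that by (simp add: summable_sums)
    from sums_diff[OF this sums_single[of 0 "\<lambda>n. a n * x ^ n"]]
    have "(\<lambda>n. a n * x ^ n - (if n = 0 then a n * x ^ n else 0)) sums f x"
      by (simp add: f_def)
    also have "(\<lambda>n. a n * x ^ n - (if n = 0 then a n * x ^ n else 0)) = (\<lambda>n. b n * (x - 0) ^ n)"
      by (auto simp: b_def)
    finally show ?thesis .
  qed
  have f0: "f 0 = 0" by (simp add: f_def)
  have fx: "f (of_real x) = - a 0" if "0 < x" "x < r" for x
    using zero[OF that] by (simp add: f_def)
  have a0: "a 0 = 0"
  proof -
    have "r \<le> conv_radius b"
      using sb by (subst le_conv_radius_iff[where \<xi>=0]) (blast intro: sums_summable)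
    moreover have "ereal (r / 2) < ereal r" using \<open>r > 0\<close> by simp
    ultimately have "ereal (r / 2) < conv_radius b" by (rule less_le_trans[rotated])
    hence "continuous_on (cball 0 (r/2)) (\<lambda>x. \<Sum>n. b n * (x - 0) ^ n)"
      by (intro powser_continuous_suminf)
    also have "?this \<longleftrightarrow> continuous_on (cball 0 (r/2)) f"
    proof (rule continuous_on_cong[OF refl])
      fix x :: 'a assume "x \<in> cball 0 (r / 2)"
      hence "norm (x - 0) < r" using \<open>r > 0\<close> by (simp add: dist_norm)
      thus "(\<Sum>n. b n * (x - 0) ^ n) = f x" by (rule sums_unique[OF sb, symmetric])
    qed
    finally have "continuous_on (ball 0 (r/2)) f"
      by (rule continuous_on_subset) auto
    hence "isCont f 0"
      using \<open>r > 0\<close> by (simp add: continuous_on_eq_continuous_at)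
    hence "(f \<longlongrightarrow> 0) (at 0)" using f0 by (simp add: isCont_def)
    moreover have "filterlim (of_real :: real \<Rightarrow> 'a) (at 0) (at_right 0)"
    proof -
      have "filterlim (of_real :: real \<Rightarrow> 'a) (nhds 0) (at_right 0)"
        using tendsto_of_real[OF tendsto_ident_at, of 0 "{0<..}", where 'a = 'a] by simp
      moreover have "eventually (\<lambda>x::real. of_real x \<in> UNIV \<and> (of_real x :: 'a) \<noteq> 0) (at_right 0)"
        unfolding eventually_at_filter by (intro always_eventually) auto
      ultimately show ?thesis unfolding filterlim_at by blast
    qed
    ultimately have "((\<lambda>x. f (of_real x)) \<longlongrightarrow> 0) (at_right 0)"
      by (rule filterlim_compose)
    moreover have "eventually (\<lambda>x. f (of_real x) = - a 0) (at_right 0)"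
      using eventually_at_right_real[OF \<open>r > 0\<close>] by (rule eventually_mono) (rule fx, auto)
    ultimately have "((\<lambda>x::real. - a 0) \<longlongrightarrow> 0) (at_right 0)"
      by (rule Lim_transform_eventually)
    thus ?thesis by (simp add: tendsto_const_iff)
  qed
  have "n > 0" using an a0 by (cases n) auto
  hence bn: "b n \<noteq> 0" using an by (simp add: b_def)
  obtain s where s: "0 < s" "\<And>z. z \<in> cball 0 s - {0} \<Longrightarrow> f z \<noteq> 0"
    using powser_0_nonzero[OF \<open>r > 0\<close> sb f0 bn \<open>n > 0\<close>] by blast
  have "f (of_real (min s (r/2))) \<noteq> 0"
    using s(1) \<open>r > 0\<close> by (intro s(2)) auto
  thus False using fx[of "min s (r/2)"] a0 s(1) \<open>r > 0\<close> by auto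
qed

text \<open>Replaces differentiation under the integral sign: by \<open>exp_moment_sums\<close> the
  moments, divided by factorials, are the Taylor coefficients of \<open>G\<close> at
  \<open>v\<close>, and these are unique.\<close>

lemma moments_eq_deriv:
  fixes f :: "real \<Rightarrow> complex"
  assumes meas: "f \<in> borel_measurable borel"
    and int: "integrable lborel (\<lambda>u. norm (f u) * exp (r * \<bar>u\<bar>))" and "r > 0"
    and eq: "\<And>h. norm h < r \<Longrightarrow> (LINT u|lborel. f u * exp (h * of_real u)) = G (v + h)"
  shows "(LINT u|lborel. f u * of_real u ^ k) = (deriv ^^ k) G v"
proof -
  define a where "a = (\<lambda>k. (LINT u|lborel. f u * of_real u ^ k) / fact k)"
  have s: "(\<lambda>n. a n * (w - v) ^ n) sums G w" if "w \<in> ball v r" for w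
  proof -
    have "norm (w - v) < r" using that by (simp add: dist_norm norm_minus_commute)
    thus ?thesis
      using exp_moment_sums[OF meas int, of "w - v"] eq[of "w - v"] by (simp add: a_def field_simps)
  qed
  have holo: "G holomorphic_on ball v r"
    using s by (rule power_series_holomorphic)
  have "a k = (deriv ^^ k) G v / fact k"
  proof -
    have 1: "(\<lambda>n. (deriv ^^ n) G v / fact n * (w - v) ^ n) sums G w" if "w \<in> ball v r" for w
      using holomorphic_power_series[OF holo that] .
    have 2: "(\<lambda>n. (a n - (deriv ^^ n) G v / fact n) * x ^ n) sums 0" if "norm x < r" for x
      using sums_diff[OF s[of "v + x"] 1[of "v + x"]] that
      by (simp add: dist_norm algebra_simps)
    have "a k - (deriv ^^ k) G v / fact k = 0"
      by (rule powser_eq_0[OF \<open>r > 0\<close>]) (use 2 in \<open>auto simp: sums_iff\<close>)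
    thus ?thesis by simp
  qed
  thus ?thesis by (simp add: a_def)
qed

section \<open>Cauchy's formula on horizontal strips\<close>

lemma has_contour_integral_linepath_same_Im_iff:
  assumes "Im z = c" "Im z' = c" "Re z = a" "Re z' = b" "a < b"
  shows   "(f has_contour_integral I) (linepath z z') \<longleftrightarrow>
             ((\<lambda>x. f (Complex x c)) has_integral I) {a..b}"
proof -
  have "(f has_contour_integral I) (linepath z z') \<longleftrightarrow>
          ((\<lambda>x. f (linepath z z' x) * (z' - z)) has_integral I) {0..1}"
    by (subst has_contour_integral_linepath) simp_all
  also have "\<dots> \<longleftrightarrow> ((\<lambda>x. f (Complex (a + (b - a) * x) c) * of_real (b - a)) has_integral I) {0..1}"
    using assms
    by (intro has_integral_cong arg_cong2[of _ _ _ _ "(*)"] arg_cong[of _ _ f])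
       (auto simp: linepath_def complex_eq_iff algebra_simps)
  also have "{0..1} = (\<lambda>x. x / (b - a)) ` {0..b-a}"
    using assms by simp
  also have "((\<lambda>x. f (Complex (a + (b - a) * x) c) * of_real (b - a)) has_integral I) \<dots> \<longleftrightarrow>
             ((\<lambda>x. f (Complex (a + x) c) * of_real (b - a)) has_integral ((b-a) *\<^sub>R I)) {0..b-a}"
    by (subst has_integral_stretch_real_iff) (use assms in simp_all)
  also have "\<dots> \<longleftrightarrow> ((\<lambda>x. of_real (b-a) * f (Complex x c)) has_integral (b-a) *\<^sub>R I) {a..b}"
    by (subst has_integral_shift_real_ivl_iff[where c = "-a"])
       (simp_all add: scaleR_conv_of_real mult_ac)
  also have "\<dots> \<longleftrightarrow> ((\<lambda>x. f (Complex x c)) has_integral I) {a..b}"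
    by (subst has_integral_mult_right_iff) (use assms in \<open>auto simp: scaleR_conv_of_real\<close>)
  finally show ?thesis .
qed

lemma tendsto_integral_symmetric_interval:
  fixes f :: "real \<Rightarrow> complex"
  assumes f: "integrable lborel f" and X: "filterlim X at_top sequentially"
  shows "(\<lambda>n. integral {- X n..X n} f) \<longlonglongrightarrow> (LINT u|lborel. f u)"
proof -
  have "(\<lambda>n. LINT u|lborel. indicator {- X n..X n} u *\<^sub>R f u) \<longlonglongrightarrow> (LINT u|lborel. f u)"
  proof (rule integral_dominated_convergence[where w = "\<lambda>u. norm (f u)"])
    show "integrable lborel (\<lambda>u. norm (f u))" using f by simp
    show "AE u in lborel. (\<lambda>n. indicator {- X n..X n} u *\<^sub>R f u) \<longlonglongrightarrow> f u"
    proof (rule AE_I2)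
      fix u :: real
      have "eventually (\<lambda>n. X n \<ge> \<bar>u\<bar>) sequentially"
        using X by (simp add: filterlim_at_top)
      hence "eventually (\<lambda>n. indicator {- X n..X n} u *\<^sub>R f u = f u) sequentially"
        by eventually_elim (auto simp: indicator_def)
      thus "(\<lambda>n. indicator {- X n..X n} u *\<^sub>R f u) \<longlonglongrightarrow> f u"
        by (rule tendsto_eventually)
    qed
  qed (use f in \<open>auto simp: indicator_def\<close>)
  moreover have "(LINT u|lborel. indicator {- X n..X n} u *\<^sub>R f u) = integral {- X n..X n} f" for n
  proof -
    have "set_integrable lborel {- X n..X n} f"
      using f by (simp add: set_integrable_def integrable_mult_indicator)
    from set_borel_integral_eq_integral(2)[OF this]
    show ?thesis by (simp add: set_lebesgue_integral_def)
  qed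
  ultimately show ?thesis by simp
qed

text \<open>Cauchy's formula on the rectangles with real part in [-n, n]. The two vertical sides
  have fixed length and are killed by the decay of \<open>W\<close>; the horizontal sides converge
  to the two line integrals.\<close>

lemma strip_Cauchy_integral_formula:
  assumes holo: "f holomorphic_on S" and S: "open S" "convex S" "{z. a \<le> Im z \<and> Im z \<le> b} \<subseteq> S"
    and v: "a < Im v" "Im v < b"
    and W: "\<And>z. a \<le> Im z \<Longrightarrow> Im z \<le> b \<Longrightarrow> norm (f z) \<le> W \<bar>Re z\<bar>"
    and W0: "(\<lambda>n. W (real n)) \<longlonglongrightarrow> 0"
    and inta: "integrable lborel (\<lambda>u. f (Complex u a) / (Complex u a - v))"
    and intb: "integrable lborel (\<lambda>u. f (Complex u b) / (Complex u b - v))"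
  shows "(LINT u|lborel. f (Complex u a) / (Complex u a - v))
       - (LINT u|lborel. f (Complex u b) / (Complex u b - v)) = 2 * pi * \<i> * f v"
proof -
  define h where "h = (\<lambda>w. f w / (w - v))"
  define I1 where "I1 = (\<lambda>n. integral {- real n..real n} (\<lambda>u. h (Complex u a)))"
  define I3 where "I3 = (\<lambda>n. integral {- real n..real n} (\<lambda>u. h (Complex u b)))"
  define E where "E = (\<lambda>n. I1 n - I3 n - 2 * pi * \<i> * f v)"
  have cont: "continuous_on A h" if "A \<subseteq> S - {v}" for A
    unfolding h_def using that holomorphic_on_imp_continuous_on[OF holo]
    by (intro continuous_intros) (auto intro: continuous_on_subset)
  \<comment> \<open>Beyond \<bar>Re v\<bar> + 1 the vertical sides keep distance at least 1 from
    \<open>v\<close>, so the denominator costs nothing.\<close>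
  have bound: "norm (E n) \<le> 2 * (W (real n) / 1 * (b - a))" if n: "real n \<ge> \<bar>Re v\<bar> + 1" for n
  proof -
    define N where "N = real n"
    have N: "N \<ge> \<bar>Re v\<bar> + 1" "N > 0" using n by (auto simp: N_def)
    have ab: "a < b" using v by simp
    define a1 a2 a3 a4 where "a1 = Complex (-N) a" "a2 = Complex N a" "a3 = Complex N b" "a4 = Complex (-N) b"
    note a_defs = this
    have rp: "rectpath a1 a3 = linepath a1 a2 +++ linepath a2 a3 +++ linepath a3 a4 +++ linepath a4 a1"
      by (simp add: rectpath_def Let_def a_defs)
    have vbox: "v \<in> box a1 a3"
      using v N by (auto simp: in_box_complex_iff a_defs)
    have pim: "path_image (rectpath a1 a3) \<subseteq> S - {v}"
    proof -
      have "path_image (rectpath a1 a3) = cbox a1 a3 - box a1 a3"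
        using N ab by (intro path_image_rectpath_cbox_minus_box) (auto simp: a_defs)
      moreover have "cbox a1 a3 \<subseteq> S"
        using S(3) by (auto simp: in_cbox_complex_iff a_defs)
      ultimately show ?thesis using vbox by auto
    qed
    have seg: "closed_segment a1 a2 \<subseteq> S - {v}" "closed_segment a2 a3 \<subseteq> S - {v}"
              "closed_segment a3 a4 \<subseteq> S - {v}" "closed_segment a4 a1 \<subseteq> S - {v}"
      using pim unfolding rp by (auto simp: path_image_join)
    have ci: "h contour_integrable_on linepath a1 a2" "h contour_integrable_on linepath a2 a3"
             "h contour_integrable_on linepath a3 a4" "h contour_integrable_on linepath a4 a1"
      using seg by (auto intro!: contour_integrable_continuous_linepath cont)
    have "(h has_contour_integral (2 * pi * \<i> * f v)) (rectpath a1 a3)"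
    proof -
      have "((\<lambda>w. f w / (w - v)) has_contour_integral
         complex_of_real (2 * pi) * \<i> * winding_number (rectpath a1 a3) v * f v) (rectpath a1 a3)"
      proof (rule Cauchy_integral_formula_convex_simple[OF S(2) holo _ _ pim])
        show "v \<in> interior S" using S v by (auto simp: interior_open)
      qed auto
      thus ?thesis using winding_number_rectpath[OF vbox] by (simp add: h_def)
    qed
    hence "contour_integral (rectpath a1 a3) h = 2 * pi * \<i> * f v"
      by (rule contour_integral_unique)
    hence "2 * pi * \<i> * f v = contour_integral (linepath a1 a2) h + contour_integral (linepath a2 a3) h
         + contour_integral (linepath a3 a4) h + contour_integral (linepath a4 a1) h"
      using ci unfolding rp by (simp add: add.assoc)
    moreover have "contour_integral (linepath a1 a2) h = I1 n"
    proof -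
      have "((\<lambda>u. h (Complex u a)) has_integral contour_integral (linepath a1 a2) h) {-N..N}"
        using has_contour_integral_integral[OF ci(1)] N
        by (subst (asm) has_contour_integral_linepath_same_Im_iff[where a = "-N" and b = N and c = a])
           (auto simp: a_defs)
      thus ?thesis by (simp add: I1_def N_def integral_unique)
    qed
    moreover have "contour_integral (linepath a3 a4) h = - I3 n"
    proof -
      have rev: "contour_integral (linepath a3 a4) h = - contour_integral (linepath a4 a3) h"
        using ci(3) cont[OF seg(3)] by (simp add: contour_integral_reverse_linepath)
      have "h contour_integrable_on linepath a4 a3"
        using seg(3) by (auto intro!: contour_integrable_continuous_linepath cont simp: closed_segment_commute)
      hence "((\<lambda>u. h (Complex u b)) has_integral contour_integral (linepath a4 a3) h) {-N..N}"
        using has_contour_integral_integral[of h "linepath a4 a3"] N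
        by (subst (asm) has_contour_integral_linepath_same_Im_iff[where a = "-N" and b = N and c = b])
           (auto simp: a_defs)
      thus ?thesis unfolding rev by (simp add: I3_def N_def integral_unique)
    qed
    ultimately have "E n = - (contour_integral (linepath a2 a3) h + contour_integral (linepath a4 a1) h)"
      by (simp add: E_def algebra_simps)
    moreover have hb: "norm (h z) \<le> W N / 1" if "a \<le> Im z" "Im z \<le> b" "\<bar>Re z\<bar> = N" for z
    proof -
      have "1 \<le> \<bar>Re (z - v)\<bar>" using N that by simp
      also have "\<dots> \<le> norm (z - v)" by (rule abs_Re_le_cmod)
      finally have "1 \<le> norm (z - v)" .
      moreover have "norm (f z) \<le> W N" using W[of z] that by simp
      ultimately show ?thesis unfolding h_def norm_divide
        by (intro frac_le) (auto intro: order_trans[OF norm_ge_zero])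
    qed
    have W_ge: "W N / 1 \<ge> 0"
      using hb[of a2] ab N by (auto simp: a_defs intro: order_trans[OF norm_ge_zero])
    have "norm (contour_integral (linepath a2 a3) h) \<le> W N / 1 * norm (a3 - a2)"
      using W_ge ab N by (intro has_contour_integral_bound_linepath[OF has_contour_integral_integral[OF ci(2)]] hb)
        (auto simp: a_defs closed_segment_same_Re closed_segment_eq_real_ivl)
    moreover have "norm (contour_integral (linepath a4 a1) h) \<le> W N / 1 * norm (a1 - a4)"
      using W_ge ab N by (intro has_contour_integral_bound_linepath[OF has_contour_integral_integral[OF ci(4)]] hb)
        (auto simp: a_defs closed_segment_same_Re closed_segment_eq_real_ivl)
    moreover have "norm (a3 - a2) = b - a" "norm (a1 - a4) = b - a"
      using ab by (simp_all add: a_defs complex_diff cmod_def)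
    ultimately show ?thesis
      by (smt (verit, best) N_def norm_minus_cancel norm_triangle_ineq)
  qed
  have "E \<longlonglongrightarrow> 0"
  proof (rule tendsto_0_le[where K = 1 and f = "\<lambda>n. 2 * (W (real n) / 1 * (b - a))"])
    show "(\<lambda>n. 2 * (W (real n) / 1 * (b - a))) \<longlonglongrightarrow> 0"
      using W0 by (auto intro!: tendsto_eq_intros)
    obtain N where N: "real N \<ge> \<bar>Re v\<bar> + 1" using real_arch_simple by blast
    show "eventually (\<lambda>n. norm (E n) \<le> norm (2 * (W (real n) / 1 * (b - a))) * 1) sequentially"
      using eventually_ge_at_top[of N] by eventually_elim (use N bound in \<open>smt (verit) of_nat_mono real_norm_def\<close>)
  qed
  moreover have "E \<longlonglongrightarrow> (LINT u|lborel. h (Complex u a)) - (LINT u|lborel. h (Complex u b)) - 2 * pi * \<i> * f v"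
    unfolding E_def I1_def I3_def
    by (intro tendsto_intros tendsto_integral_symmetric_interval) (use inta intb in \<open>simp_all add: h_def filterlim_real_sequentially\<close>)
  ultimately have "(LINT u|lborel. h (Complex u a)) - (LINT u|lborel. h (Complex u b)) - 2 * pi * \<i> * f v = 0"
    using LIMSEQ_unique by blast
  thus ?thesis by (simp add: h_def)
qed

lemma holomorphic_on_infsum:
  fixes f :: "'a \<Rightarrow> complex \<Rightarrow> complex"
  assumes holo: "\<And>n. n \<in> X \<Longrightarrow> f n holomorphic_on S"
    and loc: "\<And>z. z \<in> S \<Longrightarrow> \<exists>r>0. \<exists>M. cball z r \<subseteq> S \<and> M summable_on X \<and>
                (\<forall>n\<in>X. \<forall>w\<in>cball z r. norm (f n w) \<le> M n)"
    and "open S"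
  shows "(\<lambda>w. \<Sum>\<^sub>\<infinity>n\<in>X. f n w) holomorphic_on S"
proof -
  have "(\<lambda>w. \<Sum>\<^sub>\<infinity>n\<in>X. f n w) field_differentiable at z" if z: "z \<in> S" for z
  proof -
    obtain r M where r: "r > 0" "cball z r \<subseteq> S" and M: "M summable_on X"
      "\<And>n w. n \<in> X \<Longrightarrow> w \<in> cball z r \<Longrightarrow> norm (f n w) \<le> M n"
      using loc[OF z] by blast
    have ul: "uniform_limit (cball z r) (\<lambda>X y. \<Sum>x\<in>X. f x y) (\<lambda>y. \<Sum>\<^sub>\<infinity>x\<in>X. f x y) (finite_subsets_at_top X)"
      using M by (intro Weierstrass_m_test_general[where M = M]) auto
    have ev: "eventually (\<lambda>Y. continuous_on (cball z r) (\<lambda>y. \<Sum>x\<in>Y. f x y) \<and>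
               (\<lambda>y. \<Sum>x\<in>Y. f x y) holomorphic_on ball z r) (finite_subsets_at_top X)"
      using eventually_finite_subsets_at_top_weakI[of X "\<lambda>Y. Y \<subseteq> X"]
    proof (rule eventually_mono)
      fix Y assume "Y \<subseteq> X"
      hence h: "(\<lambda>y. \<Sum>x\<in>Y. f x y) holomorphic_on S"
        using holo by (intro holomorphic_intros) auto
      show "continuous_on (cball z r) (\<lambda>y. \<Sum>x\<in>Y. f x y) \<and>
               (\<lambda>y. \<Sum>x\<in>Y. f x y) holomorphic_on ball z r"
        using holomorphic_on_imp_continuous_on[OF h] h r
        by (meson ball_subset_cball continuous_on_subset holomorphic_on_subset order_trans)
    qed auto
    have "(\<lambda>w. \<Sum>\<^sub>\<infinity>n\<in>X. f n w) holomorphic_on ball z r"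
      by (rule holomorphic_uniform_limit[OF ev ul]) auto
    thus ?thesis
      using r(1) by (intro holomorphic_on_imp_differentiable_at[of _ "ball z r"]) auto
  qed
  thus ?thesis
    unfolding holomorphic_on_def by (blast intro: field_differentiable_at_within)
qed

section \<open>The theta function has no zeros\<close>

lemma has_sum_power_nat_abs:
  fixes r :: real
  assumes "0 \<le> r" "r < 1"
  shows "((\<lambda>n::int. r ^ nat \<bar>n\<bar>) has_sum (2 * r / (1 - r))) (- {0})"
proof -
  have s: "(\<lambda>n. r ^ Suc n) sums (r / (1 - r))"
    using sums_mult[OF geometric_sums[of r], of r] assms by simp
  hence h: "((\<lambda>n. r ^ Suc n) has_sum (r / (1 - r))) UNIV"
    using assms by (intro norm_summable_imp_has_sum) (auto simp: sums_iff)
  have "((\<lambda>n::int. r ^ nat \<bar>n\<bar>) has_sum (r / (1 - r))) {1..}"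
    using h by (rule has_sum_reindex_bij_witness[of _ "\<lambda>n. nat (n - 1)" "\<lambda>n. int n + 1", THEN iffD1, rotated -1])
      (auto simp: nat_add_distrib)
  moreover have "((\<lambda>n::int. r ^ nat \<bar>n\<bar>) has_sum (r / (1 - r))) {..-1}"
    using h by (rule has_sum_reindex_bij_witness[of _ "\<lambda>n. nat (- n - 1)" "\<lambda>n. - int n - 1", THEN iffD1, rotated -1])
      (auto simp: nat_add_distrib)
  ultimately have "((\<lambda>n::int. r ^ nat \<bar>n\<bar>) has_sum (r / (1 - r) + r / (1 - r))) ({1..} \<union> {..-1})"
    by (rule has_sum_Un_disjoint) auto
  also have "{1..} \<union> {..-1} = - {0 :: int}" by auto
  finally show ?thesis by (simp add: field_simps)
qed

lemma summable_on_power_nat_abs: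
  fixes r :: real
  assumes "0 \<le> r" "r < 1"
  shows "(\<lambda>n::int. r ^ nat \<bar>n\<bar>) summable_on UNIV"
proof -
  have "(\<lambda>n::int. r ^ nat \<bar>n\<bar>) summable_on insert 0 (- {0})"
    using has_sum_power_nat_abs[OF assms] by (subst summable_on_insert_iff) (auto simp: summable_on_def)
  also have "insert 0 (- {0::int}) = UNIV" by auto
  finally show ?thesis .
qed

text \<open>Jacobi's theta constant as a function of the nome: \<open>theta x\<close> is its value
  at q = exp(-pi x). The nome puts the limit x to infinity at the interior point q = 0, and the
  domain becomes a disc, on which logarithms of zero-free functions exist.\<close>

definition theta3 :: "complex \<Rightarrow> complex" where
  "theta3 q = (\<Sum>\<^sub>\<infinity>n\<in>(UNIV::int set). q ^ nat (n\<^sup>2))"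

lemma nat_abs_le_square: "nat \<bar>n\<bar> \<le> nat (n\<^sup>2)" for n :: int
  by (rule nat_mono) (metis abs_ge_zero abs_le_square_iff abs_mult_self_eq int_one_le_iff_zero_less
      linorder_not_le mult_le_cancel_left1 order_le_less power2_eq_square)

lemma norm_theta3_term_le:
  fixes q :: complex
  assumes "norm q \<le> r" "r \<le> 1"
  shows "norm (q ^ nat (n\<^sup>2)) \<le> r ^ nat \<bar>n\<bar>"
proof -
  have "norm (q ^ nat (n\<^sup>2)) \<le> r ^ nat (n\<^sup>2)"
    using assms by (simp add: norm_power power_mono)
  also have "\<dots> \<le> r ^ nat \<bar>n\<bar>"
    using assms norm_ge_zero[of q] nat_abs_le_square[of n] by (intro power_decreasing) linarith+
  finally show ?thesis .
qed

lemma theta3_abs_summable: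
  fixes q :: complex
  assumes "norm q < 1"
  shows "(\<lambda>n::int. norm (q ^ nat (n\<^sup>2))) summable_on A"
proof -
  have "(\<lambda>n::int. norm (q ^ nat (n\<^sup>2))) summable_on UNIV"
  proof (rule summable_on_comparison_test)
    show "(\<lambda>n::int. norm q ^ nat \<bar>n\<bar>) summable_on UNIV"
      using assms by (intro summable_on_power_nat_abs) auto
    show "norm (q ^ nat (n\<^sup>2)) \<le> norm q ^ nat \<bar>n\<bar>" for n :: int
      using assms by (intro norm_theta3_term_le) auto
  qed (rule norm_ge_zero)
  thus ?thesis by (rule summable_on_subset_banach) auto
qed

text \<open>Comparison with a geometric series, as n^2 \<ge> \<bar>n\<bar>. It is used at small
  nomes: for the zero-freeness, and for the values that inversion produces near the point i.\<close>

lemma norm_theta3_minus_1_le: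
  assumes "norm q < 1"
  shows "norm (theta3 q - 1) \<le> 2 * norm q / (1 - norm q)"
proof -
  note s = theta3_abs_summable[OF assms]
  have "theta3 q = (\<Sum>\<^sub>\<infinity>n\<in>insert 0 (-{0::int}). q ^ nat (n\<^sup>2))"
    unfolding theta3_def by (rule arg_cong2[where f = infsum]) auto
  also have "\<dots> = 1 + (\<Sum>\<^sub>\<infinity>n\<in>-{0::int}. q ^ nat (n\<^sup>2))"
    using Infinite_Sum.abs_summable_summable[OF s] by (subst infsum_insert) auto
  finally have "norm (theta3 q - 1) = norm (\<Sum>\<^sub>\<infinity>n\<in>-{0::int}. q ^ nat (n\<^sup>2))" by simp
  also have "\<dots> \<le> (\<Sum>\<^sub>\<infinity>n\<in>-{0::int}. norm (q ^ nat (n\<^sup>2)))"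
    by (rule norm_infsum_bound[OF s])
  also have "\<dots> \<le> (\<Sum>\<^sub>\<infinity>n\<in>-{0::int}. norm q ^ nat \<bar>n\<bar>)"
  proof (rule infsum_mono)
    show "(\<lambda>n::int. norm q ^ nat \<bar>n\<bar>) summable_on -{0}"
      using has_sum_power_nat_abs[of "norm q"] assms by (auto simp: summable_on_def)
    show "norm (q ^ nat (n\<^sup>2)) \<le> norm q ^ nat \<bar>n\<bar>" for n :: int
      using assms by (intro norm_theta3_term_le) auto
  qed (rule s)
  also have "\<dots> = 2 * norm q / (1 - norm q)"
    using has_sum_power_nat_abs[of "norm q"] assms by (intro infsumI) auto
  finally show ?thesis .
qed

text \<open>Growth of first order at the unit circle; it is the source of the polynomial bound on
  the coefficients \<open>r_alpha\<close>.\<close>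

lemma norm_theta3_le:
  assumes "norm q < 1"
  shows "norm (theta3 q) \<le> 2 / (1 - norm q)"
proof -
  have "norm (theta3 q) \<le> norm (theta3 q - 1) + 1"
    by (metis diff_add_cancel norm_one norm_triangle_ineq)
  also have "\<dots> \<le> 2 * norm q / (1 - norm q) + 1"
    using norm_theta3_minus_1_le[OF assms] by simp
  also have "\<dots> \<le> 2 / (1 - norm q)"
    using assms by (simp add: divide_simps)
  finally show ?thesis .
qed

lemma theta3_holomorphic: "theta3 holomorphic_on ball 0 1"
proof -
  have "(\<lambda>q. \<Sum>\<^sub>\<infinity>n\<in>(UNIV::int set). q ^ nat (n\<^sup>2)) holomorphic_on ball 0 1"
  proof (rule holomorphic_on_infsum)
    fix z :: complex assume z: "z \<in> ball 0 1"
    define r where "r = (1 - norm z) / 2"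
    have r: "r > 0" "norm z + r < 1" using z by (auto simp: r_def field_simps)
    have *: "norm w \<le> norm z + r" if "w \<in> cball z r" for w
      using that norm_triangle_ineq2[of w z] by (simp add: dist_norm norm_minus_commute)
    show "\<exists>r>0. \<exists>M. cball z r \<subseteq> ball 0 1 \<and> M summable_on (UNIV::int set) \<and>
                (\<forall>n\<in>UNIV. \<forall>w\<in>cball z r. norm (w ^ nat (n\<^sup>2)) \<le> M n)"
    proof (intro exI[of _ r] conjI exI[of _ "\<lambda>n. (norm z + r) ^ nat \<bar>n\<bar>"] ballI)
      show "(\<lambda>n::int. (norm z + r) ^ nat \<bar>n\<bar>) summable_on UNIV"
        using r by (intro summable_on_power_nat_abs) auto
      show "norm (w ^ nat (n\<^sup>2)) \<le> (norm z + r) ^ nat \<bar>n\<bar>" if "w \<in> cball z r" for w and n :: int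
        using *[OF that] r by (intro norm_theta3_term_le) auto
      show "cball z r \<subseteq> ball 0 1" using * r by fastforce
    qed (use r in auto)
  qed (auto intro!: holomorphic_intros)
  thus ?thesis by (simp add: theta3_def [abs_def])
qed

lemma minus_power_square: "(- q) ^ nat (n\<^sup>2) = (if even n then 1 else -1) * q ^ nat (n\<^sup>2)"
  for q :: complex and n :: int
proof -
  have "even (nat (n\<^sup>2)) \<longleftrightarrow> even n" by (simp add: even_nat_iff)
  thus ?thesis by (auto simp: power_minus_odd)
qed

text \<open>In the sum of both sides the odd n cancel, and n = 2k contributes q^(4 k^2). The nome -q
  belongs to the half-plane variable shifted by i, so this is what connects theta near i with theta
  near 0.\<close>

lemma theta3_minus:
  assumes "norm q < 1"
  shows "theta3 (- q) = 2 * theta3 (q ^ 4) - theta3 q"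
proof -
  note s = Infinite_Sum.abs_summable_summable[OF theta3_abs_summable[OF assms]]
  have "norm (-q) < 1" using assms by simp
  note s' = Infinite_Sum.abs_summable_summable[OF theta3_abs_summable[OF this]]
  have "theta3 (-q) + theta3 q = (\<Sum>\<^sub>\<infinity>n\<in>(UNIV::int set). (-q) ^ nat (n\<^sup>2) + q ^ nat (n\<^sup>2))"
    unfolding theta3_def by (rule infsum_add[symmetric]) (fact s s')+
  also have "\<dots> = (\<Sum>\<^sub>\<infinity>n\<in>range ((*) (2::int)). 2 * q ^ nat (n\<^sup>2))"
    by (rule infsum_cong_neutral) (auto simp: minus_power_square elim!: evenE)
  also have "\<dots> = (\<Sum>\<^sub>\<infinity>n\<in>(UNIV::int set). 2 * (q ^ 4) ^ nat (n\<^sup>2))"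
    by (subst infsum_reindex) (auto simp: inj_on_def o_def power_mult_distrib nat_mult_distrib power_mult)
  also have "\<dots> = 2 * theta3 (q ^ 4)"
    by (simp add: theta3_def infsum_cmult_right')
  finally show ?thesis by (simp add: algebra_simps)
qed

text \<open>The classical identity between theta_3 and theta_4. In the double sum over (m, n) the
  pairs with m + n odd cancel; the others are (k + l, k - l), where m^2 + n^2 = 2 k^2 + 2 l^2 and
  the sign (-1)^(k-l) splits between k and l.\<close>

lemma theta3_times_theta3_minus:
  assumes "norm q < 1"
  shows "theta3 q * theta3 (- q) = (theta3 (- q\<^sup>2))\<^sup>2"
proof -
  define a where "a = (\<lambda>n::int. q ^ nat (n\<^sup>2))"
  define b where "b = (\<lambda>n::int. (- q) ^ nat (n\<^sup>2))"
  define d where "d = (\<lambda>n::int. (- q\<^sup>2) ^ nat (n\<^sup>2))"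
  define P where "P = (\<lambda>(m, n). a m * b n)"
  define O' where "O' = {(m, n). odd (m + n :: int)}"
  define E where "E = {(m, n). even (m + n :: int)}"
  have nq: "norm (- q) < 1" "norm (- q\<^sup>2) < 1"
    using assms by (auto simp: norm_power power_less_one_iff abs_square_less_1)
  have abs_prod: "(\<lambda>x. norm (case x of (m, n) \<Rightarrow> f m * g n)) summable_on (UNIV \<times> UNIV)"
    if "(\<lambda>n. norm (f n)) summable_on UNIV" "(\<lambda>n. norm (g n)) summable_on UNIV" for f g :: "int \<Rightarrow> complex"
  proof (subst Infinite_Sum.abs_summable_on_Sigma_iff, intro conjI ballI)
    show "(\<lambda>y. norm (case (x, y) of (m, n) \<Rightarrow> f m * g n)) summable_on UNIV" for x
      using that by (simp add: norm_mult summable_on_cmult_right)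
    have "(\<lambda>x. (\<Sum>\<^sub>\<infinity>y. norm (g y)) * norm (f x)) summable_on UNIV"
      using that by (intro summable_on_cmult_right)
    thus "(\<lambda>x. norm (\<Sum>\<^sub>\<infinity>y. norm (case (x, y) of (m, n) \<Rightarrow> f m * g n))) summable_on UNIV"
      using that by (simp add: norm_mult infsum_cmult_right' mult.commute infsum_nonneg)
  qed
  have as: "(\<lambda>n. norm (a n)) summable_on UNIV" "(\<lambda>n. norm (b n)) summable_on UNIV" "(\<lambda>n. norm (d n)) summable_on UNIV"
    using theta3_abs_summable[of _ UNIV] assms nq unfolding a_def b_def d_def by blast+
  have prod: "infsum f UNIV * infsum g UNIV = infsum (\<lambda>(m, n). f m * g n) UNIV"
    if "(\<lambda>n. norm (f n)) summable_on UNIV" "(\<lambda>n. norm (g n)) summable_on UNIV" for f g :: "int \<Rightarrow> complex"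
  proof -
    have "infsum (\<lambda>(m, n). f m * g n) (UNIV \<times> UNIV) = (\<Sum>\<^sub>\<infinity>m. \<Sum>\<^sub>\<infinity>n. f m * g n)"
      by (subst infsum_Sigma_banach[symmetric]) (use Infinite_Sum.abs_summable_summable[OF abs_prod[OF that]] in auto)
    thus ?thesis by (simp add: infsum_cmult_right' infsum_cmult_left')
  qed
  have Ps: "P summable_on A" for A
    using Infinite_Sum.abs_summable_summable[OF abs_prod[OF as(1,2)]]
    unfolding P_def by (rule summable_on_subset_banach) auto
  \<comment> \<open>If m + n is odd, exactly one index is odd, so exchanging the indices reverses
    the sign of the term.\<close>
  have "infsum P O' = infsum (\<lambda>(m, n). P (n, m)) O'"
    by (rule infsum_reindex_bij_witness[of _ "\<lambda>(m, n). (n, m)" "\<lambda>(m, n). (n, m)"])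
       (auto simp: O'_def add.commute)
  also have "\<dots> = infsum (\<lambda>x. - P x) O'"
    by (rule infsum_cong) (auto simp: P_def O'_def a_def b_def minus_power_square)
  also have "\<dots> = - infsum P O'" by (rule infsum_uminus)
  finally have PO: "infsum P O' = 0" by simp
  have "theta3 q * theta3 (- q) = infsum P UNIV"
    using prod[OF as(1,2)] by (simp add: theta3_def a_def b_def P_def)
  also have "(UNIV :: (int \<times> int) set) = O' \<union> E" by (auto simp: O'_def E_def)
  also have "infsum P (O' \<union> E) = infsum P O' + infsum P E"
    by (rule infsum_Un_disjoint) (auto intro: Ps simp: O'_def E_def)
  also have "infsum P E = infsum (\<lambda>(m, n). d m * d n) UNIV"
  proof (rule infsum_reindex_bij_witness[of _ "\<lambda>(m, n). (m + n, m - n)" "\<lambda>(m, n). ((m + n) div 2, (m - n) div 2)"])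
    fix x :: "int \<times> int" assume x: "x \<in> E"
    obtain m n where [simp]: "x = (m, n)" by (cases x)
    from x have "even (m + n)" by (auto simp: E_def)
    then obtain k where k: "m + n = 2 * k" by (elim evenE)
    hence m: "m = k + (k - n)" by simp
    define l where "l = k - n"
    have mn: "m = k + l" "n = k - l" using m by (auto simp: l_def)
    show "(case (case x of (m, n) \<Rightarrow> ((m + n) div 2, (m - n) div 2)) of (m, n) \<Rightarrow> (m + n, m - n)) = x"
      by (simp add: mn)
    have "nat ((k + l)\<^sup>2) + nat ((k - l)\<^sup>2) = 2 * nat (k\<^sup>2) + 2 * nat (l\<^sup>2)"
    proof -
      have "nat ((k + l)\<^sup>2) + nat ((k - l)\<^sup>2) = nat ((k + l)\<^sup>2 + (k - l)\<^sup>2)"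
        by (simp add: nat_add_distrib)
      also have "(k + l)\<^sup>2 + (k - l)\<^sup>2 = 2 * k\<^sup>2 + 2 * l\<^sup>2" by (simp add: power2_eq_square algebra_simps)
      finally show ?thesis by (simp add: nat_add_distrib nat_mult_distrib)
    qed
    hence "q ^ nat ((k + l)\<^sup>2) * q ^ nat ((k - l)\<^sup>2) = (q\<^sup>2) ^ nat (k\<^sup>2) * (q\<^sup>2) ^ nat (l\<^sup>2)"
      by (simp flip: power_add power_mult add: algebra_simps)
    thus "(case (case x of (m, n) \<Rightarrow> ((m + n) div 2, (m - n) div 2)) of (m, n) \<Rightarrow> d m * d n) = P x"
      by (auto simp: mn P_def a_def b_def d_def minus_power_square)
  qed (auto simp: E_def)
  also have "\<dots> = (theta3 (- q\<^sup>2))\<^sup>2"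
    using prod[OF as(3,3)] by (simp add: theta3_def d_def power2_eq_square)
  finally show ?thesis by (simp add: PO)
qed

text \<open>A zero \<open>q\<close> would, by the previous identity, propagate to \<open>- q\<^sup>2\<close> and
  hence accumulate at \<open>0\<close>, where the function is close to \<open>1\<close>.\<close>
lemma theta3_nonzero:
  assumes "norm q < 1"
  shows "theta3 q \<noteq> 0"
proof
  assume zero: "theta3 q = 0"
  define Q where "Q = (\<lambda>n. ((\<lambda>q. - q\<^sup>2) ^^ n) q)"
  have norm_Q: "norm (Q n) = norm q ^ (2 ^ n)" for n
    by (induction n) (auto simp: Q_def norm_power power_mult mult.commute simp flip: power_mult)
  have norm_Q_lt: "norm (Q n) < 1" for n
    unfolding norm_Q using assms by (simp add: power_less_one_iff)
  have Q0: "theta3 (Q n) = 0" for n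
  proof (induction n)
    case (Suc n)
    have "(theta3 (Q (Suc n)))\<^sup>2 = theta3 (Q n) * theta3 (- Q n)"
      using theta3_times_theta3_minus[OF norm_Q_lt[of n]] by (simp add: Q_def)
    with Suc show ?case by simp
  qed (use zero in \<open>simp add: Q_def\<close>)
  have "(\<lambda>n. norm q ^ n) \<longlonglongrightarrow> 0" using assms by (intro LIMSEQ_power_zero) auto
  hence "eventually (\<lambda>n. norm q ^ n < 1 / 4) sequentially"
    by (rule order_tendstoD) auto
  then obtain n where n: "norm q ^ n < 1 / 4" by (auto simp: eventually_sequentially)
  have "norm (Q n) \<le> norm q ^ n"
    unfolding norm_Q using assms less_exp[of n] by (intro power_decreasing) auto
  hence "norm (Q n) < 1 / 4" using n by simp
  hence "2 * norm (Q n) / (1 - norm (Q n)) < 1"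
    by (simp add: divide_simps)
  moreover have "norm (theta3 (Q n) - 1) = 1" by (simp add: Q0)
  ultimately show False using norm_theta3_minus_1_le[OF norm_Q_lt[of n]] by simp
qed

section \<open>Poisson summation\<close>

lemma has_integral_cis_unit_interval:
  fixes k :: int
  shows "((\<lambda>t. cis (2 * pi * of_int k * t)) has_integral (if k = 0 then 1 else 0)) {-(1/2)..1/2}"
proof (cases "k = 0")
  case True
  thus ?thesis using has_integral_const_real[of "1::complex" "-(1/2)" "1/2"] by simp
next
  case False
  define m where "m = 2 * pi * of_int k"
  have m: "m \<noteq> 0" using False by (simp add: m_def)
  have "((\<lambda>t. cis (m * t)) has_integral (cis (m * (1/2)) / (\<i> * m) - cis (m * (-(1/2))) / (\<i> * m))) {-(1/2)..1/2}"
  proof (rule fundamental_theorem_of_calculus)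
    fix t :: real assume "t \<in> {-(1/2)..1/2}"
    have "((\<lambda>z. exp (\<i> * m * z) / (\<i> * m)) has_field_derivative exp (\<i> * m * of_real t)) (at (of_real t))"
      using m by (auto intro!: derivative_eq_intros simp: field_simps)
    from has_vector_derivative_real_field[OF this]
    show "((\<lambda>t. cis (m * t) / (\<i> * m)) has_vector_derivative cis (m * t)) (at t within {-(1/2)..1/2})"
      by (simp add: cis_conv_exp mult_ac)
  qed auto
  also have "cis (m * (1/2)) = cis (m * (-(1/2)))"
  proof -
    have "cis (m * (1/2)) = cis (m * (-(1/2))) * cis (2 * pi * of_int k)"
      by (subst cis_mult) (simp add: m_def field_simps)
    also have "cis (2 * pi * of_int k) = 1" by (rule cis_multiple_2pi) auto
    finally show ?thesis by simp
  qed
  finally show ?thesis using False by (simp add: m_def)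
qed

text \<open>The integral of the squared distance between \<open>\<phi>\<close> and its Fourier
  polynomial is nonnegative; orthonormality of the exponentials evaluates it.\<close>

lemma Bessel_inequality_unit_interval:
  fixes \<phi> :: "real \<Rightarrow> complex"
  assumes cont: "continuous_on {-(1/2)..1/2} \<phi>" and "finite K"
  defines "a \<equiv> (\<lambda>k::int. integral {-(1/2)..1/2} (\<lambda>t. \<phi> t * cis (- (2 * pi * of_int k * t))))"
  shows "(\<Sum>k\<in>K. (norm (a k))\<^sup>2) \<le> integral {-(1/2)..1/2} (\<lambda>t. (norm (\<phi> t))\<^sup>2)"
proof -
  define I where "I = {-(1/2)..1/2::real}"
  define e where "e = (\<lambda>k::int. \<lambda>t::real. cis (2 * pi * of_int k * t))"
  have e_cnj: "cis (- (2 * pi * of_int k * t)) = cnj (e k t)" for k t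
    by (simp add: e_def cis_cnj)
  have conte: "continuous_on I (e k)" for k
    unfolding e_def by (intro continuous_intros)
  note cont' = cont [folded I_def]
  have h1: "((\<lambda>t. \<phi> t * cnj (e k t)) has_integral a k) I" for k
    unfolding a_def e_cnj I_def[symmetric]
    by (rule integrable_integral) (auto simp: I_def intro!: integrable_continuous_interval continuous_intros cont conte[unfolded I_def])
  have h2: "((\<lambda>t. e k t * cnj (\<phi> t)) has_integral cnj (a k)) I" for k
    using h1[of k] by (subst has_integral_cnj[symmetric]) (simp add: o_def mult.commute)
  have h3: "((\<lambda>t. e j t * cnj (e k t)) has_integral (if j = k then 1 else 0)) I" for j k
  proof -
    have "e j t * cnj (e k t) = cis (2 * pi * of_int (j - k) * t)" for t
      by (simp add: e_def cis_cnj cis_mult algebra_simps)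
    thus ?thesis using has_integral_cis_unit_interval[of "j - k"] by (simp add: I_def)
  qed
  define p where "p = (\<lambda>t. \<Sum>k\<in>K. a k * e k t)"
  have sq1: "(\<Sum>k\<in>K. a k * cnj (a k)) = of_real (\<Sum>k\<in>K. (norm (a k))\<^sup>2)"
    by (simp add: complex_norm_square del: of_real_power)
  have sq2: "(\<Sum>k\<in>K. cnj (a k) * a k) = of_real (\<Sum>k\<in>K. (norm (a k))\<^sup>2)"
    unfolding sq1[symmetric] by (simp add: mult.commute)
  have h4: "((\<lambda>t. \<phi> t * cnj (\<phi> t)) has_integral of_real (integral I (\<lambda>t. (norm (\<phi> t))\<^sup>2))) I"
  proof -
    have "((\<lambda>t. (norm (\<phi> t))\<^sup>2) has_integral integral I (\<lambda>t. (norm (\<phi> t))\<^sup>2)) I"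
      by (rule integrable_integral) (auto simp: I_def intro!: integrable_continuous_interval continuous_intros cont)
    from has_integral_linear[OF this bounded_linear_of_real[where 'a = complex]] show ?thesis
      by (simp add: o_def complex_norm_square del: of_real_power)
  qed
  have "((\<lambda>t. \<phi> t * cnj (\<phi> t) - (\<Sum>k\<in>K. cnj (a k) * (\<phi> t * cnj (e k t)))
           - (\<Sum>k\<in>K. a k * (e k t * cnj (\<phi> t)))
           + (\<Sum>j\<in>K. \<Sum>k\<in>K. a j * cnj (a k) * (e j t * cnj (e k t)))) has_integral
         (of_real (integral I (\<lambda>t. (norm (\<phi> t))\<^sup>2)) - (\<Sum>k\<in>K. cnj (a k) * a k) - (\<Sum>k\<in>K. a k * cnj (a k))
           + (\<Sum>j\<in>K. \<Sum>k\<in>K. a j * cnj (a k) * (if j = k then 1 else 0)))) I"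
    using \<open>finite K\<close>
    by (intro has_integral_add has_integral_diff has_integral_sum has_integral_mult_right h1 h2 h3 h4) auto
  also have "(\<lambda>t. \<phi> t * cnj (\<phi> t) - (\<Sum>k\<in>K. cnj (a k) * (\<phi> t * cnj (e k t)))
           - (\<Sum>k\<in>K. a k * (e k t * cnj (\<phi> t)))
           + (\<Sum>j\<in>K. \<Sum>k\<in>K. a j * cnj (a k) * (e j t * cnj (e k t))))
        = (\<lambda>t. of_real ((norm (\<phi> t - p t))\<^sup>2))"
  proof
    fix t
    have "of_real ((norm (\<phi> t - p t))\<^sup>2) = (\<phi> t - p t) * cnj (\<phi> t - p t)"
      by (rule complex_norm_square)
    also have "\<dots> = \<phi> t * cnj (\<phi> t) - \<phi> t * cnj (p t) - p t * cnj (\<phi> t) + p t * cnj (p t)"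
      by (simp add: algebra_simps)
    also have "\<phi> t * cnj (p t) = (\<Sum>k\<in>K. cnj (a k) * (\<phi> t * cnj (e k t)))"
      unfolding p_def cnj_sum sum_distrib_left by (simp add: mult_ac)
    also have "p t * cnj (\<phi> t) = (\<Sum>k\<in>K. a k * (e k t * cnj (\<phi> t)))"
      unfolding p_def sum_distrib_right by (simp add: mult_ac)
    also have "p t * cnj (p t) = (\<Sum>j\<in>K. \<Sum>k\<in>K. a j * cnj (a k) * (e j t * cnj (e k t)))"
      unfolding p_def cnj_sum sum_product by (simp add: mult_ac)
    finally show "\<phi> t * cnj (\<phi> t) - (\<Sum>k\<in>K. cnj (a k) * (\<phi> t * cnj (e k t)))
           - (\<Sum>k\<in>K. a k * (e k t * cnj (\<phi> t)))
           + (\<Sum>j\<in>K. \<Sum>k\<in>K. a j * cnj (a k) * (e j t * cnj (e k t)))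
        = of_real ((norm (\<phi> t - p t))\<^sup>2)" ..
  qed
  also have "(\<Sum>j\<in>K. \<Sum>k\<in>K. a j * cnj (a k) * (if j = k then 1 else 0)) = (\<Sum>j\<in>K. a j * cnj (a j))"
    using \<open>finite K\<close> by (simp add: if_distrib cong: if_cong)
  finally have "((\<lambda>t. of_real ((norm (\<phi> t - p t))\<^sup>2)) has_integral
      complex_of_real (integral I (\<lambda>t. (norm (\<phi> t))\<^sup>2) - (\<Sum>k\<in>K. (norm (a k))\<^sup>2))) I"
    unfolding sq1 sq2 by simp
  from has_integral_Re[OF this]
  have "((\<lambda>t. (norm (\<phi> t - p t))\<^sup>2) has_integral
          (integral I (\<lambda>t. (norm (\<phi> t))\<^sup>2) - (\<Sum>k\<in>K. (norm (a k))\<^sup>2))) I" by simp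
  hence "0 \<le> integral I (\<lambda>t. (norm (\<phi> t))\<^sup>2) - (\<Sum>k\<in>K. (norm (a k))\<^sup>2)"
    by (rule has_integral_nonneg) auto
  thus ?thesis by (simp add: I_def)
qed

text \<open>Riemann-Lebesgue in the form that Bessel's inequality yields: along an injective
  enumeration of frequencies the squared coefficients are summable.\<close>

lemma Fourier_coeff_tendsto_0:
  fixes \<phi> :: "real \<Rightarrow> complex" and g :: "nat \<Rightarrow> int"
  assumes cont: "continuous_on {-(1/2)..1/2} \<phi>" and "inj g"
  shows "(\<lambda>n. integral {-(1/2)..1/2} (\<lambda>t. \<phi> t * cis (- (2 * pi * of_int (g n) * t)))) \<longlonglongrightarrow> 0"
proof -
  define a where "a = (\<lambda>k::int. integral {-(1/2)..1/2} (\<lambda>t. \<phi> t * cis (- (2 * pi * of_int k * t))))"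
  have "summable (\<lambda>n. (norm (a (g n)))\<^sup>2)"
  proof (rule bounded_imp_summable)
    fix n
    have "(\<Sum>k\<le>n. (norm (a (g k)))\<^sup>2) = (\<Sum>k\<in>g ` {..n}. (norm (a k))\<^sup>2)"
      using \<open>inj g\<close> by (subst sum.reindex) (auto simp: inj_on_def)
    also have "\<dots> \<le> integral {-(1/2)..1/2} (\<lambda>t. (norm (\<phi> t))\<^sup>2)"
      unfolding a_def by (rule Bessel_inequality_unit_interval[OF cont]) auto
    finally show "(\<Sum>k\<le>n. (norm (a (g k)))\<^sup>2) \<le> integral {-(1/2)..1/2} (\<lambda>t. (norm (\<phi> t))\<^sup>2)" .
  qed auto
  hence "(\<lambda>n. (norm (a (g n)))\<^sup>2) \<longlonglongrightarrow> 0" by (rule summable_LIMSEQ_zero)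
  from tendsto_real_sqrt[OF this] have "(\<lambda>n. norm (a (g n))) \<longlonglongrightarrow> 0" by simp
  thus ?thesis unfolding a_def by (rule tendsto_norm_zero_cancel)
qed

text \<open>With \<phi> = (F - F(0)) / (e - 1) and e(t) = exp(2 pi i t), the coefficients of F -
  F(0) are differences of consecutive coefficients of \<phi>. The symmetric partial sums telescope,
  and the two remaining coefficients tend to 0. Complex differentiability of F at 0 makes \<phi>
  continuous there.\<close>

lemma Fourier_series_at_0:
  fixes F :: "complex \<Rightarrow> complex" and c :: "int \<Rightarrow> complex"
  assumes holo: "F holomorphic_on ball 0 1"
    and c: "\<And>k. c k = integral {-(1/2)..1/2} (\<lambda>t. F (of_real t) * cis (- (2 * pi * of_int k * t)))"
  shows "(\<lambda>N. \<Sum>k=-int N..int N. c k) \<longlonglongrightarrow> F 0"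
proof -
  define I where "I = {-(1/2)..1/2::real}"
  define e where "e = (\<lambda>z. exp (2 * pi * \<i> * z))"
  define \<phi> where "\<phi> = (\<lambda>z. if z = 0 then deriv F 0 / (2 * pi * \<i>) else (F z - F 0) / (e z - 1))"
  have contF: "continuous_on (ball 0 1) F" using holo by (rule holomorphic_on_imp_continuous_on)
  have I_ball: "complex_of_real ` I \<subseteq> ball 0 1" by (auto simp: I_def)
  have e1: "e (of_real t) \<noteq> 1" if "t \<in> I" "t \<noteq> 0" for t
  proof
    assume "e (of_real t) = 1"
    then obtain n :: int where "2 * pi * t = of_int (2 * n) * pi" by (auto simp: e_def exp_eq_1)
    hence "t = of_int n" by simp
    with that show False by (auto simp: I_def)
  qed
  have isCont0: "isCont \<phi> 0"
  proof -
    have "((\<lambda>z. ((F z - F 0) / (z - 0)) / ((e z - e 0) / (z - 0))) \<longlongrightarrow> deriv F 0 / (2 * pi * \<i>)) (at 0)"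
    proof (rule tendsto_divide)
      have "(F has_field_derivative deriv F 0) (at 0)"
        using holo by (intro holomorphic_derivI[of _ "ball 0 1"]) auto
      thus "((\<lambda>z. (F z - F 0) / (z - 0)) \<longlongrightarrow> deriv F 0) (at 0)"
        by (simp add: has_field_derivative_iff)
      have "(e has_field_derivative (2 * pi * \<i>)) (at 0)"
        unfolding e_def by (auto intro!: derivative_eq_intros)
      thus "((\<lambda>z. (e z - e 0) / (z - 0)) \<longlongrightarrow> 2 * pi * \<i>) (at 0)"
        by (simp add: has_field_derivative_iff)
    qed auto
    moreover have "eventually (\<lambda>z. ((F z - F 0) / (z - 0)) / ((e z - e 0) / (z - 0)) = \<phi> z) (at 0)"
      by (auto simp: eventually_at_filter \<phi>_def e_def)
    ultimately have "(\<phi> \<longlongrightarrow> deriv F 0 / (2 * pi * \<i>)) (at 0)"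
      by (rule Lim_transform_eventually)
    thus ?thesis by (simp add: isCont_def \<phi>_def)
  qed
  have cont\<phi>: "continuous_on I (\<lambda>t. \<phi> (of_real t))"
  proof (rule continuous_at_imp_continuous_on, safe)
    fix t assume t: "t \<in> I"
    have oc: "isCont (\<lambda>t. complex_of_real t) t" by (intro continuous_intros)
    show "isCont (\<lambda>t. \<phi> (of_real t)) t"
    proof (cases "t = 0")
      case True
      thus ?thesis using isCont_o2[OF oc, of \<phi>] isCont0 by simp
    next
      case False
      have "isCont (\<lambda>z. (F z - F 0) / (e z - 1)) (of_real t)"
      proof (intro continuous_intros)
        show "isCont F (of_real t)"
          using contF I_ball t by (auto simp: continuous_on_eq_continuous_at)
        show "isCont e (of_real t)" unfolding e_def by (intro continuous_intros)
        show "e (of_real t) - 1 \<noteq> 0" using e1[OF t False] by simp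
      qed
      moreover have "eventually (\<lambda>z. z \<in> - {0}) (nhds (complex_of_real t))"
        using False by (intro eventually_nhds_in_open) auto
      hence "eventually (\<lambda>z. (F z - F 0) / (e z - 1) = \<phi> z) (nhds (of_real t))"
        by eventually_elim (auto simp: \<phi>_def)
      ultimately have "isCont \<phi> (of_real t)" by (subst (asm) isCont_cong) auto
      thus ?thesis by (rule isCont_o2[OF oc])
    qed
  qed
  define a where "a = (\<lambda>k::int. integral I (\<lambda>t. \<phi> (of_real t) * cis (- (2 * pi * of_int k * t))))"
  have a: "((\<lambda>t. \<phi> (of_real t) * cis (- (2 * pi * of_int k * t))) has_integral a k) I" for k
    unfolding a_def by (rule integrable_integral)
      (auto simp: I_def intro!: integrable_continuous_interval continuous_intros cont\<phi>[unfolded I_def])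
  have c': "((\<lambda>t. F (of_real t) * cis (- (2 * pi * of_int k * t))) has_integral c k) I" for k
  proof -
    have "continuous_on I (\<lambda>t. F (of_real t))"
      by (intro continuous_on_compose2[OF contF] continuous_intros I_ball)
    thus ?thesis unfolding c I_def[symmetric]
      by (intro integrable_integral) (auto simp: I_def intro!: integrable_continuous_interval continuous_intros)
  qed
  have one: "((\<lambda>t. cis (- (2 * pi * of_int k * t))) has_integral (if k = 0 then 1 else 0)) I" for k :: int
    using has_integral_cis_unit_interval[of "- k"] by (simp add: I_def)
  \<comment> \<open>Multiplying \<phi> by e lowers the frequency index by one, so the factor e - 1
    turns a coefficient into a difference of neighbours.\<close>
  have step: "c k - (if k = 0 then F 0 else 0) = a (k - 1) - a k" for k
  proof -
    have i1: "((\<lambda>t. F (of_real t) * cis (- (2 * pi * of_int k * t)) - F 0 * cis (- (2 * pi * of_int k * t)))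
            has_integral (c k - F 0 * (if k = 0 then 1 else 0))) I"
      by (intro has_integral_diff has_integral_mult_right c' one)
    have i2: "((\<lambda>t. \<phi> (of_real t) * cis (- (2 * pi * of_int (k - 1) * t))
          - \<phi> (of_real t) * cis (- (2 * pi * of_int k * t))) has_integral (a (k - 1) - a k)) I"
      by (intro has_integral_diff a)
    have "F (of_real t) * cis (- (2 * pi * of_int k * t)) - F 0 * cis (- (2 * pi * of_int k * t))
        = \<phi> (of_real t) * cis (- (2 * pi * of_int (k - 1) * t))
          - \<phi> (of_real t) * cis (- (2 * pi * of_int k * t))" if t: "t \<in> I" for t
    proof (cases "t = 0")
      case False
      have "cis (- (2 * pi * of_int (k - 1) * t)) = cis (- (2 * pi * of_int k * t)) * e (of_real t)"
        unfolding e_def cis_conv_exp exp_add[symmetric] by (simp add: algebra_simps)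
      moreover have "F (of_real t) - F 0 = \<phi> (of_real t) * (e (of_real t) - 1)"
        using e1[OF t False] False by (simp add: \<phi>_def)
      moreover have "a * C - b * C = P * C' - P * C" if "C' = C * E" "a - b = P * (E - 1)"
        for a b C C' E P :: complex
      proof -
        have "a * C - b * C = (a - b) * C" by (simp add: left_diff_distrib)
        thus ?thesis unfolding that by (simp add: algebra_simps)
      qed
      ultimately show ?thesis by blast
    qed auto
    hence "c k - F 0 * (if k = 0 then 1 else 0) = a (k - 1) - a k"
      using has_integral_unique[OF has_integral_eq[OF _ i1] i2] by blast
    thus ?thesis by (auto split: if_splits)
  qed
  have sum: "(\<Sum>k=-int N..int N. c k) = F 0 + a (- int N - 1) - a (int N)" for N
  proof (induction N)
    case 0
    thus ?case using step[of 0] by (simp add: algebra_simps)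
  next
    case (Suc N)
    have "{- int (Suc N)..int (Suc N)} = insert (int N + 1) (insert (- int N - 1) {- int N..int N})"
      by auto
    hence "(\<Sum>k=-int (Suc N)..int (Suc N). c k) = c (int N + 1) + (c (- int N - 1) + (\<Sum>k=-int N..int N. c k))"
      by simp
    also have "\<dots> = F 0 + a (- int (Suc N) - 1) - a (int (Suc N))"
      unfolding Suc using step[of "int N + 1"] step[of "- int N - 1"] by (simp add: algebra_simps)
    finally show ?case .
  qed
  have lim: "(\<lambda>n. a (g n)) \<longlonglongrightarrow> 0" if "inj g" for g :: "nat \<Rightarrow> int"
    unfolding a_def I_def using that cont\<phi> by (intro Fourier_coeff_tendsto_0) (auto simp: I_def)
  have "(\<lambda>N. F 0 + a (- int N - 1) - a (int N)) \<longlonglongrightarrow> F 0 + 0 - 0"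
    by (intro tendsto_intros lim) (auto simp: inj_def)
  thus ?thesis by (simp add: sum)
qed

section \<open>Gaussians and the transformation law of theta\<close>

lemma Gaussian_integrable:
  assumes "x > 0"
  shows "integrable lborel (\<lambda>t. exp (- (pi * x * t\<^sup>2)))"
proof -
  define c where "c = sqrt (2 * pi * x)"
  have c: "c > 0" "c\<^sup>2 = 2 * pi * x" using assms by (auto simp: c_def)
  have "integrable lborel (\<lambda>t. std_normal_density (0 + c * t))"
    by (rule lborel_integrable_real_affine) (use c in auto)
  hence "integrable lborel (\<lambda>t. sqrt (2 * pi) * std_normal_density (0 + c * t))" by simp
  also have "(\<lambda>t. sqrt (2 * pi) * std_normal_density (0 + c * t)) = (\<lambda>t. exp (- (pi * x * t\<^sup>2)))"
    by (simp add: std_normal_density_def power_mult_distrib c mult_ac)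
  finally show ?thesis .
qed

text \<open>This is the characteristic function of the standard normal distribution after scaling by
  c = sqrt(2 pi x).\<close>

lemma Gaussian_Fourier_transform:
  assumes "x > 0"
  shows "(LINT t|lborel. of_real (exp (- (pi * x * t\<^sup>2))) * cis (s * t)) = of_real (exp (- (s\<^sup>2 / (4 * pi * x))) / sqrt x)"
proof -
  define c where "c = sqrt (2 * pi * x)"
  have c: "c > 0" "c\<^sup>2 = 2 * pi * x" using assms by (auto simp: c_def)
  define w where "w = s / c"
  have "of_real (exp (- (w\<^sup>2 / 2))) = char std_normal_distribution w"
    by (simp add: char_std_normal_distribution)
  also have "\<dots> = (LINT t|lborel. std_normal_density t *\<^sub>R iexp (w * t))"
    unfolding char_def by (subst integral_density) auto
  also have "\<dots> = c *\<^sub>R (LINT t|lborel. std_normal_density (0 + c * t) *\<^sub>R iexp (w * (0 + c * t)))"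
    using lborel_integral_real_affine[of c "\<lambda>t. std_normal_density t *\<^sub>R iexp (w * t)" 0] c by simp
  also have "(\<lambda>t. std_normal_density (0 + c * t) *\<^sub>R iexp (w * (0 + c * t))) =
      (\<lambda>t. of_real (1 / sqrt (2 * pi)) * (of_real (exp (- (pi * x * t\<^sup>2))) * cis (s * t)))"
  proof
    fix t
    have e: "w * (0 + c * t) = s * t" using c by (simp add: w_def)
    have "iexp (w * (0 + c * t)) = cis (s * t)" unfolding e by (simp add: cis_conv_exp)
    moreover have "std_normal_density (0 + c * t) = 1 / sqrt (2 * pi) * exp (- (pi * x * t\<^sup>2))"
      by (simp add: std_normal_density_def power_mult_distrib c mult_ac)
    ultimately show "std_normal_density (0 + c * t) *\<^sub>R iexp (w * (0 + c * t)) =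
      of_real (1 / sqrt (2 * pi)) * (of_real (exp (- (pi * x * t\<^sup>2))) * cis (s * t))"
      by (simp add: scaleR_conv_of_real)
  qed
  also have "c *\<^sub>R (LINT t|lborel. complex_of_real (1 / sqrt (2 * pi)) * (of_real (exp (- (pi * x * t\<^sup>2))) * cis (s * t)))
    = of_real (c / sqrt (2 * pi)) * (LINT t|lborel. (of_real (exp (- (pi * x * t\<^sup>2))) * cis (s * t)))"
    by (simp add: scaleR_conv_of_real)
  also have "c / sqrt (2 * pi) = sqrt x"
    by (simp add: c_def real_sqrt_mult)
  finally have "of_real (sqrt x) * (LINT t|lborel. (of_real (exp (- (pi * x * t\<^sup>2))) * cis (s * t))) =
      complex_of_real (exp (- (w\<^sup>2 / 2)))" by simp
  moreover have "w\<^sup>2 / 2 = s\<^sup>2 / (4 * pi * x)"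
    using c by (simp add: w_def power_divide)
  ultimately show ?thesis using assms by (simp add: field_simps)
qed

lemma filterlim_symmetric_int_intervals:
  "filterlim (\<lambda>m. {- int m..int m}) (finite_subsets_at_top UNIV) sequentially"
  unfolding filterlim_finite_subsets_at_top
proof (intro allI impI)
  fix X :: "int set" assume "finite X \<and> X \<subseteq> UNIV"
  hence fin: "finite ((\<lambda>n. nat \<bar>n\<bar>) ` X)" by simp
  show "eventually (\<lambda>m. finite {- int m..int m} \<and> X \<subseteq> {- int m..int m} \<and> {- int m..int m} \<subseteq> UNIV) sequentially"
    using eventually_ge_at_top[of "Max ((\<lambda>n. nat \<bar>n\<bar>) ` X)"]
  proof eventually_elim
    case (elim m)
    have "n \<in> {- int m..int m}" if "n \<in> X" for n
    proof -
      have "nat \<bar>n\<bar> \<le> m" using Max_ge[OF fin, of "nat \<bar>n\<bar>"] that elim by fastforce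
      thus ?thesis by auto
    qed
    thus ?case by auto
  qed
qed

text \<open>The real part of (z + n)^2 is at least \<bar>n\<bar> - 3: for n \<noteq> 0 the real
  shift gives (\<bar>n\<bar> - 1)^2 \<ge> \<bar>n\<bar> - 2, and the imaginary part takes away at
  most 1. The right side is a summable majorant, uniform in z.\<close>

lemma norm_Gaussian_shift_le:
  fixes z :: complex
  assumes "x > 0" "norm z \<le> 1"
  shows "norm (exp (- (of_real (pi * x) * (z + of_int n)\<^sup>2))) \<le> exp (3 * pi * x) * exp (- pi * x) ^ nat \<bar>n\<bar>"
proof -
  define m where "m = real_of_int \<bar>n\<bar>"
  have "\<bar>Re z\<bar> \<le> 1" "\<bar>Im z\<bar> \<le> 1"
    using assms abs_Re_le_cmod[of z] abs_Im_le_cmod[of z] by linarith+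
  hence im: "(Im z)\<^sup>2 \<le> 1" by (simp add: abs_square_le_1)
  have "m - 3 \<le> (Re z + of_int n)\<^sup>2 - (Im z)\<^sup>2"
  proof (cases "n = 0")
    case True
    have "0 \<le> (Re z + of_int n)\<^sup>2" by simp
    moreover have "m = 0" using True by (simp add: m_def)
    ultimately show ?thesis using im by linarith
  next
    case False
    hence "m \<ge> 1" by (simp add: m_def)
    have "m - 1 \<le> \<bar>Re z + of_int n\<bar>" using \<open>\<bar>Re z\<bar> \<le> 1\<close> by (simp add: m_def)
    hence "(m - 1)\<^sup>2 \<le> (Re z + of_int n)\<^sup>2"
      using \<open>m \<ge> 1\<close> by (metis abs_le_square_iff abs_of_nonneg diff_ge_0_iff_ge)
    moreover have "m - 2 \<le> (m - 1)\<^sup>2"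
    proof -
      have "(m - 1)\<^sup>2 - (m - 2) = (m - 3/2)\<^sup>2 + 3/4" by (simp add: power2_eq_square algebra_simps)
      moreover have "0 \<le> (m - 3/2)\<^sup>2" by simp
      ultimately show ?thesis by linarith
    qed
    ultimately show ?thesis using im by linarith
  qed
  hence "- (pi * x * ((Re z + of_int n)\<^sup>2 - (Im z)\<^sup>2)) \<le> 3 * pi * x + real (nat \<bar>n\<bar>) * (- pi * x)"
    using assms mult_left_mono[of "m - 3" "(Re z + of_int n)\<^sup>2 - (Im z)\<^sup>2" "pi * x"]
    by (simp add: m_def algebra_simps)
  hence "exp (- (pi * x * ((Re z + of_int n)\<^sup>2 - (Im z)\<^sup>2))) \<le> exp (3 * pi * x) * exp (- pi * x) ^ nat \<bar>n\<bar>"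
    by (simp flip: exp_of_nat_mult exp_add)
  thus ?thesis by (simp add: power2_eq_square algebra_simps)
qed

lemma theta_has_sum_shift:
  assumes "x > 0"
  shows "(\<lambda>n::int. exp (3 * pi * x) * exp (- pi * x) ^ nat \<bar>n\<bar>) summable_on UNIV"
  using assms by (intro summable_on_cmult_right summable_on_power_nat_abs) auto

text \<open>Unfolding: the integer translates of the unit interval tile a symmetric interval, whose
  end points are half-integers.\<close>

lemma integral_periodization:
  fixes h :: "real \<Rightarrow> complex"
  assumes cont: "continuous_on UNIV h"
  shows "integral {-(1/2)..1/2} (\<lambda>t. \<Sum>n=-int m..int m. h (t + of_int n)) = integral {- (real m + 1/2)..real m + 1/2} h"
proof -
  have ci: "h integrable_on {a..b}" for a b
    by (rule integrable_continuous_interval) (rule continuous_on_subset[OF cont], simp)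
  have shift: "integral {-(1/2)..1/2} (\<lambda>t. h (t + of_int n)) = integral {of_int n - 1/2..of_int n + 1/2} h" for n
    using integral_shift_Icc_real[of "-(1/2)" "1/2" h "of_int n"] by (simp add: o_def add.commute algebra_simps)
  have "integral {-(1/2)..1/2} (\<lambda>t. \<Sum>n=-int m..int m. h (t + of_int n)) =
        (\<Sum>n=-int m..int m. integral {of_int n - 1/2..of_int n + 1/2} h)"
    unfolding shift[symmetric]
    by (rule integral_sum) (auto intro!: integrable_continuous_interval continuous_on_compose2[OF cont] continuous_intros)
  also have "\<dots> = integral {- (real m + 1/2)..real m + 1/2} h"
  proof (induction m)
    case (Suc m)
    have "{- int (Suc m)..int (Suc m)} = insert (int m + 1) (insert (- int m - 1) {- int m..int m})"
      by auto
    hence "(\<Sum>n=-int (Suc m)..int (Suc m). integral {of_int n - 1/2..of_int n + 1/2} h) =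
        integral {real m + 1/2..real m + 3/2} h + (integral {- real m - 3/2..- real m - 1/2} h
         + (\<Sum>n=-int m..int m. integral {of_int n - 1/2..of_int n + 1/2} h))"
      by (simp add: algebra_simps)
    also have "\<dots> = integral {- real m - 3/2..- real m - 1/2} h + integral {- real m - 1/2..real m + 1/2} h
        + integral {real m + 1/2..real m + 3/2} h"
      unfolding Suc by (simp add: algebra_simps)
    also have "integral {- real m - 3/2..- real m - 1/2} h + integral {- real m - 1/2..real m + 1/2} h
        = integral {- real m - 3/2..real m + 1/2} h"
      by (rule Henstock_Kurzweil_Integration.integral_combine) (auto intro: ci)
    also have "\<dots> + integral {real m + 1/2..real m + 3/2} h = integral {- real m - 3/2..real m + 3/2} h"
      by (rule Henstock_Kurzweil_Integration.integral_combine) (auto intro: ci)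
    finally show ?case by (simp add: algebra_simps)
  qed simp
  finally show ?thesis .
qed

lemma theta3_exp_has_sum:
  assumes "x > 0"
  shows "((\<lambda>n::int. exp (- pi * (of_int n)\<^sup>2 * x)) has_sum theta x) UNIV"
    and "theta3 (of_real (exp (- pi * x))) = of_real (theta x)"
proof -
  have eq: "exp (- pi * x) ^ nat (n\<^sup>2) = exp (- pi * (of_int n)\<^sup>2 * x)" for n :: int
    by (simp flip: exp_of_nat_mult add: algebra_simps)
  have "(\<lambda>n::int. norm (complex_of_real (exp (- pi * x)) ^ nat (n\<^sup>2))) summable_on UNIV"
    using assms by (intro theta3_abs_summable) simp
  hence s: "(\<lambda>n::int. exp (- pi * (of_int n)\<^sup>2 * x)) summable_on UNIV"
    by (simp add: norm_power eq[simplified])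
  thus 1: "((\<lambda>n::int. exp (- pi * (of_int n)\<^sup>2 * x)) has_sum theta x) UNIV"
    unfolding theta_def by (rule has_sum_infsum)
  have "theta3 (of_real (exp (- pi * x))) = (\<Sum>\<^sub>\<infinity>n::int. complex_of_real (exp (- pi * (of_int n)\<^sup>2 * x)))"
    unfolding theta3_def eq[symmetric] by simp
  also have "\<dots> = of_real (theta x)"
    using has_sum_of_real[OF 1, where 'a = complex] by (rule infsumI)
  finally show "theta3 (of_real (exp (- pi * x))) = of_real (theta x)" .
qed

text \<open>Poisson summation. The periodised Gaussian \<open>F\<close> has the Fourier coefficients
  \<open>c k\<close>, again Gaussian; evaluating its Fourier series at 0 compares theta at 1/x with
  theta at x. \<open>F\<close> is taken at complex arguments because
  \<open>Fourier_series_at_0\<close> requires a holomorphic function.\<close>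

lemma theta_functional_equation:
  assumes "x > 0"
  shows "theta (1 / x) = sqrt x * theta x"
proof -
  define G where "G = (\<lambda>n::int. \<lambda>z. exp (- (of_real (pi * x) * (z + of_int n)\<^sup>2)) :: complex)"
  define F where "F = (\<lambda>z. \<Sum>\<^sub>\<infinity>n. G n z)"
  define M where "M = (\<lambda>n::int. exp (3 * pi * x) * exp (- pi * x) ^ nat \<bar>n\<bar>)"
  have M: "M summable_on UNIV" unfolding M_def by (rule theta_has_sum_shift[OF assms])
  have GM: "norm (G n z) \<le> M n" if "norm z \<le> 1" for n z
    unfolding G_def M_def by (rule norm_Gaussian_shift_le[OF assms that])
  have holo: "F holomorphic_on ball 0 1"
    unfolding F_def
  proof (rule holomorphic_on_infsum)
    fix z :: complex assume "z \<in> ball 0 1"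
    then obtain r where r: "r > 0" "cball z r \<subseteq> ball 0 1"
      using open_contains_cball by blast
    thus "\<exists>r>0. \<exists>M. cball z r \<subseteq> ball 0 1 \<and> M summable_on (UNIV :: int set) \<and> (\<forall>n\<in>UNIV. \<forall>w\<in>cball z r. norm (G n w) \<le> M n)"
      by (intro exI[of _ r] exI[of _ M] conjI M ballI GM) auto
  qed (auto simp: G_def intro!: holomorphic_intros)
  define I where "I = {-(1/2)..1/2::real}"
  define c where "c = (\<lambda>k::int. of_real (exp (- pi * (of_int k)\<^sup>2 * (1 / x)) / sqrt x) :: complex)"
  have coeff: "c k = integral {-(1/2)..1/2} (\<lambda>t. F (of_real t) * cis (- (2 * pi * of_int k * t)))" for k
  proof -
    define h where "h = (\<lambda>t. of_real (exp (- (pi * x * t\<^sup>2))) * cis (- (2 * pi * of_int k * t)))"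
    have conth: "continuous_on UNIV h" unfolding h_def by (intro continuous_intros)
    have h_shift: "h (t + of_int n) = G n (of_real t) * cis (- (2 * pi * of_int k * t))" for t n
    proof -
      have "cis (- (2 * pi * of_int k * (t + of_int n))) = cis (- (2 * pi * of_int k * t)) * cis (2 * pi * of_int (- k * n))"
        by (subst cis_mult) (simp add: algebra_simps)
      also have "cis (2 * pi * of_int (- k * n)) = 1" by (rule cis_multiple_2pi) auto
      finally have "cis (- (2 * pi * of_int k * (t + of_int n))) = cis (- (2 * pi * of_int k * t))" by simp
      moreover have "complex_of_real (exp (- (pi * x * (t + of_int n)\<^sup>2))) = G n (of_real t)"
        unfolding G_def by (simp flip: exp_of_real)
      ultimately show ?thesis by (simp add: h_def)
    qed
    have inth: "integrable lborel h"
    proof (rule Bochner_Integration.integrable_bound[OF Gaussian_integrable[OF assms]])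
      show "h \<in> borel_measurable lborel"
        using borel_measurable_continuous_onI[OF conth] by simp
    qed (auto simp: h_def norm_mult)
    have lim1: "(\<lambda>m. integral {- (real m + 1/2)..real m + 1/2} h) \<longlonglongrightarrow> (LINT t|lborel. h t)"
    proof (rule tendsto_integral_symmetric_interval[OF inth])
      show "filterlim (\<lambda>m. real m + 1/2) at_top sequentially" by real_asymp
    qed
    have ul: "uniform_limit I (\<lambda>m t. \<Sum>n=-int m..int m. h (t + of_int n)) (\<lambda>t. \<Sum>\<^sub>\<infinity>n. h (t + of_int n)) sequentially"
    proof -
      have "uniform_limit I (\<lambda>X t. \<Sum>n\<in>X. h (t + of_int n)) (\<lambda>t. \<Sum>\<^sub>\<infinity>n. h (t + of_int n)) (finite_subsets_at_top UNIV)"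
      proof (rule Weierstrass_m_test_general[OF _ M])
        fix n :: int and t assume "t \<in> I"
        hence "norm (complex_of_real t) \<le> 1" by (auto simp: I_def)
        from GM[OF this, of n] show "norm (h (t + of_int n)) \<le> M n" by (simp add: h_shift norm_mult)
      qed
      from filterlim_compose[OF this filterlim_symmetric_int_intervals] show ?thesis .
    qed
    obtain A J where A: "\<And>m. ((\<lambda>t. \<Sum>n=-int m..int m. h (t + of_int n)) has_integral A m) I"
      and J: "((\<lambda>t. \<Sum>\<^sub>\<infinity>n. h (t + of_int n)) has_integral J) I" and lim2: "A \<longlonglongrightarrow> J"
    proof (rule uniform_limit_integral[OF ul[unfolded I_def]])
      show "continuous_on {-(1/2)..1/2} (\<lambda>t. \<Sum>n=-int m..int m. h (t + of_int n))" for m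
        by (intro continuous_intros continuous_on_compose2[OF conth]) auto
    qed (auto simp: I_def)
    have "A m = integral {- (real m + 1/2)..real m + 1/2} h" for m
      using A[of m] integral_periodization[OF conth, of m] by (simp add: I_def integral_unique)
    with lim2 lim1 have "J = (LINT t|lborel. h t)"
      by (metis (no_types, lifting) LIMSEQ_unique ext)
    also have "\<dots> = c k"
      using Gaussian_Fourier_transform[OF assms, of "- (2 * pi * of_int k)"]
      by (simp add: h_def c_def power_mult_distrib power2_eq_square field_simps)
    finally have "c k = integral I (\<lambda>t. \<Sum>\<^sub>\<infinity>n. h (t + of_int n))"
      using J by (simp add: integral_unique)
    thus ?thesis by (simp add: h_shift infsum_cmult_left' F_def I_def)
  qed
  have "(\<lambda>N. \<Sum>k=-int N..int N. c k) \<longlonglongrightarrow> F 0"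
    by (rule Fourier_series_at_0[OF holo coeff])
  moreover have "(\<lambda>N. \<Sum>k=-int N..int N. c k) \<longlonglongrightarrow> of_real (theta (1 / x) / sqrt x)"
  proof -
    have "((\<lambda>k. exp (- pi * (of_int k)\<^sup>2 * (1 / x)) * (1 / sqrt x)) has_sum (theta (1 / x) * (1 / sqrt x))) UNIV"
      by (rule has_sum_cmult_left[OF theta3_exp_has_sum(1)]) (use assms in auto)
    from has_sum_of_real[OF this, where 'a = complex]
    have "(c has_sum of_real (theta (1 / x) / sqrt x)) UNIV" by (simp add: c_def)
    from filterlim_compose[OF this[unfolded has_sum_def] filterlim_symmetric_int_intervals]
    show ?thesis .
  qed
  ultimately have "F 0 = of_real (theta (1 / x) / sqrt x)" by (rule LIMSEQ_unique)
  moreover have "F 0 = of_real (theta x)"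
  proof -
    have "G n 0 = of_real (exp (- pi * (of_int n)\<^sup>2 * x))" for n
      unfolding G_def by (simp flip: exp_of_real add: mult_ac)
    hence "F 0 = (\<Sum>\<^sub>\<infinity>n. complex_of_real (exp (- pi * (of_int n)\<^sup>2 * x)))" by (simp add: F_def)
    also have "\<dots> = of_real (theta x)"
      using has_sum_of_real[OF theta3_exp_has_sum(1)[OF assms], where 'a = complex] by (rule infsumI)
    finally show ?thesis .
  qed
  ultimately have "theta x = theta (1 / x) / sqrt x" by (metis of_real_eq_iff)
  thus ?thesis using assms by (simp add: field_simps)
qed

section \<open>Real powers of the theta function\<close>

text \<open>Identity theorem; it carries the transformation law and the evenness of the kernel from
  real to complex arguments.\<close>

lemma holomorphic_eq_if_eq_on_reals:
  fixes f g :: "complex \<Rightarrow> complex"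
  assumes holo: "f holomorphic_on S" "g holomorphic_on S" and S: "open S" "connected S"
    and "a < b" and real_in: "\<And>x. a < x \<Longrightarrow> x < b \<Longrightarrow> of_real x \<in> S"
    and eq: "\<And>x. a < x \<Longrightarrow> x < b \<Longrightarrow> f (of_real x) = g (of_real x)"
    and "z \<in> S"
  shows "f z = g z"
proof -
  define m where "m = (a + b) / 2"
  have m: "a < m" "m < b" using \<open>a < b\<close> by (auto simp: m_def)
  have "of_real m islimpt (complex_of_real ` {a<..<b})"
    unfolding islimpt_approachable
  proof (intro allI impI)
    fix e :: real assume "e > 0"
    define d where "d = min (e / 2) ((b - m) / 2)"
    have d: "d > 0" "d < e" "d < b - m"
      using \<open>e > 0\<close> m by (auto simp: d_def min_def)
    define x where "x = m + d"
    have "x \<in> {a<..<b}" "x \<noteq> m" "dist (complex_of_real x) (of_real m) < e"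
      using m d by (auto simp: x_def dist_norm)
    thus "\<exists>x'\<in>complex_of_real ` {a<..<b}. x' \<noteq> of_real m \<and> dist x' (of_real m) < e"
      by (intro bexI[of _ "of_real x"] conjI) (auto simp only: of_real_eq_iff)
  qed
  hence "f z - g z = 0"
  proof (rule analytic_continuation[of "\<lambda>z. f z - g z" S "complex_of_real ` {a<..<b}" "of_real m", rotated 5])
    show "(\<lambda>z. f z - g z) holomorphic_on S" by (intro holomorphic_intros holo)
    show "of_real m \<in> S" using m by (intro real_in)
  qed (use assms(3-) in auto)
  thus ?thesis by simp
qed

section \<open>Logarithm and real powers of theta, and the coefficients r_alpha\<close>

lemma theta_ge_1:
  assumes "x > 0"
  shows "theta x \<ge> 1"
proof -
  have "sum (\<lambda>n::int. exp (- pi * (of_int n)\<^sup>2 * x)) {0} \<le> theta x"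
    by (rule has_sum_mono_neutral[OF has_sum_finite theta3_exp_has_sum(1)[OF assms]]) auto
  thus ?thesis by simp
qed

text \<open>A logarithm exists because \<open>theta3\<close> has no zeros in the disc. The
  normalisation at 0 selects the branch that is real on [0, 1), so that its multiples give the
  ordinary real powers there.\<close>

definition theta3_log :: "complex \<Rightarrow> complex" where
  "theta3_log = (SOME L. L holomorphic_on ball 0 1 \<and> L 0 = 0 \<and> (\<forall>q\<in>ball 0 1. exp (L q) = theta3 q))"

lemma theta3_0 [simp]: "theta3 0 = 1"
  using norm_theta3_minus_1_le[of 0] by simp

lemma theta3_log:
  shows theta3_log_holomorphic: "theta3_log holomorphic_on ball 0 1"
    and theta3_log_0: "theta3_log 0 = 0"
    and exp_theta3_log: "norm q < 1 \<Longrightarrow> exp (theta3_log q) = theta3 q"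
proof -
  obtain g where g: "g holomorphic_on ball 0 1" "\<And>z. z \<in> ball 0 1 \<Longrightarrow> theta3 z = exp (g z)"
    using contractible_imp_holomorphic_log[OF theta3_holomorphic convex_imp_contractible[OF convex_ball] theta3_nonzero]
    by auto
  have "exp (g 0) = 1" using g(2)[of 0] by simp
  hence "\<exists>L. L holomorphic_on ball 0 1 \<and> L 0 = 0 \<and> (\<forall>q\<in>ball 0 1. exp (L q) = theta3 q)"
    using g by (intro exI[of _ "\<lambda>z. g z - g 0"]) (auto intro!: holomorphic_intros simp: exp_diff)
  from someI_ex[OF this, folded theta3_log_def]
  show "theta3_log holomorphic_on ball 0 1" "theta3_log 0 = 0"
    "norm q < 1 \<Longrightarrow> exp (theta3_log q) = theta3 q" by auto
qed

definition theta3_powr :: "real \<Rightarrow> complex \<Rightarrow> complex" where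
  "theta3_powr \<alpha> q = exp (of_real \<alpha> * theta3_log q)"

lemma theta3_powr_holomorphic: "theta3_powr \<alpha> holomorphic_on ball 0 1"
  unfolding theta3_powr_def [abs_def] by (intro holomorphic_intros theta3_log_holomorphic)

lemma theta3_powr_0 [simp]: "theta3_powr \<alpha> 0 = 1"
  by (simp add: theta3_powr_def theta3_log_0)

lemma norm_theta3_powr:
  assumes "norm q < 1"
  shows "norm (theta3_powr \<alpha> q) = norm (theta3 q) powr \<alpha>"
proof -
  have "norm (theta3 q) = exp (Re (theta3_log q))"
    by (simp flip: exp_theta3_log[OF assms])
  thus ?thesis by (simp add: theta3_powr_def powr_def)
qed

text \<open>As theta is positive on [0, 1), the imaginary part \<open>f\<close> always satisfies sin
  f = 0 and cos f > 0. It is continuous and starts at 0. A nonzero value would have modulus at least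
  pi, hence f would pass through pi/2 or -pi/2, where the cosine vanishes.\<close>

lemma Im_theta3_log_real:
  assumes "0 \<le> r" "r < 1"
  shows "Im (theta3_log (of_real r)) = 0"
proof (rule ccontr)
  assume nz: "Im (theta3_log (of_real r)) \<noteq> 0"
  define f where "f = (\<lambda>t. Im (theta3_log (of_real t)))"
  have cont: "continuous_on {0..r} f"
    unfolding f_def
    by (intro continuous_intros continuous_on_compose2[OF holomorphic_on_imp_continuous_on[OF theta3_log_holomorphic]])
       (use assms in auto)
  have theta_pos: "\<exists>y>0. theta3 (of_real t) = of_real y" if "t \<in> {0..r}" for t
  proof (cases "t = 0")
    case False
    hence t: "0 < t" "t < 1" using that assms by auto
    define x where "x = - ln t / pi"
    have x: "x > 0" "exp (- pi * x) = t" using t by (auto simp: x_def divide_simps)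
    show ?thesis using theta3_exp_has_sum(2)[OF x(1)] theta_ge_1[OF x(1)] x
      by (intro exI[of _ "theta x"]) auto
  qed (auto intro: exI[of _ 1])
  have no: "sin (f t) = 0 \<and> cos (f t) > 0" if t: "t \<in> {0..r}" for t
  proof -
    obtain y where y: "y > 0" "theta3 (of_real t) = of_real y" using theta_pos[OF t] by blast
    have "exp (theta3_log (of_real t)) = of_real y"
      using exp_theta3_log[of "of_real t"] y t assms by auto
    hence "Re (exp (theta3_log (of_real t))) = y" "Im (exp (theta3_log (of_real t))) = 0" by simp_all
    hence "exp (Re (theta3_log (of_real t))) * cos (f t) = y" "exp (Re (theta3_log (of_real t))) * sin (f t) = 0"
      unfolding f_def Re_exp Im_exp by simp_all
    thus ?thesis using y(1) by (auto simp: zero_less_mult_iff)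
  qed
  have f0: "f 0 = 0" by (simp add: f_def theta3_log_0)
  have "connected (f ` {0..r})" by (rule connected_continuous_image[OF cont]) auto
  hence ivt: "\<exists>t\<in>{0..r}. f t = y" if "(0 \<le> y \<and> y \<le> f r) \<or> (f r \<le> y \<and> y \<le> 0)" for y
  proof -
    have "0 \<in> f ` {0..r}" "f r \<in> f ` {0..r}" using f0 assms by (auto intro!: image_eqI[of 0 f 0])
    hence "y \<in> f ` {0..r}"
      using that \<open>connected (f ` {0..r})\<close> unfolding connected_iff_interval by blast
    thus ?thesis by auto
  qed
  have fr: "sin (f r) = 0" "cos (f r) > 0" using no[of r] assms by auto
  have "f r \<noteq> 0" using nz by (simp add: f_def)
  have "\<bar>f r\<bar> \<ge> pi"
  proof (rule ccontr)
    assume "\<not> \<bar>f r\<bar> \<ge> pi"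
    hence "f r = 0" using fr(1) sin_gt_zero[of "f r"] sin_gt_zero[of "- f r"] by (cases "f r" "0::real" rule: linorder_cases) auto
    with \<open>f r \<noteq> 0\<close> show False by simp
  qed
  hence "(\<exists>t\<in>{0..r}. f t = pi / 2) \<or> (\<exists>t\<in>{0..r}. f t = - (pi / 2))"
    using ivt[of "pi / 2"] ivt[of "- (pi / 2)"] pi_gt_zero by (cases "f r \<ge> 0") auto
  then obtain t where t: "t \<in> {0..r}" "f t = pi / 2 \<or> f t = - (pi / 2)" by blast
  from t(2) have "cos (f t) = 0" by (elim disjE) (simp_all only: cos_pi_half cos_minus)
  thus False using no[OF t(1)] by simp
qed

lemma theta3_powr_real:
  assumes "x > 0"
  shows "theta3_powr \<alpha> (of_real (exp (- pi * x))) = of_real (theta x powr \<alpha>)"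
proof -
  define L where "L = theta3_log (of_real (exp (- pi * x)))"
  have r: "exp (- pi * x) < 1" using assms by simp
  have "Im L = 0"
    unfolding L_def by (rule Im_theta3_log_real) (use r in auto)
  hence L: "L = of_real (Re L)" by (simp add: complex_eq_iff)
  have "exp L = of_real (theta x)"
    using exp_theta3_log[of "of_real (exp (- pi * x))"] theta3_exp_has_sum(2)[OF assms] r by (simp add: L_def)
  hence "of_real (exp (Re L)) = complex_of_real (theta x)" by (subst (asm) L) (simp flip: exp_of_real)
  hence "exp (Re L) = theta x" by (simp only: of_real_eq_iff)
  moreover from this have "Re L = ln (theta x)" by (metis ln_exp)
  ultimately have "exp (\<alpha> * Re L) = theta x powr \<alpha>" using theta_ge_1[OF assms] by (auto simp: powr_def)
  moreover have "theta3_powr \<alpha> (of_real (exp (- pi * x))) = exp (of_real \<alpha> * L)"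
    by (simp add: theta3_powr_def L_def)
  hence "theta3_powr \<alpha> (of_real (exp (- pi * x))) = of_real (exp (\<alpha> * Re L))"
    by (subst (asm) L) (simp flip: exp_of_real)
  ultimately show ?thesis by simp
qed

text \<open>The Taylor coefficients of \<open>theta3_powr\<close> without the constant term fulfil
  the description that defines \<open>r_alpha\<close>, and power series are determined by their
  values at real nomes. The bound is Cauchy's estimate on a circle that depends on n.\<close>

lemma r_alpha_properties:
  shows r_alpha_0: "r_alpha \<alpha> 0 = 0"
    and r_alpha_sums: "norm q < 1 \<Longrightarrow> (\<lambda>n. of_real (r_alpha \<alpha> n) * q ^ n) sums (theta3_powr \<alpha> q - 1)"
    and r_alpha_bound: "\<alpha> > 0 \<Longrightarrow> n \<ge> 1 \<Longrightarrow> \<bar>r_alpha \<alpha> n\<bar> \<le> exp 1 * (4 * real n) powr \<alpha>"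
proof -
  define a where "a = (\<lambda>n. (deriv ^^ n) (theta3_powr \<alpha>) 0 / fact n)"
  define r where "r = (\<lambda>n. if n = 0 then 0 else Re (a n))"
  have a: "(\<lambda>n. a n * q ^ n) sums theta3_powr \<alpha> q" if "norm q < 1" for q
    using holomorphic_power_series[OF theta3_powr_holomorphic, of q] that by (simp add: a_def)
  have a0: "a 0 = 1" by (simp add: a_def)
  have powr_real: "theta3_powr \<alpha> (of_real t) \<in> \<real>" if "0 < t" "t < 1" for t
  proof -
    have "- ln t / pi > 0" "exp (- pi * (- ln t / pi)) = t" using that by (auto simp: divide_simps)
    thus ?thesis using theta3_powr_real[of "- ln t / pi" \<alpha>] by (metis Reals_of_real)
  qed
  have a_real: "a n = of_real (Re (a n))" for n
  proof -
    \<comment> \<open>Reflection principle: the imaginary parts of the coefficients form a power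
      series that vanishes at real nomes, where the power of theta is real.\<close>
    have s: "(\<lambda>n. (a n - cnj (a n)) * q ^ n) sums (theta3_powr \<alpha> q - cnj (theta3_powr \<alpha> (cnj q)))" if "norm q < 1" for q
    proof -
      have "(\<lambda>n. cnj (a n * cnj q ^ n)) sums cnj (theta3_powr \<alpha> (cnj q))"
        using a[of "cnj q"] that by (subst sums_cnj) simp
      from sums_diff[OF a[OF that] this] show ?thesis by (simp add: left_diff_distrib)
    qed
    have "a n - cnj (a n) = 0"
    proof (rule powser_eq_0[of 1])
      fix t :: real assume t: "0 < t" "t < 1"
      have "(\<Sum>n. (a n - cnj (a n)) * of_real t ^ n) = theta3_powr \<alpha> (of_real t) - cnj (theta3_powr \<alpha> (of_real t))"
        using s[of "of_real t"] t by (simp add: sums_iff)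
      also have "\<dots> = 0" using powr_real[OF t] by (simp add: Reals_cnj_iff)
      finally show "(\<Sum>n. (a n - cnj (a n)) * of_real t ^ n) = 0" .
    qed (use s in \<open>auto simp: sums_iff\<close>)
    thus ?thesis by (simp add: complex_eq_iff)
  qed
  have rs: "(\<lambda>n. of_real (r n) * q ^ n) sums (theta3_powr \<alpha> q - 1)" if "norm q < 1" for q
  proof -
    from sums_diff[OF a[OF that] sums_single[of 0 "\<lambda>n. a n * q ^ n"]]
    have "(\<lambda>n. a n * q ^ n - (if n = 0 then a n * q ^ n else 0)) sums (theta3_powr \<alpha> q - 1)"
      by (simp add: a0)
    also have "(\<lambda>n. a n * q ^ n - (if n = 0 then a n * q ^ n else 0)) = (\<lambda>n. of_real (r n) * q ^ n)"
      using a_real by (auto simp: r_def fun_eq_iff)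
    finally show ?thesis .
  qed
  have r_real: "(\<lambda>n. r n * exp (- pi * real n * x)) sums (theta x powr \<alpha> - 1)" if "x > 0" for x
  proof -
    have "(\<lambda>n. complex_of_real (r n * exp (- pi * real n * x))) sums of_real (theta x powr \<alpha> - 1)"
      using rs[of "of_real (exp (- pi * x))"] that theta3_powr_real[OF that]
      by (simp add: exp_of_nat_mult[symmetric] mult_ac flip: of_real_power)
    thus ?thesis by (simp only: sums_of_real_iff)
  qed
  have "r_alpha \<alpha> = r"
    unfolding r_alpha_def
  proof (rule the_equality)
    fix r' assume r': "r' 0 = 0 \<and> (\<forall>x>0. (\<lambda>n. r' n * exp (- pi * real n * x)) sums (theta x powr \<alpha> - 1))"
    have s: "(\<lambda>n. (r' n - r n) * t ^ n) sums 0" if t: "0 < t" "t < 1" for t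
    proof -
      define x where "x = - ln t / pi"
      have x: "x > 0" "exp (- pi * x) = t" using t by (auto simp: x_def divide_simps)
      have "exp (- pi * real n * x) = t ^ n" for n
        unfolding x(2)[symmetric] by (simp flip: exp_of_nat_mult add: mult_ac)
      thus ?thesis using sums_diff[OF r'[THEN conjunct2, rule_format, OF x(1)] r_real[OF x(1)]]
        by (simp add: left_diff_distrib)
    qed
    have "r' n - r n = 0" for n
    proof (rule powser_eq_0[of 1])
      fix t :: real assume "norm t < 1"
      \<comment> \<open>Convergence is so far known at positive arguments only; a larger positive
        \<open>t'\<close> gives it at every t of smaller modulus, whatever its sign.\<close>
      define t' where "t' = (\<bar>t\<bar> + 1) / 2"
      have "0 < t'" "t' < 1" "norm t < norm t'" using \<open>norm t < 1\<close> by (auto simp: t'_def)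
      thus "summable (\<lambda>n. (r' n - r n) * t ^ n)"
        using powser_inside[of "\<lambda>n. r' n - r n" t' t] s[of t'] by (auto simp: sums_iff)
    qed (use s in \<open>auto simp: sums_iff\<close>)
    thus "r' = r" by (simp add: fun_eq_iff)
  qed (use r_real in \<open>auto simp: r_def\<close>)
  thus "r_alpha \<alpha> 0 = 0" "norm q < 1 \<Longrightarrow> (\<lambda>n. of_real (r_alpha \<alpha> n) * q ^ n) sums (theta3_powr \<alpha> q - 1)"
    using rs by (auto simp: r_def)
  assume \<alpha>: "\<alpha> > 0" and n: "n \<ge> 1"
  \<comment> \<open>On this circle theta is at most 2 (n + 1) \<le> 4 n, while \<rho>^(-n) = (1 +
    1/n)^n stays below e.\<close>
  define \<rho> where "\<rho> = real n / (real n + 1)"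
  have \<rho>: "0 < \<rho>" "\<rho> < 1" "1 - \<rho> = 1 / (real n + 1)" using n by (auto simp: \<rho>_def field_simps)
  have "norm ((deriv ^^ n) (theta3_powr \<alpha>) 0) \<le> fact n * (4 * real n) powr \<alpha> / \<rho> ^ n"
  proof (rule norm_higher_deriv_le[OF theta3_powr_holomorphic open_ball _ \<rho>(1)])
    fix q :: complex assume "q \<in> cball 0 \<rho>"
    hence q: "norm q \<le> \<rho>" "norm q < 1" using \<rho> by auto
    have "norm (theta3 q) \<le> 2 / (1 - norm q)" by (rule norm_theta3_le[OF q(2)])
    also have "\<dots> \<le> 2 / (1 - \<rho>)" using q \<rho> by (intro divide_left_mono mult_pos_pos) auto
    also have "\<dots> \<le> 4 * real n" using n by (simp add: \<rho>(3))
    finally show "norm (theta3_powr \<alpha> q) \<le> (4 * real n) powr \<alpha>"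
      unfolding norm_theta3_powr[OF q(2)] using \<alpha> by (intro powr_mono2) auto
  qed (use \<rho> in auto)
  hence "norm (a n) \<le> fact n * (4 * real n) powr \<alpha> / \<rho> ^ n / fact n"
    unfolding a_def norm_divide norm_fact by (rule divide_right_mono) simp
  hence "norm (a n) \<le> (4 * real n) powr \<alpha> / \<rho> ^ n" by simp
  also have "\<dots> = (1 + 1 / real n) ^ n * (4 * real n) powr \<alpha>"
    using n by (simp add: \<rho>_def power_divide field_simps)
  also have "\<dots> \<le> exp 1 * (4 * real n) powr \<alpha>"
    using n exp_ge_one_plus_x_over_n_power_n[of n 1] by (intro mult_right_mono) auto
  finally have "norm (a n) \<le> exp 1 * (4 * real n) powr \<alpha>" .
  moreover have "\<bar>r n\<bar> \<le> norm (a n)" using abs_Re_le_cmod[of "a n"] n by (simp add: r_def)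
  ultimately show "\<bar>r_alpha \<alpha> n\<bar> \<le> exp 1 * (4 * real n) powr \<alpha>"
    using \<open>r_alpha \<alpha> = r\<close> by simp
qed

lemma theta3_exp_holomorphic:
  assumes "f holomorphic_on A" "\<And>z. z \<in> A \<Longrightarrow> Re (f z) < 0"
  shows "(\<lambda>z. theta3 (exp (f z))) holomorphic_on A"
    and "(\<lambda>z. theta3_powr \<alpha> (exp (f z))) holomorphic_on A"
proof -
  have "(\<lambda>z. exp (f z)) holomorphic_on A" "(\<lambda>z. exp (f z)) \<in> A \<rightarrow> ball 0 1"
    using assms by (auto intro!: holomorphic_intros)
  thus "(\<lambda>z. theta3 (exp (f z))) holomorphic_on A" "(\<lambda>z. theta3_powr \<alpha> (exp (f z))) holomorphic_on A"
    using holomorphic_on_compose_gen[OF _ theta3_holomorphic, of "\<lambda>z. exp (f z)" A]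
      holomorphic_on_compose_gen[OF _ theta3_powr_holomorphic, of "\<lambda>z. exp (f z)" A \<alpha>]
    by (auto simp: o_def)
qed

text \<open>Continuation from the real interval to the right half-plane, where the principal square
  root is holomorphic.\<close>

lemma theta3_functional_equation:
  assumes "Re \<xi> > 0"
  shows "theta3 (exp (- of_real pi / \<xi>)) = csqrt \<xi> * theta3 (exp (- of_real pi * \<xi>))"
proof (rule holomorphic_eq_if_eq_on_reals[where S = "{z. Re z > 0}" and a = 0 and b = 1 and z = \<xi>
      and f = "\<lambda>\<xi>. theta3 (exp (- of_real pi / \<xi>))" and g = "\<lambda>\<xi>. csqrt \<xi> * theta3 (exp (- of_real pi * \<xi>))"])
  have Re_inv: "Re (- of_real pi / z) < 0" if "Re z > 0" for z
    using that by (auto simp: Re_divide intro!: divide_pos_pos add_pos_nonneg)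
  show "(\<lambda>\<xi>. theta3 (exp (- of_real pi / \<xi>))) holomorphic_on {z. Re z > 0}"
    using Re_inv by (intro theta3_exp_holomorphic holomorphic_intros) auto
  show "(\<lambda>\<xi>. csqrt \<xi> * theta3 (exp (- of_real pi * \<xi>))) holomorphic_on {z. Re z > 0}"
    by (intro theta3_exp_holomorphic holomorphic_intros) (auto simp: complex_nonpos_Reals_iff)
  show "open {z. Re z > 0}" by (rule open_halfspace_Re_gt)
  show "connected {z. Re z > 0}" by (intro convex_connected convex_halfspace_Re_gt)
  fix x :: real assume x: "0 < x" "x < 1"
  have "theta3 (exp (- of_real pi / of_real x)) = of_real (theta (1 / x))"
    using theta3_exp_has_sum(2)[of "1 / x"] x by (simp flip: exp_of_real)
  moreover have "theta3 (exp (- of_real pi * of_real x)) = of_real (theta x)"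
    using theta3_exp_has_sum(2)[of x] x by (simp flip: exp_of_real)
  moreover have "csqrt (of_real x) = of_real (sqrt x)" using x by simp
  ultimately show "theta3 (exp (- of_real pi / of_real x)) = csqrt (of_real x) * theta3 (exp (- of_real pi * of_real x))"
    using theta_functional_equation[OF x(1)] by simp
qed (use assms in auto)

text \<open>A negative power of X records both the controlled growth as X tends to 0 and a decay as
  X tends to infinity. In the n-th term the exponential gives N! / (n X)^N, and N \<ge> \<alpha> + 2
  leaves n^(-2) after the coefficient bound.\<close>

lemma theta3_powr_minus_1_bound:
  assumes "\<alpha> > 0" "real N \<ge> \<alpha> + 2"
  obtains C where "C > 0"
    "\<And>X q. X > 0 \<Longrightarrow> norm q \<le> exp (- pi * X) \<Longrightarrow> norm (theta3_powr \<alpha> q - 1) \<le> C / X ^ N"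
proof -
  have N2: "2 \<le> N" using assms by linarith
  define K where "K = exp 1 * 4 powr \<alpha> * fact N"
  define S where "S = (\<Sum>n. 1 / real n ^ 2)"
  have K: "K > 0" by (simp add: K_def)
  have sS: "summable (\<lambda>n. 1 / real n ^ 2)"
    using inverse_power_summable[of 2, where 'a = real] by (simp add: field_simps)
  have S: "S \<ge> 0" unfolding S_def by (rule suminf_nonneg[OF sS]) auto
  have "norm (theta3_powr \<alpha> q - 1) \<le> (K * S + 1) / X ^ N" if X: "X > 0" and q: "norm q \<le> exp (- pi * X)" for X q
  proof -
    have "exp (- pi * X) < 1" using X by simp
    hence q1: "norm q < 1" using q by linarith
    note sums = r_alpha_sums[OF q1, of \<alpha>]
    have bound: "norm (of_real (r_alpha \<alpha> n) * q ^ n) \<le> K / X ^ N * (1 / real n ^ 2)" for n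
    proof (cases "n = 0")
      case False
      hence n: "n \<ge> 1" by simp
      have "norm (q ^ n) \<le> exp (- pi * X) ^ n" unfolding norm_power using q by (intro power_mono) auto
      also have "\<dots> = exp (- (pi * (n * X)))" by (simp flip: exp_of_nat_mult add: mult_ac)
      also have "\<dots> \<le> exp (- (n * X))"
      proof -
        have "1 * (n * X) \<le> pi * (n * X)" using X pi_gt3 by (intro mult_right_mono) auto
        thus ?thesis by simp
      qed
      also have "\<dots> \<le> fact N / (n * X) ^ N"
        using power_div_fact_le_exp[of "n * X" N] X n by (simp add: exp_minus field_simps)
      finally have "norm (q ^ n) \<le> fact N / (n * X) ^ N" .
      moreover have "\<bar>r_alpha \<alpha> n\<bar> \<le> exp 1 * (4 powr \<alpha> * (real n ^ N / real n ^ 2))"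
      proof -
        have "real n powr \<alpha> \<le> real n powr real (N - 2)"
          using n N2 assms(2) by (intro powr_mono) (auto simp: of_nat_diff)
        also have "\<dots> = real n ^ (N - 2)" using n by (subst powr_realpow) auto
        also have "\<dots> = real n ^ N / real n ^ 2" using n N2 by (intro power_diff) auto
        finally have "(4 * real n) powr \<alpha> \<le> 4 powr \<alpha> * (real n ^ N / real n ^ 2)"
          unfolding powr_mult by (rule mult_left_mono) simp
        thus ?thesis using r_alpha_bound[OF assms(1) n] by (meson exp_ge_zero mult_left_mono order_trans)
      qed
      ultimately have "norm (of_real (r_alpha \<alpha> n) * q ^ n) \<le>
          exp 1 * (4 powr \<alpha> * (real n ^ N / real n ^ 2)) * (fact N / (n * X) ^ N)"
        unfolding norm_mult norm_of_real by (intro mult_mono) auto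
      also have "\<dots> = K / X ^ N * (1 / real n ^ 2)"
        using n by (simp add: K_def power_mult_distrib field_simps)
      finally show ?thesis .
    qed (simp add: r_alpha_0)
    have sb: "(\<lambda>n. K / X ^ N * (1 / real n ^ 2)) sums (K / X ^ N * S)"
      unfolding S_def by (intro sums_mult summable_sums sS)
    have "norm (theta3_powr \<alpha> q - 1) \<le> K / X ^ N * S"
      using norm_sums_le[OF sums sb bound] .
    also have "\<dots> \<le> (K * S + 1) / X ^ N" using X by (simp add: field_simps)
    finally show ?thesis .
  qed
  moreover have "K * S + 1 > 0" using K S by (simp add: add_nonneg_pos)
  ultimately show ?thesis using that by blast
qed

section \<open>The theta kernel on the strip\<close>

definition theta_kernel :: "real \<Rightarrow> complex \<Rightarrow> complex" where
  "theta_kernel \<alpha> v = exp (of_real (\<alpha> / 4) * v) * (theta3_powr \<alpha> (exp (- of_real pi * exp v)) - 1)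
     - exp (- of_real (\<alpha> / 4) * v)"

definition strip :: "complex set" where
  "strip = {v. - (pi / 2) < Im v \<and> Im v < pi / 2}"

lemma open_strip: "open strip" and convex_strip: "convex strip"
proof -
  have eq: "strip = {v. Im v > - (pi / 2)} \<inter> {v. Im v < pi / 2}"
    by (auto simp: strip_def)
  show "open strip" unfolding eq by (intro open_Int open_halfspace_Im_gt open_halfspace_Im_lt)
  show "convex strip" unfolding eq by (intro convex_Int convex_halfspace_Im_gt convex_halfspace_Im_lt)
qed

lemma Re_exp_strip: "v \<in> strip \<Longrightarrow> Re (exp v) > 0"
  by (auto simp: strip_def Re_exp intro!: mult_pos_pos cos_gt_zero_pi)

lemma theta_powr_exp_holomorphic:
  "(\<lambda>v. theta3_powr \<alpha> (exp (- of_real pi * exp v))) holomorphic_on strip"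
  using Re_exp_strip by (intro theta3_exp_holomorphic holomorphic_intros) auto

lemma theta_kernel_holomorphic: "theta_kernel \<alpha> holomorphic_on strip"
  unfolding theta_kernel_def [abs_def] by (intro holomorphic_intros theta_powr_exp_holomorphic)

lemma theta_kernel_of_real:
  "theta_kernel \<alpha> (of_real u) = of_real (exp (\<alpha> / 4 * u) * (theta (exp u) powr \<alpha> - 1) - exp (- (\<alpha> / 4) * u))"
proof -
  have "theta3_powr \<alpha> (exp (- of_real pi * exp (of_real u))) = of_real (theta (exp u) powr \<alpha>)"
    using theta3_powr_real[of "exp u" \<alpha>] by (simp flip: exp_of_real)
  thus ?thesis by (simp add: theta_kernel_def flip: exp_of_real)
qed

text \<open>The weight exp(\<alpha> v/4) symmetrises the transformation law: on the real line
  exp(\<alpha> u/4) theta(e^u)^\<alpha> is even, and the subtracted exponentials are exchanged by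
  the reflection.\<close>

lemma theta_kernel_even:
  assumes "v \<in> strip"
  shows "theta_kernel \<alpha> (- v) = theta_kernel \<alpha> v"
proof (rule holomorphic_eq_if_eq_on_reals[where S = strip and a = 0 and b = 1 and z = v
      and f = "\<lambda>v. theta_kernel \<alpha> (- v)" and g = "theta_kernel \<alpha>"])
  have "uminus ` strip \<subseteq> strip" by (auto simp: strip_def)
  thus "(\<lambda>v. theta_kernel \<alpha> (- v)) holomorphic_on strip"
    by (intro holomorphic_on_compose_gen[OF _ theta_kernel_holomorphic, of "\<lambda>v. - v", unfolded o_def] holomorphic_intros) auto
  fix u :: real
  have "theta (exp (- u)) = exp (u / 2) * theta (exp u)"
  proof -
    have "theta (1 / exp u) = sqrt (exp u) * theta (exp u)"
      by (rule theta_functional_equation) auto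
    moreover have "sqrt (exp u) = exp (u / 2)"
      by (rule real_sqrt_unique) (auto simp: power2_eq_square simp flip: exp_add)
    ultimately show ?thesis by (simp add: exp_minus inverse_eq_divide)
  qed
  hence "theta (exp (- u)) powr \<alpha> = exp (\<alpha> * u / 2) * theta (exp u) powr \<alpha>"
    using theta_ge_1[of "exp u"] by (simp add: powr_mult exp_powr_real mult_ac)
  hence "exp (- (\<alpha> / 4 * u)) * (theta (exp (- u)) powr \<alpha>) = exp (\<alpha> / 4 * u) * theta (exp u) powr \<alpha>"
    by (simp flip: exp_add add: mult.assoc[symmetric])
  hence "exp (\<alpha> / 4 * (- u)) * (theta (exp (- u)) powr \<alpha> - 1) - exp (- (\<alpha> / 4) * (- u)) =
     exp (\<alpha> / 4 * u) * (theta (exp u) powr \<alpha> - 1) - exp (- (\<alpha> / 4) * u)"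
    by (simp add: algebra_simps)
  thus "theta_kernel \<alpha> (- of_real u) = theta_kernel \<alpha> (of_real u)"
    unfolding of_real_minus[symmetric] theta_kernel_of_real by simp
next
  show "of_real x \<in> strip" for x by (simp add: strip_def)
qed (use assms in \<open>auto intro!: theta_kernel_holomorphic open_strip convex_connected convex_strip\<close>)

text \<open>For Re v \<ge> 0 the grouping in the definition, with 1 subtracted from the power of
  theta, shows the decay: N \<ge> \<alpha> beats the weight. The left half follows by evenness. Near
  the edge of the strip the loss is only a power of 1/cos w, which is negligible against the
  exponentials in 1/\<delta> that decide the proof.\<close>

lemma theta_kernel_bound:
  assumes "\<alpha> > 0"
  obtains C and N :: nat where "C > 0"
    "\<And>w v. 0 \<le> w \<Longrightarrow> w < pi / 2 \<Longrightarrow> \<bar>Im v\<bar> \<le> w \<Longrightarrow>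
       norm (theta_kernel \<alpha> v) \<le> C / cos w ^ N * exp (- (\<alpha> / 4) * \<bar>Re v\<bar>)"
proof -
  define N where "N = nat \<lceil>\<alpha>\<rceil> + 2"
  have N: "real N \<ge> \<alpha> + 2" using real_nat_ceiling_ge[of \<alpha>] unfolding N_def by simp
  obtain C where C: "C > 0"
    "\<And>X q. X > 0 \<Longrightarrow> norm q \<le> exp (- pi * X) \<Longrightarrow> norm (theta3_powr \<alpha> q - 1) \<le> C / X ^ N"
    using theta3_powr_minus_1_bound[OF assms N] by metis
  have pos: "norm (theta_kernel \<alpha> v) \<le> (C + 1) / cos w ^ N * exp (- (\<alpha> / 4) * \<bar>Re v\<bar>)"
    if w: "0 \<le> w" "w < pi / 2" "\<bar>Im v\<bar> \<le> w" and v: "Re v \<ge> 0" for w v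
  proof -
    define c where "c = cos w"
    have c: "c > 0" "c \<le> 1" using w by (auto simp: c_def intro!: cos_gt_zero_pi)
    have "c \<le> cos \<bar>Im v\<bar>" unfolding c_def using w by (intro cos_monotone_0_pi_le) auto
    hence cc: "c \<le> cos (Im v)" by simp
    define X where "X = exp (Re v) * c"
    have X: "X > 0" using c by (simp add: X_def)
    have "X \<le> Re (exp v)" using cc by (simp add: X_def Re_exp)
    hence "norm (exp (- of_real pi * exp v)) \<le> exp (- pi * X)" by simp
    from C(2)[OF X this] have "norm (theta3_powr \<alpha> (exp (- of_real pi * exp v)) - 1) \<le> C / X ^ N" .
    hence "norm (exp (of_real (\<alpha> / 4) * v) * (theta3_powr \<alpha> (exp (- of_real pi * exp v)) - 1))
        \<le> exp (\<alpha> / 4 * Re v) * (C / X ^ N)"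
      unfolding norm_mult by (intro mult_mono) auto
    also have "\<dots> = C / c ^ N * exp (\<alpha> / 4 * Re v - real N * Re v)"
    proof -
      have "X ^ N = exp (real N * Re v) * c ^ N"
        by (simp add: X_def power_mult_distrib exp_of_nat_mult)
      thus ?thesis by (simp add: exp_diff mult_ac)
    qed
    also have "\<dots> \<le> C / c ^ N * exp (- (\<alpha> / 4) * Re v)"
    proof -
      have "\<alpha> * Re v \<le> real N * Re v" using N v by (intro mult_right_mono) auto
      moreover have "\<alpha> * Re v \<ge> 0" using v assms by simp
      ultimately have "\<alpha> / 4 * Re v - real N * Re v \<le> - (\<alpha> / 4) * Re v" by (simp add: field_simps)
      thus ?thesis using C(1) c by (intro mult_left_mono) auto
    qed
    finally have "norm (exp (of_real (\<alpha> / 4) * v) * (theta3_powr \<alpha> (exp (- of_real pi * exp v)) - 1))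
        \<le> C / c ^ N * exp (- (\<alpha> / 4) * Re v)" .
    moreover have "norm (exp (- of_real (\<alpha> / 4) * v)) \<le> 1 / c ^ N * exp (- (\<alpha> / 4) * Re v)"
    proof -
      have "1 * exp (- (\<alpha> / 4) * Re v) \<le> 1 / c ^ N * exp (- (\<alpha> / 4) * Re v)"
        using c by (intro mult_right_mono) (auto simp: power_le_one)
      thus ?thesis by simp
    qed
    ultimately have "norm (theta_kernel \<alpha> v) \<le> C / c ^ N * exp (- (\<alpha> / 4) * Re v) + 1 / c ^ N * exp (- (\<alpha> / 4) * Re v)"
      unfolding theta_kernel_def using norm_triangle_ineq4 order_trans add_mono by meson
    also have "\<dots> = (C + 1) / c ^ N * exp (- (\<alpha> / 4) * \<bar>Re v\<bar>)"
      using v by (simp add: add_divide_distrib distrib_right)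
    finally show ?thesis by (simp add: c_def)
  qed
  have "norm (theta_kernel \<alpha> v) \<le> (C + 1) / cos w ^ N * exp (- (\<alpha> / 4) * \<bar>Re v\<bar>)"
    if w: "0 \<le> w" "w < pi / 2" "\<bar>Im v\<bar> \<le> w" for w v
  proof (cases "Re v \<ge> 0")
    case False
    have "v \<in> strip" using w by (auto simp: strip_def)
    thus ?thesis using pos[of w "- v"] w False theta_kernel_even[of v \<alpha>] by simp
  qed (use pos w in auto)
  moreover have "C + 1 > 0" using C by simp
  ultimately show ?thesis using that by blast
qed

section \<open>Behaviour of theta near the point i\<close>

definition theta_part :: "real \<Rightarrow> complex \<Rightarrow> complex" where
  "theta_part \<alpha> v = exp (of_real (\<alpha> / 4) * v) * theta3_powr \<alpha> (exp (- of_real pi * exp v))"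

lemma theta_kernel_eq:
  "theta_kernel \<alpha> v = theta_part \<alpha> v - exp (of_real (\<alpha> / 4) * v) - exp (- of_real (\<alpha> / 4) * v)"
  by (simp add: theta_kernel_def theta_part_def algebra_simps)

lemma theta_part_holomorphic: "theta_part \<alpha> holomorphic_on strip"
  unfolding theta_part_def [abs_def] by (intro holomorphic_intros theta_powr_exp_holomorphic)

text \<open>The vanishing at i made explicit: inversion is applied to both terms of
  \<open>theta3_minus\<close>, the square root of 1/(4 \<xi>) cancels the factor 2, and the two
  theta values on the right both tend to 1 at exponential speed.\<close>

lemma theta3_minus_near_1:
  assumes "Re \<xi> > 0"
  shows "theta3 (- exp (- of_real pi * \<xi>)) = csqrt (1 / \<xi>) * (theta3 (exp (- of_real pi / (4 * \<xi>))) - theta3 (exp (- of_real pi / \<xi>)))"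
proof -
  define p where "p = exp (- of_real pi * \<xi>)"
  have inv: "Re (1 / \<xi>) > 0" using assms by (auto simp: Re_divide intro!: divide_pos_pos add_pos_nonneg)
  have inv4: "Re (1 / (4 * \<xi>)) > 0"
    using assms by (auto simp: Re_divide simp del: Re_divide_numeral intro!: divide_pos_pos add_pos_nonneg)
  have "\<xi> \<noteq> 0" using assms by auto
  have "norm p < 1" using assms by (simp add: p_def)
  hence "theta3 (- p) = 2 * theta3 (p ^ 4) - theta3 p" by (rule theta3_minus)
  also have "theta3 p = csqrt (1 / \<xi>) * theta3 (exp (- of_real pi / \<xi>))"
    using theta3_functional_equation[OF inv] by (simp add: p_def)
  also have "theta3 (p ^ 4) = csqrt (1 / (4 * \<xi>)) * theta3 (exp (- of_real pi / (4 * \<xi>)))"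
    using theta3_functional_equation[OF inv4] by (simp add: p_def mult_ac flip: exp_of_nat_mult)
  also have "csqrt (1 / (4 * \<xi>)) = csqrt (1 / \<xi>) / 2"
  proof (rule csqrt_unique)
    show "(csqrt (1 / \<xi>) / 2)\<^sup>2 = 1 / (4 * \<xi>)" by (simp add: power_divide)
    show "0 < Re (csqrt (1 / \<xi>) / 2) \<or> Re (csqrt (1 / \<xi>) / 2) = 0 \<and> 0 \<le> Im (csqrt (1 / \<xi>) / 2)"
      using csqrt_principal[of "1 / \<xi>"] by auto
  qed
  finally show ?thesis by (simp add: p_def algebra_simps)
qed

lemma theta3_minus_near_1_bound:
  assumes "0 < \<delta>" "\<delta> \<le> 1 / 100" "Re \<xi> \<ge> 7 / 10 * \<delta>" "norm \<xi> \<le> 13 / 10 * \<delta>"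
  shows "norm (theta3 (- exp (- of_real pi * \<xi>))) \<le> 320 * exp (- (pi / (12 * \<delta>)))"
proof -
  have Re_pos: "Re \<xi> > 0" using assms by simp
  hence "\<xi> \<noteq> 0" by auto
  have "7 / 10 * \<delta> \<le> norm \<xi>" using assms complex_Re_le_cmod[of \<xi>] by linarith
  \<comment> \<open>Re(1/\<xi>) = Re \<xi> / \<bar>\<xi>\<bar>^2, and 0.7 / 1.69 exceeds 0.4. The
    argument 1/(4 \<xi>) then still has real part at least 1/(10 \<delta>), which is the rate in
    \<open>s\<close>.\<close>
  have Re_inv: "Re (1 / \<xi>) \<ge> 4 / (10 * \<delta>)"
  proof -
    have "4 / (10 * \<delta>) \<le> (7 / 10 * \<delta>) / (13 / 10 * \<delta>)\<^sup>2"
      using assms by (simp add: field_simps power2_eq_square)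
    also have "\<dots> \<le> Re \<xi> / (norm \<xi>)\<^sup>2"
      using assms \<open>\<xi> \<noteq> 0\<close> by (intro frac_le power_mono) auto
    also have "\<dots> = Re (1 / \<xi>)" by (simp add: Re_divide cmod_power2)
    finally show ?thesis .
  qed
  define s where "s = exp (- (pi / (10 * \<delta>)))"
  have "pi / (10 * \<delta>) \<ge> 3 / (10 * (1/100))"
    using assms pi_gt3 by (intro frac_le) auto
  hence "pi / (10 * \<delta>) \<ge> 30" by simp
  hence "exp (pi / (10 * \<delta>)) \<ge> 2" using exp_ge_add_one_self[of "pi / (10 * \<delta>)"] by linarith
  hence s: "s > 0" "s \<le> 1 / 2" unfolding s_def exp_minus by (auto simp: field_simps)
  have close: "norm (theta3 (exp (- of_real pi * z)) - 1) \<le> 4 * s" if "Re z \<ge> 1 / (10 * \<delta>)" for z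
  proof -
    have "pi * (1 / (10 * \<delta>)) \<le> pi * Re z" using that by (intro mult_left_mono) auto
    hence q: "norm (exp (- of_real pi * z)) \<le> s" by (simp add: s_def)
    have "norm (theta3 (exp (- of_real pi * z)) - 1) \<le>
        2 * norm (exp (- of_real pi * z)) / (1 - norm (exp (- of_real pi * z)))"
      using q s by (intro norm_theta3_minus_1_le) linarith
    also have "\<dots> \<le> 2 * s / (1 / 2)" using q s by (intro frac_le) auto
    finally show ?thesis by simp
  qed
  have "norm (theta3 (exp (- of_real pi / (4 * \<xi>))) - theta3 (exp (- of_real pi / \<xi>))) \<le> 8 * s"
  proof -
    have "Re (1 / (4 * \<xi>)) = Re (1 / \<xi>) / 4" by (metis Re_divide_numeral divide_divide_eq_left mult.commute)
    moreover have "4 / (10 * \<delta>) = 4 * (1 / (10 * \<delta>))" "1 / (10 * \<delta>) > 0" using assms(1) by auto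
    ultimately have "1 / (10 * \<delta>) \<le> Re (1 / (4 * \<xi>))" "1 / (10 * \<delta>) \<le> Re (1 / \<xi>)"
      using Re_inv by linarith+
    note 12 = close[OF this(1)] close[OF this(2)]
    define A B where "A = theta3 (exp (- of_real pi / (4 * \<xi>)))" "B = theta3 (exp (- of_real pi / \<xi>))"
    have "norm (A - B) \<le> norm (A - 1) + norm (B - 1)"
      using norm_triangle_ineq4[of "A - 1" "B - 1"] by simp
    thus ?thesis using 12 by (simp add: A_B_def)
  qed
  \<comment> \<open>The algebraic factor is at most 2/\<delta>; it is hidden in an exponential
    chosen so that 1/10 - 1/60 = 1/12.\<close>
  moreover have "norm (csqrt (1 / \<xi>)) \<le> 40 * exp (pi / (60 * \<delta>))"
  proof -
    have "norm (1 / \<xi>) \<le> 2 / \<delta>"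
      using \<open>7 / 10 * \<delta> \<le> norm \<xi>\<close> \<open>\<xi> \<noteq> 0\<close> assms by (simp add: norm_divide field_simps)
    hence "norm (csqrt (1 / \<xi>)) \<le> sqrt (2 / \<delta>)" by (simp add: norm_csqrt)
    also have "\<dots> \<le> 2 / \<delta>" using assms by (intro real_le_lsqrt) (auto simp: power2_eq_square field_simps)
    also have "\<dots> \<le> 40 * (pi / (60 * \<delta>))" using assms pi_gt3 by (simp add: field_simps)
    also have "\<dots> \<le> 40 * exp (pi / (60 * \<delta>))" using exp_ge_add_one_self[of "pi / (60 * \<delta>)"] by (intro mult_left_mono) linarith+
    finally show ?thesis .
  qed
  ultimately have "norm (theta3 (- exp (- of_real pi * \<xi>))) \<le> (40 * exp (pi / (60 * \<delta>))) * (8 * s)"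
    unfolding theta3_minus_near_1[OF Re_pos] norm_mult by (intro mult_mono) auto
  also have "\<dots> = 320 * exp (pi / (60 * \<delta>) - pi / (10 * \<delta>))" by (simp add: s_def mult_exp_exp)
  also have "pi / (60 * \<delta>) - pi / (10 * \<delta>) = - (pi / (12 * \<delta>))" using assms by (simp add: field_simps)
  finally show ?thesis .
qed

text \<open>Writing v = w + i pi/2 gives exp v = i + \<xi> with \<xi> = i (exp w - 1), which is i w
  up to \<delta>/25. As w differs from -i \<delta> by at most \<delta>/4, Re \<xi> is at least (1 -
  1/4 - 1/25) \<delta> and \<bar>\<xi>\<bar> at most (5/4 + 1/25) \<delta>, within the ranges 7/10
  and 13/10 of \<open>theta3_minus_near_1_bound\<close>.\<close>

lemma theta_part_bound:
  assumes "\<alpha> > 0" "0 < \<delta>" "\<delta> \<le> 1 / 100" "norm (v - \<i> * of_real (pi / 2 - \<delta>)) \<le> \<delta> / 4"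
  shows "norm (theta_part \<alpha> v) \<le> exp \<alpha> * 320 powr \<alpha> * exp (- (pi * \<alpha> / (12 * \<delta>)))"
    and "v \<in> strip"
proof -
  define h where "h = v - \<i> * of_real (pi / 2 - \<delta>)"
  define w where "w = h - \<i> * of_real \<delta>"
  have h: "norm h \<le> \<delta> / 4" using assms by (simp add: h_def)
  have Imh: "\<bar>Im h\<bar> \<le> \<delta> / 4" and Reh: "\<bar>Re h\<bar> \<le> \<delta> / 4"
    using h abs_Im_le_cmod[of h] abs_Re_le_cmod[of h] by linarith+
  have v: "v = w + \<i> * of_real (pi / 2)" by (simp add: w_def h_def algebra_simps)
  have Imv: "Im v = pi / 2 - \<delta> + Im h" by (simp add: h_def)
  show vs: "v \<in> strip" using Imh Imv assms pi_gt3 by (auto simp: strip_def)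
  have nw: "norm w \<le> 5 / 4 * \<delta>"
    using norm_triangle_ineq4[of h "\<i> * of_real \<delta>"] h assms by (simp add: w_def norm_mult)
  define \<xi> where "\<xi> = \<i> * (exp w - 1)"
  define e where "e = exp w - 1 - w"
  have e: "norm e \<le> \<delta> / 25"
  proof -
    have "norm (exp w - (\<Sum>k\<le>1. w ^ k / fact k)) \<le> exp \<bar>Re w\<bar> * (norm w ^ Suc 1) / fact 1"
      by (rule Taylor_exp)
    hence "norm e \<le> exp \<bar>Re w\<bar> * (norm w)\<^sup>2" by (simp add: e_def algebra_simps numeral_2_eq_2)
    also have "\<dots> \<le> 2 * (5 / 4 * \<delta>)\<^sup>2"
    proof (intro mult_mono power_mono nw)
      have "exp \<bar>Re w\<bar> \<le> exp (1 / 2)" using abs_Re_le_cmod[of w] nw assms by simp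
      also have "\<dots> \<le> 2" using exp_bound_half[of "1/2::real"] by simp
      finally show "exp \<bar>Re w\<bar> \<le> 2" .
    qed auto
    also have "\<dots> = 25 / 8 * \<delta> * \<delta>" by (simp add: power2_eq_square)
    also have "\<dots> \<le> 25 / 8 * \<delta> * (1 / 100)" using assms by (intro mult_left_mono) auto
    also have "\<dots> \<le> \<delta> / 25" using assms by simp
    finally show ?thesis .
  qed
  have \<xi>: "\<xi> = \<i> * w + \<i> * e" by (simp add: \<xi>_def e_def algebra_simps)
  have "Re \<xi> = \<delta> - Im h - Im e" by (simp add: \<xi> w_def)
  hence Re\<xi>: "Re \<xi> \<ge> 7 / 10 * \<delta>" using Imh e abs_Im_le_cmod[of e] by linarith
  have "norm \<xi> \<le> norm w + norm e" unfolding \<xi> using norm_triangle_ineq[of "\<i> * w" "\<i> * e"] by (simp add: norm_mult)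
  hence n\<xi>: "norm \<xi> \<le> 13 / 10 * \<delta>" using nw e assms(2) by linarith
  have "exp (\<i> * of_real (pi / 2)) = \<i>" by (simp only: cis_conv_exp[symmetric] cis_pi_half)
  hence expv: "exp v = \<i> + \<xi>" unfolding v exp_add by (simp add: \<xi>_def algebra_simps)
  have "exp (- of_real pi * exp v) = - exp (- of_real pi * \<xi>)"
  proof -
    have "exp (- of_real pi * exp v) = exp (- (of_real pi * \<i>)) * exp (- of_real pi * \<xi>)"
      unfolding expv exp_add[symmetric] by (simp add: algebra_simps)
    also have "exp (- (of_real pi * \<i>)) = - 1"
      by (simp add: exp_minus)
    finally show ?thesis by simp
  qed
  hence "norm (theta3 (exp (- of_real pi * exp v))) \<le> 320 * exp (- (pi / (12 * \<delta>)))"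
    using theta3_minus_near_1_bound[OF assms(2,3) Re\<xi> n\<xi>] by simp
  moreover have "norm (exp (- of_real pi * exp v)) < 1" using Re_exp_strip[OF vs] by simp
  ultimately have "norm (theta3_powr \<alpha> (exp (- of_real pi * exp v))) \<le> (320 * exp (- (pi / (12 * \<delta>)))) powr \<alpha>"
    using assms by (subst norm_theta3_powr) (auto intro!: powr_mono2)
  also have "\<dots> = 320 powr \<alpha> * exp (- (pi * \<alpha> / (12 * \<delta>)))"
    by (subst powr_mult) (simp_all add: exp_powr_real mult_ac)
  finally have "norm (theta3_powr \<alpha> (exp (- of_real pi * exp v))) \<le> 320 powr \<alpha> * exp (- (pi * \<alpha> / (12 * \<delta>)))" .
  moreover have "norm (exp (of_real (\<alpha> / 4) * v)) \<le> exp \<alpha>"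
  proof -
    have "Re v \<le> 4" using Reh assms by (simp add: v w_def)
    hence "\<alpha> / 4 * Re v \<le> \<alpha> / 4 * 4" using assms by (intro mult_left_mono) auto
    thus ?thesis by simp
  qed
  ultimately show "norm (theta_part \<alpha> v) \<le> exp \<alpha> * 320 powr \<alpha> * exp (- (pi * \<alpha> / (12 * \<delta>)))"
    unfolding theta_part_def norm_mult mult.assoc by (intro mult_mono) auto
qed

section \<open>The completed zeta function\<close>

lemma integrable_exp_abs:
  assumes "\<kappa> > 0"
  shows "integrable lborel (\<lambda>u::real. exp (- \<kappa> * \<bar>u\<bar>))"
proof -
  interpret prob_space "density lborel (exponential_density \<kappa>)"
    using assms by (rule prob_space_exponential_density)
  have "integrable (density lborel (exponential_density \<kappa>)) (\<lambda>_. 1 :: real)" by simp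
  hence 1: "integrable lborel (exponential_density \<kappa>)"
    using assms by (subst (asm) integrable_density) (auto simp: erlang_density_nonneg)
  have 2: "integrable lborel (\<lambda>u. exponential_density \<kappa> (0 + (- 1) * u))"
    by (rule lborel_integrable_real_affine[OF 1]) simp
  have "integrable lborel (\<lambda>u. (exponential_density \<kappa> u + exponential_density \<kappa> (0 + (- 1) * u)) / \<kappa>)"
    using 1 2 by (intro integrable_divide Bochner_Integration.integrable_add)
  thus ?thesis
  proof (rule Bochner_Integration.integrable_bound)
    have "exp (- \<kappa> * \<bar>u\<bar>) \<le> (exponential_density \<kappa> u + exponential_density \<kappa> (0 + (- 1) * u)) / \<kappa>" for u
      using assms by (auto simp: exponential_density_def field_simps)
    thus "AE u in lborel. norm (exp (- \<kappa> * \<bar>u\<bar>)) \<le> norm ((exponential_density \<kappa> u + exponential_density \<kappa> (0 + (- 1) * u)) / \<kappa>)"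
      by (intro AE_I2) (metis abs_exp_cancel abs_ge_self order_trans real_norm_def)
  qed simp
qed

lemma integral_exp_abs:
  fixes \<kappa> :: real
  assumes "\<kappa> > 0"
  shows "(LINT u|lborel. exp (- \<kappa> * \<bar>u\<bar>)) = (LINT u|lborel. exp (- \<bar>u\<bar>)) / \<kappa>"
proof -
  have "(LINT u|lborel. exp (- \<bar>u\<bar>)) = \<kappa> * (LINT u|lborel. exp (- \<bar>0 + \<kappa> * u\<bar>))"
    using lborel_integral_real_affine[of \<kappa> "\<lambda>u. exp (- \<bar>u\<bar>)" 0] assms by (simp add: abs_mult)
  thus ?thesis using assms by (simp add: abs_mult field_simps)
qed

lemma exp_half_line:
  fixes z :: complex
  assumes "Re z > 0"
  shows "integrable lborel (\<lambda>t. of_real (indicat_real {0<..} t) * exp (- z * of_real t))"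
    and "(LINT t|lborel. of_real (indicat_real {0<..} t) * exp (- z * of_real t)) = 1 / z"
proof -
  have z: "z \<noteq> 0" using assms by auto
  show 1: "integrable lborel (\<lambda>t. of_real (indicat_real {0<..} t) * exp (- z * of_real t))"
    by (rule Bochner_Integration.integrable_bound[OF integrable_exp_abs[OF assms]])
       (auto simp: indicator_def norm_mult)
  have "(LBINT t=0..\<infinity>. exp (- z * of_real t)) = 0 - (- 1 / z)"
  proof (rule interval_integral_FTC_integrable[where F = "\<lambda>t. - exp (- z * of_real t) / z"])
    fix t :: real
    have "((\<lambda>w. - exp (- z * w) / z) has_field_derivative exp (- z * of_real t)) (at (of_real t))"
      using z by (auto intro!: derivative_eq_intros)
    from has_vector_derivative_real_field[OF this]
    show "((\<lambda>t. - exp (- z * of_real t) / z) has_vector_derivative exp (- z * of_real t)) (at t)" .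
    show "isCont (\<lambda>t. exp (- z * of_real t)) t" by (intro continuous_intros)
  next
    show "set_integrable lborel (einterval 0 \<infinity>) (\<lambda>t. exp (- z * of_real t))"
      using 1 by (simp add: set_integrable_def scaleR_conv_of_real zero_ereal_def)
    show "(((\<lambda>t. - exp (- z * of_real t) / z) \<circ> real_of_ereal) \<longlongrightarrow> - 1 / z) (at_right 0)"
      unfolding zero_ereal_def ereal_tendsto_simps
      using z by (auto intro!: tendsto_eq_intros)
    have "((\<lambda>t. exp (- (Re z * t))) \<longlongrightarrow> 0) at_top"
      using assms by (intro filterlim_compose[OF exp_at_bot] filterlim_uminus_at_bot_at_top[THEN filterlim_compose]
          filterlim_tendsto_pos_mult_at_top[OF tendsto_const] filterlim_ident)
    hence "((\<lambda>t. exp (- z * of_real t)) \<longlongrightarrow> 0) at_top"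
      by (rule_tac tendsto_norm_zero_cancel) simp
    hence "((\<lambda>t. - exp (- z * of_real t) / z) \<longlongrightarrow> - 0 / z) at_top"
      using z by (intro tendsto_intros)
    thus "(((\<lambda>t. - exp (- z * of_real t) / z) \<circ> real_of_ereal) \<longlongrightarrow> 0) (at_left \<infinity>)"
      unfolding ereal_tendsto_simps by simp
  qed auto
  thus "(LINT t|lborel. of_real (indicat_real {0<..} t) * exp (- z * of_real t)) = 1 / z"
    by (simp add: interval_lebesgue_integral_def set_lebesgue_integral_def scaleR_conv_of_real zero_ereal_def)
qed

text \<open>Euler's integral under t = e^u; in this variable Mellin transforms become exponential
  transforms over the real line.\<close>

lemma Gamma_exp_integral:
  fixes s :: complex
  assumes "Re s > 0"
  shows "integrable lborel (\<lambda>u. exp (s * of_real u - of_real (exp u)))"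
    and "(LINT u|lborel. exp (s * of_real u - of_real (exp u))) = Gamma s"
proof -
  define f where "f = (\<lambda>t. complex_of_real t powr (s - 1) / of_real (exp t))"
  have eq: "\<bar>exp u\<bar> *\<^sub>R f (exp u) = exp (s * of_real u - of_real (exp u))" for u
  proof -
    have "complex_of_real (exp u) powr (s - 1) = exp ((s - 1) * of_real u)"
      by (simp add: powr_def Ln_of_real)
    hence "\<bar>exp u\<bar> *\<^sub>R f (exp u) = exp (of_real u) * exp ((s - 1) * of_real u) / exp (of_real (exp u))"
      by (simp add: f_def scaleR_conv_of_real exp_of_real)
    also have "\<dots> = exp (of_real u + (s - 1) * of_real u - of_real (exp u))"
      by (simp only: exp_add exp_diff)
    also have "of_real u + (s - 1) * of_real u = s * of_real u"
      by (simp add: algebra_simps)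
    finally show ?thesis .
  qed
  have im: "exp ` (UNIV :: real set) = {0<..}"
    by (auto simp: image_iff) (metis exp_ln)
  have "f absolutely_integrable_on {0<..}"
    unfolding f_def using absolutely_integrable_Gamma_integral'[OF assms] .
  moreover have "integral {0<..} f = Gamma s"
    unfolding f_def using Gamma_integral_complex'[OF assms] by (simp add: integral_unique)
  ultimately have "(\<lambda>u. \<bar>exp u\<bar> *\<^sub>R f (exp u)) absolutely_integrable_on UNIV \<and>
      integral UNIV (\<lambda>u. \<bar>exp u\<bar> *\<^sub>R f (exp u)) = Gamma s"
    by (subst has_absolute_integral_change_of_variables_real[where g = exp and h = exp])
       (auto simp: im inj_on_def intro!: derivative_eq_intros)
  hence *: "(\<lambda>u. exp (s * of_real u - of_real (exp u))) absolutely_integrable_on UNIV"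
    "integral UNIV (\<lambda>u. exp (s * of_real u - of_real (exp u))) = Gamma s"
    by (simp_all only: eq)
  have meas: "(\<lambda>u. exp (s * of_real u - of_real (exp u))) \<in> borel_measurable lborel" by measurable
  show 1: "integrable lborel (\<lambda>u. exp (s * of_real u - of_real (exp u)))"
    using *(1) meas by (simp add: set_integrable_def integrable_completion)
  show "(LINT u|lborel. exp (s * of_real u - of_real (exp u))) = Gamma s"
    using *(2) integral_lborel[OF 1] by simp
qed

lemma Gamma_exp_integral_scaled:
  fixes s :: complex and a :: real
  assumes "Re s > 0" "a > 0"
  shows "integrable lborel (\<lambda>u. exp (s * of_real u - of_real (a * exp u)))"
    and "(LINT u|lborel. exp (s * of_real u - of_real (a * exp u))) = of_real a powr (- s) * Gamma s"
proof -
  define f where "f = (\<lambda>u. exp (s * of_real u - of_real (exp u)))"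
  have eq: "of_real a powr (- s) * f (ln a + 1 * u) = exp (s * of_real u - of_real (a * exp u))" for u
  proof -
    have "of_real a powr (- s) * f (ln a + 1 * u) = exp (- s * of_real (ln a)) * exp (s * of_real (ln a + u) - of_real (exp (ln a + u)))"
      using assms by (simp add: f_def powr_def Ln_of_real)
    also have "\<dots> = exp (- s * of_real (ln a) + (s * of_real (ln a + u) - of_real (exp (ln a + u))))"
      by (rule exp_add[symmetric])
    also have "- s * of_real (ln a) + (s * of_real (ln a + u) - of_real (exp (ln a + u))) = s * of_real u - of_real (a * exp u)"
    proof -
      have "exp (ln a + u) = a * exp u" using assms by (simp add: exp_add)
      thus ?thesis by (simp add: algebra_simps)
    qed
    finally show ?thesis .
  qed
  have "integrable lborel (\<lambda>u. of_real a powr (- s) * f (ln a + 1 * u))"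
    using lborel_integrable_real_affine[of f 1 "ln a"] Gamma_exp_integral(1)[OF assms(1)] by (simp add: f_def)
  thus "integrable lborel (\<lambda>u. exp (s * of_real u - of_real (a * exp u)))" by (simp only: eq)
  have "Gamma s = (LINT u|lborel. f (ln a + 1 * u))"
    using lborel_integral_real_affine[of 1 f "ln a"] Gamma_exp_integral(2)[OF assms(1)] by (simp add: f_def)
  hence "of_real a powr (- s) * Gamma s = (LINT u|lborel. of_real a powr (- s) * f (ln a + 1 * u))" by simp
  thus "(LINT u|lborel. exp (s * of_real u - of_real (a * exp u))) = of_real a powr (- s) * Gamma s"
    by (simp only: eq)
qed

section \<open>Mellin transform of theta and continuation of the Dirichlet series\<close>

definition theta_tail :: "real \<Rightarrow> real \<Rightarrow> real" where
  "theta_tail \<alpha> u = theta (exp u) powr \<alpha> - 1"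

lemma of_real_theta_tail:
  "complex_of_real (theta_tail \<alpha> u) = theta3_powr \<alpha> (exp (- of_real pi * exp (of_real u))) - 1"
  using theta3_powr_real[of "exp u" \<alpha>] by (simp add: theta_tail_def flip: exp_of_real)

lemma measurable_theta_tail [measurable]: "theta_tail \<alpha> \<in> borel_measurable borel"
proof -
  have "continuous_on UNIV (\<lambda>u. theta3_powr \<alpha> (exp (- of_real pi * exp (of_real u))) - 1)"
    by (intro continuous_intros continuous_on_compose2[OF holomorphic_on_imp_continuous_on[OF theta_powr_exp_holomorphic]])
       (auto simp: strip_def)
  hence "continuous_on UNIV (\<lambda>u. Re (complex_of_real (theta_tail \<alpha> u)))"
    unfolding of_real_theta_tail by (rule continuous_on_Re)
  thus ?thesis by (simp add: borel_measurable_continuous_onI)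
qed

lemma theta_tail_bound:
  assumes "\<alpha> > 0"
  obtains C where "C > 0" "\<And>u. u \<ge> 0 \<Longrightarrow> \<bar>theta_tail \<alpha> u\<bar> \<le> C * exp (- r * u)"
proof -
  define N where "N = nat \<lceil>max (\<alpha> + 2) r\<rceil>"
  have N: "real N \<ge> \<alpha> + 2" "real N \<ge> r"
    using real_nat_ceiling_ge[of "max (\<alpha> + 2) r"] unfolding N_def by auto
  obtain C where C: "C > 0"
    "\<And>X q. X > 0 \<Longrightarrow> norm q \<le> exp (- pi * X) \<Longrightarrow> norm (theta3_powr \<alpha> q - 1) \<le> C / X ^ N"
    using theta3_powr_minus_1_bound[OF assms N(1)] by metis
  have "\<bar>theta_tail \<alpha> u\<bar> \<le> C * exp (- r * u)" if "u \<ge> 0" for u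
  proof -
    have "norm (exp (- of_real pi * exp (complex_of_real u))) = exp (- pi * exp u)"
      by (simp add: Re_exp)
    hence "norm (complex_of_real (theta_tail \<alpha> u)) \<le> C / exp u ^ N"
      unfolding of_real_theta_tail by (intro C(2)) auto
    also have "\<dots> = C * exp (- (real N * u))" by (simp add: exp_minus exp_of_nat_mult divide_inverse)
    also have "\<dots> \<le> C * exp (- r * u)"
      using C(1) N(2) that by (intro mult_left_mono) (auto intro: mult_right_mono)
    finally show ?thesis by simp
  qed
  thus ?thesis using that C(1) by blast
qed

lemma theta_tail_reflect:
  "theta_tail \<alpha> u = exp (- (\<alpha> / 2) * u) * theta_tail \<alpha> (- u) + exp (- (\<alpha> / 2) * u) - 1"
proof -
  have "theta (1 / exp (- u)) = sqrt (exp (- u)) * theta (exp (- u))"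
    by (rule theta_functional_equation) auto
  moreover have "sqrt (exp (- u)) = exp (- u / 2)"
    by (rule real_sqrt_unique) (auto simp: power2_eq_square simp flip: exp_add)
  ultimately have "theta (exp u) = exp (- u / 2) * theta (exp (- u))" by (simp add: exp_minus inverse_eq_divide)
  hence "theta (exp u) powr \<alpha> = exp (- (\<alpha> / 2) * u) * theta (exp (- u)) powr \<alpha>"
    using theta_ge_1[of "exp (- u)"] by (simp add: powr_mult exp_powr_real mult_ac)
  thus ?thesis by (simp add: theta_tail_def algebra_simps)
qed

text \<open>The Mellin integral over x > 1 in the variable x = e^u. \<open>theta_tail\<close> decays
  faster than any exponential there, so this function is entire.\<close>

definition mellin_half :: "real \<Rightarrow> complex \<Rightarrow> complex" where
  "mellin_half \<alpha> s = (LINT u|lborel. of_real (indicat_real {0<..} u * theta_tail \<alpha> u) * exp (s * of_real u))"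

lemma mellin_half_integrable_abs:
  assumes "\<alpha> > 0"
  shows "integrable lborel (\<lambda>u. norm (complex_of_real (indicat_real {0<..} u * theta_tail \<alpha> u)) * exp (r * \<bar>u\<bar>))"
proof -
  obtain C where C: "C > 0" "\<And>u. u \<ge> 0 \<Longrightarrow> \<bar>theta_tail \<alpha> u\<bar> \<le> C * exp (- (r + 1) * u)"
    using theta_tail_bound[OF assms, of "r + 1"] by metis
  have "integrable lborel (\<lambda>u. C * exp (- 1 * \<bar>u\<bar>))"
    by (intro integrable_mult_right integrable_exp_abs) simp
  thus ?thesis
  proof (rule Bochner_Integration.integrable_bound)
    have "norm (complex_of_real (indicat_real {0<..} u * theta_tail \<alpha> u)) * exp (r * \<bar>u\<bar>) \<le> C * exp (- 1 * \<bar>u\<bar>)" for u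
    proof (cases "u > 0")
      case True
      hence "\<bar>theta_tail \<alpha> u\<bar> * exp (r * u) \<le> C * exp (- (r + 1) * u) * exp (r * u)"
        using C(2)[of u] by (intro mult_right_mono) auto
      also have "\<dots> = C * exp (- u)" by (simp add: algebra_simps flip: exp_add)
      finally show ?thesis using True by (simp add: abs_mult)
    qed (use C in auto)
    thus "AE u in lborel. norm (norm (complex_of_real (indicat_real {0<..} u * theta_tail \<alpha> u)) * exp (r * \<bar>u\<bar>)) \<le> norm (C * exp (- 1 * \<bar>u\<bar>))"
      using C(1) by (intro AE_I2) (simp add: abs_mult)
  qed measurable
qed

lemma mellin_half_integrable:
  fixes s :: complex
  assumes "\<alpha> > 0"
  shows "integrable lborel (\<lambda>u. of_real (indicat_real {0<..} u * theta_tail \<alpha> u) * exp (s * of_real u))"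
proof (rule Bochner_Integration.integrable_bound[OF mellin_half_integrable_abs[OF assms, of "\<bar>Re s\<bar>"]])
  have "Re s * u \<le> \<bar>Re s\<bar> * \<bar>u\<bar>" for u by (simp flip: abs_mult)
  thus "AE u in lborel. norm (of_real (indicat_real {0<..} u * theta_tail \<alpha> u) * exp (s * of_real u))
      \<le> norm (norm (complex_of_real (indicat_real {0<..} u * theta_tail \<alpha> u)) * exp (\<bar>Re s\<bar> * \<bar>u\<bar>))"
    by (intro AE_I2) (auto simp: norm_mult intro!: mult_left_mono)
qed measurable

lemma mellin_half_holomorphic:
  assumes "\<alpha> > 0"
  shows "mellin_half \<alpha> holomorphic_on A"
proof -
  have "mellin_half \<alpha> holomorphic_on UNIV"
    unfolding mellin_half_def [abs_def]
    by (rule exp_transform_holomorphic) (measurable, rule mellin_half_integrable_abs[OF assms])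
  thus ?thesis by (rule holomorphic_on_subset) auto
qed

lemma neg_half_line:
  fixes z :: complex
  assumes "Re z > 0"
  shows "integrable lborel (\<lambda>t. of_real (indicat_real {..<0} t) * exp (z * of_real t))"
    and "(LINT t|lborel. of_real (indicat_real {..<0} t) * exp (z * of_real t)) = 1 / z"
proof -
  define f where "f = (\<lambda>t. of_real (indicat_real {0<..} t) * exp (- z * of_real t))"
  have eq: "f (0 + (-1) * t) = of_real (indicat_real {..<0} t) * exp (z * of_real t)" for t
    by (auto simp: f_def indicator_def)
  show "integrable lborel (\<lambda>t. of_real (indicat_real {..<0} t) * exp (z * of_real t))"
    using lborel_integrable_real_affine[of f "-1" 0] exp_half_line(1)[OF assms] unfolding eq f_def[symmetric] by simp
  show "(LINT t|lborel. of_real (indicat_real {..<0} t) * exp (z * of_real t)) = 1 / z"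
    using lborel_integral_real_affine[of "-1" f 0] exp_half_line(2)[OF assms] unfolding eq by (simp add: f_def)
qed

text \<open>Riemann's formula for pi^(-s) Gamma(s) zeta_\<alpha>(s): two entire functions and two
  poles, visibly symmetric under s to \<alpha>/2 - s.\<close>

definition zeta_completed :: "real \<Rightarrow> complex \<Rightarrow> complex" where
  "zeta_completed \<alpha> s = mellin_half \<alpha> s + mellin_half \<alpha> (of_real (\<alpha> / 2) - s) + 1 / (s - of_real (\<alpha> / 2)) - 1 / s"

text \<open>Riemann's splitting at x = 1. \<open>theta_tail_reflect\<close> folds the half u < 0
  onto u > 0; the two exponentials left over integrate to 1/(s - \<alpha>/2) and 1/s, which is where
  Re s > \<alpha>/2 is needed.\<close>

lemma Mellin_theta_tail:
  assumes "\<alpha> > 0" "Re s > \<alpha> / 2"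
  shows "(LINT u|lborel. of_real (theta_tail \<alpha> u) * exp (s * of_real u)) = zeta_completed \<alpha> s"
proof -
  define h where "h = \<alpha> / 2"
  have pos: "Re s > 0" "Re (s - of_real h) > 0" using assms by (auto simp: h_def)
  define P where "P = (\<lambda>s u. complex_of_real (indicat_real {0<..} u * theta_tail \<alpha> u) * exp (s * of_real u))"
  define E where "E = (\<lambda>z t. complex_of_real (indicat_real {..<0} t) * exp (z * of_real t))"
  have iP: "integrable lborel (P z)" for z unfolding P_def by (rule mellin_half_integrable[OF assms(1)])
  have iP': "integrable lborel (\<lambda>u. P z (0 + (-1) * u))" for z
    by (rule lborel_integrable_real_affine[OF iP]) simp
  have LP: "(LINT u|lborel. P z u) = mellin_half \<alpha> z" for z by (simp add: P_def mellin_half_def)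
  have LP': "(LINT u|lborel. P z (0 + (-1) * u)) = mellin_half \<alpha> z" for z
    using lborel_integral_real_affine[of "-1" "P z" 0] LP[of z] by simp
  have iE: "integrable lborel (E z)" "(LINT u|lborel. E z u) = 1 / z" if "Re z > 0" for z
    unfolding E_def using neg_half_line[OF that] by auto
  have "(LINT u|lborel. of_real (theta_tail \<alpha> u) * exp (s * of_real u)) =
     (LINT u|lborel. P s u + P (of_real h - s) (0 + (-1) * u) + E (s - of_real h) u - E s u)"
  proof (rule integral_cong_AE)
    have "of_real (theta_tail \<alpha> u) * exp (s * of_real u) = P s u + P (of_real h - s) (0 + (-1) * u) + E (s - of_real h) u - E s u"
      if "u \<noteq> 0" for u
    proof (cases "u > 0")
      case False
      hence u: "u < 0" using that by simp
      have "of_real (exp (- h * u)) * exp (s * of_real u) = exp ((s - of_real h) * of_real u)"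
        by (simp add: exp_of_real[symmetric] algebra_simps flip: exp_add)
      hence "of_real (theta_tail \<alpha> u) * exp (s * of_real u) =
         of_real (theta_tail \<alpha> (- u)) * exp ((s - of_real h) * of_real u) + exp ((s - of_real h) * of_real u) - exp (s * of_real u)"
        by (subst theta_tail_reflect) (simp add: h_def[symmetric] algebra_simps)
      thus ?thesis using u by (simp add: P_def E_def algebra_simps)
    qed (simp add: P_def E_def)
    moreover have "AE u in lborel. u \<noteq> (0::real)" by (rule AE_lborel_singleton)
    ultimately show "AE u in lborel. of_real (theta_tail \<alpha> u) * exp (s * of_real u) =
        P s u + P (of_real h - s) (0 + (-1) * u) + E (s - of_real h) u - E s u"
      by (auto elim: eventually_mono)
  qed (unfold P_def E_def, measurable)
  also have "\<dots> = mellin_half \<alpha> s + mellin_half \<alpha> (of_real h - s) + 1 / (s - of_real h) - 1 / s"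
    using iP iP' iE[OF pos(1)] iE[OF pos(2)]
    by (simp only: Bochner_Integration.integral_diff Bochner_Integration.integral_add
        Bochner_Integration.integrable_add LP LP')
  finally show ?thesis by (simp add: zeta_completed_def h_def)
qed

text \<open>Termwise Mellin transform of the expansion of theta^\<alpha> - 1; beyond \<alpha> + 1
  the coefficient bound makes it absolutely convergent. The factors pi^s and 1/Gamma(s) then remove
  the completion.\<close>

lemma r_alpha_Dirichlet_sums:
  assumes "\<alpha> > 0" "Re s > \<alpha> + 1"
  shows "(\<lambda>n. of_real (r_alpha \<alpha> n) * of_nat n powr (- s)) sums (of_real pi powr s * rGamma s * zeta_completed \<alpha> s)"
proof -
  have s: "Re s > 0" "Re s > \<alpha> / 2" using assms by auto
  define F where "F = (\<lambda>n u. complex_of_real (r_alpha \<alpha> n) * exp (s * of_real u - of_real (pi * real n * exp u)))"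
  define G where "G = (\<lambda>n u. \<bar>r_alpha \<alpha> n\<bar> * exp (Re s * u - pi * real n * exp u))"
  have normF: "norm (F n u) = G n u" for n u by (simp add: F_def G_def norm_mult)
  have iF: "integrable lborel (F n)" for n
  proof (cases "n = 0")
    case False
    thus ?thesis unfolding F_def
      by (intro integrable_mult_right Gamma_exp_integral_scaled(1) s(1)) auto
  qed (simp add: F_def r_alpha_0)
  have LF: "(LINT u|lborel. F n u) = of_real (r_alpha \<alpha> n) * (of_real (pi * real n) powr (- s) * Gamma s)" for n
  proof (cases "n = 0")
    case False
    thus ?thesis unfolding F_def
      using Gamma_exp_integral_scaled(2)[OF s(1), of "pi * real n"] by simp
  qed (simp add: F_def r_alpha_0)
  have LG: "(LINT u|lborel. G n u) = \<bar>r_alpha \<alpha> n\<bar> * ((pi * real n) powr (- Re s) * Gamma (Re s))" for n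
  proof (cases "n = 0")
    case False
    have "complex_of_real (LINT u|lborel. exp (Re s * u - pi * real n * exp u)) =
        (LINT u|lborel. exp (of_real (Re s) * of_real u - of_real (pi * real n * exp u)))"
      by (subst integral_complex_of_real[symmetric]) (simp flip: exp_of_real)
    also have "\<dots> = of_real (pi * real n) powr (- of_real (Re s)) * Gamma (of_real (Re s))"
      using False s(1) by (intro Gamma_exp_integral_scaled(2)) auto
    also have "\<dots> = of_real ((pi * real n) powr (- Re s) * Gamma (Re s))"
      using powr_of_real[of "pi * real n" "- Re s"] by (simp add: Gamma_complex_of_real)
    finally have "(LINT u|lborel. exp (Re s * u - pi * real n * exp u)) = (pi * real n) powr (- Re s) * Gamma (Re s)"
      by (simp only: of_real_eq_iff)
    thus ?thesis by (simp add: G_def)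
  qed (simp add: G_def r_alpha_0)
  have sumG: "summable (\<lambda>n. LINT u|lborel. norm (F n u))"
    unfolding normF LG
  proof (rule summable_comparison_test')
    define K where "K = exp 1 * 4 powr \<alpha> * (pi powr (- Re s) * Gamma (Re s))"
    show "summable (\<lambda>n. K * real n powr (\<alpha> - Re s))"
      using assms by (intro summable_mult) (simp add: summable_real_powr_iff)
    show "norm (\<bar>r_alpha \<alpha> n\<bar> * ((pi * real n) powr (- Re s) * Gamma (Re s))) \<le> K * real n powr (\<alpha> - Re s)" if "n \<ge> 1" for n
    proof -
      have "Gamma (Re s) > 0" using s by (intro Gamma_real_pos) auto
      hence "norm (\<bar>r_alpha \<alpha> n\<bar> * ((pi * real n) powr (- Re s) * Gamma (Re s))) =
         \<bar>r_alpha \<alpha> n\<bar> * ((pi * real n) powr (- Re s) * Gamma (Re s))" by (simp add: abs_mult)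
      also have "\<dots> \<le> (exp 1 * (4 * real n) powr \<alpha>) * ((pi * real n) powr (- Re s) * Gamma (Re s))"
        using r_alpha_bound[OF assms(1) that] \<open>Gamma (Re s) > 0\<close> by (intro mult_right_mono) auto
      also have "\<dots> = K * (real n powr \<alpha> * real n powr (- Re s))"
        by (simp add: K_def powr_mult mult_ac)
      also have "real n powr \<alpha> * real n powr (- Re s) = real n powr (\<alpha> - Re s)"
        by (simp flip: powr_add)
      finally show ?thesis .
    qed
  qed
  have ptw: "(\<lambda>n. F n u) sums (of_real (theta_tail \<alpha> u) * exp (s * of_real u))" for u
  proof -
    define q where "q = exp (- of_real pi * exp (complex_of_real u))"
    have "norm q < 1" by (simp add: q_def Re_exp)
    from r_alpha_sums[OF this, of \<alpha>]
    have "(\<lambda>n. of_real (r_alpha \<alpha> n) * q ^ n) sums of_real (theta_tail \<alpha> u)"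
      by (simp add: of_real_theta_tail q_def)
    hence "(\<lambda>n. of_real (r_alpha \<alpha> n) * q ^ n * exp (s * of_real u)) sums (of_real (theta_tail \<alpha> u) * exp (s * of_real u))"
      by (rule sums_mult2)
    moreover have "of_real (r_alpha \<alpha> n) * q ^ n * exp (s * of_real u) = F n u" for n
    proof -
      have "q ^ n * exp (s * of_real u) = exp (of_nat n * (- of_real pi * exp (of_real u)) + s * of_real u)"
        unfolding exp_add exp_of_nat_mult q_def ..
      also have "of_nat n * (- of_real pi * exp (of_real u)) + s * of_real u = s * of_real u - of_real (pi * real n * exp u)"
        by (simp add: exp_of_real algebra_simps)
      finally show ?thesis by (simp add: F_def mult.assoc)
    qed
    ultimately show ?thesis by simp
  qed
  have sums_normF: "AE u in lborel. summable (\<lambda>n. norm (F n u))"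
  proof (rule AE_I2)
    fix u :: real
    define r where "r = exp (- pi * exp u)"
    have r: "0 < r" "r < 1" by (auto simp: r_def)
    \<comment> \<open>Convergence at the larger nome r' < 1 yields absolute convergence at
      r.\<close>
    define r' where "r' = (1 + r) / 2"
    have r': "r < r'" "r' < 1" using r by (auto simp: r'_def)
    have "summable (\<lambda>n. complex_of_real (r_alpha \<alpha> n) * of_real r' ^ n)"
      using r_alpha_sums[of "of_real r'" \<alpha>] r r' by (auto simp: sums_iff)
    hence "summable (\<lambda>n. norm (complex_of_real (r_alpha \<alpha> n) * of_real r ^ n))"
      by (rule powser_insidea) (use r r' in auto)
    hence "summable (\<lambda>n. norm (complex_of_real (r_alpha \<alpha> n) * of_real r ^ n) * exp (Re s * u))"
      by (rule summable_mult2)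
    moreover have "norm (complex_of_real (r_alpha \<alpha> n) * of_real r ^ n) * exp (Re s * u) = norm (F n u)" for n
    proof -
      have "r ^ n * exp (Re s * u) = exp (real n * (- pi * exp u) + Re s * u)"
        unfolding exp_add exp_of_nat_mult r_def ..
      also have "real n * (- pi * exp u) + Re s * u = Re s * u - pi * real n * exp u" by simp
      finally show ?thesis using r by (simp add: normF G_def norm_mult norm_power)
    qed
    ultimately show "summable (\<lambda>n. norm (F n u))" by simp
  qed
  have "(\<lambda>n. LINT u|lborel. F n u) sums (LINT u|lborel. (\<Sum>n. F n u))"
    by (rule sums_integral[OF iF sums_normF sumG])
  also have "(\<lambda>u. \<Sum>n. F n u) = (\<lambda>u. of_real (theta_tail \<alpha> u) * exp (s * of_real u))"
    using ptw by (auto simp: sums_iff)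
  also have "(LINT u|lborel. of_real (theta_tail \<alpha> u) * exp (s * of_real u)) = zeta_completed \<alpha> s"
    by (rule Mellin_theta_tail[OF assms(1) s(2)])
  finally have "(\<lambda>n. of_real pi powr s * rGamma s * (of_real (r_alpha \<alpha> n) * (of_real (pi * real n) powr (- s) * Gamma s)))
      sums (of_real pi powr s * rGamma s * zeta_completed \<alpha> s)"
    unfolding LF by (rule sums_mult)
  also have "(\<lambda>n. of_real pi powr s * rGamma s * (of_real (r_alpha \<alpha> n) * (of_real (pi * real n) powr (- s) * Gamma s)))
      = (\<lambda>n. of_real (r_alpha \<alpha> n) * of_nat n powr (- s))"
  proof
    fix n
    show "of_real pi powr s * rGamma s * (of_real (r_alpha \<alpha> n) * (of_real (pi * real n) powr (- s) * Gamma s))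
      = of_real (r_alpha \<alpha> n) * of_nat n powr (- s)"
  proof (cases "n = 0")
    case False
    have "s \<notin> \<int>\<^sub>\<le>\<^sub>0" using s(1) by (auto elim!: nonpos_Ints_cases)
    hence "rGamma s * Gamma s = 1" by (simp add: rGamma_inverse_Gamma Gamma_eq_zero_iff)
    moreover have "complex_of_real pi powr s * of_real (pi * real n) powr (- s) = of_nat n powr (- s)"
    proof -
      have "complex_of_real (pi * real n) powr (- s) = of_real pi powr (- s) * of_real (real n) powr (- s)"
        by (subst of_real_mult) (rule powr_times_real, use False in auto)
      thus ?thesis by (simp add: powr_minus field_simps)
    qed
    ultimately have "(complex_of_real pi powr s * of_real (pi * real n) powr (- s)) * (rGamma s * Gamma s) = of_nat n powr (- s)" by simp
    thus ?thesis by (simp add: mult_ac)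
    qed (simp add: r_alpha_0)
  qed
  finally show ?thesis .
qed

text \<open>Identifies the continuation chosen by the definite description: two candidates agree on
  a common right half-plane of convergence, and the once punctured plane is connected.\<close>

lemma zeta_alpha_properties:
  assumes "\<alpha> > 0"
  shows "\<And>s. s \<noteq> of_real (\<alpha> / 2) \<Longrightarrow> s \<noteq> 0 \<Longrightarrow> zeta_alpha \<alpha> s = of_real pi powr s * rGamma s * zeta_completed \<alpha> s"
proof -
  define h where "h = \<alpha> / 2"
  \<comment> \<open>The pole of \<open>zeta_completed\<close> at 0 cancels against the zero of
    1/Gamma there. Writing \<open>rGamma (s + 1)\<close> in place of \<open>rGamma s / s\<close>
    keeps the formula holomorphic at 0; only the pole \<alpha>/2 needs a default value.\<close>
  define Z where "Z = (\<lambda>s. if s = of_real h then 0 else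
     of_real pi powr s * (rGamma s * (mellin_half \<alpha> s + mellin_half \<alpha> (of_real h - s) + 1 / (s - of_real h)) - rGamma (s + 1)))"
  have Z_eq: "Z s = of_real pi powr s * rGamma s * zeta_completed \<alpha> s" if "s \<noteq> of_real h" "s \<noteq> 0" for s
  proof -
    have "rGamma (s + 1) = rGamma s / s" using rGamma_plus1[of s] that by (simp add: field_simps)
    thus ?thesis using that by (simp add: Z_def zeta_completed_def h_def right_diff_distrib mult.assoc)
  qed
  have "(\<lambda>s. of_real pi powr s * (rGamma s * (mellin_half \<alpha> s + mellin_half \<alpha> (of_real h - s) + 1 / (s - of_real h)) - rGamma (s + 1)))
          holomorphic_on (- {of_real h})"
  proof -
    have "(\<lambda>s. mellin_half \<alpha> (of_real h - s)) holomorphic_on (- {of_real h})"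
    proof -
      have "(\<lambda>s. complex_of_real h - s) holomorphic_on (- {of_real h})" by (intro holomorphic_intros)
      from holomorphic_on_compose[OF this mellin_half_holomorphic[OF assms]] show ?thesis by (simp add: o_def)
    qed
    thus ?thesis
      by (intro holomorphic_intros mellin_half_holomorphic[OF assms]) auto
  qed
  hence Z_holo: "Z holomorphic_on (- {of_real h})"
    by (rule holomorphic_transform) (auto simp: Z_def)
  have Z_sums: "(\<lambda>n. of_real (r_alpha \<alpha> n) * of_nat n powr (- s)) sums Z s" if "Re s > \<alpha> + 1" for s
  proof -
    have "Re s \<noteq> h" "Re s \<noteq> 0" using that assms by (auto simp: h_def)
    hence "s \<noteq> of_real h" "s \<noteq> 0" by auto
    thus ?thesis using r_alpha_Dirichlet_sums[OF assms that] Z_eq[of s] by simp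
  qed
  have "zeta_alpha \<alpha> = Z"
    unfolding zeta_alpha_def h_def[symmetric]
  proof (rule the_equality)
    fix f assume f: "f holomorphic_on (- {of_real h}) \<and> f (of_real h) = 0 \<and>
      (\<exists>\<sigma>. \<forall>s. Re s > \<sigma> \<longrightarrow> (\<lambda>n. of_real (r_alpha \<alpha> n) * of_nat n powr (- s)) sums f s)"
    then obtain \<sigma> where \<sigma>: "\<And>s. Re s > \<sigma> \<Longrightarrow> (\<lambda>n. of_real (r_alpha \<alpha> n) * of_nat n powr (- s)) sums f s" by blast
    define \<tau> where "\<tau> = max (max \<sigma> (\<alpha> + 1)) h"
    have "f s = Z s" for s
    proof (cases "s = of_real h")
      case False
      show ?thesis
      proof (rule analytic_continuation_open[of "{s. Re s > \<tau>}" "- {of_real h}" f Z s])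
        show "{s. Re s > \<tau>} \<noteq> {}" by (auto intro!: exI[of _ "of_real (\<tau> + 1)"])
        show "open {s. Re s > \<tau>}" by (rule open_halfspace_Re_gt)
        show "connected (- {complex_of_real h})"
          by (intro connected_punctured_universe) auto
        show "f z = Z z" if "z \<in> {s. Re s > \<tau>}" for z
          using \<sigma>[of z] Z_sums[of z] that by (auto simp: \<tau>_def intro: sums_unique2)
      qed (use f Z_holo False in \<open>auto simp: \<tau>_def\<close>)
    qed (use f in \<open>auto simp: Z_def\<close>)
    thus "f = Z" by auto
  next
    have "Z (of_real h) = 0" by (simp add: Z_def)
    thus "Z holomorphic_on (- {of_real h}) \<and> Z (of_real h) = 0 \<and>
      (\<exists>\<sigma>. \<forall>s. Re s > \<sigma> \<longrightarrow> (\<lambda>n. of_real (r_alpha \<alpha> n) * of_nat n powr (- s)) sums Z s)"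
      using Z_holo Z_sums by blast
  qed
  thus "\<And>s. s \<noteq> of_real (\<alpha> / 2) \<Longrightarrow> s \<noteq> 0 \<Longrightarrow> zeta_alpha \<alpha> s = of_real pi powr s * rGamma s * zeta_completed \<alpha> s"
    using Z_eq by (simp add: h_def)
qed

section \<open>The completed function on the critical line as a Fourier transform\<close>

definition Xi_alpha :: "real \<Rightarrow> real \<Rightarrow> complex" where
  "Xi_alpha \<alpha> t = (LINT u|lborel. theta_kernel \<alpha> (of_real u) * exp (\<i> * of_real t * of_real u))"

text \<open>On the line both pole terms are negatives of integrals of decaying exponentials over u >
  0. Moved under the Mellin integrals they complete \<open>theta_tail\<close> to the kernel on the
  positive half-line; evenness of the kernel supplies the other half.\<close>

lemma zeta_completed_critical_line:
  assumes "\<alpha> > 0"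
  shows "zeta_completed \<alpha> (of_real (\<alpha> / 4) + \<i> * of_real t) = Xi_alpha \<alpha> t"
proof -
  define a where "a = \<alpha> / 4"
  have a: "a > 0" "\<alpha> / 2 = 2 * a" using assms by (auto simp: a_def)
  define s where "s = complex_of_real a + \<i> * of_real t"
  define s' where "s' = complex_of_real a - \<i> * of_real t"
  have Re_s: "Re s > 0" "Re s' > 0" using a by (auto simp: s_def s'_def)
  define P where "P = (\<lambda>s u. complex_of_real (indicat_real {0<..} u * theta_tail \<alpha> u) * exp (s * of_real u))"
  define E where "E = (\<lambda>z t. complex_of_real (indicat_real {0<..} t) * exp (- z * of_real t))"
  \<comment> \<open>The pole term is attached to the integral with the opposite argument: 1/(s -
    \<alpha>/2) = -1/s' joins the integral at s, and -1/s the one at s', where s' = \<alpha>/2 -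
    s.\<close>
  define Q where "Q = (\<lambda>s u. P s u - E (of_real (2 * a) - s) u)"
  have iP: "integrable lborel (P z)" for z unfolding P_def by (rule mellin_half_integrable[OF assms(1)])
  have LP: "(LINT u|lborel. P z u) = mellin_half \<alpha> z" for z by (simp add: P_def mellin_half_def)
  have iE: "integrable lborel (E z)" "(LINT u|lborel. E z u) = 1 / z" if "Re z > 0" for z
    unfolding E_def using exp_half_line[OF that] by auto
  have s_refl: "of_real (2 * a) - s = s'" "of_real (2 * a) - s' = s" by (auto simp: s_def s'_def)
  have Q: "Q s = (\<lambda>u. P s u - E s' u)" "Q s' = (\<lambda>u. P s' u - E s u)"
    unfolding Q_def s_refl by (rule refl)+
  have iQ: "integrable lborel (Q s)" "integrable lborel (Q s')"
    "(LINT u|lborel. Q s u) = mellin_half \<alpha> s - 1 / s'" "(LINT u|lborel. Q s' u) = mellin_half \<alpha> s' - 1 / s"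
    unfolding Q using iP iE[OF Re_s(1)] iE[OF Re_s(2)] LP by auto
  have iQ': "integrable lborel (\<lambda>u. Q s' (0 + (-1) * u))"
    by (rule lborel_integrable_real_affine[OF iQ(2)]) simp
  have LQ': "(LINT u|lborel. Q s' (0 + (-1) * u)) = mellin_half \<alpha> s' - 1 / s"
    using lborel_integral_real_affine[of "-1" "Q s'" 0] iQ(4) by simp
  have pos: "theta_kernel \<alpha> (of_real u) * exp (\<i> * of_real t * of_real u) = Q s u"
    if "u > 0" and s: "s = complex_of_real a + \<i> * of_real t" for u t s
  proof -
    have gen: "(A * T - B) * X = T * (A * X) - B * X" for A T B X :: complex
      by (simp add: algebra_simps)
    have kern: "theta_kernel \<alpha> (of_real u) = exp (of_real a * of_real u) * of_real (theta_tail \<alpha> u) - exp (- of_real a * of_real u)"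
      by (simp add: theta_kernel_def of_real_theta_tail a_def)
    have "theta_kernel \<alpha> (of_real u) * exp (\<i> * of_real t * of_real u) =
       of_real (theta_tail \<alpha> u) * exp (of_real a * of_real u + \<i> * of_real t * of_real u)
         - exp (- of_real a * of_real u + \<i> * of_real t * of_real u)"
      unfolding exp_add kern by (rule gen)
    also have "of_real a * of_real u + \<i> * of_real t * of_real u = s * complex_of_real u"
      by (simp add: s algebra_simps)
    also have "- of_real a * of_real u + \<i> * of_real t * of_real u = - (of_real (2 * a) - s) * complex_of_real u"
      by (simp add: s algebra_simps)
    finally show ?thesis unfolding Q_def P_def E_def using \<open>u > 0\<close> by simp
  qed
  have "Xi_alpha \<alpha> t = (LINT u|lborel. Q s u + Q s' (0 + (-1) * u))"
    unfolding Xi_alpha_def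
  proof (rule integral_cong_AE)
    have "theta_kernel \<alpha> (of_real u) * exp (\<i> * of_real t * of_real u) = Q s u + Q s' (0 + (-1) * u)"
      if "u \<noteq> 0" for u
    proof (cases "u > 0")
      case True
      thus ?thesis using pos[OF True s_def] by (simp add: Q_def P_def E_def)
    next
      case False
      hence u: "- u > 0" using that by simp
      have "theta_kernel \<alpha> (of_real u) = theta_kernel \<alpha> (of_real (- u))"
        using theta_kernel_even[of "of_real u" \<alpha>] by (simp add: strip_def)
      hence "theta_kernel \<alpha> (of_real u) * exp (\<i> * of_real t * of_real u) =
          theta_kernel \<alpha> (of_real (- u)) * exp (\<i> * of_real (- t) * of_real (- u))" by simp
      also have "\<dots> = Q s' (- u)"
        by (rule pos[OF u]) (simp add: s'_def)
      finally show ?thesis using u by (simp add: Q_def P_def E_def)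
    qed
    moreover have "AE u in lborel. u \<noteq> (0::real)" by (rule AE_lborel_singleton)
    ultimately show "AE u in lborel. theta_kernel \<alpha> (of_real u) * exp (\<i> * of_real t * of_real u) = Q s u + Q s' (0 + (-1) * u)"
      by (auto elim: eventually_mono)
    have "continuous_on UNIV (\<lambda>u. theta_kernel \<alpha> (of_real u))"
      by (intro continuous_on_compose2[OF holomorphic_on_imp_continuous_on[OF theta_kernel_holomorphic]] continuous_intros)
         (auto simp: strip_def)
    hence [measurable]: "(\<lambda>u. theta_kernel \<alpha> (complex_of_real u)) \<in> borel_measurable borel"
      by (rule borel_measurable_continuous_onI)
    show "(\<lambda>u. theta_kernel \<alpha> (of_real u) * exp (\<i> * of_real t * of_real u)) \<in> borel_measurable lborel"
      by measurable
    show "(\<lambda>u. Q s u + Q s' (0 + (-1) * u)) \<in> borel_measurable lborel"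
      using iQ(1) iQ' by measurable
  qed
  also have "\<dots> = (mellin_half \<alpha> s - 1 / s') + (mellin_half \<alpha> s' - 1 / s)"
    using iQ iQ' LQ' by simp
  also have "\<dots> = zeta_completed \<alpha> s"
    unfolding zeta_completed_def a(2) s_refl
  proof -
    have "s - of_real (2 * a) = - s'" using s_refl(1) by (simp add: algebra_simps)
    thus "mellin_half \<alpha> s - 1 / s' + (mellin_half \<alpha> s' - 1 / s) = mellin_half \<alpha> s + mellin_half \<alpha> s' + 1 / (s - of_real (2 * a)) - 1 / s"
      by simp
  qed
  finally show ?thesis by (simp add: s_def a_def)
qed

lemma zeta_alpha_critical_line:
  assumes "\<alpha> > 0" "s = of_real (\<alpha> / 4) + \<i> * of_real t"
  shows "of_real pi powr (- s) * Gamma s * zeta_alpha \<alpha> s = Xi_alpha \<alpha> t"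
proof -
  have Re_s: "Re s = \<alpha> / 4" by (simp add: assms)
  hence "s \<noteq> of_real (\<alpha> / 2)" "s \<noteq> 0" using assms(1) by (auto simp: complex_eq_iff)
  hence "zeta_alpha \<alpha> s = of_real pi powr s * rGamma s * Xi_alpha \<alpha> t"
    using zeta_alpha_properties[OF assms(1)] zeta_completed_critical_line[OF assms(1), of t] assms(2) by simp
  moreover have "s \<notin> \<int>\<^sub>\<le>\<^sub>0" using Re_s assms(1) by (auto elim!: nonpos_Ints_cases)
  hence "Gamma s * rGamma s = 1" by (simp add: rGamma_inverse_Gamma Gamma_eq_zero_iff)
  moreover have "complex_of_real pi powr (- s) * of_real pi powr s = 1" by (simp add: powr_minus)
  ultimately have "of_real pi powr (- s) * Gamma s * zeta_alpha \<alpha> s =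
     (of_real pi powr (- s) * of_real pi powr s) * (Gamma s * rGamma s) * Xi_alpha \<alpha> t" by (simp add: mult_ac)
  thus ?thesis using \<open>Gamma s * rGamma s = 1\<close> \<open>complex_of_real pi powr (- s) * of_real pi powr s = 1\<close> by simp
qed

section \<open>Fourier inversion on the critical line\<close>

lemma holomorphic_line_integrable:
  fixes f :: "complex \<Rightarrow> complex"
  assumes "continuous_on {z. Im z = a} f" "\<kappa> > 0"
    and "\<And>z. Im z = a \<Longrightarrow> norm (f z) \<le> K * exp (- \<kappa> * \<bar>Re z\<bar>)"
  shows "integrable lborel (\<lambda>u. f (Complex u a))"
proof (rule Bochner_Integration.integrable_bound)
  show "integrable lborel (\<lambda>u. K * exp (- \<kappa> * \<bar>u\<bar>))"
    by (intro integrable_mult_right integrable_exp_abs assms)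
  have "continuous_on UNIV (\<lambda>u. f (Complex u a))"
    unfolding Complex_eq by (intro continuous_on_compose2[OF assms(1)] continuous_intros) auto
  thus "(\<lambda>u. f (Complex u a)) \<in> borel_measurable lborel"
    by (simp add: borel_measurable_continuous_onI)
  show "AE u in lborel. norm (f (Complex u a)) \<le> norm (K * exp (- \<kappa> * \<bar>u\<bar>))"
  proof (rule AE_I2)
    fix u
    have "norm (f (Complex u a)) \<le> K * exp (- \<kappa> * \<bar>u\<bar>)" using assms(3)[of "Complex u a"] by simp
    also have "\<dots> \<le> norm (K * exp (- \<kappa> * \<bar>u\<bar>))" by (simp only: real_norm_def abs_ge_self)
    finally show "norm (f (Complex u a)) \<le> norm (K * exp (- \<kappa> * \<bar>u\<bar>))" .
  qed
qed

lemma strip_Cauchy_exp_decay: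
  assumes holo: "f holomorphic_on S" and S: "open S" "convex S" "{z. a \<le> Im z \<and> Im z \<le> b} \<subseteq> S"
    and v: "a < Im v" "Im v < b" and "\<kappa> > 0"
    and K: "\<And>z. a \<le> Im z \<Longrightarrow> Im z \<le> b \<Longrightarrow> norm (f z) \<le> K * exp (- \<kappa> * \<bar>Re z\<bar>)"
  shows "(LINT u|lborel. f (Complex u a) / (Complex u a - v))
       - (LINT u|lborel. f (Complex u b) / (Complex u b - v)) = 2 * pi * \<i> * f v"
proof (rule strip_Cauchy_integral_formula[OF holo S v])
  show "norm (f z) \<le> K * exp (- \<kappa> * \<bar>Re z\<bar>)" if "a \<le> Im z" "Im z \<le> b" for z
    using K that by blast
  show "(\<lambda>n. K * exp (- \<kappa> * real n)) \<longlonglongrightarrow> 0"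
    using \<open>\<kappa> > 0\<close> by real_asymp
  have K0: "K \<ge> 0"
    using K[of v] v norm_ge_zero[of "f v"] by (smt (verit) exp_gt_zero mult_neg_pos)
  have line: "integrable lborel (\<lambda>u. f (Complex u c) / (Complex u c - v))" if c: "c = a \<or> c = b" for c
  proof (rule holomorphic_line_integrable[OF _ \<open>\<kappa> > 0\<close>, where K = "K / \<bar>c - Im v\<bar>"])
    have "c \<noteq> Im v" using v c by auto
    have sub: "{z. Im z = c} \<subseteq> S" using S(3) c v by auto
    show "continuous_on {z. Im z = c} (\<lambda>z. f z / (z - v))"
      using continuous_on_subset[OF holomorphic_on_imp_continuous_on[OF holo] sub] \<open>c \<noteq> Im v\<close>
      by (intro continuous_intros) auto
    fix z assume z: "Im z = c"
    have "\<bar>c - Im v\<bar> \<le> norm (z - v)" using abs_Im_le_cmod[of "z - v"] z by simp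
    moreover have "norm (f z) \<le> K * exp (- \<kappa> * \<bar>Re z\<bar>)" using K[of z] z c v by auto
    ultimately have "norm (f z) / norm (z - v) \<le> K * exp (- \<kappa> * \<bar>Re z\<bar>) / \<bar>c - Im v\<bar>"
      using \<open>c \<noteq> Im v\<close> K0 by (intro frac_le) auto
    thus "norm (f z / (z - v)) \<le> K / \<bar>c - Im v\<bar> * exp (- \<kappa> * \<bar>Re z\<bar>)"
      by (simp add: norm_divide)
  qed
  show "integrable lborel (\<lambda>u. f (Complex u a) / (Complex u a - v))"
       "integrable lborel (\<lambda>u. f (Complex u b) / (Complex u b - v))" using line by blast+
qed

text \<open>Cauchy's formula applied to f(z) (z - v), whose value at v is 0: the formula then says
  that the two line integrals of f agree.\<close>

lemma strip_shift:
  assumes holo: "f holomorphic_on S" and S: "open S" "convex S" "{z. a \<le> Im z \<and> Im z \<le> b} \<subseteq> S"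
    and "a < b" and "\<kappa> > 0"
    and K: "\<And>z. a \<le> Im z \<Longrightarrow> Im z \<le> b \<Longrightarrow> norm (f z) \<le> K * exp (- \<kappa> * \<bar>Re z\<bar>)"
  shows "(LINT u|lborel. f (Complex u a)) = (LINT u|lborel. f (Complex u b))"
proof -
  define v where "v = Complex 0 ((a + b) / 2)"
  have v: "a < Im v" "Im v < b" using \<open>a < b\<close> by (auto simp: v_def)
  have K0: "K \<ge> 0"
    using K[of v] v norm_ge_zero[of "f v"] by (smt (verit) exp_gt_zero mult_neg_pos)
  \<comment> \<open>Half of the decay rate pays for the linear factor, through x \<le> (2/\<kappa>)
    exp(\<kappa> x/2).\<close>
  define K' where "K' = K * (2 / \<kappa> + (b - a))"
  have "(LINT u|lborel. f (Complex u a) * (Complex u a - v) / (Complex u a - v))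
       - (LINT u|lborel. f (Complex u b) * (Complex u b - v) / (Complex u b - v)) = 2 * pi * \<i> * (f v * (v - v))"
  proof (rule strip_Cauchy_exp_decay[where f = "\<lambda>z. f z * (z - v)" and \<kappa> = "\<kappa> / 2" and K = K', OF _ S v])
    show "(\<lambda>z. f z * (z - v)) holomorphic_on S" by (intro holomorphic_intros holo)
    show "\<kappa> / 2 > 0" using \<open>\<kappa> > 0\<close> by simp
    fix z assume z: "a \<le> Im z" "Im z \<le> b"
    have "norm (z - v) \<le> \<bar>Re (z - v)\<bar> + \<bar>Im (z - v)\<bar>" by (rule cmod_le)
    also have "\<dots> \<le> \<bar>Re z\<bar> + (b - a)" using z by (auto simp: v_def field_simps)
    also have "\<dots> \<le> (2 / \<kappa> + (b - a)) * exp (\<kappa> / 2 * \<bar>Re z\<bar>)"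
    proof -
      have "\<kappa> / 2 * \<bar>Re z\<bar> \<le> exp (\<kappa> / 2 * \<bar>Re z\<bar>)"
        using exp_ge_add_one_self[of "\<kappa> / 2 * \<bar>Re z\<bar>"] by linarith
      hence "\<bar>Re z\<bar> \<le> 2 / \<kappa> * exp (\<kappa> / 2 * \<bar>Re z\<bar>)" using \<open>\<kappa> > 0\<close> by (simp add: field_simps)
      moreover have "(b - a) * 1 \<le> (b - a) * exp (\<kappa> / 2 * \<bar>Re z\<bar>)"
        using \<open>a < b\<close> \<open>\<kappa> > 0\<close> by (intro mult_left_mono) auto
      ultimately show ?thesis by (simp add: distrib_right)
    qed
    finally have "norm (z - v) \<le> (2 / \<kappa> + (b - a)) * exp (\<kappa> / 2 * \<bar>Re z\<bar>)" .
    hence "norm (f z * (z - v)) \<le> (K * exp (- \<kappa> * \<bar>Re z\<bar>)) * ((2 / \<kappa> + (b - a)) * exp (\<kappa> / 2 * \<bar>Re z\<bar>))"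
      unfolding norm_mult using K[OF z] K0 by (intro mult_mono) auto
    also have "\<dots> = K' * (exp (- \<kappa> * \<bar>Re z\<bar>) * exp (\<kappa> / 2 * \<bar>Re z\<bar>))"
      by (simp add: K'_def)
    also have "exp (- \<kappa> * \<bar>Re z\<bar>) * exp (\<kappa> / 2 * \<bar>Re z\<bar>) = exp (- (\<kappa> / 2) * \<bar>Re z\<bar>)"
      by (simp add: field_simps flip: exp_add)
    finally show "norm (f z * (z - v)) \<le> K' * exp (- (\<kappa> / 2) * \<bar>Re z\<bar>)" .
  qed
  moreover have "f (Complex u c) * (Complex u c - v) / (Complex u c - v) = f (Complex u c)" if "c = a \<or> c = b" for u c
  proof -
    have "Complex u c \<noteq> v" using v that by auto
    thus ?thesis by simp
  qed
  ultimately show ?thesis by simp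
qed

lemma Xi_alpha_shift:
  assumes "\<alpha> > 0" "0 \<le> w" "w < pi / 2"
  shows "Xi_alpha \<alpha> t = (LINT u|lborel. theta_kernel \<alpha> (Complex u w) * exp (\<i> * of_real t * Complex u w))"
proof (cases "w = 0")
  case True
  thus ?thesis by (simp add: Xi_alpha_def complex_of_real_def)
next
  case False
  obtain C N where C: "C > 0" and bd: "\<And>w v. 0 \<le> w \<Longrightarrow> w < pi / 2 \<Longrightarrow> \<bar>Im v\<bar> \<le> w \<Longrightarrow>
       norm (theta_kernel \<alpha> v) \<le> C / cos w ^ N * exp (- (\<alpha> / 4) * \<bar>Re v\<bar>)"
    using theta_kernel_bound[OF assms(1)] by metis
  have "(LINT u|lborel. theta_kernel \<alpha> (Complex u 0) * exp (\<i> * of_real t * Complex u 0)) =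
        (LINT u|lborel. theta_kernel \<alpha> (Complex u w) * exp (\<i> * of_real t * Complex u w))"
  proof (rule strip_shift[where S = strip and f = "\<lambda>z. theta_kernel \<alpha> z * exp (\<i> * of_real t * z)"
        and \<kappa> = "\<alpha> / 4" and K = "C / cos w ^ N * exp (\<bar>t\<bar> * w)"])
    show "(\<lambda>z. theta_kernel \<alpha> z * exp (\<i> * of_real t * z)) holomorphic_on strip"
      by (intro holomorphic_intros theta_kernel_holomorphic)
    show "{z. 0 \<le> Im z \<and> Im z \<le> w} \<subseteq> strip" using assms pi_gt_zero unfolding strip_def by auto
    fix z assume z: "0 \<le> Im z" "Im z \<le> w"
    have "norm (theta_kernel \<alpha> z) \<le> C / cos w ^ N * exp (- (\<alpha> / 4) * \<bar>Re z\<bar>)"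
      using assms z by (intro bd) auto
    moreover have "norm (exp (\<i> * of_real t * z)) \<le> exp (\<bar>t\<bar> * w)"
    proof -
      have "- (t * Im z) \<le> \<bar>t\<bar> * \<bar>Im z\<bar>" by (metis abs_ge_minus_self abs_mult)
      also have "\<dots> \<le> \<bar>t\<bar> * w" using z by (intro mult_left_mono) auto
      finally show ?thesis by simp
    qed
    ultimately have "norm (theta_kernel \<alpha> z * exp (\<i> * of_real t * z)) \<le>
        (C / cos w ^ N * exp (- (\<alpha> / 4) * \<bar>Re z\<bar>)) * exp (\<bar>t\<bar> * w)"
      unfolding norm_mult by (intro mult_mono) (auto intro: order_trans[OF norm_ge_zero])
    thus "norm (theta_kernel \<alpha> z * exp (\<i> * of_real t * z)) \<le> C / cos w ^ N * exp (\<bar>t\<bar> * w) * exp (- (\<alpha> / 4) * \<bar>Re z\<bar>)"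
      by (simp add: mult_ac)
  qed (use assms False open_strip convex_strip in auto)
  thus ?thesis by (simp add: Xi_alpha_def complex_of_real_def)
qed

lemma Xi_alpha_minus: "Xi_alpha \<alpha> (- t) = Xi_alpha \<alpha> t"
proof -
  have "Xi_alpha \<alpha> t = (LINT u|lborel. theta_kernel \<alpha> (of_real (0 + (-1) * u)) * exp (\<i> * of_real t * of_real (0 + (-1) * u)))"
    unfolding Xi_alpha_def
    using lborel_integral_real_affine[of "-1" "\<lambda>u. theta_kernel \<alpha> (of_real u) * exp (\<i> * of_real t * of_real u)" 0] by simp
  moreover have "theta_kernel \<alpha> (- of_real u) = theta_kernel \<alpha> (of_real u)" for u
    by (rule theta_kernel_even) (simp add: strip_def)
  ultimately show ?thesis by (simp add: Xi_alpha_def)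
qed

lemma Xi_alpha_real: "Xi_alpha \<alpha> t \<in> \<real>"
proof -
  have "cnj (Xi_alpha \<alpha> t) = (LINT u|lborel. cnj (theta_kernel \<alpha> (of_real u) * exp (\<i> * of_real t * of_real u)))"
    unfolding Xi_alpha_def by (rule Bochner_Integration.integral_cnj[symmetric])
  also have "\<dots> = Xi_alpha \<alpha> (- t)"
    by (simp add: Xi_alpha_def theta_kernel_of_real exp_cnj)
  finally show ?thesis by (simp add: Xi_alpha_minus Reals_cnj_iff)
qed

text \<open>Read off from \<open>zeta_completed\<close>: \<open>mellin_half\<close> is entire and
  the line stays away from both poles.\<close>

lemma continuous_on_Xi_alpha:
  assumes "\<alpha> > 0"
  shows "continuous_on A (Xi_alpha \<alpha>)"
proof -
  have cm: "continuous_on UNIV (mellin_half \<alpha>)"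
    by (intro holomorphic_on_imp_continuous_on mellin_half_holomorphic assms)
  define s where "s = (\<lambda>t. complex_of_real (\<alpha> / 4) + \<i> * of_real t)"
  have cs: "continuous_on A s" unfolding s_def by (intro continuous_intros)
  have nz: "s t \<noteq> 0" "s t - of_real (\<alpha> / 2) \<noteq> 0" for t
  proof -
    have "Re (s t) \<noteq> 0" "Re (s t - of_real (\<alpha> / 2)) \<noteq> 0" using assms by (auto simp: s_def)
    thus "s t \<noteq> 0" "s t - of_real (\<alpha> / 2) \<noteq> 0" by (metis zero_complex.sel(1))+
  qed
  have "continuous_on A (\<lambda>t. zeta_completed \<alpha> (s t))"
    unfolding zeta_completed_def
    by (intro continuous_on_add continuous_on_diff continuous_on_divide continuous_on_const cs ballI nz
        continuous_on_compose2[OF cm] subset_UNIV)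
  thus ?thesis by (simp only: s_def zeta_completed_critical_line[OF assms])
qed

lemma Xi_alpha_measurable: "\<alpha> > 0 \<Longrightarrow> Xi_alpha \<alpha> \<in> borel_measurable borel"
  by (intro borel_measurable_continuous_onI continuous_on_Xi_alpha)

text \<open>For t \<ge> 0 moving the contour to height w extracts the factor exp(-w t); evenness
  covers t < 0. The bound is kept for every w, as w will approach pi/2 together with T.\<close>

lemma Xi_alpha_bound:
  assumes "\<alpha> > 0"
  obtains C and N :: nat where "C > 0"
    "\<And>w t. 0 \<le> w \<Longrightarrow> w < pi / 2 \<Longrightarrow> norm (Xi_alpha \<alpha> t) \<le> C / cos w ^ N * exp (- w * \<bar>t\<bar>)"
proof -
  obtain C N where C: "C > 0" and bd: "\<And>w v. 0 \<le> w \<Longrightarrow> w < pi / 2 \<Longrightarrow> \<bar>Im v\<bar> \<le> w \<Longrightarrow>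
       norm (theta_kernel \<alpha> v) \<le> C / cos w ^ N * exp (- (\<alpha> / 4) * \<bar>Re v\<bar>)"
    using theta_kernel_bound[OF assms(1)] by metis
  define D where "D = (LINT u|lborel. exp (- (\<alpha> / 4) * \<bar>u\<bar>))"
  have iD: "integrable lborel (\<lambda>u. exp (- (\<alpha> / 4) * \<bar>u\<bar>))"
    using assms by (intro integrable_exp_abs) auto
  have D0: "D \<ge> 0" unfolding D_def by (intro integral_nonneg_AE) auto
  have pos: "norm (Xi_alpha \<alpha> t) \<le> C * (D + 1) / cos w ^ N * exp (- w * \<bar>t\<bar>)" if w: "0 \<le> w" "w < pi / 2" and t: "t \<ge> 0" for w t
  proof -
    have c: "cos w > 0" using w by (intro cos_gt_zero_pi) auto
    have "norm (Xi_alpha \<alpha> t) \<le> (LINT u|lborel. C / cos w ^ N * exp (- (\<alpha> / 4) * \<bar>u\<bar>) * exp (- w * t))"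
      unfolding Xi_alpha_shift[OF assms w]
    proof (rule Bochner_Integration.integral_norm_bound_integral)
      show le: "norm (theta_kernel \<alpha> (Complex u w) * exp (\<i> * of_real t * Complex u w))
         \<le> C / cos w ^ N * exp (- (\<alpha> / 4) * \<bar>u\<bar>) * exp (- w * t)" for u
      proof -
        have "norm (exp (\<i> * of_real t * Complex u w)) = exp (- w * t)" by (simp add: mult.commute)
        moreover have "norm (theta_kernel \<alpha> (Complex u w)) \<le> C / cos w ^ N * exp (- (\<alpha> / 4) * \<bar>u\<bar>)"
          using bd[of w "Complex u w"] w by simp
        ultimately show ?thesis unfolding norm_mult by (simp only: mult_right_mono exp_ge_zero)
      qed
      show int: "integrable lborel (\<lambda>u. C / cos w ^ N * exp (- (\<alpha> / 4) * \<bar>u\<bar>) * exp (- w * t))"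
        by (intro integrable_mult_left integrable_mult_right iD)
      have "continuous_on UNIV (\<lambda>u. theta_kernel \<alpha> (Complex u w) * exp (\<i> * of_real t * Complex u w))"
        unfolding Complex_eq using w
        by (intro continuous_intros continuous_on_compose2[OF holomorphic_on_imp_continuous_on[OF theta_kernel_holomorphic]])
           (auto simp: strip_def)
      hence "(\<lambda>u. theta_kernel \<alpha> (Complex u w) * exp (\<i> * of_real t * Complex u w)) \<in> borel_measurable lborel"
        by (simp add: borel_measurable_continuous_onI)
      thus "integrable lborel (\<lambda>u. theta_kernel \<alpha> (Complex u w) * exp (\<i> * of_real t * Complex u w))"
        by (rule Bochner_Integration.integrable_bound[OF int]) (intro AE_I2 order_trans[OF le], simp only: real_norm_def abs_ge_self)
    qed
    also have "\<dots> = C / cos w ^ N * D * exp (- w * t)" by (simp add: D_def)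
    also have "\<dots> \<le> C * (D + 1) / cos w ^ N * exp (- w * \<bar>t\<bar>)"
      using C c t by (simp add: field_simps)
    finally show ?thesis .
  qed
  have "norm (Xi_alpha \<alpha> t) \<le> C * (D + 1) / cos w ^ N * exp (- w * \<bar>t\<bar>)" if w: "0 \<le> w" "w < pi / 2" for w t
    using pos[OF w, of t] pos[OF w, of "- t"] by (cases "t \<ge> 0") (auto simp: Xi_alpha_minus)
  moreover have "C * (D + 1) > 0" using C D0 by simp
  ultimately show ?thesis using that by blast
qed

text \<open>For Re p > 0 the double integral converges absolutely, and the inner integral over t > 0
  of exp(t (i u - p)) is 1/(p - i u).\<close>

lemma Laplace_Fourier_Fubini:
  fixes G :: "real \<Rightarrow> complex" and p :: complex
  assumes G: "integrable lborel G" and p: "Re p > 0"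
  shows "(LINT t|lborel. of_real (indicat_real {0<..} t) * (LINT u|lborel. G u * exp (of_real t * (\<i> * of_real u - p))))
     = (LINT u|lborel. G u / (p - \<i> * of_real u))"
proof -
  define f where "f = (\<lambda>t u. of_real (indicat_real {0<..} t) * (G u * exp (of_real t * (\<i> * of_real u - p))))"
  have [measurable]: "G \<in> borel_measurable borel" using G by simp
  have norm_f: "norm (f t u) = indicat_real {0<..} t * exp (- Re p * t) * norm (G u)" for t u
    by (simp add: f_def norm_mult mult_ac)
  have "integrable (lborel \<Otimes>\<^sub>M lborel) (case_prod f)"
  proof (rule lborel_pair.Fubini_integrable)
    show "case_prod f \<in> borel_measurable (lborel \<Otimes>\<^sub>M lborel)"
      unfolding f_def by measurable
    have *: "(LINT u|lborel. norm (f t u)) = indicat_real {0<..} t * exp (- Re p * t) * (LINT u|lborel. norm (G u))" for t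
      unfolding norm_f by (subst integral_mult_right_zero) simp
    have "integrable lborel (\<lambda>t. indicat_real {0<..} t * exp (- Re p * t))"
      by (rule Bochner_Integration.integrable_bound[OF integrable_exp_abs[OF p]]) (auto simp: indicator_def)
    thus "integrable lborel (\<lambda>t. LINT u|lborel. norm (case (t, u) of (t, u) \<Rightarrow> f t u))"
      unfolding prod.case * by (rule integrable_mult_left)
    show "AE t in lborel. integrable lborel (\<lambda>u. case (t, u) of (t, u) \<Rightarrow> f t u)"
    proof (rule AE_I2)
      fix t :: real
      have "integrable lborel (\<lambda>u. indicat_real {0<..} t * exp (- Re p * t) * norm (G u))"
        using G by (intro integrable_mult_right integrable_norm)
      moreover have "f t \<in> borel_measurable lborel" unfolding f_def by measurable
      ultimately have "integrable lborel (f t)"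
        by (rule Bochner_Integration.integrable_bound) (simp add: norm_f abs_mult)
      thus "integrable lborel (\<lambda>u. case (t, u) of (t, u) \<Rightarrow> f t u)" by simp
    qed
  qed
  from lborel_pair.Fubini_integral[OF this]
  have "(LINT t|lborel. LINT u|lborel. f t u) = (LINT u|lborel. LINT t|lborel. f t u)" by simp
  also have "\<dots> = (LINT u|lborel. G u / (p - \<i> * of_real u))"
  proof (intro Bochner_Integration.integral_cong refl)
    fix u
    have "(LINT t|lborel. f t u) = (LINT t|lborel. G u * (of_real (indicat_real {0<..} t) * exp (- (p - \<i> * of_real u) * of_real t)))"
      unfolding f_def by (intro Bochner_Integration.integral_cong refl) (simp add: algebra_simps)
    also have "\<dots> = G u * (1 / (p - \<i> * of_real u))"
      by (subst integral_mult_right_zero, subst exp_half_line(2)) (use p in auto)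
    finally show "(LINT t|lborel. f t u) = G u / (p - \<i> * of_real u)" by simp
  qed
  finally show ?thesis by (simp add: f_def)
qed

lemma Xi_alpha_transform_integrable:
  assumes "\<alpha> > 0" "w < pi / 2"
  shows "integrable lborel (\<lambda>t. norm (Xi_alpha \<alpha> t) * exp (w * \<bar>t\<bar>))"
proof -
  obtain C N where C: "C > 0" and bd: "\<And>w t. 0 \<le> w \<Longrightarrow> w < pi / 2 \<Longrightarrow> norm (Xi_alpha \<alpha> t) \<le> C / cos w ^ N * exp (- w * \<bar>t\<bar>)"
    using Xi_alpha_bound[OF assms(1)] by metis
  \<comment> \<open>A height strictly between w and pi/2; the gap w' - w is the decay that
    remains.\<close>
  define w' where "w' = (max w 0 + pi / 2) / 2"
  have w': "0 \<le> w'" "w' < pi / 2" "w < w'" using assms(2) pi_gt_zero by (auto simp: w'_def max_def)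
  have c: "cos w' > 0" using w' by (intro cos_gt_zero_pi) auto
  have [measurable]: "Xi_alpha \<alpha> \<in> borel_measurable borel" by (rule Xi_alpha_measurable[OF assms(1)])
  have "integrable lborel (\<lambda>t. C / cos w' ^ N * exp (- (w' - w) * \<bar>t\<bar>))"
    using w' by (intro integrable_mult_right integrable_exp_abs) auto
  thus ?thesis
  proof (rule Bochner_Integration.integrable_bound)
    show "AE t in lborel. norm (norm (Xi_alpha \<alpha> t) * exp (w * \<bar>t\<bar>)) \<le> norm (C / cos w' ^ N * exp (- (w' - w) * \<bar>t\<bar>))"
    proof (rule AE_I2)
      fix t
      have "norm (Xi_alpha \<alpha> t) * exp (w * \<bar>t\<bar>) \<le> C / cos w' ^ N * exp (- w' * \<bar>t\<bar>) * exp (w * \<bar>t\<bar>)"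
        using w' by (intro mult_right_mono bd) auto
      also have "\<dots> = C / cos w' ^ N * exp (- (w' - w) * \<bar>t\<bar>)"
        by (simp add: algebra_simps flip: exp_add)
      finally show "norm (norm (Xi_alpha \<alpha> t) * exp (w * \<bar>t\<bar>)) \<le> norm (C / cos w' ^ N * exp (- (w' - w) * \<bar>t\<bar>))"
        using C c by (simp add: abs_mult)
    qed
  qed measurable
qed

text \<open>If the kernel is integrated at a height above Im v, the t-integral becomes a Laplace
  integral, and what remains is a Cauchy integral along that line.\<close>

lemma Xi_alpha_half_transform:
  assumes "\<alpha> > 0" "0 \<le> w" "w < pi / 2" "Im v < w"
  shows "(LINT t|lborel. of_real (indicat_real {0<..} t) * (Xi_alpha \<alpha> t * exp (- \<i> * of_real t * v)))
     = \<i> * (LINT u|lborel. theta_kernel \<alpha> (Complex u w) / (Complex u w - v))"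
proof -
  obtain C N where C: "C > 0" and bd: "\<And>w v. 0 \<le> w \<Longrightarrow> w < pi / 2 \<Longrightarrow> \<bar>Im v\<bar> \<le> w \<Longrightarrow>
       norm (theta_kernel \<alpha> v) \<le> C / cos w ^ N * exp (- (\<alpha> / 4) * \<bar>Re v\<bar>)"
    using theta_kernel_bound[OF assms(1)] by metis
  define p where "p = of_real w + \<i> * v"
  have p: "Re p > 0" using assms by (simp add: p_def)
  have iG: "integrable lborel (\<lambda>u. theta_kernel \<alpha> (Complex u w))"
  proof (rule holomorphic_line_integrable[of _ _ "\<alpha> / 4" "C / cos w ^ N"])
    show "continuous_on {z. Im z = w} (theta_kernel \<alpha>)"
      using assms by (intro holomorphic_on_imp_continuous_on holomorphic_on_subset[OF theta_kernel_holomorphic])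
        (auto simp: strip_def)
  qed (use assms bd in auto)
  have e: "\<i> * of_real t * Complex u w + - \<i> * of_real t * v = of_real t * (\<i> * of_real u - p)" for t u
    by (simp add: p_def Complex_eq algebra_simps)
  have "Xi_alpha \<alpha> t * exp (- \<i> * of_real t * v) = (LINT u|lborel. theta_kernel \<alpha> (Complex u w) * exp (of_real t * (\<i> * of_real u - p)))" for t
    unfolding Xi_alpha_shift[OF assms(1-3)] e[symmetric] exp_add
    by (subst integral_mult_left_zero[symmetric]) (simp add: mult.assoc)
  hence "(LINT t|lborel. of_real (indicat_real {0<..} t) * (Xi_alpha \<alpha> t * exp (- \<i> * of_real t * v)))
     = (LINT u|lborel. theta_kernel \<alpha> (Complex u w) / (p - \<i> * of_real u))"
    by (simp only: Laplace_Fourier_Fubini[OF iG p])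
  also have "\<dots> = (LINT u|lborel. \<i> * (theta_kernel \<alpha> (Complex u w) / (Complex u w - v)))"
  proof (intro Bochner_Integration.integral_cong refl)
    fix u
    have "p - \<i> * of_real u = - \<i> * (Complex u w - v)" by (simp add: p_def Complex_eq algebra_simps)
    moreover have "Complex u w - v \<noteq> 0" using assms by auto
    ultimately show "theta_kernel \<alpha> (Complex u w) / (p - \<i> * of_real u) = \<i> * (theta_kernel \<alpha> (Complex u w) / (Complex u w - v))"
      by (simp add: divide_simps)
  qed
  also have "\<dots> = \<i> * (LINT u|lborel. theta_kernel \<alpha> (Complex u w) / (Complex u w - v))"
    by (rule integral_mult_right_zero)
  finally show ?thesis .
qed

text \<open>Inversion by Cauchy's formula: the halves t > 0 and t < 0 produce the Cauchy integrals
  of the kernel along Im z = w and Im z = -w, and v lies between the two lines.\<close>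

lemma Xi_alpha_inversion:
  assumes "\<alpha> > 0" "v \<in> strip"
  shows "(LINT t|lborel. Xi_alpha \<alpha> t * exp (- \<i> * of_real t * v)) = 2 * pi * theta_kernel \<alpha> v"
proof -
  define w where "w = (\<bar>Im v\<bar> + pi / 2) / 2"
  have w: "0 \<le> w" "w < pi / 2" "\<bar>Im v\<bar> < w" using assms(2) by (auto simp: w_def strip_def)
  have [measurable]: "Xi_alpha \<alpha> \<in> borel_measurable borel" by (rule Xi_alpha_measurable[OF assms(1)])
  define P where "P = (\<lambda>v t. of_real (indicat_real {0<..} t) * (Xi_alpha \<alpha> t * exp (- \<i> * of_real t * v)))"
  have iP: "integrable lborel (P v)" if "\<bar>Im v\<bar> < w" for v
  proof (rule Bochner_Integration.integrable_bound[OF Xi_alpha_transform_integrable[OF assms(1) w(2)]])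
    show "P v \<in> borel_measurable lborel" unfolding P_def by measurable
    show "AE t in lborel. norm (P v t) \<le> norm (norm (Xi_alpha \<alpha> t) * exp (w * \<bar>t\<bar>))"
    proof (rule AE_I2)
      fix t
      show "norm (P v t) \<le> norm (norm (Xi_alpha \<alpha> t) * exp (w * \<bar>t\<bar>))"
      proof (cases "t > 0")
        case True
        have "t * Im v \<le> t * w" using True that by (intro mult_left_mono) auto
        thus ?thesis using True by (simp add: P_def norm_mult mult_left_mono mult.commute)
      qed (simp add: P_def)
    qed
  qed
  have iP': "integrable lborel (\<lambda>t. P (- v) (0 + (-1) * t))"
    using w by (intro lborel_integrable_real_affine iP) auto
  have "(LINT t|lborel. Xi_alpha \<alpha> t * exp (- \<i> * of_real t * v)) = (LINT t|lborel. P v t + P (- v) (0 + (-1) * t))"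
  proof (rule integral_cong_AE)
    have "Xi_alpha \<alpha> t * exp (- \<i> * of_real t * v) = P v t + P (- v) (0 + (-1) * t)" if "t \<noteq> 0" for t
      using that by (cases "t > 0") (auto simp: P_def Xi_alpha_minus)
    moreover have "AE t in lborel. t \<noteq> (0::real)" by (rule AE_lborel_singleton)
    ultimately show "AE t in lborel. Xi_alpha \<alpha> t * exp (- \<i> * of_real t * v) = P v t + P (- v) (0 + (-1) * t)"
      by (auto elim: eventually_mono)
  qed (unfold P_def, measurable)
  also have "\<dots> = (LINT t|lborel. P v t) + (LINT t|lborel. P (- v) (0 + (-1) * t))"
    using iP[OF w(3)] iP' by (rule Bochner_Integration.integral_add)
  also have "(LINT t|lborel. P (- v) (0 + (-1) * t)) = (LINT t|lborel. P (- v) t)"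
    using lborel_integral_real_affine[of "-1" "P (- v)" 0] by simp
  also have "(LINT t|lborel. P v t) = \<i> * (LINT u|lborel. theta_kernel \<alpha> (Complex u w) / (Complex u w - v))"
    unfolding P_def using w by (intro Xi_alpha_half_transform assms(1)) auto
  also have "(LINT t|lborel. P (- v) t) = \<i> * (LINT u|lborel. theta_kernel \<alpha> (Complex u w) / (Complex u w - (- v)))"
    unfolding P_def using w by (intro Xi_alpha_half_transform assms(1)) auto
  \<comment> \<open>The reflection u to -u together with the evenness of the kernel moves this
    integral to the line of height -w, with a change of sign.\<close>
  also have "(LINT u|lborel. theta_kernel \<alpha> (Complex u w) / (Complex u w - (- v))) =
      (LINT u|lborel. theta_kernel \<alpha> (Complex (0 + (-1) * u) w) / (Complex (0 + (-1) * u) w - (- v)))"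
    using lborel_integral_real_affine[of "-1" "\<lambda>u. theta_kernel \<alpha> (Complex u w) / (Complex u w - (- v))" 0] by simp
  also have "\<dots> = (LINT u|lborel. - (theta_kernel \<alpha> (Complex u (- w)) / (Complex u (- w) - v)))"
  proof (intro Bochner_Integration.integral_cong refl)
    fix u
    have neg: "Complex (0 + (-1) * u) w = - Complex u (- w)" by (simp add: complex_eq_iff)
    have "theta_kernel \<alpha> (- Complex u (- w)) = theta_kernel \<alpha> (Complex u (- w))"
      using w by (intro theta_kernel_even) (auto simp: strip_def)
    moreover have "- Complex u (- w) - (- v) = - (Complex u (- w) - v)" by simp
    ultimately show "theta_kernel \<alpha> (Complex (0 + (-1) * u) w) / (Complex (0 + (-1) * u) w - (- v)) =
        - (theta_kernel \<alpha> (Complex u (- w)) / (Complex u (- w) - v))"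
      unfolding neg by (metis divide_minus_right)
  qed
  also have "\<dots> = - (LINT u|lborel. theta_kernel \<alpha> (Complex u (- w)) / (Complex u (- w) - v))" by simp
  finally have eq: "(LINT t|lborel. Xi_alpha \<alpha> t * exp (- \<i> * of_real t * v)) =
     - \<i> * ((LINT u|lborel. theta_kernel \<alpha> (Complex u (- w)) / (Complex u (- w) - v))
         - (LINT u|lborel. theta_kernel \<alpha> (Complex u w) / (Complex u w - v)))" by (simp add: algebra_simps)
  obtain C N where C: "C > 0" and bd: "\<And>w v. 0 \<le> w \<Longrightarrow> w < pi / 2 \<Longrightarrow> \<bar>Im v\<bar> \<le> w \<Longrightarrow>
       norm (theta_kernel \<alpha> v) \<le> C / cos w ^ N * exp (- (\<alpha> / 4) * \<bar>Re v\<bar>)"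
    using theta_kernel_bound[OF assms(1)] by metis
  have "(LINT u|lborel. theta_kernel \<alpha> (Complex u (- w)) / (Complex u (- w) - v))
         - (LINT u|lborel. theta_kernel \<alpha> (Complex u w) / (Complex u w - v)) = 2 * pi * \<i> * theta_kernel \<alpha> v"
  proof (rule strip_Cauchy_exp_decay[OF theta_kernel_holomorphic open_strip convex_strip])
    show "{z. - w \<le> Im z \<and> Im z \<le> w} \<subseteq> strip" using w unfolding strip_def by auto
    show "norm (theta_kernel \<alpha> z) \<le> C / cos w ^ N * exp (- (\<alpha> / 4) * \<bar>Re z\<bar>)" if "- w \<le> Im z" "Im z \<le> w" for z
      using w that by (intro bd) auto
  qed (use w assms in auto)
  thus ?thesis unfolding eq by (simp add: algebra_simps)
qed

section \<open>Polynomial moments\<close>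

text \<open>By Cauchy's estimate this controls \<open>q\<close> applied to the derivative operator, at the centre of a disc
  of radius \<open>\<rho>\<close> on which the function is bounded by \<open>1\<close>.\<close>
definition poly_majorant :: "real \<Rightarrow> complex poly \<Rightarrow> real" where
  "poly_majorant \<rho> q = (\<Sum>i\<le>degree q. norm (coeff q i) * (fact i / \<rho> ^ i))"

lemma poly_majorant_eq:
  assumes "degree q \<le> d"
  shows "poly_majorant \<rho> q = (\<Sum>i\<le>d. norm (coeff q i) * (fact i / \<rho> ^ i))"
  unfolding poly_majorant_def
  by (rule sum.mono_neutral_left) (use assms in \<open>auto simp: coeff_eq_0\<close>)

lemma poly_majorant_nonneg: "\<rho> > 0 \<Longrightarrow> poly_majorant \<rho> q \<ge> 0"
  unfolding poly_majorant_def by (intro sum_nonneg mult_nonneg_nonneg) auto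

lemma poly_majorant_smult: "poly_majorant \<rho> (smult c q) = norm c * poly_majorant \<rho> q"
proof -
  have "poly_majorant \<rho> (smult c q) = (\<Sum>i\<le>degree q. norm (coeff (smult c q) i) * (fact i / \<rho> ^ i))"
    by (rule poly_majorant_eq) (rule degree_smult_le)
  thus ?thesis by (simp add: poly_majorant_def sum_distrib_left norm_mult mult.assoc)
qed

text \<open>Multiplication by the variable moves coefficient i to i + 1 and so multiplies its weight
  by (i + 1)/\<rho>, at most (d + 1)/\<rho>.\<close>

lemma poly_majorant_linear_mult:
  assumes "\<rho> > 0" "degree q \<le> d"
  shows "poly_majorant \<rho> ([:b, c:] * q) \<le> (norm b + norm c * (real d + 1) / \<rho>) * poly_majorant \<rho> q"
proof -
  have "[:b, c:] * q = smult b q + pCons 0 (smult c q)" by simp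
  moreover have "degree \<dots> \<le> Suc d"
    using assms(2) by (intro degree_add_le) (auto intro: order_trans[OF degree_smult_le] order_trans[OF degree_pCons_le])
  ultimately have "poly_majorant \<rho> ([:b, c:] * q) =
      (\<Sum>i\<le>Suc d. norm (coeff (smult b q + pCons 0 (smult c q)) i) * (fact i / \<rho> ^ i))"
    using poly_majorant_eq by metis
  also have "\<dots> \<le> (\<Sum>i\<le>Suc d. norm b * (norm (coeff q i) * (fact i / \<rho> ^ i)) + norm c * (norm (coeff (pCons 0 q) i) * (fact i / \<rho> ^ i)))"
  proof (rule sum_mono)
    fix i
    have "norm (coeff (smult b q + pCons 0 (smult c q)) i) \<le> norm b * norm (coeff q i) + norm c * norm (coeff (pCons 0 q) i)"
      by (cases i) (auto simp: coeff_pCons norm_mult intro: order_trans[OF norm_triangle_ineq])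
    hence "norm (coeff (smult b q + pCons 0 (smult c q)) i) * (fact i / \<rho> ^ i)
       \<le> (norm b * norm (coeff q i) + norm c * norm (coeff (pCons 0 q) i)) * (fact i / \<rho> ^ i)"
      using assms by (intro mult_right_mono) auto
    thus "norm (coeff (smult b q + pCons 0 (smult c q)) i) * (fact i / \<rho> ^ i)
       \<le> norm b * (norm (coeff q i) * (fact i / \<rho> ^ i)) + norm c * (norm (coeff (pCons 0 q) i) * (fact i / \<rho> ^ i))"
      by (simp only: distrib_right mult.assoc)
  qed
  also have "\<dots> = norm b * (\<Sum>i\<le>Suc d. norm (coeff q i) * (fact i / \<rho> ^ i))
      + norm c * (\<Sum>i\<le>Suc d. norm (coeff (pCons 0 q) i) * (fact i / \<rho> ^ i))"
    by (simp only: sum.distrib sum_distrib_left)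
  also have "(\<Sum>i\<le>Suc d. norm (coeff q i) * (fact i / \<rho> ^ i)) = poly_majorant \<rho> q"
    using assms(2) by (intro poly_majorant_eq[symmetric]) auto
  also have "norm b * poly_majorant \<rho> q + norm c * (\<Sum>i\<le>Suc d. norm (coeff (pCons 0 q) i) * (fact i / \<rho> ^ i))
      \<le> norm b * poly_majorant \<rho> q + norm c * ((real d + 1) / \<rho> * poly_majorant \<rho> q)"
  proof (intro add_left_mono mult_left_mono norm_ge_zero)
    have "(\<Sum>i\<le>Suc d. norm (coeff (pCons 0 q) i) * (fact i / \<rho> ^ i)) = (\<Sum>i\<le>d. norm (coeff q i) * (fact (Suc i) / \<rho> ^ Suc i))"
      by (subst sum.atMost_Suc_shift) (simp add: coeff_pCons)
    also have "\<dots> \<le> (\<Sum>i\<le>d. (real d + 1) / \<rho> * (norm (coeff q i) * (fact i / \<rho> ^ i)))"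
    proof (rule sum_mono)
      fix i assume "i \<in> {..d}"
      hence "real (Suc i) / \<rho> \<le> (real d + 1) / \<rho>" using assms by (intro divide_right_mono) auto
      hence "real (Suc i) / \<rho> * (norm (coeff q i) * (fact i / \<rho> ^ i)) \<le> (real d + 1) / \<rho> * (norm (coeff q i) * (fact i / \<rho> ^ i))"
        using assms by (intro mult_right_mono) auto
      thus "norm (coeff q i) * (fact (Suc i) / \<rho> ^ Suc i) \<le> (real d + 1) / \<rho> * (norm (coeff q i) * (fact i / \<rho> ^ i))"
        by (simp add: mult_ac)
    qed
    also have "\<dots> = (real d + 1) / \<rho> * poly_majorant \<rho> q"
      using assms(2) by (simp only: sum_distrib_left poly_majorant_eq)
    finally show "(\<Sum>i\<le>Suc d. norm (coeff (pCons 0 q) i) * (fact i / \<rho> ^ i)) \<le> (real d + 1) / \<rho> * poly_majorant \<rho> q" .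
  qed
  finally show ?thesis by (simp add: algebra_simps)
qed

lemma degree_linear_mult_le: "degree ([:b, c:] * q) \<le> degree q + 1"
  using degree_mult_le[of "[:b, c:]" q] by (simp split: if_splits)

lemma poly_majorant_linear_prod:
  assumes "\<rho> > 0"
  shows "poly_majorant \<rho> ((\<Prod>j<k. [:b j, c j:]) * q) \<le>
     (\<Prod>j<k. norm (b j) + norm (c j) * (real (degree q + j) + 1) / \<rho>) * poly_majorant \<rho> q \<and>
     degree ((\<Prod>j<k. [:b j, c j:]) * q) \<le> degree q + k"
proof (induction k)
  case (Suc k)
  define Q where "Q = (\<Prod>j<k. [:b j, c j:]) * q"
  have eq: "(\<Prod>j<Suc k. [:b j, c j:]) * q = [:b k, c k:] * Q"
    by (simp only: Q_def prod.lessThan_Suc mult_ac)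
  have IH: "poly_majorant \<rho> Q \<le> (\<Prod>j<k. norm (b j) + norm (c j) * (real (degree q + j) + 1) / \<rho>) * poly_majorant \<rho> q"
    "degree Q \<le> degree q + k" using Suc by (auto simp: Q_def)
  have "poly_majorant \<rho> ([:b k, c k:] * Q) \<le> (norm (b k) + norm (c k) * (real (degree q + k) + 1) / \<rho>) * poly_majorant \<rho> Q"
    by (rule poly_majorant_linear_mult[OF assms IH(2)])
  also have "\<dots> \<le> (norm (b k) + norm (c k) * (real (degree q + k) + 1) / \<rho>) *
      ((\<Prod>j<k. norm (b j) + norm (c j) * (real (degree q + j) + 1) / \<rho>) * poly_majorant \<rho> q)"
    using assms by (intro mult_left_mono IH add_nonneg_nonneg) auto
  finally have "poly_majorant \<rho> ([:b k, c k:] * Q) \<le>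
     (\<Prod>j<Suc k. norm (b j) + norm (c j) * (real (degree q + j) + 1) / \<rho>) * poly_majorant \<rho> q"
    by (simp only: prod.lessThan_Suc mult_ac)
  moreover have "degree ([:b k, c k:] * Q) \<le> degree q + Suc k"
    using degree_linear_mult_le[of "b k" "c k" Q] IH(2) by simp
  ultimately show ?case unfolding eq by blast
qed simp

lemma higher_deriv_exp_linear:
  "(deriv ^^ k) (\<lambda>s::complex. exp (c * s + d)) = (\<lambda>s. c ^ k * exp (c * s + d))"
proof (induction k)
  case (Suc k)
  have "deriv (\<lambda>s. c ^ k * exp (c * s + d)) s = c ^ Suc k * exp (c * s + d)" for s
    by (rule DERIV_imp_deriv) (auto intro!: derivative_eq_intros)
  thus ?case by (simp only: funpow.simps o_apply Suc)
qed simp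

definition theta_part_sup :: "real \<Rightarrow> real \<Rightarrow> real" where
  "theta_part_sup \<alpha> \<delta> = exp \<alpha> * 320 powr \<alpha> * exp (- (pi * \<alpha> / (12 * \<delta>)))"

lemma Xi_alpha_exp_integrable:
  assumes "\<alpha> > 0" "0 < \<delta>" "\<delta> \<le> 1 / 100"
  shows "integrable lborel (\<lambda>t. norm (Xi_alpha \<alpha> t * of_real (exp ((pi / 2 - \<delta>) * t))) * exp (\<delta> / 4 * \<bar>t\<bar>))"
proof (rule Bochner_Integration.integrable_bound[OF Xi_alpha_transform_integrable[OF assms(1), of "pi / 2 - 3 / 4 * \<delta>"]])
  have [measurable]: "Xi_alpha \<alpha> \<in> borel_measurable borel" by (rule Xi_alpha_measurable[OF assms(1)])
  show "(\<lambda>t. norm (Xi_alpha \<alpha> t * of_real (exp ((pi / 2 - \<delta>) * t))) * exp (\<delta> / 4 * \<bar>t\<bar>)) \<in> borel_measurable lborel"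
    by measurable
  have "norm (Xi_alpha \<alpha> t * of_real (exp ((pi / 2 - \<delta>) * t))) * exp (\<delta> / 4 * \<bar>t\<bar>)
        \<le> norm (Xi_alpha \<alpha> t) * exp ((pi / 2 - 3 / 4 * \<delta>) * \<bar>t\<bar>)" for t
  proof -
    have "(pi / 2 - \<delta>) * t \<le> (pi / 2 - \<delta>) * \<bar>t\<bar>" using assms pi_gt3 by (intro mult_left_mono) auto
    hence "(pi / 2 - \<delta>) * t + \<delta> / 4 * \<bar>t\<bar> \<le> (pi / 2 - 3 / 4 * \<delta>) * \<bar>t\<bar>" by (simp add: algebra_simps)
    hence "exp ((pi / 2 - \<delta>) * t) * exp (\<delta> / 4 * \<bar>t\<bar>) \<le> exp ((pi / 2 - 3 / 4 * \<delta>) * \<bar>t\<bar>)"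
      by (simp only: exp_add[symmetric] exp_le_cancel_iff)
    thus ?thesis unfolding norm_mult mult.assoc by (intro mult_left_mono) auto
  qed
  thus "AE t in lborel. norm (norm (Xi_alpha \<alpha> t * of_real (exp ((pi / 2 - \<delta>) * t))) * exp (\<delta> / 4 * \<bar>t\<bar>))
        \<le> norm (norm (Xi_alpha \<alpha> t) * exp ((pi / 2 - 3 / 4 * \<delta>) * \<bar>t\<bar>))"
    by (intro AE_I2) (simp add: abs_mult)
qed (use assms in auto)

lemma poly_times_exp_integrable:
  fixes f :: "real \<Rightarrow> complex"
  assumes "f \<in> borel_measurable borel" "integrable lborel (\<lambda>t. norm (f t) * exp (r * \<bar>t\<bar>))" "r > 0"
  shows "integrable lborel (\<lambda>t. f t * poly q (of_real t))"
    and "integrable lborel (\<lambda>t. f t * of_real t ^ k)"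
proof -
  have mono: "integrable lborel (\<lambda>t. f t * of_real t ^ k)" for k
  proof (rule Bochner_Integration.integrable_bound)
    show "integrable lborel (\<lambda>t. fact k / r ^ k * (norm (f t) * exp (r * \<bar>t\<bar>)))"
      by (intro integrable_mult_right assms)
    show "(\<lambda>t. f t * of_real t ^ k) \<in> borel_measurable lborel" using assms(1) by measurable
    have "norm (f t * of_real t ^ k) \<le> fact k / r ^ k * (norm (f t) * exp (r * \<bar>t\<bar>))" for t
    proof -
      have "(r * \<bar>t\<bar>) ^ k / fact k \<le> exp (r * \<bar>t\<bar>)" using assms(3) by (intro power_div_fact_le_exp) auto
      hence "\<bar>t\<bar> ^ k \<le> fact k / r ^ k * exp (r * \<bar>t\<bar>)"
        using assms(3) by (simp add: power_mult_distrib field_simps)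
      hence "norm (f t) * \<bar>t\<bar> ^ k \<le> norm (f t) * (fact k / r ^ k * exp (r * \<bar>t\<bar>))"
        by (rule mult_left_mono) simp
      thus ?thesis by (simp add: norm_mult norm_power mult_ac)
    qed
    thus "AE t in lborel. norm (f t * of_real t ^ k) \<le> norm (fact k / r ^ k * (norm (f t) * exp (r * \<bar>t\<bar>)))"
      by (intro AE_I2) (metis abs_ge_self order_trans real_norm_def)
  qed
  show "integrable lborel (\<lambda>t. f t * of_real t ^ k)" by (rule mono)
  have "integrable lborel (\<lambda>t. \<Sum>i\<le>degree q. coeff q i * (f t * of_real t ^ i))"
    by (intro Bochner_Integration.integrable_sum integrable_mult_right mono)
  thus "integrable lborel (\<lambda>t. f t * poly q (of_real t))"
    by (simp add: poly_altdef sum_distrib_left mult_ac)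
qed

text \<open>The moments against exp(\<omega> t) are derivatives of the kernel at i \<omega>. Those
  of the two explicit exponentials reproduce \<open>q\<close> at i a and -i a; those of
  \<open>theta_part\<close> are bounded by Cauchy's estimate on the disc of radius \<delta>/4, which
  is how the majorant arises.\<close>

lemma Xi_alpha_poly_moment:
  assumes "\<alpha> > 0" "0 < \<delta>" "\<delta> \<le> 1 / 100"
  defines "\<omega> \<equiv> pi / 2 - \<delta>" and "a \<equiv> \<alpha> / 4"
  shows "integrable lborel (\<lambda>t. Xi_alpha \<alpha> t * of_real (exp (\<omega> * t)) * poly q (of_real t))"
    and "norm ((LINT t|lborel. Xi_alpha \<alpha> t * of_real (exp (\<omega> * t)) * poly q (of_real t))
          + 2 * pi * (poly q (\<i> * of_real a) * exp (\<i> * of_real (a * \<omega>)) + poly q (- \<i> * of_real a) * exp (- \<i> * of_real (a * \<omega>))))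
        \<le> 2 * pi * poly_majorant (\<delta> / 4) q * theta_part_sup \<alpha> \<delta>"
proof -
  define f where "f = (\<lambda>t. Xi_alpha \<alpha> t * of_real (exp (\<omega> * t)))"
  have meas: "f \<in> borel_measurable borel"
    unfolding f_def using Xi_alpha_measurable[OF assms(1)] by measurable
  have intf: "integrable lborel (\<lambda>t. norm (f t) * exp (\<delta> / 4 * \<bar>t\<bar>))"
    unfolding f_def \<omega>_def by (rule Xi_alpha_exp_integrable[OF assms(1-3)])
  have r: "\<delta> / 4 > 0" using assms by simp
  note ints = poly_times_exp_integrable[OF meas intf r]
  show "integrable lborel (\<lambda>t. Xi_alpha \<alpha> t * of_real (exp (\<omega> * t)) * poly q (of_real t))"
    using ints(1) by (simp add: f_def)
  \<comment> \<open>exp(-i t v0) = exp(\<omega> t). The variable \<open>s\<close> is rotated by i in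
    \<open>A\<close>, \<open>e1\<close> and \<open>e2\<close> so that derivatives in
    \<open>s\<close> correspond to powers of t without unit factors.\<close>
  define v0 where "v0 = \<i> * complex_of_real \<omega>"
  define A where "A = (\<lambda>s. theta_part \<alpha> (v0 + \<i> * s))"
  define e1 where "e1 = (\<lambda>s. exp (\<i> * of_real a * s + of_real a * v0))"
  define e2 where "e2 = (\<lambda>s. exp (- \<i> * of_real a * s + - of_real a * v0))"
  define G where "G = (\<lambda>s. of_real (2 * pi) * (A s - e1 s - e2 s))"
  define S where "S = (\<lambda>s. v0 + \<i> * s) -` strip"
  have S_ball: "cball 0 (\<delta> / 4) \<subseteq> S"
  proof (rule subsetI)
    fix s :: complex assume "s \<in> cball 0 (\<delta> / 4)"
    hence "norm (v0 + \<i> * s - \<i> * of_real (pi / 2 - \<delta>)) \<le> \<delta> / 4" by (simp add: v0_def \<omega>_def norm_mult)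
    hence "v0 + \<i> * s \<in> strip" by (rule theta_part_bound(2)[OF assms(1-3)])
    thus "s \<in> S" by (simp add: S_def)
  qed
  have S: "open S" unfolding S_def
    by (intro open_vimage open_strip continuous_intros)
  have holoA: "A holomorphic_on S"
  proof -
    have "(\<lambda>s. v0 + \<i> * s) holomorphic_on S" "(\<lambda>s. v0 + \<i> * s) \<in> S \<rightarrow> strip"
      by (auto simp: S_def intro!: holomorphic_intros)
    thus ?thesis using holomorphic_on_compose_gen[OF _ theta_part_holomorphic, of "\<lambda>s. v0 + \<i> * s" S \<alpha>]
      by (auto simp: o_def A_def)
  qed
  have holo12: "e1 holomorphic_on S" "e2 holomorphic_on S"
    unfolding e1_def e2_def by (intro holomorphic_intros)+
  have "0 \<in> S" using S_ball r by auto
  have moment: "(LINT t|lborel. f t * of_real t ^ k) = (deriv ^^ k) G 0" for k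
  proof (rule moments_eq_deriv[OF meas intf r])
    fix h :: complex assume h: "norm h < \<delta> / 4"
    have "h \<in> S" by (rule subsetD[OF S_ball]) (use h in simp)
    hence vs: "v0 + \<i> * h \<in> strip" by (simp add: S_def)
    have "f t * exp (h * of_real t) = Xi_alpha \<alpha> t * exp (- \<i> * of_real t * (v0 + \<i> * h))" for t
    proof -
      have e: "- \<i> * of_real t * (v0 + \<i> * h) = of_real (\<omega> * t) + h * of_real t"
        by (simp add: v0_def algebra_simps)
      show ?thesis unfolding f_def e exp_add exp_of_real by (simp only: mult.assoc)
    qed
    hence "(LINT t|lborel. f t * exp (h * of_real t)) = 2 * pi * theta_kernel \<alpha> (v0 + \<i> * h)"
      using Xi_alpha_inversion[OF assms(1) vs] by simp
    also have "\<dots> = G (0 + h)"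
    proof -
      have ee: "of_real (\<alpha> / 4) * (v0 + \<i> * h) = \<i> * of_real a * h + of_real a * v0"
        "- of_real (\<alpha> / 4) * (v0 + \<i> * h) = - \<i> * of_real a * h + - of_real a * v0"
        by (simp_all add: a_def algebra_simps)
      show ?thesis unfolding theta_kernel_eq ee G_def A_def e1_def e2_def by simp
    qed
    finally show "(LINT t|lborel. f t * exp (h * of_real t)) = G (0 + h)" .
  qed
  have derivG: "(deriv ^^ k) G 0 = 2 * pi * ((deriv ^^ k) A 0 - (\<i> * of_real a) ^ k * exp (of_real a * v0) - (- \<i> * of_real a) ^ k * exp (- of_real a * v0))" for k
  proof -
    have "(deriv ^^ k) G 0 = of_real (2 * pi) * (deriv ^^ k) (\<lambda>s. A s - e1 s - e2 s) 0"
      unfolding G_def using S \<open>0 \<in> S\<close> holoA holo12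
      by (intro higher_deriv_cmult[of _ S]) (auto intro!: holomorphic_intros)
    also have "(deriv ^^ k) (\<lambda>s. A s - e1 s - e2 s) 0 = (deriv ^^ k) (\<lambda>s. A s - e1 s) 0 - (deriv ^^ k) e2 0"
      using S \<open>0 \<in> S\<close> holoA holo12 by (intro higher_deriv_diff[of _ S]) (auto intro!: holomorphic_intros)
    also have "(deriv ^^ k) (\<lambda>s. A s - e1 s) 0 = (deriv ^^ k) A 0 - (deriv ^^ k) e1 0"
      using S \<open>0 \<in> S\<close> holoA holo12 by (intro higher_deriv_diff[of _ S]) auto
    also have "(deriv ^^ k) e1 0 = (\<i> * of_real a) ^ k * exp (of_real a * v0)"
      unfolding e1_def higher_deriv_exp_linear by simp
    also have "(deriv ^^ k) e2 0 = (- \<i> * of_real a) ^ k * exp (- of_real a * v0)"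
      unfolding e2_def higher_deriv_exp_linear by simp
    finally show ?thesis by simp
  qed
  have derivA: "norm ((deriv ^^ k) A 0) \<le> fact k * theta_part_sup \<alpha> \<delta> / (\<delta> / 4) ^ k" for k
  proof (rule norm_higher_deriv_le[OF holoA S S_ball r])
    fix s :: complex assume "s \<in> cball 0 (\<delta> / 4)"
    hence "norm (v0 + \<i> * s - \<i> * of_real (pi / 2 - \<delta>)) \<le> \<delta> / 4" by (simp add: v0_def \<omega>_def norm_mult)
    thus "norm (A s) \<le> theta_part_sup \<alpha> \<delta>" unfolding A_def theta_part_sup_def
      by (rule theta_part_bound(1)[OF assms(1-3)])
  qed
  have "(LINT t|lborel. f t * poly q (of_real t)) = (LINT t|lborel. (\<Sum>i\<le>degree q. coeff q i * (f t * of_real t ^ i)))"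
    by (simp add: poly_altdef sum_distrib_left mult_ac)
  also have "\<dots> = (\<Sum>i\<le>degree q. (LINT t|lborel. coeff q i * (f t * of_real t ^ i)))"
    by (rule Bochner_Integration.integral_sum) (intro integrable_mult_right ints)
  also have "\<dots> = (\<Sum>i\<le>degree q. coeff q i * (deriv ^^ i) G 0)"
    by (simp only: integral_mult_right_zero moment)
  also have "\<dots> = 2 * pi * (\<Sum>i\<le>degree q. coeff q i * (deriv ^^ i) A 0)
      - 2 * pi * (poly q (\<i> * of_real a) * exp (of_real a * v0) + poly q (- \<i> * of_real a) * exp (- of_real a * v0))"
    unfolding derivG poly_altdef
    by (simp add: sum_distrib_left sum_distrib_right sum_subtractf sum.distrib algebra_simps)
  finally have "(LINT t|lborel. f t * poly q (of_real t)) + 2 * pi * (poly q (\<i> * of_real a) * exp (of_real a * v0) + poly q (- \<i> * of_real a) * exp (- of_real a * v0))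
     = 2 * pi * (\<Sum>i\<le>degree q. coeff q i * (deriv ^^ i) A 0)" by simp
  moreover have "norm (complex_of_real (2 * pi) * (\<Sum>i\<le>degree q. coeff q i * (deriv ^^ i) A 0)) \<le> 2 * pi * poly_majorant (\<delta> / 4) q * theta_part_sup \<alpha> \<delta>"
  proof -
    have "norm (\<Sum>i\<le>degree q. coeff q i * (deriv ^^ i) A 0) \<le> (\<Sum>i\<le>degree q. norm (coeff q i) * (fact i * theta_part_sup \<alpha> \<delta> / (\<delta> / 4) ^ i))"
      by (intro order_trans[OF norm_sum] sum_mono) (simp only: norm_mult, intro mult_left_mono derivA norm_ge_zero)
    also have "\<dots> = poly_majorant (\<delta> / 4) q * theta_part_sup \<alpha> \<delta>"
      unfolding poly_majorant_def sum_distrib_right by (intro sum.cong refl) simp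
    finally show ?thesis by (simp add: norm_mult)
  qed
  moreover have "of_real a * v0 = \<i> * of_real (a * \<omega>)" "- of_real a * v0 = - \<i> * of_real (a * \<omega>)" by (simp_all add: v0_def)
  ultimately show "norm ((LINT t|lborel. Xi_alpha \<alpha> t * of_real (exp (\<omega> * t)) * poly q (of_real t))
          + 2 * pi * (poly q (\<i> * of_real a) * exp (\<i> * of_real (a * \<omega>)) + poly q (- \<i> * of_real a) * exp (- \<i> * of_real (a * \<omega>))))
        \<le> 2 * pi * poly_majorant (\<delta> / 4) q * theta_part_sup \<alpha> \<delta>"
    by (simp only: f_def of_real_mult of_real_numeral)
qed

section \<open>Bounds for Kummer's series and its moments\<close>

text \<open>The quotients are the coefficients of (1 - u)^(-X), all nonnegative, so a single term is
  at most the sum; -ln(1 - u) \<le> 2 u for u \<le> 1/2.\<close>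

lemma pochhammer_le_exp:
  fixes X u :: real
  assumes "X \<ge> 0" "0 < u" "u \<le> 1 / 2"
  shows "pochhammer X k / fact k \<le> exp (2 * u * X) / u ^ k"
proof -
  have s: "(\<lambda>n. (- X gchoose n) * (- u) ^ n) sums (1 + (- u)) powr (- X)"
    using assms by (intro gen_binomial_real) auto
  have eq: "(- X gchoose n) * (- u) ^ n = pochhammer X n / fact n * u ^ n" for n
  proof -
    have "(- 1 :: real) ^ n * (- 1) ^ n = 1" by (simp flip: power_mult_distrib)
    thus ?thesis unfolding gbinomial_pochhammer power_minus[of u] by simp
  qed
  have nn: "0 \<le> pochhammer X n / fact n * u ^ n" for n
    using assms by (auto simp: pochhammer_prod intro!: mult_nonneg_nonneg divide_nonneg_nonneg prod_nonneg)
  have "pochhammer X k / fact k * u ^ k \<le> (\<Sum>n. pochhammer X n / fact n * u ^ n)"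
    using sum_le_suminf[of "\<lambda>n. pochhammer X n / fact n * u ^ n" "{k}"] s nn
    by (simp add: eq sums_iff)
  also have "\<dots> = (1 - u) powr (- X)" using s by (simp add: eq sums_iff)
  also have "\<dots> \<le> exp (2 * u * X)"
  proof -
    have "- ln (1 - u) \<le> 2 * u"
    proof -
      have "1 / (1 - u) \<le> 1 + 2 * u" using assms by (simp add: field_simps)
      also have "\<dots> \<le> exp (2 * u)" by (rule exp_ge_add_one_self)
      finally have "ln (1 / (1 - u)) \<le> ln (exp (2 * u))" using assms by (subst ln_le_cancel_iff) auto
      thus ?thesis using assms by (simp add: ln_div)
    qed
    from mult_right_mono[OF this assms(1)] have "- X * ln (1 - u) \<le> 2 * u * X" by (simp add: mult.commute)
    thus ?thesis using assms by (simp add: powr_def)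
  qed
  finally show ?thesis using assms by (simp add: field_simps)
qed

lemma norm_pochhammer_le: "norm (pochhammer (s::complex) k) \<le> pochhammer (norm s) k"
  unfolding pochhammer_prod prod_norm[symmetric]
proof (rule prod_mono, intro conjI norm_ge_zero)
  show "norm (s + of_nat i) \<le> norm s + of_nat i" for i
    using norm_triangle_ineq[of s "of_nat i"] by simp
qed

text \<open>This is 1F1(1; h; R). It is what remains of a Kummer series once the numerator symbols
  have been bounded by factorials, and it grows like exp R up to a factor linear in R.\<close>

definition inverse_pochhammer_series :: "real \<Rightarrow> real \<Rightarrow> real" where
  "inverse_pochhammer_series h R = (\<Sum>k. R ^ k / pochhammer h k)"

lemma pochhammer_ge_fact:
  fixes h :: real
  assumes "h > 0"
  shows "pochhammer h (Suc k) \<ge> h * fact k"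
proof -
  have "pochhammer (1::real) k \<le> pochhammer (h + 1) k"
    unfolding pochhammer_prod using assms by (intro prod_mono) auto
  hence "fact k \<le> pochhammer (h + 1) k" by (simp add: pochhammer_fact)
  thus ?thesis using assms by (simp add: pochhammer_rec)
qed

lemma inverse_pochhammer_series:
  assumes "h > 0" "R \<ge> 0"
  shows "summable (\<lambda>k. R ^ k / pochhammer h k)"
    and "inverse_pochhammer_series h R \<le> 1 + R / h * exp R"
    and "inverse_pochhammer_series h R \<ge> 0"
proof -
  have e: "(\<lambda>k. R / h * (R ^ k / fact k)) sums (R / h * exp R)"
    using sums_mult[OF exp_converges[of R], of "R / h"] by (simp add: field_simps)
  have le: "R ^ Suc k / pochhammer h (Suc k) \<le> R / h * (R ^ k / fact k)" for k
  proof -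
    have "R ^ Suc k / pochhammer h (Suc k) \<le> R ^ Suc k / (h * fact k)"
      using assms pochhammer_ge_fact[OF assms(1), of k] pochhammer_pos[OF assms(1)] by (intro divide_left_mono) auto
    thus ?thesis by simp
  qed
  have nn: "R ^ k / pochhammer h k \<ge> 0" for k using assms pochhammer_pos[OF assms(1), of k] by simp
  have s: "summable (\<lambda>k. R ^ Suc k / pochhammer h (Suc k))"
    by (rule summable_comparison_test'[OF sums_summable[OF e]]) (use le nn[of "Suc _"] in \<open>simp only: real_norm_def abs_of_nonneg\<close>)
  thus s': "summable (\<lambda>k. R ^ k / pochhammer h k)" by (subst (asm) summable_Suc_iff)
  have "inverse_pochhammer_series h R = (\<Sum>k. R ^ Suc k / pochhammer h (Suc k)) + 1"
    unfolding inverse_pochhammer_series_def using suminf_split_head[OF s'] by simp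
  also have "(\<Sum>k. R ^ Suc k / pochhammer h (Suc k)) \<le> R / h * exp R"
    using suminf_le[OF le s sums_summable[OF e]] sums_unique[OF e] by simp
  finally show "inverse_pochhammer_series h R \<le> 1 + R / h * exp R" by simp
  show "inverse_pochhammer_series h R \<ge> 0"
    unfolding inverse_pochhammer_series_def by (intro suminf_nonneg s' nn)
qed

definition kummer_term :: "real \<Rightarrow> real \<Rightarrow> complex \<Rightarrow> nat \<Rightarrow> complex" where
  "kummer_term h y s k = pochhammer s k / pochhammer (of_real h) k * of_real y ^ k / fact k"

text \<open>The parameter u trades growth in s against growth of the coefficients. It is later a
  multiple of \<delta>, so that exp(2 u \<bar>s\<bar>) fits into the decay of Xi and the price
  appears as y/u.\<close>

lemma kummer_term_bound:
  assumes "h > 0" "y \<ge> 0" "0 < u" "u \<le> 1 / 2"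
  shows "norm (kummer_term h y s k) \<le> exp (2 * u * norm s) * ((y / u) ^ k / pochhammer h k)"
proof -
  have "norm (kummer_term h y s k) = norm (pochhammer s k) / fact k * (y ^ k / pochhammer h k)"
    using assms pochhammer_pos[OF assms(1), of k]
    by (simp add: kummer_term_def norm_mult norm_divide norm_power pochhammer_of_real)
  also have "\<dots> \<le> exp (2 * u * norm s) / u ^ k * (y ^ k / pochhammer h k)"
  proof (rule mult_right_mono)
    have "norm (pochhammer s k) / fact k \<le> pochhammer (norm s) k / fact k"
      by (intro divide_right_mono norm_pochhammer_le) auto
    also have "\<dots> \<le> exp (2 * u * norm s) / u ^ k" using assms by (intro pochhammer_le_exp) auto
    finally show "norm (pochhammer s k) / fact k \<le> exp (2 * u * norm s) / u ^ k" .
    show "0 \<le> y ^ k / pochhammer h k"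
      using assms pochhammer_pos[OF assms(1), of k] by (intro divide_nonneg_pos) auto
  qed
  also have "\<dots> = exp (2 * u * norm s) * ((y / u) ^ k / pochhammer h k)"
    by (simp add: power_divide)
  finally show ?thesis .
qed

lemma kummer_sums:
  assumes "h > 0" "y \<ge> 0"
  shows "kummer_term h y s sums kummer_1F1 s (of_real h) (of_real y)"
    and "summable (\<lambda>k. norm (kummer_term h y s k))"
proof -
  have "summable (\<lambda>k. exp (2 * (1/2) * norm s) * ((y / (1/2)) ^ k / pochhammer h k))"
    using assms by (intro summable_mult inverse_pochhammer_series) auto
  thus 1: "summable (\<lambda>k. norm (kummer_term h y s k))"
    by (rule summable_comparison_test') (use kummer_term_bound[OF assms, of "1/2"] in auto)
  show "kummer_term h y s sums kummer_1F1 s (of_real h) (of_real y)"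
    using summable_sums[OF summable_norm_cancel[OF 1]]
    by (simp add: kummer_1F1_def kummer_term_def [abs_def])
qed

lemma kummer_bound:
  assumes "h > 0" "y \<ge> 0" "0 < u" "u \<le> 1 / 2"
  shows "norm (kummer_1F1 s (of_real h) (of_real y)) \<le> exp (2 * u * norm s) * inverse_pochhammer_series h (y / u)"
proof (rule norm_sums_le[OF kummer_sums(1)[OF assms(1,2)]])
  show "(\<lambda>k. exp (2 * u * norm s) * ((y / u) ^ k / pochhammer h k)) sums (exp (2 * u * norm s) * inverse_pochhammer_series h (y / u))"
    unfolding inverse_pochhammer_series_def using assms
    by (intro sums_mult summable_sums inverse_pochhammer_series) auto
qed (use kummer_term_bound[OF assms] in auto)

lemma isCont_kummer:
  assumes "h > 0" "y \<ge> 0"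
  shows "isCont (\<lambda>s. kummer_1F1 s (of_real h) (of_real y)) s"
proof -
  define R where "R = norm s + 1"
  have "uniform_limit (ball 0 R) (\<lambda>n s. \<Sum>k<n. kummer_term h y s k) (\<lambda>s. \<Sum>k. kummer_term h y s k) sequentially"
  proof (rule Weierstrass_m_test)
    show "summable (\<lambda>k. exp (2 * (1/2) * R) * ((y / (1/2)) ^ k / pochhammer h k))"
      using assms by (intro summable_mult inverse_pochhammer_series) auto
    fix k and s :: complex assume "s \<in> ball 0 R"
    hence "exp (2 * (1/2) * norm s) \<le> exp (2 * (1/2) * R)" by simp
    hence "exp (2 * (1/2) * norm s) * ((y / (1/2)) ^ k / pochhammer h k) \<le> exp (2 * (1/2) * R) * ((y / (1/2)) ^ k / pochhammer h k)"
      using assms pochhammer_pos[OF assms(1), of k] by (intro mult_right_mono) auto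
    thus "norm (kummer_term h y s k) \<le> exp (2 * (1/2) * R) * ((y / (1/2)) ^ k / pochhammer h k)"
      using kummer_term_bound[OF assms, of "1/2" s k] by simp
  qed
  hence "continuous_on (ball 0 R) (\<lambda>s. \<Sum>k. kummer_term h y s k)"
  proof (rule uniform_limit_theorem[rotated])
    show "\<forall>\<^sub>F n in sequentially. continuous_on (ball 0 R) (\<lambda>s. \<Sum>k<n. kummer_term h y s k)"
      unfolding kummer_term_def divide_inverse
      by (intro always_eventually allI continuous_intros)
  qed auto
  moreover have "(\<lambda>s. \<Sum>k. kummer_term h y s k) = (\<lambda>s. kummer_1F1 s (of_real h) (of_real y))"
    using kummer_sums(1)[OF assms] by (auto simp: sums_iff)
  moreover have "s \<in> ball 0 R" by (simp add: R_def)
  ultimately show ?thesis by (simp add: continuous_on_eq_continuous_at)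
qed

lemma kummer_cnj:
  assumes "h > 0" "y \<ge> 0"
  shows "kummer_1F1 (cnj s) (of_real h) (of_real y) = cnj (kummer_1F1 s (of_real h) (of_real y))"
proof -
  have "(\<lambda>k. cnj (kummer_term h y s k)) sums cnj (kummer_1F1 s (of_real h) (of_real y))"
    using kummer_sums(1)[OF assms, of s] by (subst sums_cnj)
  also have "(\<lambda>k. cnj (kummer_term h y s k)) = kummer_term h y (cnj s)"
    by (auto simp: kummer_term_def pochhammer_prod)
  finally show ?thesis using kummer_sums(1)[OF assms, of "cnj s"] by (rule sums_unique2[symmetric])
qed

text \<open>The product is (d + k)!/d!, that is, k! times a binomial coefficient.\<close>

lemma prod_shifted_le:
  "(\<Prod>j<k. real (d + j) + 1) \<le> 2 ^ (d + k) * fact k"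
proof -
  have "(\<Prod>j<k. real (d + j) + 1) * fact d = fact (d + k)"
  proof (induction k)
    case (Suc k)
    have "(\<Prod>j<Suc k. real (d + j) + 1) * fact d = ((\<Prod>j<k. real (d + j) + 1) * fact d) * (real (d + k) + 1)"
      by simp
    also have "\<dots> = fact (d + Suc k)" unfolding Suc by (simp add: mult.commute add.commute)
    finally show ?case .
  qed simp
  also have "\<dots> = real (fact k * fact d * ((d + k) choose k))"
  proof -
    have "fact k * fact d * ((d + k) choose k) = (fact (d + k) :: nat)"
      using binomial_fact_lemma[of k "d + k"] by simp
    hence "real (fact k * fact d * ((d + k) choose k)) = real (fact (d + k))" by (simp only:)
    thus ?thesis by simp
  qed
  also have "\<dots> \<le> fact k * fact d * 2 ^ (d + k)"
  proof -
    have "(d + k) choose k \<le> 2 ^ (d + k)" by (rule binomial_le_pow2)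
    hence "real ((d + k) choose k) \<le> 2 ^ (d + k)" by (metis of_nat_le_iff of_nat_numeral of_nat_power)
    thus ?thesis by simp
  qed
  finally have "(\<Prod>j<k. real (d + j) + 1) * fact d \<le> (2 ^ (d + k) * fact k) * fact d" by (simp add: mult_ac)
  thus ?thesis by (simp only: mult_le_cancel_right_pos fact_gt_zero)
qed

text \<open>Each Kummer term is a polynomial in t, so the previous moment formula applies termwise.
  The product of linear factors raises the majorant by about 2^k k! (4/\<delta> + 1 + a)^k; the k!
  cancels the one in the series, and \<open>inverse_pochhammer_series\<close> is left. The main
  terms sum to at most exp y.\<close>

lemma Xi_kummer_moment:
  fixes \<epsilon> :: complex and q :: "complex poly"
  assumes "\<alpha> > 0" "0 < \<delta>" "\<delta> \<le> 1 / 100" "y \<ge> 0" and \<epsilon>: "\<epsilon> = \<i> \<or> \<epsilon> = - \<i>"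
  defines "\<omega> \<equiv> pi / 2 - \<delta>" and "a \<equiv> \<alpha> / 4"
  defines "f \<equiv> (\<lambda>t. Xi_alpha \<alpha> t * kummer_1F1 (of_real a + \<epsilon> * of_real t) (of_real (\<alpha> / 2)) (of_real y)
      * poly q (of_real t) * of_real (exp (\<omega> * t)))"
  shows "integrable lborel f"
    and "norm (LINT t|lborel. f t) \<le> 2 * pi * exp y * (norm (poly q (\<i> * of_real a)) + norm (poly q (- \<i> * of_real a)))
       + 2 * pi * theta_part_sup \<alpha> \<delta> * poly_majorant (\<delta> / 4) q * 2 ^ degree q
          * inverse_pochhammer_series (\<alpha> / 2) (2 * y * (4 / \<delta> + 1 + a))"
proof -
  define h where "h = \<alpha> / 2"
  have h: "h > 0" "h = 2 * a" "a > 0" using assms(1) by (auto simp: h_def a_def)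
  define c where "c = (\<lambda>k. y ^ k / (pochhammer h k * fact k))"
  have c: "c k \<ge> 0" for k using assms(4) pochhammer_pos[OF h(1), of k] by (simp add: c_def)
  define Q where "Q = (\<lambda>k. smult (of_real (c k)) ((\<Prod>j<k. [:of_real a + of_nat j, \<epsilon>:]) * q))"
  have poly_prod': "poly (\<Prod>j<k. [:of_real a + of_nat j, \<epsilon>:]) t = pochhammer (of_real a + \<epsilon> * t) k" for k t
    by (simp add: poly_prod pochhammer_prod atLeast0LessThan algebra_simps)
  have poly_Q: "poly (Q k) t = kummer_term h y (of_real a + \<epsilon> * t) k * poly q t" for k t
    by (simp add: Q_def poly_prod' kummer_term_def c_def pochhammer_of_real)
  define g where "g = (\<lambda>t. Xi_alpha \<alpha> t * of_real (exp (\<omega> * t)))"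
  define F where "F = (\<lambda>k t. g t * poly (Q k) (of_real t))"
  have norm\<epsilon>: "norm \<epsilon> = 1" using \<epsilon> by auto
  have meas: "g \<in> borel_measurable borel"
    unfolding g_def using Xi_alpha_measurable[OF assms(1)] by measurable
  have F_eq: "F k t = f' k t" if "f' = (\<lambda>k t. g t * poly q (of_real t) * kummer_term h y (of_real a + \<epsilon> * of_real t) k)" for f' k t
    by (simp add: F_def poly_Q that)
  have F_sums: "(\<lambda>k. F k t) sums f t" for t
  proof -
    have "(\<lambda>k. g t * poly q (of_real t) * kummer_term h y (of_real a + \<epsilon> * of_real t) k) sums
       (g t * poly q (of_real t) * kummer_1F1 (of_real a + \<epsilon> * of_real t) (of_real h) (of_real y))"
      by (intro sums_mult kummer_sums h assms)
    thus ?thesis by (simp add: F_def poly_Q f_def g_def h_def mult_ac)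
  qed
  have iF: "integrable lborel (F k)" for k
    unfolding F_def g_def \<omega>_def by (rule Xi_alpha_poly_moment(1)[OF assms(1-3)])
  \<comment> \<open>Kummer growth is then exp(\<delta> \<bar>t\<bar>/8), half of the available
    margin exp(\<delta> \<bar>t\<bar>/4); the other half makes the polynomial integrable.\<close>
  define u where "u = \<delta> / 16"
  have u: "0 < u" "u \<le> 1 / 2" using assms by (auto simp: u_def)
  define H where "H = (\<lambda>t. norm (g t * of_real (exp (\<delta> / 8 * \<bar>t\<bar>)) * poly q (of_real t)) * exp (\<delta> / 8 * a))"
  have iH: "integrable lborel H"
    unfolding H_def
  proof (intro integrable_mult_left integrable_norm poly_times_exp_integrable(1)[where r = "\<delta> / 8"])
    show "(\<lambda>t. g t * of_real (exp (\<delta> / 8 * \<bar>t\<bar>))) \<in> borel_measurable borel" using meas by measurable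
    have "norm (g t * complex_of_real (exp (\<delta> / 8 * \<bar>t\<bar>))) * exp (\<delta> / 8 * \<bar>t\<bar>) = norm (g t) * exp (\<delta> / 4 * \<bar>t\<bar>)" for t
    proof -
      have "exp (\<delta> / 8 * \<bar>t\<bar>) * exp (\<delta> / 8 * \<bar>t\<bar>) = exp (\<delta> / 4 * \<bar>t\<bar>)" by (simp flip: exp_add)
      thus ?thesis by (simp add: norm_mult mult.assoc)
    qed
    thus "integrable lborel (\<lambda>t. norm (g t * complex_of_real (exp (\<delta> / 8 * \<bar>t\<bar>))) * exp (\<delta> / 8 * \<bar>t\<bar>))"
      using Xi_alpha_exp_integrable[OF assms(1-3)] by (simp add: g_def \<omega>_def)
  qed (use assms in auto)
  define E where "E = (\<lambda>k. (y / u) ^ k / pochhammer h k)"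
  have sE: "summable E" unfolding E_def using assms h u by (intro inverse_pochhammer_series) auto
  have E0: "E k \<ge> 0" for k using assms u pochhammer_pos[OF h(1), of k] by (simp add: E_def)
  have FH: "norm (F k t) \<le> H t * E k" for k t
  proof -
    have "norm (of_real a + \<epsilon> * of_real t) \<le> a + \<bar>t\<bar>"
      using norm_triangle_ineq[of "of_real a" "\<epsilon> * of_real t"] h(3) by (simp add: norm_mult norm\<epsilon>)
    hence "exp (2 * u * norm (of_real a + \<epsilon> * of_real t)) \<le> exp (2 * u * (a + \<bar>t\<bar>))" using u by simp
    hence "exp (2 * u * norm (of_real a + \<epsilon> * of_real t)) * E k \<le> exp (2 * u * (a + \<bar>t\<bar>)) * E k"
      by (intro mult_right_mono E0)
    hence "norm (kummer_term h y (of_real a + \<epsilon> * of_real t) k) \<le> exp (2 * u * (a + \<bar>t\<bar>)) * E k"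
      using kummer_term_bound[OF h(1) assms(4) u, of "of_real a + \<epsilon> * of_real t" k] by (simp add: E_def)
    also have "exp (2 * u * (a + \<bar>t\<bar>)) = exp (\<delta> / 8 * \<bar>t\<bar>) * exp (\<delta> / 8 * a)"
      by (simp add: u_def algebra_simps flip: exp_add)
    finally have "norm (g t * poly q (of_real t)) * norm (kummer_term h y (of_real a + \<epsilon> * of_real t) k)
        \<le> norm (g t * poly q (of_real t)) * (exp (\<delta> / 8 * \<bar>t\<bar>) * exp (\<delta> / 8 * a) * E k)"
      by (rule mult_left_mono) simp
    thus ?thesis by (simp add: F_def poly_Q H_def norm_mult mult_ac)
  qed
  have sum_norm: "summable (\<lambda>k. norm (F k t))" for t
    by (rule summable_comparison_test'[OF summable_mult[OF sE, of "H t"]]) (use FH in auto)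
  have sumF: "summable (\<lambda>k. LINT t|lborel. norm (F k t))"
  proof (rule summable_comparison_test'[OF summable_mult[OF sE, of "LINT t|lborel. H t"]])
    fix k :: nat
    have "(LINT t|lborel. norm (F k t)) \<le> (LINT t|lborel. H t * E k)"
      by (intro integral_mono integrable_norm iF integrable_mult_left iH FH)
    thus "norm (LINT t|lborel. norm (F k t)) \<le> (LINT t|lborel. H t) * E k" by simp
  qed
  have fs: "f = (\<lambda>t. \<Sum>k. F k t)" using F_sums by (auto simp: sums_iff)
  show "integrable lborel f" unfolding fs
    by (rule integrable_suminf[OF iF]) (use sum_norm sumF in auto)
  have Lsums: "(\<lambda>k. LINT t|lborel. F k t) sums (LINT t|lborel. f t)"
    unfolding fs by (rule sums_integral[OF iF]) (use sum_norm sumF in auto)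
  define B where "B = theta_part_sup \<alpha> \<delta>"
  have B: "B \<ge> 0" by (simp add: B_def theta_part_sup_def)
  define R where "R = 2 * y * (4 / \<delta> + 1 + a)"
  define q0 where "q0 = norm (poly q (\<i> * of_real a)) + norm (poly q (- \<i> * of_real a))"
  define m where "m = poly_majorant (\<delta> / 4) q"
  have m: "m \<ge> 0" unfolding m_def using assms by (intro poly_majorant_nonneg) auto
  define G where "G = (\<lambda>k. 2 * pi * q0 * (y ^ k / fact k) + 2 * pi * B * m * 2 ^ degree q * (R ^ k / pochhammer h k))"
  have bound: "norm (LINT t|lborel. F k t) \<le> G k" for k
  proof -
    have maj: "poly_majorant (\<delta> / 4) (Q k) \<le> m * 2 ^ degree q * (R ^ k / pochhammer h k)"
    proof -
      have "poly_majorant (\<delta> / 4) ((\<Prod>j<k. [:of_real a + of_nat j, \<epsilon>:]) * q) \<le>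
          (\<Prod>j<k. norm (complex_of_real a + of_nat j) + norm \<epsilon> * (real (degree q + j) + 1) / (\<delta> / 4)) * m"
        using poly_majorant_linear_prod[of "\<delta> / 4" "\<lambda>j. of_real a + of_nat j" "\<lambda>_. \<epsilon>" k q] assms(2) by (auto simp: m_def)
      also have "\<dots> \<le> (\<Prod>j<k. (real (degree q + j) + 1) * (4 / \<delta> + 1 + a)) * m"
      proof (intro mult_right_mono prod_mono conjI m)
        fix j
        show "0 \<le> norm (complex_of_real a + of_nat j) + norm \<epsilon> * (real (degree q + j) + 1) / (\<delta> / 4)"
          using assms(2) by (intro add_nonneg_nonneg) auto
        have "norm (complex_of_real a + of_nat j) = a + real j"
          using h(3) by (metis add_nonneg_nonneg less_imp_le norm_of_real abs_of_nonneg of_nat_0_le_iff of_real_add of_real_of_nat_eq)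
        also have "\<dots> \<le> (real (degree q + j) + 1) * (1 + a)"
          using h(3) by (simp add: algebra_simps)
        finally have "norm (complex_of_real a + of_nat j) \<le> (real (degree q + j) + 1) * (1 + a)" .
        moreover have "norm \<epsilon> * (real (degree q + j) + 1) / (\<delta> / 4) = (real (degree q + j) + 1) * (4 / \<delta>)"
          by (simp add: norm\<epsilon>)
        ultimately show "norm (complex_of_real a + of_nat j) + norm \<epsilon> * (real (degree q + j) + 1) / (\<delta> / 4)
           \<le> (real (degree q + j) + 1) * (4 / \<delta> + 1 + a)"
          by (simp only: distrib_left)
      qed
      also have "\<dots> = (\<Prod>j<k. real (degree q + j) + 1) * (4 / \<delta> + 1 + a) ^ k * m"
        by (simp add: prod.distrib)
      also have "\<dots> \<le> (2 ^ (degree q + k) * fact k) * (4 / \<delta> + 1 + a) ^ k * m"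
        using assms(2) h(3) m by (intro mult_right_mono prod_shifted_le) auto
      finally have "c k * poly_majorant (\<delta> / 4) ((\<Prod>j<k. [:of_real a + of_nat j, \<epsilon>:]) * q) \<le>
          c k * ((2 ^ (degree q + k) * fact k) * (4 / \<delta> + 1 + a) ^ k * m)"
        by (rule mult_left_mono[OF _ c])
      also have "\<dots> = m * 2 ^ degree q * (R ^ k / pochhammer h k)"
      proof -
        define E' where "E' = (4 / \<delta> + 1 + a) ^ k"
        have "R ^ k = 2 ^ k * y ^ k * E'" unfolding R_def power_mult_distrib E'_def ..
        thus ?thesis using pochhammer_pos[OF h(1), of k]
          unfolding E'_def[symmetric] by (simp add: c_def power_add)
      qed
      finally show ?thesis using c[of k] by (simp add: Q_def poly_majorant_smult)
    qed
    \<comment> \<open>At t = i a and t = -i a the Kummer parameter a + \<epsilon> t is 0 or 2a = h.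
      The numerator symbol therefore never exceeds the denominator symbol (h)_k.\<close>
    have small: "norm (poly (Q k) (e * of_real a)) \<le> y ^ k / fact k * norm (poly q (e * of_real a))"
      if e: "e = \<i> \<or> e = - \<i>" for e
    proof -
      have "of_real a + \<epsilon> * (e * of_real a) = 0 \<or> of_real a + \<epsilon> * (e * of_real a) = of_real h"
        using e \<epsilon> by (auto simp: h(2))
      hence "norm (of_real a + \<epsilon> * (e * of_real a)) \<le> h" using h(1) by auto
      hence "norm (pochhammer (of_real a + \<epsilon> * (e * of_real a)) k) \<le> pochhammer h k"
        by (intro order_trans[OF norm_pochhammer_le]) (auto simp: pochhammer_prod intro!: prod_mono)
      hence "c k * norm (pochhammer (of_real a + \<epsilon> * (e * of_real a)) k) \<le> c k * pochhammer h k"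
        by (rule mult_left_mono[OF _ c])
      also have "\<dots> = y ^ k / fact k" using pochhammer_pos[OF h(1), of k] by (simp add: c_def)
      finally have "c k * norm (pochhammer (of_real a + \<epsilon> * (e * of_real a)) k) * norm (poly q (e * of_real a))
          \<le> y ^ k / fact k * norm (poly q (e * of_real a))" by (rule mult_right_mono) simp
      thus ?thesis using c[of k] by (simp add: Q_def poly_prod' norm_mult mult.assoc)
    qed
    define P1 where "P1 = poly (Q k) (\<i> * of_real a) * exp (\<i> * of_real (a * \<omega>))"
    define P2 where "P2 = poly (Q k) (- \<i> * of_real a) * exp (- \<i> * of_real (a * \<omega>))"
    have "norm P1 \<le> y ^ k / fact k * norm (poly q (\<i> * of_real a))"
      "norm P2 \<le> y ^ k / fact k * norm (poly q (- \<i> * of_real a))"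
      using small[of \<i>] small[of "- \<i>"] by (auto simp: P1_def P2_def norm_mult)
    hence "norm P1 + norm P2 \<le> q0 * (y ^ k / fact k)"
      unfolding q0_def distrib_right by (simp add: mult.commute)
    hence P12: "norm (P1 + P2) \<le> q0 * (y ^ k / fact k)"
      using norm_triangle_ineq[of P1 P2] by linarith
    have "norm ((LINT t|lborel. F k t) + 2 * pi * (P1 + P2)) \<le> 2 * pi * poly_majorant (\<delta> / 4) (Q k) * B"
      using Xi_alpha_poly_moment(2)[OF assms(1-3), of "Q k"]
      by (simp only: F_def g_def P1_def P2_def a_def \<omega>_def B_def)
    also have "\<dots> \<le> 2 * pi * (m * 2 ^ degree q * (R ^ k / pochhammer h k)) * B"
      using maj B by (intro mult_right_mono mult_left_mono) auto
    finally have 1: "norm ((LINT t|lborel. F k t) + 2 * pi * (P1 + P2)) \<le> 2 * pi * (m * 2 ^ degree q * (R ^ k / pochhammer h k)) * B" .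
    have 2: "norm (2 * pi * (P1 + P2)) \<le> 2 * pi * (q0 * (y ^ k / fact k))"
    proof -
      have "norm (2 * pi * (P1 + P2)) = 2 * pi * norm (P1 + P2)" by (simp add: norm_mult)
      also have "\<dots> \<le> 2 * pi * (q0 * (y ^ k / fact k))" by (intro mult_left_mono P12) auto
      finally show ?thesis .
    qed
    have "norm (LINT t|lborel. F k t) \<le> norm ((LINT t|lborel. F k t) + 2 * pi * (P1 + P2)) + norm (2 * pi * (P1 + P2))"
      using norm_triangle_ineq4[of "(LINT t|lborel. F k t) + 2 * pi * (P1 + P2)" "2 * pi * (P1 + P2)"] by simp
    also have "\<dots> \<le> 2 * pi * (m * 2 ^ degree q * (R ^ k / pochhammer h k)) * B + 2 * pi * (q0 * (y ^ k / fact k))"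
      using 1 2 by (rule add_mono)
    finally show ?thesis by (simp add: G_def mult_ac)
  qed
  have R: "R \<ge> 0" using assms h(3) by (simp add: R_def)
  have "G sums (2 * pi * q0 * exp y + 2 * pi * B * m * 2 ^ degree q * inverse_pochhammer_series h R)"
    unfolding G_def inverse_pochhammer_series_def
    using exp_converges[of y]
    by (intro sums_add sums_mult summable_sums inverse_pochhammer_series h R) (simp add: field_simps)
  from norm_sums_le[OF Lsums this bound]
  show "norm (LINT t|lborel. f t) \<le> 2 * pi * exp y * (norm (poly q (\<i> * of_real a)) + norm (poly q (- \<i> * of_real a)))
       + 2 * pi * theta_part_sup \<alpha> \<delta> * poly_majorant (\<delta> / 4) q * 2 ^ degree q
          * inverse_pochhammer_series (\<alpha> / 2) (2 * y * (4 / \<delta> + 1 + a))"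
    by (simp add: q0_def B_def m_def R_def h_def mult_ac)
qed

section \<open>The even real function Phi\<close>

definition Phi_alpha :: "real \<Rightarrow> real \<Rightarrow> real \<Rightarrow> complex" where
  "Phi_alpha \<alpha> y t = Xi_alpha \<alpha> t *
     (kummer_1F1 (of_real (\<alpha> / 4) + \<i> * of_real t) (of_real (\<alpha> / 2)) (of_real y) +
      kummer_1F1 (of_real (\<alpha> / 4) + (- \<i>) * of_real t) (of_real (\<alpha> / 2)) (of_real y))"

lemma Phi_alpha_minus: "Phi_alpha \<alpha> y (- t) = Phi_alpha \<alpha> y t"
  by (simp add: Phi_alpha_def Xi_alpha_minus add.commute)

lemma Phi_alpha_real:
  assumes "\<alpha> > 0" "y \<ge> 0"
  shows "Phi_alpha \<alpha> y t \<in> \<real>"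
proof -
  have "kummer_1F1 (of_real (\<alpha> / 4) + (- \<i>) * of_real t) (of_real (\<alpha> / 2)) (of_real y) =
     cnj (kummer_1F1 (of_real (\<alpha> / 4) + \<i> * of_real t) (of_real (\<alpha> / 2)) (of_real y))"
    using kummer_cnj[of "\<alpha> / 2" y "of_real (\<alpha> / 4) + \<i> * of_real t"] assms by simp
  thus ?thesis unfolding Phi_alpha_def
    by (metis Reals_mult Xi_alpha_real complex_add_cnj Reals_of_real)
qed

lemma continuous_on_Phi_alpha:
  assumes "\<alpha> > 0" "y \<ge> 0"
  shows "continuous_on A (Phi_alpha \<alpha> y)"
proof -
  have k: "continuous_on UNIV (\<lambda>s. kummer_1F1 s (of_real (\<alpha> / 2)) (of_real y))"
    using isCont_kummer[of "\<alpha> / 2" y] assms by (intro continuous_at_imp_continuous_on) auto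
  show ?thesis unfolding Phi_alpha_def
    by (intro continuous_on_mult continuous_on_add continuous_on_Xi_alpha assms continuous_on_compose2[OF k] continuous_intros subset_UNIV)
qed

lemma half_le_sin:
  fixes x :: real
  assumes "0 \<le> x" "x \<le> 1"
  shows "x / 2 \<le> sin x"
proof -
  have "(\<lambda>x. sin x - x / 2) 0 \<le> (\<lambda>x. sin x - x / 2) x"
  proof (rule DERIV_nonneg_imp_nondecreasing[OF assms(1)])
    fix t :: real assume t: "0 \<le> t" "t \<le> x"
    have "cos (pi / 3) \<le> cos t"
      using t assms pi_gt3 by (intro cos_monotone_0_pi_le) linarith+
    hence "cos t - 1 / 2 \<ge> 0" by (simp add: cos_60)
    moreover have "((\<lambda>x. sin x - x / 2) has_real_derivative (cos t - 1 / 2)) (at t)"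
      by (auto intro!: derivative_eq_intros)
    ultimately show "\<exists>y. ((\<lambda>x. sin x - x / 2) has_real_derivative y) (at t) \<and> 0 \<le> y" by blast
  qed
  thus ?thesis by simp
qed

text \<open>Uniform in the shift, and with explicit dependence on \<delta>, because \<delta> later
  tends to 0 as T grows. The shift itself costs exp(2 M), since pi/2 < 2.\<close>

lemma Phi_alpha_shift_bound:
  assumes "\<alpha> > 0" "y \<ge> 0" "M \<ge> 0"
  obtains C and N :: nat where "C > 0"
    "\<And>\<delta> \<mu> t. 0 < \<delta> \<Longrightarrow> \<delta> \<le> 1 / 100 \<Longrightarrow> \<bar>\<mu>\<bar> \<le> M \<Longrightarrow>
       norm (Phi_alpha \<alpha> y (t + \<mu>)) \<le> C / \<delta> ^ N * inverse_pochhammer_series (\<alpha> / 2) (8 * y / \<delta>)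
          * exp (- (pi / 2 - \<delta> / 2) * \<bar>t\<bar>)"
proof -
  obtain C N where C: "C > 0" "\<And>w t. 0 \<le> w \<Longrightarrow> w < pi / 2 \<Longrightarrow> norm (Xi_alpha \<alpha> t) \<le> C / cos w ^ N * exp (- w * \<bar>t\<bar>)"
    using Xi_alpha_bound[OF assms(1)] by metis
  define a where "a = \<alpha> / 4"
  have a: "a > 0" using assms by (simp add: a_def)
  define D where "D = C * 8 ^ N * (2 * exp a * exp (2 * M))"
  have "norm (Phi_alpha \<alpha> y (t + \<mu>)) \<le> D / \<delta> ^ N * inverse_pochhammer_series (\<alpha> / 2) (8 * y / \<delta>)
          * exp (- (pi / 2 - \<delta> / 2) * \<bar>t\<bar>)" if \<delta>: "0 < \<delta>" "\<delta> \<le> 1 / 100" and \<mu>: "\<bar>\<mu>\<bar> \<le> M" for \<delta> \<mu> t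
  proof -
    define E where "E = inverse_pochhammer_series (\<alpha> / 2) (8 * y / \<delta>)"
    have E: "E \<ge> 0" unfolding E_def using assms \<delta> by (intro inverse_pochhammer_series(3)) auto
    \<comment> \<open>Xi decays at rate pi/2 - \<delta>/4, and the Kummer bound with u = \<delta>/8
      gives back \<delta>/4; the net rate is pi/2 - \<delta>/2.\<close>
    define w where "w = pi / 2 - \<delta> / 4"
    have w: "0 \<le> w" "w < pi / 2" using \<delta> pi_gt3 by (auto simp: w_def)
    define s where "s = t + \<mu>"
    have "cos w = sin (\<delta> / 4)" by (simp add: w_def cos_diff)
    hence cw: "\<delta> / 8 \<le> cos w" using half_le_sin[of "\<delta> / 4"] \<delta> by simp
    have 1: "norm (Xi_alpha \<alpha> s) \<le> C * 8 ^ N / \<delta> ^ N * exp (- w * \<bar>s\<bar>)"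
    proof -
      have "C / cos w ^ N \<le> C / (\<delta> / 8) ^ N"
        using cw \<delta> C(1) by (intro divide_left_mono power_mono mult_pos_pos zero_less_power) auto
      hence "C / cos w ^ N * exp (- w * \<bar>s\<bar>) \<le> C / (\<delta> / 8) ^ N * exp (- w * \<bar>s\<bar>)"
        by (rule mult_right_mono) simp
      thus ?thesis using C(2)[OF w, of s] by (simp add: power_divide)
    qed
    have 2: "norm (kummer_1F1 (of_real a + e * of_real s) (of_real (\<alpha> / 2)) (of_real y)) \<le> exp a * exp (\<delta> / 4 * \<bar>s\<bar>) * E"
      if e: "norm e = 1" for e
    proof -
      have "norm (of_real a + e * of_real s) \<le> a + \<bar>s\<bar>"
        using norm_triangle_ineq[of "of_real a" "e * of_real s"] a e by (simp add: norm_mult)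
      hence "2 * (\<delta> / 8) * norm (of_real a + e * of_real s) \<le> \<delta> / 4 * (a + \<bar>s\<bar>)" using \<delta> by simp
      also have "\<dots> \<le> a + \<delta> / 4 * \<bar>s\<bar>"
      proof -
        have "\<delta> / 4 * a \<le> 1 * a" using \<delta> a by (intro mult_right_mono) auto
        thus ?thesis by (simp add: distrib_left)
      qed
      finally have "exp (2 * (\<delta> / 8) * norm (of_real a + e * of_real s)) \<le> exp a * exp (\<delta> / 4 * \<bar>s\<bar>)"
        by (simp flip: exp_add)
      hence "exp (2 * (\<delta> / 8) * norm (of_real a + e * of_real s)) * E \<le> exp a * exp (\<delta> / 4 * \<bar>s\<bar>) * E"
        by (rule mult_right_mono[OF _ E])
      thus ?thesis
        using kummer_bound[of "\<alpha> / 2" y "\<delta> / 8" "of_real a + e * of_real s"] assms \<delta> by (simp add: E_def mult.commute)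
    qed
    have shrink: "exp (- (pi / 2 - \<delta> / 2) * \<bar>s\<bar>) \<le> exp (2 * M) * exp (- (pi / 2 - \<delta> / 2) * \<bar>t\<bar>)"
    proof -
      have "\<bar>t\<bar> - M \<le> \<bar>s\<bar>" using \<mu> by (simp add: s_def)
      hence "(pi / 2 - \<delta> / 2) * (\<bar>t\<bar> - M) \<le> (pi / 2 - \<delta> / 2) * \<bar>s\<bar>"
        using \<delta> pi_gt3 by (intro mult_left_mono) auto
      moreover have "(pi / 2 - \<delta> / 2) * M \<le> 2 * M"
        using \<delta> pi_less_4 assms by (intro mult_right_mono) auto
      ultimately have "- (pi / 2 - \<delta> / 2) * \<bar>s\<bar> \<le> 2 * M + - (pi / 2 - \<delta> / 2) * \<bar>t\<bar>"
        unfolding right_diff_distrib mult_minus_left by linarith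
      thus ?thesis by (simp flip: exp_add)
    qed
    have "norm (Phi_alpha \<alpha> y s) \<le> (C * 8 ^ N / \<delta> ^ N * exp (- w * \<bar>s\<bar>)) * (exp a * exp (\<delta> / 4 * \<bar>s\<bar>) * E + exp a * exp (\<delta> / 4 * \<bar>s\<bar>) * E)"
      unfolding Phi_alpha_def norm_mult a_def[symmetric] using C(1) \<delta>
      by (intro mult_mono 1 order_trans[OF norm_triangle_ineq] add_mono 2) auto
    also have "\<dots> = C * 8 ^ N / \<delta> ^ N * (2 * exp a) * E * (exp (- w * \<bar>s\<bar>) * exp (\<delta> / 4 * \<bar>s\<bar>))" by simp
    also have "exp (- w * \<bar>s\<bar>) * exp (\<delta> / 4 * \<bar>s\<bar>) = exp (- (pi / 2 - \<delta> / 2) * \<bar>s\<bar>)"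
      by (simp add: w_def algebra_simps flip: exp_add)
    also have "C * 8 ^ N / \<delta> ^ N * (2 * exp a) * E * exp (- (pi / 2 - \<delta> / 2) * \<bar>s\<bar>)
        \<le> C * 8 ^ N / \<delta> ^ N * (2 * exp a) * E * (exp (2 * M) * exp (- (pi / 2 - \<delta> / 2) * \<bar>t\<bar>))"
      using C(1) \<delta> E by (intro mult_left_mono shrink) auto
    finally have "norm (Phi_alpha \<alpha> y s) \<le> C * 8 ^ N / \<delta> ^ N * (2 * exp a) * E * (exp (2 * M) * exp (- (pi / 2 - \<delta> / 2) * \<bar>t\<bar>))" .
    thus ?thesis by (simp add: D_def s_def E_def mult_ac)
  qed
  moreover have "D > 0" using C by (simp add: D_def)
  ultimately show ?thesis using that by blast
qed

section \<open>Moments against polynomials with prescribed real roots\<close>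

definition root_poly :: "real list \<Rightarrow> complex poly" where
  "root_poly rs = (\<Prod>x\<leftarrow>rs. [:- of_real x, 1:])"

lemma poly_root_poly: "poly (root_poly rs) z = (\<Prod>x\<leftarrow>rs. z - of_real x)"
  by (induction rs) (auto simp: root_poly_def algebra_simps)

lemma degree_root_poly: "degree (root_poly rs) = length rs"
proof (induction rs)
  case (Cons x rs)
  have "root_poly rs \<noteq> 0" by (auto simp: root_poly_def prod_list_zero_iff)
  thus ?case using Cons by (simp add: root_poly_def degree_mult_eq del: mult_pCons_left)
qed (simp add: root_poly_def)

text \<open>Each linear factor contributes the size of its shifted root plus (j + 1)/\<rho>, where j
  is the degree reached before it; both are replaced by their maxima.\<close>

lemma poly_majorant_root_poly_shift:
  assumes "\<rho> > 0" "\<And>x. x \<in> set rs \<Longrightarrow> \<bar>x\<bar> \<le> T" "T \<ge> 0"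
  shows "poly_majorant \<rho> (root_poly (map (\<lambda>x. x + \<mu>) rs)) \<le> (T + \<bar>\<mu>\<bar> + real (length rs) / \<rho>) ^ length rs"
proof -
  define D where "D = length rs"
  define b where "b = (\<lambda>j. - complex_of_real (rs ! j + \<mu>))"
  have eq: "root_poly (map (\<lambda>x. x + \<mu>) rs) = (\<Prod>j<D. [:b j, 1:]) * 1"
    by (simp add: root_poly_def prod.list_conv_set_nth D_def b_def atLeast0LessThan o_def)
  have "poly_majorant \<rho> (root_poly (map (\<lambda>x. x + \<mu>) rs)) \<le>
     (\<Prod>j<D. norm (b j) + norm (1::complex) * (real (degree (1::complex poly) + j) + 1) / \<rho>) * poly_majorant \<rho> 1"
    unfolding eq using poly_majorant_linear_prod[OF assms(1), of b "\<lambda>_. 1" D 1] by blast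
  also have "poly_majorant \<rho> 1 = 1" by (simp add: poly_majorant_def)
  also have "(\<Prod>j<D. norm (b j) + norm (1::complex) * (real (degree (1::complex poly) + j) + 1) / \<rho>) * 1
      \<le> (\<Prod>j<D. T + \<bar>\<mu>\<bar> + real D / \<rho>)"
    unfolding mult_1_right
  proof (intro prod_mono conjI)
    fix j assume j: "j \<in> {..<D}"
    show "0 \<le> norm (b j) + norm (1::complex) * (real (degree (1::complex poly) + j) + 1) / \<rho>"
      using assms by (intro add_nonneg_nonneg) auto
    have "\<bar>rs ! j\<bar> \<le> T" using j by (intro assms) (auto simp: D_def)
    hence "norm (b j) \<le> T + \<bar>\<mu>\<bar>" unfolding b_def norm_minus_cancel norm_of_real by linarith
    moreover have "(real j + 1) / \<rho> \<le> real D / \<rho>" using j assms by (intro divide_right_mono) auto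
    ultimately show "norm (b j) + norm (1::complex) * (real (degree (1::complex poly) + j) + 1) / \<rho> \<le> T + \<bar>\<mu>\<bar> + real D / \<rho>"
      by simp
  qed
  finally show ?thesis by (simp add: D_def)
qed

lemma Phi_alpha_moment:
  assumes "\<alpha> > 0" "y \<ge> 0" "0 < \<delta>" "\<delta> \<le> 1 / 100"
  defines "\<omega> \<equiv> pi / 2 - \<delta>" and "a \<equiv> \<alpha> / 4"
  shows "integrable lborel (\<lambda>t. Phi_alpha \<alpha> y t * poly q (of_real t) * of_real (exp (\<omega> * t)))"
    and "norm (LINT t|lborel. Phi_alpha \<alpha> y t * poly q (of_real t) * of_real (exp (\<omega> * t))) \<le>
       4 * pi * exp y * (norm (poly q (\<i> * of_real a)) + norm (poly q (- \<i> * of_real a)))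
       + 4 * pi * theta_part_sup \<alpha> \<delta> * poly_majorant (\<delta> / 4) q * 2 ^ degree q
          * inverse_pochhammer_series (\<alpha> / 2) (2 * y * (4 / \<delta> + 1 + a))"
proof -
  define f where "f = (\<lambda>\<epsilon> t. Xi_alpha \<alpha> t * kummer_1F1 (of_real a + \<epsilon> * of_real t) (of_real (\<alpha> / 2)) (of_real y)
      * poly q (of_real t) * of_real (exp (\<omega> * t)))"
  note m = Xi_kummer_moment[OF assms(1,3,4,2), of _ q, folded \<omega>_def a_def]
  have i: "integrable lborel (f \<i>)" "integrable lborel (f (- \<i>))"
    unfolding f_def by (intro m(1); simp)+
  have eq: "(\<lambda>t. Phi_alpha \<alpha> y t * poly q (of_real t) * of_real (exp (\<omega> * t))) = (\<lambda>t. f \<i> t + f (- \<i>) t)"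
    by (simp add: f_def Phi_alpha_def a_def algebra_simps fun_eq_iff)
  show "integrable lborel (\<lambda>t. Phi_alpha \<alpha> y t * poly q (of_real t) * of_real (exp (\<omega> * t)))"
    unfolding eq using i by (rule Bochner_Integration.integrable_add)
  define Z where "Z = 2 * pi * exp y * (norm (poly q (\<i> * of_real a)) + norm (poly q (- \<i> * of_real a)))
       + 2 * pi * theta_part_sup \<alpha> \<delta> * poly_majorant (\<delta> / 4) q * 2 ^ degree q
          * inverse_pochhammer_series (\<alpha> / 2) (2 * y * (4 / \<delta> + 1 + a))"
  have "norm (LINT t|lborel. f \<i> t) \<le> Z" "norm (LINT t|lborel. f (- \<i>) t) \<le> Z"
    unfolding f_def Z_def by (rule m(2); simp)+
  hence "norm ((LINT t|lborel. f \<i> t) + (LINT t|lborel. f (- \<i>) t)) \<le> 2 * Z"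
    using norm_triangle_ineq[of "LINT t|lborel. f \<i> t" "LINT t|lborel. f (- \<i>) t"] by linarith
  thus "norm (LINT t|lborel. Phi_alpha \<alpha> y t * poly q (of_real t) * of_real (exp (\<omega> * t))) \<le>
       4 * pi * exp y * (norm (poly q (\<i> * of_real a)) + norm (poly q (- \<i> * of_real a)))
       + 4 * pi * theta_part_sup \<alpha> \<delta> * poly_majorant (\<delta> / 4) q * 2 ^ degree q
          * inverse_pochhammer_series (\<alpha> / 2) (2 * y * (4 / \<delta> + 1 + a))"
    unfolding eq using i by (simp add: Z_def algebra_simps)
qed

text \<open>The part of a moment that comes from \<open>theta_part\<close>: its supremum, the
  majorant at radius \<delta>/4 of a polynomial with D roots of modulus at most T + M, and the loss
  2^D together with the series from Kummer's function.\<close>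

definition moment_error :: "real \<Rightarrow> real \<Rightarrow> real \<Rightarrow> real \<Rightarrow> real \<Rightarrow> nat \<Rightarrow> real" where
  "moment_error \<alpha> y M \<delta> T D = theta_part_sup \<alpha> \<delta> * (T + M + 4 * real D / \<delta>) ^ D * 2 ^ D
     * inverse_pochhammer_series (\<alpha> / 2) (2 * y * (4 / \<delta> + 1 + \<alpha> / 4))"

text \<open>Translating t by \<mu> moves the shift from Phi to the roots of the polynomial, which is
  then evaluated at \<plusminus>i \<alpha>/4 - \<mu>. The exponential weight changes by
  exp(-\<omega> \<mu>) \<le> exp(2 M).\<close>

lemma shifted_Phi_alpha_moment:
  assumes "\<alpha> > 0" "y \<ge> 0" "0 < \<delta>" "\<delta> \<le> 1 / 100" "\<bar>\<mu>\<bar> \<le> M" "T \<ge> 0"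
    and rs: "\<And>x. x \<in> set rs \<Longrightarrow> \<bar>x\<bar> \<le> T"
    and W: "\<And>e. e = \<i> \<or> e = - \<i> \<Longrightarrow> norm (poly (root_poly rs) (e * of_real (\<alpha> / 4) - of_real \<mu>)) \<le> W"
  shows "integrable lborel (\<lambda>t. Phi_alpha \<alpha> y (t + \<mu>) * poly (root_poly rs) (of_real t) * of_real (exp ((pi / 2 - \<delta>) * t)))"
    and "norm (LINT t|lborel. Phi_alpha \<alpha> y (t + \<mu>) * poly (root_poly rs) (of_real t) * of_real (exp ((pi / 2 - \<delta>) * t)))
       \<le> exp (2 * M) * (8 * pi * exp y * W + 4 * pi * moment_error \<alpha> y M \<delta> T (length rs))"
proof -
  define \<omega> where "\<omega> = pi / 2 - \<delta>"
  define q where "q = root_poly (map (\<lambda>x. x + \<mu>) rs)"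
  have polyq: "poly q z = poly (root_poly rs) (z - of_real \<mu>)" for z
    by (simp add: q_def poly_root_poly o_def algebra_simps)
  define g where "g = (\<lambda>t. of_real (exp (- \<omega> * \<mu>)) * (Phi_alpha \<alpha> y t * poly q (of_real t) * of_real (exp (\<omega> * t))))"
  have eq: "g (\<mu> + 1 * t) = Phi_alpha \<alpha> y (t + \<mu>) * poly (root_poly rs) (of_real t) * of_real (exp ((pi / 2 - \<delta>) * t))" for t
  proof -
    have "exp (- \<omega> * \<mu>) * exp (\<omega> * (\<mu> + 1 * t)) = exp (\<omega> * t)"
      by (simp add: algebra_simps flip: exp_add)
    hence e: "complex_of_real (exp (- \<omega> * \<mu>)) * of_real (exp (\<omega> * (\<mu> + 1 * t))) = of_real (exp (\<omega> * t))"
      by (simp only: of_real_mult[symmetric])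
    have "g (\<mu> + 1 * t) = Phi_alpha \<alpha> y (\<mu> + 1 * t) * poly q (of_real (\<mu> + 1 * t)) *
        (of_real (exp (- \<omega> * \<mu>)) * of_real (exp (\<omega> * (\<mu> + 1 * t))))"
      by (simp only: g_def mult_ac)
    thus ?thesis unfolding e by (simp add: polyq \<omega>_def add.commute)
  qed
  note m = Phi_alpha_moment[OF assms(1-4), of q, folded \<omega>_def]
  have ig: "integrable lborel g" unfolding g_def by (intro integrable_mult_right m)
  from lborel_integrable_real_affine[OF this, of 1 \<mu>]
  show "integrable lborel (\<lambda>t. Phi_alpha \<alpha> y (t + \<mu>) * poly (root_poly rs) (of_real t) * of_real (exp ((pi / 2 - \<delta>) * t)))"
    unfolding eq by simp
  have L: "(LINT t|lborel. Phi_alpha \<alpha> y (t + \<mu>) * poly (root_poly rs) (of_real t) * of_real (exp ((pi / 2 - \<delta>) * t))) = (LINT t|lborel. g t)"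
    using lborel_integral_real_affine[of 1 g \<mu>] unfolding eq by simp
  define B where "B = theta_part_sup \<alpha> \<delta>"
  define E where "E = inverse_pochhammer_series (\<alpha> / 2) (2 * y * (4 / \<delta> + 1 + \<alpha> / 4))"
  have B: "B \<ge> 0" by (simp add: B_def theta_part_sup_def)
  have E: "E \<ge> 0" unfolding E_def using assms by (intro inverse_pochhammer_series(3)) auto
  have maj: "poly_majorant (\<delta> / 4) q \<le> (T + M + 4 * real (length rs) / \<delta>) ^ length rs"
  proof -
    have "poly_majorant (\<delta> / 4) q \<le> (T + \<bar>\<mu>\<bar> + real (length rs) / (\<delta> / 4)) ^ length rs"
      unfolding q_def using assms by (intro poly_majorant_root_poly_shift rs) auto
    also have "real (length rs) / (\<delta> / 4) = 4 * real (length rs) / \<delta>" by simp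
    also have "(T + \<bar>\<mu>\<bar> + 4 * real (length rs) / \<delta>) ^ length rs \<le> (T + M + 4 * real (length rs) / \<delta>) ^ length rs"
      using assms by (intro power_mono add_mono) auto
    finally show ?thesis .
  qed
  have deg: "degree q = length rs" by (simp add: q_def degree_root_poly)
  have "norm (LINT t|lborel. g t) = exp (- \<omega> * \<mu>) * norm (LINT t|lborel. Phi_alpha \<alpha> y t * poly q (of_real t) * of_real (exp (\<omega> * t)))"
    unfolding g_def by (subst integral_mult_right_zero) (simp add: norm_mult)
  also have "\<dots> \<le> exp (2 * M) * (4 * pi * exp y * (norm (poly q (\<i> * of_real (\<alpha> / 4))) + norm (poly q (- \<i> * of_real (\<alpha> / 4))))
       + 4 * pi * B * poly_majorant (\<delta> / 4) q * 2 ^ degree q * E)"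
  proof (rule mult_mono)
    have "- \<omega> * \<mu> \<le> \<bar>\<omega>\<bar> * \<bar>\<mu>\<bar>" by (metis abs_ge_minus_self abs_mult mult_minus_left)
    also have "\<dots> \<le> 2 * M" using assms pi_less_4 pi_gt3 by (intro mult_mono) (auto simp: \<omega>_def)
    finally show "exp (- \<omega> * \<mu>) \<le> exp (2 * M)" by simp
    show "norm (LINT t|lborel. Phi_alpha \<alpha> y t * poly q (of_real t) * of_real (exp (\<omega> * t))) \<le>
       4 * pi * exp y * (norm (poly q (\<i> * of_real (\<alpha> / 4))) + norm (poly q (- \<i> * of_real (\<alpha> / 4))))
       + 4 * pi * B * poly_majorant (\<delta> / 4) q * 2 ^ degree q * E"
      unfolding B_def E_def by (rule m(2))
  qed auto
  also have "\<dots> \<le> exp (2 * M) * (4 * pi * exp y * (W + W)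
       + 4 * pi * B * (T + M + 4 * real (length rs) / \<delta>) ^ length rs * 2 ^ length rs * E)"
    unfolding deg polyq using W[of \<i>] W[of "- \<i>"] B E
    by (intro mult_left_mono add_mono mult_right_mono maj) auto
  also have "\<dots> = exp (2 * M) * (8 * pi * exp y * W + 4 * pi * moment_error \<alpha> y M \<delta> T (length rs))"
    by (simp add: moment_error_def B_def E_def algebra_simps)
  finally show "norm (LINT t|lborel. Phi_alpha \<alpha> y (t + \<mu>) * poly (root_poly rs) (of_real t) * of_real (exp ((pi / 2 - \<delta>) * t)))
       \<le> exp (2 * M) * (8 * pi * exp y * W + 4 * pi * moment_error \<alpha> y M \<delta> T (length rs))"
    unfolding L .
qed

section \<open>The series on the critical line\<close>

locale shifted_Phi_series =
  fixes \<alpha> y M :: real and c l :: "nat \<Rightarrow> real"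
  assumes alpha_pos: "\<alpha> > 0" and y_nonneg: "y \<ge> 0" and M_nonneg: "M \<ge> 0"
    and summable_c: "summable (\<lambda>n. \<bar>c n\<bar>)" and l_bound: "\<bar>l n\<bar> \<le> M"
begin

text \<open>The summands for j and -j taken together, with j = n + 1 in the application; the pair is
  even in t because Phi is.\<close>

definition F_term :: "nat \<Rightarrow> real \<Rightarrow> complex" where
  "F_term n t = of_real (c n) * (Phi_alpha \<alpha> y (t + l n) + Phi_alpha \<alpha> y (t + (- l n)))"

definition F_series :: "real \<Rightarrow> complex" where
  "F_series t = (\<Sum>n. F_term n t)"

definition c_sum :: real where
  "c_sum = (\<Sum>n. \<bar>c n\<bar>)"

lemma c_sum_nonneg: "c_sum \<ge> 0"
  unfolding c_sum_def by (intro suminf_nonneg summable_c) auto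

lemma F_term_bound:
  obtains C and N :: nat where "C > 0"
    "\<And>\<delta> n t. 0 < \<delta> \<Longrightarrow> \<delta> \<le> 1 / 100 \<Longrightarrow>
       norm (F_term n t) \<le> \<bar>c n\<bar> * (C / \<delta> ^ N * inverse_pochhammer_series (\<alpha> / 2) (8 * y / \<delta>)
          * exp (- (pi / 2 - \<delta> / 2) * \<bar>t\<bar>))"
proof -
  obtain C and N :: nat where C: "C > 0"
    "\<And>\<delta> \<mu> t. 0 < \<delta> \<Longrightarrow> \<delta> \<le> 1 / 100 \<Longrightarrow> \<bar>\<mu>\<bar> \<le> M \<Longrightarrow>
       norm (Phi_alpha \<alpha> y (t + \<mu>)) \<le> C / \<delta> ^ N * inverse_pochhammer_series (\<alpha> / 2) (8 * y / \<delta>)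
          * exp (- (pi / 2 - \<delta> / 2) * \<bar>t\<bar>)"
    by (rule Phi_alpha_shift_bound[OF alpha_pos y_nonneg M_nonneg]) (rule that)
  have "norm (F_term n t) \<le> \<bar>c n\<bar> * (2 * C / \<delta> ^ N * inverse_pochhammer_series (\<alpha> / 2) (8 * y / \<delta>)
          * exp (- (pi / 2 - \<delta> / 2) * \<bar>t\<bar>))" if \<delta>: "0 < \<delta>" "\<delta> \<le> 1 / 100" for \<delta> n t
  proof -
    have "norm (Phi_alpha \<alpha> y (t + l n) + Phi_alpha \<alpha> y (t + (- l n))) \<le>
      2 * C / \<delta> ^ N * inverse_pochhammer_series (\<alpha> / 2) (8 * y / \<delta>) * exp (- (pi / 2 - \<delta> / 2) * \<bar>t\<bar>)"
      using C(2)[OF \<delta>, of "l n" t] C(2)[OF \<delta>, of "- l n" t] l_bound[of n]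
      by (intro order_trans[OF norm_triangle_ineq]) auto
    thus ?thesis unfolding F_term_def norm_mult norm_of_real by (rule mult_left_mono) simp
  qed
  moreover have "2 * C > 0" using C by simp
  ultimately show ?thesis using that by blast
qed

lemma summable_F_term: "summable (\<lambda>n. norm (F_term n t))"
proof -
  obtain C and N :: nat where C: "C > 0"
    "\<And>\<delta> n t. 0 < \<delta> \<Longrightarrow> \<delta> \<le> 1 / 100 \<Longrightarrow>
       norm (F_term n t) \<le> \<bar>c n\<bar> * (C / \<delta> ^ N * inverse_pochhammer_series (\<alpha> / 2) (8 * y / \<delta>)
          * exp (- (pi / 2 - \<delta> / 2) * \<bar>t\<bar>))"
    by (rule F_term_bound) (rule that)
  define B where "B = C / (1 / 100) ^ N * inverse_pochhammer_series (\<alpha> / 2) (8 * y / (1 / 100))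
          * exp (- (pi / 2 - (1 / 100) / 2) * \<bar>t\<bar>)"
  have "norm (F_term n t) \<le> \<bar>c n\<bar> * B" for n
    unfolding B_def by (rule C(2)) auto
  thus ?thesis
    by (intro summable_comparison_test'[OF summable_mult2[OF summable_c, of B], where N = 0]) simp
qed

lemma F_series_bound:
  obtains C and N :: nat where "C > 0"
    "\<And>\<delta> t. 0 < \<delta> \<Longrightarrow> \<delta> \<le> 1 / 100 \<Longrightarrow>
       norm (F_series t) \<le> c_sum * (C / \<delta> ^ N * inverse_pochhammer_series (\<alpha> / 2) (8 * y / \<delta>)
          * exp (- (pi / 2 - \<delta> / 2) * \<bar>t\<bar>))"
proof -
  obtain C and N :: nat where C: "C > 0"
    "\<And>\<delta> n t. 0 < \<delta> \<Longrightarrow> \<delta> \<le> 1 / 100 \<Longrightarrow>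
       norm (F_term n t) \<le> \<bar>c n\<bar> * (C / \<delta> ^ N * inverse_pochhammer_series (\<alpha> / 2) (8 * y / \<delta>)
          * exp (- (pi / 2 - \<delta> / 2) * \<bar>t\<bar>))"
    by (rule F_term_bound) (rule that)
  have "norm (F_series t) \<le> c_sum * (C / \<delta> ^ N * inverse_pochhammer_series (\<alpha> / 2) (8 * y / \<delta>)
          * exp (- (pi / 2 - \<delta> / 2) * \<bar>t\<bar>))" if \<delta>: "0 < \<delta>" "\<delta> \<le> 1 / 100" for \<delta> t
  proof -
    have "norm (F_series t) \<le> (\<Sum>n. norm (F_term n t))"
      unfolding F_series_def by (rule summable_norm[OF summable_F_term])
    also have "\<dots> \<le> (\<Sum>n. \<bar>c n\<bar> * (C / \<delta> ^ N * inverse_pochhammer_series (\<alpha> / 2) (8 * y / \<delta>)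
          * exp (- (pi / 2 - \<delta> / 2) * \<bar>t\<bar>)))"
      by (intro suminf_le C(2) \<delta> summable_F_term summable_mult2 summable_c)
    finally show ?thesis unfolding c_sum_def suminf_mult2[OF summable_c] .
  qed
  with C(1) that show ?thesis by blast
qed

lemma F_series_minus: "F_series (- t) = F_series t"
proof -
  have "Phi_alpha \<alpha> y (- t + u) = Phi_alpha \<alpha> y (t + (- u))" for u
    using Phi_alpha_minus[of \<alpha> y "t + (- u)"] by simp
  from this[of "l _"] this[of "- l _"] show ?thesis
    by (simp add: F_series_def F_term_def add.commute)
qed

lemma F_series_real: "F_series t \<in> \<real>"
proof -
  have "F_term n t = of_real (Re (F_term n t))" for n
    unfolding F_term_def
    by (intro of_real_Re[symmetric] Reals_mult Reals_add Phi_alpha_real alpha_pos y_nonneg Reals_of_real)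
  moreover have "summable (\<lambda>n. Re (F_term n t))"
    by (intro summable_Re summable_norm_cancel[OF summable_F_term])
  ultimately have "F_series t = of_real (\<Sum>n. Re (F_term n t))"
    unfolding F_series_def by (metis (no_types, lifting) suminf_cong suminf_of_real)
  thus ?thesis by simp
qed

lemma continuous_F_series: "continuous_on UNIV F_series"
proof -
  obtain C and N :: nat where C: "C > 0"
    "\<And>\<delta> n t. 0 < \<delta> \<Longrightarrow> \<delta> \<le> 1 / 100 \<Longrightarrow>
       norm (F_term n t) \<le> \<bar>c n\<bar> * (C / \<delta> ^ N * inverse_pochhammer_series (\<alpha> / 2) (8 * y / \<delta>)
          * exp (- (pi / 2 - \<delta> / 2) * \<bar>t\<bar>))"
    by (rule F_term_bound) (rule that)
  define B where "B = C / (1 / 100) ^ N * inverse_pochhammer_series (\<alpha> / 2) (8 * y / (1 / 100))"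
  have B: "B \<ge> 0" unfolding B_def using C(1) y_nonneg alpha_pos
    by (intro mult_nonneg_nonneg inverse_pochhammer_series(3)) auto
  have "norm (F_term n t) \<le> \<bar>c n\<bar> * B" for n t
  proof -
    have "exp (- (pi / 2 - (1 / 100) / 2) * \<bar>t\<bar>) \<le> 1"
    proof -
      have "(pi / 2 - (1 / 100) / 2) * \<bar>t\<bar> \<ge> 0" using pi_gt3 by (intro mult_nonneg_nonneg) auto
      thus ?thesis by (simp only: exp_le_one_iff mult_minus_left neg_le_0_iff_le)
    qed
    hence "B * exp (- (pi / 2 - (1 / 100) / 2) * \<bar>t\<bar>) \<le> B * 1" using B by (rule mult_left_mono)
    hence "\<bar>c n\<bar> * (B * exp (- (pi / 2 - (1 / 100) / 2) * \<bar>t\<bar>)) \<le> \<bar>c n\<bar> * (B * 1)" by (rule mult_left_mono) simp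
    moreover have "norm (F_term n t) \<le> \<bar>c n\<bar> * (B * exp (- (pi / 2 - (1 / 100) / 2) * \<bar>t\<bar>))"
      unfolding B_def by (rule C(2)) auto
    ultimately show ?thesis by simp
  qed
  hence "uniform_limit UNIV (\<lambda>n t. \<Sum>i<n. F_term i t) F_series sequentially"
    unfolding F_series_def by (intro Weierstrass_m_test[OF _ summable_mult2[OF summable_c, of B]])
  moreover have "continuous_on UNIV (F_term i)" for i
    unfolding F_term_def
    by (intro continuous_intros continuous_on_compose2[OF continuous_on_Phi_alpha[OF alpha_pos y_nonneg, of UNIV]]) auto
  ultimately show ?thesis
    by (intro uniform_limit_theorem[where f = "\<lambda>n t. \<Sum>i<n. F_term i t" and F = sequentially])
       (auto intro!: always_eventually continuous_on_sum)
qed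

text \<open>Termwise integration. All evaluation points \<plusminus>i \<alpha>/4 - \<lambda>_j lie
  in one disc of radius M + \<alpha>/4, so a single \<open>W\<close> serves every term and the
  absolute sum of the c_j comes out as a factor.\<close>

lemma F_series_moment:
  assumes "0 < \<delta>" "\<delta> \<le> 1 / 100" "T \<ge> 0" "\<And>x. x \<in> set rs \<Longrightarrow> \<bar>x\<bar> \<le> T"
    and W: "\<And>w. norm w \<le> M + \<alpha> / 4 \<Longrightarrow> norm (poly (root_poly rs) w) \<le> W"
  shows "integrable lborel (\<lambda>t. F_series t * (poly (root_poly rs) (of_real t) * of_real (exp ((pi / 2 - \<delta>) * t))))"
    and "norm (LINT t|lborel. F_series t * (poly (root_poly rs) (of_real t) * of_real (exp ((pi / 2 - \<delta>) * t))))
       \<le> c_sum * (2 * (exp (2 * M) * (8 * pi * exp y * W + 4 * pi * moment_error \<alpha> y M \<delta> T (length rs))))"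
proof -
  define G where "G = (\<lambda>t. poly (root_poly rs) (of_real t) * complex_of_real (exp ((pi / 2 - \<delta>) * t)))"
  define B where "B = exp (2 * M) * (8 * pi * exp y * W + 4 * pi * moment_error \<alpha> y M \<delta> T (length rs))"
  have mom: "integrable lborel (\<lambda>t. Phi_alpha \<alpha> y (t + \<mu>) * G t)"
       "norm (LINT t|lborel. Phi_alpha \<alpha> y (t + \<mu>) * G t) \<le> B" if "\<bar>\<mu>\<bar> \<le> M" for \<mu>
  proof -
    have w: "norm (poly (root_poly rs) (e * of_real (\<alpha> / 4) - of_real \<mu>)) \<le> W" if "e = \<i> \<or> e = - \<i>" for e
    proof (rule W)
      have "norm (e * of_real (\<alpha> / 4) - of_real \<mu>) \<le> norm e * (\<alpha> / 4) + \<bar>\<mu>\<bar>"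
        using norm_triangle_ineq4[of "e * of_real (\<alpha> / 4)" "of_real \<mu>"] alpha_pos by (simp add: norm_mult)
      thus "norm (e * of_real (\<alpha> / 4) - of_real \<mu>) \<le> M + \<alpha> / 4" using \<open>\<bar>\<mu>\<bar> \<le> M\<close> that by auto
    qed
    note * = shifted_Phi_alpha_moment[OF alpha_pos y_nonneg assms(1,2) that assms(3,4) w]
    show "integrable lborel (\<lambda>t. Phi_alpha \<alpha> y (t + \<mu>) * G t)" using *(1) by (simp add: G_def mult.assoc)
    show "norm (LINT t|lborel. Phi_alpha \<alpha> y (t + \<mu>) * G t) \<le> B" using *(2) by (simp add: G_def B_def mult.assoc)
  qed
  have eq: "F_term n t * G t = of_real (c n) * (Phi_alpha \<alpha> y (t + l n) * G t + Phi_alpha \<alpha> y (t + (- l n)) * G t)" for n t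
    by (simp add: F_term_def algebra_simps)
  have ml: "\<bar>l n\<bar> \<le> M" "\<bar>- l n\<bar> \<le> M" for n using l_bound[of n] by auto
  have int: "integrable lborel (\<lambda>t. F_term n t * G t)" for n
    unfolding eq by (intro integrable_mult_right Bochner_Integration.integrable_add mom ml)
  have Fb: "norm (LINT t|lborel. F_term n t * G t) \<le> \<bar>c n\<bar> * (2 * B)" for n
  proof -
    have "(LINT t|lborel. F_term n t * G t) = of_real (c n) * ((LINT t|lborel. Phi_alpha \<alpha> y (t + l n) * G t) + (LINT t|lborel. Phi_alpha \<alpha> y (t + (- l n)) * G t))"
      unfolding eq integral_mult_right_zero
      by (simp only: Bochner_Integration.integral_add[OF mom(1)[OF ml(1)] mom(1)[OF ml(2)]])
    moreover have "norm ((LINT t|lborel. Phi_alpha \<alpha> y (t + l n) * G t) + (LINT t|lborel. Phi_alpha \<alpha> y (t + (- l n)) * G t)) \<le> 2 * B"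
      using mom(2)[OF ml(1), of n] mom(2)[OF ml(2), of n] by (intro order_trans[OF norm_triangle_ineq]) linarith
    ultimately show ?thesis by (simp add: norm_mult mult_left_mono)
  qed
  obtain C and N :: nat where C: "C > 0"
    "\<And>\<delta> n t. 0 < \<delta> \<Longrightarrow> \<delta> \<le> 1 / 100 \<Longrightarrow>
       norm (F_term n t) \<le> \<bar>c n\<bar> * (C / \<delta> ^ N * inverse_pochhammer_series (\<alpha> / 2) (8 * y / \<delta>)
          * exp (- (pi / 2 - \<delta> / 2) * \<bar>t\<bar>))"
    by (rule F_term_bound) (rule that)
  define H where "H = C / \<delta> ^ N * inverse_pochhammer_series (\<alpha> / 2) (8 * y / \<delta>)"
  \<comment> \<open>Dominating function: of the decay pi/2 - \<delta>/2 the weight exp((pi/2 -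
    \<delta>) t) leaves \<delta>/2, enough to absorb any polynomial.\<close>
  define V where "V = (\<lambda>t. H * norm (complex_of_real (exp (- (\<delta> / 2) * \<bar>t\<bar>)) * poly (root_poly rs) (of_real t)))"
  have intV: "integrable lborel V"
  proof -
    have "exp (- (\<delta> / 2) * \<bar>t\<bar>) * exp (\<delta> / 4 * \<bar>t\<bar>) = exp (- (\<delta> / 4) * \<bar>t\<bar>)" for t
      by (simp flip: exp_add)
    hence "integrable lborel (\<lambda>t. norm (complex_of_real (exp (- (\<delta> / 2) * \<bar>t\<bar>))) * exp (\<delta> / 4 * \<bar>t\<bar>))"
      using integrable_exp_abs[of "\<delta> / 4"] assms(1) by simp
    hence "integrable lborel (\<lambda>t. complex_of_real (exp (- (\<delta> / 2) * \<bar>t\<bar>)) * poly (root_poly rs) (of_real t))"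
      using assms(1) by (intro poly_times_exp_integrable(1)[where r = "\<delta> / 4"]) auto
    thus ?thesis unfolding V_def by (intro integrable_mult_right integrable_norm)
  qed
  have FV: "norm (F_term n t * G t) \<le> \<bar>c n\<bar> * V t" for n t
  proof -
    have H: "H \<ge> 0" unfolding H_def using C(1) assms y_nonneg alpha_pos
      by (intro mult_nonneg_nonneg inverse_pochhammer_series(3)) auto
    have "(pi / 2 - \<delta>) * t \<le> (pi / 2 - \<delta>) * \<bar>t\<bar>" using assms(2) pi_gt3 by (intro mult_left_mono) auto
    hence "exp (- (pi / 2 - \<delta> / 2) * \<bar>t\<bar>) * exp ((pi / 2 - \<delta>) * t) \<le> exp (- (\<delta> / 2) * \<bar>t\<bar>)"
      by (simp add: algebra_simps flip: exp_add)
    hence "\<bar>c n\<bar> * H * norm (poly (root_poly rs) (of_real t)) * (exp (- (pi / 2 - \<delta> / 2) * \<bar>t\<bar>) * exp ((pi / 2 - \<delta>) * t))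
      \<le> \<bar>c n\<bar> * H * norm (poly (root_poly rs) (of_real t)) * exp (- (\<delta> / 2) * \<bar>t\<bar>)"
      using H by (intro mult_left_mono) auto
    moreover have "norm (F_term n t * G t) \<le> (\<bar>c n\<bar> * (H * exp (- (pi / 2 - \<delta> / 2) * \<bar>t\<bar>))) * norm (G t)"
      unfolding norm_mult H_def by (intro mult_right_mono C(2) assms) auto
    ultimately show ?thesis by (simp add: V_def G_def norm_mult mult_ac)
  qed
  have summ: "AE t in lborel. summable (\<lambda>n. norm (F_term n t * G t))"
    unfolding norm_mult by (intro AE_I2 summable_mult2 summable_F_term)
  have summi: "summable (\<lambda>n. LINT t|lborel. norm (F_term n t * G t))"
  proof (rule summable_comparison_test'[OF summable_mult2[OF summable_c]])
    fix n :: nat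
    have "(LINT t|lborel. norm (F_term n t * G t)) \<le> (LINT t|lborel. \<bar>c n\<bar> * V t)"
      by (intro integral_mono integrable_norm int integrable_mult_right intV FV)
    thus "norm (LINT t|lborel. norm (F_term n t * G t)) \<le> \<bar>c n\<bar> * (LINT t|lborel. V t)"
      by simp
  qed
  have FG: "(\<Sum>n. F_term n t * G t) = F_series t * G t" for t
    unfolding F_series_def by (rule suminf_mult2[symmetric]) (rule summable_norm_cancel[OF summable_F_term])
  note ser = integrable_suminf[OF int summ summi] sums_integral[OF int summ summi]
  show "integrable lborel (\<lambda>t. F_series t * (poly (root_poly rs) (of_real t) * of_real (exp ((pi / 2 - \<delta>) * t))))"
    using ser(1) unfolding FG unfolding G_def .
  have "(LINT t|lborel. F_series t * G t) = (\<Sum>n. LINT t|lborel. F_term n t * G t)"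
    using sums_unique[OF ser(2)] unfolding FG by simp
  moreover have sc: "summable (\<lambda>n. \<bar>c n\<bar> * (2 * B))" by (rule summable_mult2[OF summable_c])
  have sn: "summable (\<lambda>n. norm (LINT t|lborel. F_term n t * G t))"
    by (rule summable_comparison_test'[OF sc]) (use Fb in auto)
  have "norm (\<Sum>n. LINT t|lborel. F_term n t * G t) \<le> (\<Sum>n. norm (LINT t|lborel. F_term n t * G t))"
    by (rule summable_norm[OF sn])
  also have "\<dots> \<le> (\<Sum>n. \<bar>c n\<bar> * (2 * B))" by (rule suminf_le[OF Fb sn sc])
  also have "\<dots> = c_sum * (2 * B)" unfolding c_sum_def by (rule suminf_mult2[OF summable_c, symmetric])
  ultimately show "norm (LINT t|lborel. F_series t * (poly (root_poly rs) (of_real t) * of_real (exp ((pi / 2 - \<delta>) * t))))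
       \<le> c_sum * (2 * (exp (2 * M) * (8 * pi * exp y * W + 4 * pi * moment_error \<alpha> y M \<delta> T (length rs))))"
    by (simp add: G_def B_def)
qed

end

text \<open>On the line cnj s = \<alpha>/2 - s, so with u = t + \<lambda>_j the two Kummer
  parameters are \<alpha>/4 - i u and \<alpha>/4 + i u, and the remaining factor is Xi at u. The
  nonzero integers are enumerated as the pairs n + 1 and -(n + 1).\<close>

lemma F_tilde_critical_line:
  assumes "\<alpha> > 0" "(\<lambda>j. \<bar>c j\<bar>) summable_on {1..}" "\<And>n. \<bar>l (Suc n)\<bar> \<le> M" "M \<ge> 0"
  shows "shifted_Phi_series \<alpha> (z\<^sup>2 / 4) M (\<lambda>n. c (Suc n)) (\<lambda>n. l (Suc n))"
    and "F_tilde c l z \<alpha> (of_real (\<alpha> / 4) + \<i> * of_real t) =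
      shifted_Phi_series.F_series \<alpha> (z\<^sup>2 / 4) (\<lambda>n. c (Suc n)) (\<lambda>n. l (Suc n)) t"
proof -
  have Suc: "{1..} = range Suc" by (auto simp: image_iff) (metis Suc_le_D)
  have "summable (\<lambda>n. \<bar>c (Suc n)\<bar>)"
    using assms(2) unfolding Suc by (subst (asm) summable_on_reindex) (auto simp: o_def intro: summable_on_imp_summable)
  then interpret shifted_Phi_series \<alpha> "z\<^sup>2 / 4" M "\<lambda>n. c (Suc n)" "\<lambda>n. l (Suc n)"
    using assms by unfold_locales auto
  show "shifted_Phi_series \<alpha> (z\<^sup>2 / 4) M (\<lambda>n. c (Suc n)) (\<lambda>n. l (Suc n))" by unfold_locales
  define P where "P = Phi_alpha \<alpha> (z\<^sup>2 / 4)"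
  define g where "g = (\<lambda>j. of_real (even_ext c j) * P (t + odd_ext l j))"
  have trm: "(let w = \<i> * of_real (odd_ext l j); s = of_real (\<alpha> / 4) + \<i> * of_real t in
       of_real (even_ext c j) * of_real pi powr (- (s + w)) * Gamma (s + w)
         * zeta_alpha \<alpha> (s + w)
         * (kummer_1F1 (of_real (\<alpha> / 2) - s - w) (of_real (\<alpha> / 2)) (of_real (z\<^sup>2 / 4))
          + kummer_1F1 (of_real (\<alpha> / 2) - cnj s + w) (of_real (\<alpha> / 2)) (of_real (z\<^sup>2 / 4)))) = g j" for j
  proof -
    define u where "u = t + odd_ext l j"
    have s: "of_real (\<alpha> / 4) + \<i> * of_real t + \<i> * of_real (odd_ext l j) = of_real (\<alpha> / 4) + \<i> * of_real u"
      by (simp add: u_def algebra_simps)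
    have k1: "of_real (\<alpha> / 2) - (of_real (\<alpha> / 4) + \<i> * of_real t) - \<i> * of_real (odd_ext l j) = of_real (\<alpha> / 4) + (- \<i>) * of_real u"
      by (simp add: u_def complex_eq_iff)
    have k2: "of_real (\<alpha> / 2) - cnj (of_real (\<alpha> / 4) + \<i> * of_real t) + \<i> * of_real (odd_ext l j) = of_real (\<alpha> / 4) + \<i> * of_real u"
      by (simp add: u_def complex_eq_iff)
    show ?thesis unfolding Let_def s k1 k2 g_def P_def Phi_alpha_def u_def[symmetric]
      using zeta_alpha_critical_line[OF assms(1) refl, of u] by (simp add: mult.assoc add.commute)
  qed
  have "F_tilde c l z \<alpha> (of_real (\<alpha> / 4) + \<i> * of_real t) = infsum g (- {0})"
    unfolding F_tilde_def Let_def by (intro infsum_cong) (use trm in \<open>simp add: Let_def\<close>)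
  also have "\<dots> = F_series t"
  proof (rule infsumI)
    let ?a = "\<lambda>n. of_real (c (Suc n)) * P (t + l (Suc n))" and ?b = "\<lambda>n. of_real (c (Suc n)) * P (t + (- l (Suc n)))"
    obtain C and N :: nat where C: "C > 0"
      "\<And>\<delta> \<mu> t. 0 < \<delta> \<Longrightarrow> \<delta> \<le> 1 / 100 \<Longrightarrow> \<bar>\<mu>\<bar> \<le> M \<Longrightarrow>
       norm (Phi_alpha \<alpha> (z\<^sup>2 / 4) (t + \<mu>)) \<le> C / \<delta> ^ N * inverse_pochhammer_series (\<alpha> / 2) (8 * (z\<^sup>2 / 4) / \<delta>)
          * exp (- (pi / 2 - \<delta> / 2) * \<bar>t\<bar>)"
      by (rule Phi_alpha_shift_bound[OF alpha_pos y_nonneg M_nonneg]) (rule that)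
    define B where "B = C / (1 / 100) ^ N * inverse_pochhammer_series (\<alpha> / 2) (8 * (z\<^sup>2 / 4) / (1 / 100))
          * exp (- (pi / 2 - (1 / 100) / 2) * \<bar>t\<bar>)"
    have PB: "norm (P (t + \<mu>)) \<le> B" if "\<bar>\<mu>\<bar> \<le> M" for \<mu>
      unfolding P_def B_def by (rule C(2)) (use that in auto)
    have *: "(\<lambda>n. of_real (c (Suc n)) * P (t + m n)) summable_on UNIV" if "\<And>n. \<bar>m n\<bar> \<le> M" for m
    proof (rule norm_summable_imp_summable_on)
      show "summable (\<lambda>n. norm (of_real (c (Suc n)) * P (t + m n)))"
        by (rule summable_comparison_test'[OF summable_mult2[OF summable_c, of B]])
           (use PB that in \<open>auto simp: norm_mult intro!: mult_left_mono\<close>)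
    qed
    have a: "(?a has_sum infsum ?a UNIV) UNIV" and b: "(?b has_sum infsum ?b UNIV) UNIV"
      by (intro has_sum_infsum *; use l_bound in simp)+
    have "(\<lambda>n. ?a n + ?b n) sums (infsum ?a UNIV + infsum ?b UNIV)"
      by (intro has_sum_imp_sums has_sum_add a b)
    hence F: "F_series t = infsum ?a UNIV + infsum ?b UNIV"
      unfolding F_series_def F_term_def by (simp add: sums_iff P_def algebra_simps)
    have "(g has_sum infsum ?a UNIV) (range (\<lambda>n. int (Suc n)))"
      by (subst has_sum_reindex) (use a in \<open>auto simp: inj_on_def o_def g_def even_ext_def odd_ext_def nat_add_distrib\<close>)
    moreover have "(g has_sum infsum ?b UNIV) (range (\<lambda>n. - int (Suc n)))"
      by (subst has_sum_reindex) (use b in \<open>auto simp: inj_on_def o_def g_def even_ext_def odd_ext_def nat_add_distrib\<close>)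
    moreover have "int (Suc n) \<noteq> - int (Suc m)" for n m by linarith
    hence "range (\<lambda>n. int (Suc n)) \<inter> range (\<lambda>n. - int (Suc n)) = {}" by blast
    ultimately have "(g has_sum (infsum ?a UNIV + infsum ?b UNIV)) (range (\<lambda>n. int (Suc n)) \<union> range (\<lambda>n. - int (Suc n)))"
      by (rule has_sum_Un_disjoint)
    moreover have "range (\<lambda>n. int (Suc n)) \<union> range (\<lambda>n. - int (Suc n)) = - {0}"
    proof -
      have "x \<in> range (\<lambda>n. int (Suc n)) \<union> range (\<lambda>n. - int (Suc n))" if "x \<noteq> 0" for x
      proof (cases "x > 0")
        case True
        hence "x = int (Suc (nat (x - 1)))" by simp
        thus ?thesis by blast
      next
        case False
        hence "x = - int (Suc (nat (- x - 1)))" using that by simp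
        thus ?thesis by blast
      qed
      thus ?thesis by (auto simp del: of_nat_Suc)
    qed
    ultimately show "(g has_sum F_series t) (- {0})" by (simp only: F)
  qed
  finally show "F_tilde c l z \<alpha> (of_real (\<alpha> / 4) + \<i> * of_real t) = F_series t" .
qed

section \<open>Counting zeros\<close>

lemma connected_no_zero_sign:
  fixes f :: "'a::topological_space \<Rightarrow> real"
  assumes "connected S" "continuous_on S f" "\<And>t. t \<in> S \<Longrightarrow> f t \<noteq> 0"
  obtains \<sigma> :: real where "\<bar>\<sigma>\<bar> = 1" "\<And>t. t \<in> S \<Longrightarrow> \<sigma> * f t > 0"
proof (cases "\<exists>x\<in>S. f x > 0")
  case True
  then obtain x where x: "x \<in> S" "f x > 0" by blast
  have "f t > 0" if "t \<in> S" for t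
  proof (rule ccontr)
    assume "\<not> f t > 0"
    hence "0 \<in> f ` S"
      using connectedD_interval[OF connected_continuous_image[OF assms(2,1)], of "f t" "f x" 0] x that by auto
    thus False using assms(3) by force
  qed
  thus ?thesis using that[of 1] by simp
next
  case False
  hence "f t < 0" if "t \<in> S" for t using assms(3)[OF that] that by force
  thus ?thesis using that[of "- 1"] by simp
qed

text \<open>Induction on the number of zeros, removing the largest one; the interval is half-open so
  that shortening it to [0, \<tau>) drops exactly \<tau>. \<open>Z\<close> collects the zeros at
  which the sign changes, each once.\<close>

lemma finite_zeros_sign_polynomial:
  fixes f :: "real \<Rightarrow> real"
  assumes "continuous_on UNIV f" "finite {t \<in> {0..<T}. f t = 0}"
  shows "\<exists>Z \<sigma>. Z \<subseteq> {t \<in> {0..<T}. f t = 0} \<and> \<bar>\<sigma>\<bar> = 1 \<and> (\<forall>t\<in>{0..<T}. \<sigma> * f t * (\<Prod>x\<in>Z. t - x) \<ge> 0)"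
  using assms(2)
proof (induction "card {t \<in> {0..<T}. f t = 0}" arbitrary: T rule: less_induct)
  case less
  define A where "A = {t \<in> {0..<T}. f t = 0}"
  have fin: "finite A" using less.prems by (simp add: A_def)
  show ?case
  proof (cases "A = {}")
    case True
    obtain \<sigma> :: real where "\<bar>\<sigma>\<bar> = 1" "\<And>t. t \<in> {0..<T} \<Longrightarrow> \<sigma> * f t > 0"
    proof (rule connected_no_zero_sign[of "{0..<T}" f])
      show "f t \<noteq> 0" if "t \<in> {0..<T}" for t using True that by (auto simp: A_def)
    qed (use continuous_on_subset[OF assms(1)] in auto)
    hence "\<forall>t\<in>{0..<T}. \<sigma> * f t * (\<Prod>x\<in>{}. t - x) \<ge> 0" by (auto intro: less_imp_le)
    thus ?thesis using \<open>\<bar>\<sigma>\<bar> = 1\<close> by blast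
  next
    case False
    define \<tau> where "\<tau> = Max A"
    have \<tau>: "\<tau> \<in> A" "\<And>x. x \<in> A \<Longrightarrow> x \<le> \<tau>" using fin False by (auto simp: \<tau>_def)
    hence \<tau>': "0 \<le> \<tau>" "\<tau> < T" "f \<tau> = 0" by (auto simp: A_def)
    have sub: "{t \<in> {0..<\<tau>}. f t = 0} \<subset> A" using \<tau> \<tau>' by (auto simp: A_def)
    obtain Z \<sigma> where Z: "Z \<subseteq> {t \<in> {0..<\<tau>}. f t = 0}" "\<bar>\<sigma>\<bar> = 1"
        "\<And>t. t \<in> {0..<\<tau>} \<Longrightarrow> \<sigma> * f t * (\<Prod>x\<in>Z. t - x) \<ge> 0"
      using less.hyps[of \<tau>] psubset_card_mono[OF fin sub] finite_subset[OF _ fin] sub unfolding A_def by blast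
    have nz: "f t \<noteq> 0" if "t \<in> {\<tau><..<T}" for t using \<tau>(2)[of t] that \<tau>' by (auto simp: A_def)
    obtain \<epsilon> :: real where \<epsilon>: "\<bar>\<epsilon>\<bar> = 1" "\<And>t. t \<in> {\<tau><..<T} \<Longrightarrow> \<epsilon> * f t > 0"
      using connected_no_zero_sign[of "{\<tau><..<T}" f] continuous_on_subset[OF assms(1)] nz
      by (metis connected_Ioo subset_UNIV)
    have pos: "(\<Prod>x\<in>Z. t - x) > 0" if "t > \<tau>" for t using Z(1) that by (intro prod_pos) auto
    have ZA: "Z \<subseteq> A" "\<tau> \<notin> Z" using Z(1) sub by auto
    have finZ: "finite Z" by (rule finite_subset[OF ZA(1) fin])
    \<comment> \<open>Beyond \<tau> the product over \<open>Z\<close> is positive. Equal signs mean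
      no change at \<tau> and \<open>Z\<close> is kept; opposite signs mean that \<tau> joins
      \<open>Z\<close>, and the overall sign is taken from the right of \<tau>.\<close>
    consider "\<epsilon> = \<sigma>" | "\<epsilon> = - \<sigma>" using \<epsilon>(1) Z(2) by fastforce
    thus ?thesis
    proof cases
      case 1
      have "\<sigma> * f t * (\<Prod>x\<in>Z. t - x) \<ge> 0" if t: "t \<in> {0..<T}" for t
        using Z(3)[of t] pos[of t] \<epsilon>(2)[of t] \<tau>' t unfolding 1
        by (cases t \<tau> rule: linorder_cases) auto
      thus ?thesis using ZA(1) Z(2) unfolding A_def by blast
    next
      case 2
      have "\<epsilon> * f t * (\<Prod>x\<in>insert \<tau> Z. t - x) \<ge> 0" if t: "t \<in> {0..<T}" for t
      proof -
        have split: "\<epsilon> * f t * (\<Prod>x\<in>insert \<tau> Z. t - x) = (\<epsilon> * f t * (\<Prod>x\<in>Z. t - x)) * (t - \<tau>)"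
          using finZ ZA(2) by (simp add: mult_ac)
        show ?thesis
        proof (cases t \<tau> rule: linorder_cases)
          case less
          hence "\<epsilon> * f t * (\<Prod>x\<in>Z. t - x) \<le> 0" using Z(3)[of t] t 2 by simp
          thus ?thesis unfolding split using less by (intro mult_nonpos_nonpos) auto
        next
          case greater
          thus ?thesis unfolding split
            using mult_pos_pos[OF mult_pos_pos[OF \<epsilon>(2)[of t] pos[OF greater]], of "t - \<tau>"] t by simp
        qed (use \<tau>' in auto)
      qed
      moreover have "insert \<tau> Z \<subseteq> A" using ZA \<tau>(1) by simp
      ultimately show ?thesis using \<epsilon>(1) unfolding A_def by blast
    qed
  qed
qed

section \<open>The even auxiliary polynomial\<close>

definition mirrored_roots :: "nat \<Rightarrow> real set \<Rightarrow> real list" where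
  "mirrored_roots m Z = replicate (2 * m) 0 @ sorted_list_of_set Z @ map uminus (sorted_list_of_set Z)"

lemma length_mirrored_roots: "length (mirrored_roots m Z) = 2 * m + 2 * card Z"
  by (simp add: mirrored_roots_def)

lemma abs_mirrored_roots_le:
  assumes "finite Z" "Z \<subseteq> {0..T}" "T \<ge> 0" "x \<in> set (mirrored_roots m Z)"
  shows "\<bar>x\<bar> \<le> T"
  using assms by (auto simp: mirrored_roots_def split: if_splits)

lemma prod_mirrored_roots:
  fixes w :: "'a::real_normed_field"
  assumes "finite Z"
  shows "(\<Prod>x\<leftarrow>mirrored_roots m Z. w - of_real x) = w ^ (2 * m) * (\<Prod>x\<in>Z. w\<^sup>2 - of_real (x\<^sup>2))"
proof -
  have e: "(\<Prod>x\<leftarrow>sorted_list_of_set Z. f x) = (\<Prod>x\<in>Z. f x)" for f :: "real \<Rightarrow> 'a"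
    using assms prod.distinct_set_conv_list[of "sorted_list_of_set Z" f] by simp
  have "(\<Prod>x\<leftarrow>mirrored_roots m Z. w - of_real x) = w ^ (2 * m) * ((\<Prod>x\<in>Z. w - of_real x) * (\<Prod>x\<in>Z. w + of_real x))"
    unfolding mirrored_roots_def map_append prod_list.append map_map e by (simp add: e o_def)
  also have "(\<Prod>x\<in>Z. w - of_real x) * (\<Prod>x\<in>Z. w + of_real x) = (\<Prod>x\<in>Z. w\<^sup>2 - of_real (x\<^sup>2))"
    unfolding prod.distrib[symmetric] by (intro prod.cong) (auto simp: algebra_simps power2_eq_square)
  finally show ?thesis .
qed

text \<open>\<open>lo x\<close> bounds \<bar>t^2 - x^2\<bar> from below for t in the window [L, 2L].
  Against it, a point w with \<bar>w\<bar> \<le> L/2 loses a factor of at most 2 at each root x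
  \<ge> 4L, and a bounded factor at the at most \<open>n\<close> smaller ones. The power of the
  variable gains 1/4 per unit of \<open>card Z + m\<close>, which outweighs the factors 2.\<close>

lemma mirrored_roots_estimates:
  fixes L \<beta> d :: real and m :: nat and Z :: "real set"
  defines "lo \<equiv> \<lambda>x. if x < 4 * L then \<beta> else x\<^sup>2 - 4 * L\<^sup>2"
  defines "mP \<equiv> L ^ (2 * (card Z + m)) * (\<Prod>x\<in>Z. lo x)"
  assumes Z: "finite Z" "\<And>x. x \<in> Z \<Longrightarrow> x \<ge> 0" "card {x \<in> Z. x < 4 * L} \<le> n"
    and L: "L \<ge> 1" and \<beta>: "0 < \<beta>" "\<beta> \<le> 1" "\<beta> \<le> L * d"
  shows "mP \<ge> \<beta> ^ n"
    and "L \<le> t \<Longrightarrow> t \<le> 2 * L \<Longrightarrow> (\<And>x. x \<in> Z \<Longrightarrow> \<bar>t - x\<bar> \<ge> d) \<Longrightarrow>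
       mP \<le> \<bar>\<Prod>x\<leftarrow>mirrored_roots (card Z + m) Z. t - x\<bar>"
    and "norm (w::complex) \<le> L / 2 \<Longrightarrow>
       norm (\<Prod>x\<leftarrow>mirrored_roots (card Z + m) Z. w - of_real x) \<le> (17 * L\<^sup>2 / \<beta>) ^ n / 4 ^ m * mP"
proof -
  define S where "S = {x \<in> Z. x < 4 * L}"
  have S: "finite S" "S \<subseteq> Z" using Z(1) by (auto simp: S_def)
  have split: "(\<Prod>x\<in>Z. f x) = (\<Prod>x\<in>S. f x) * (\<Prod>x\<in>Z - S. f x)" for f :: "real \<Rightarrow> real"
    using prod.subset_diff[OF S(2) Z(1), of f] by (simp add: mult.commute)
  have L2: "L\<^sup>2 \<ge> 1" using L by (simp add: one_le_power)
  have big: "x\<^sup>2 \<ge> 16 * L\<^sup>2" if "x \<in> Z - S" for x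
    using power_mono[of "4 * L" x 2] L that by (auto simp: S_def power_mult_distrib)
  have lo_big: "lo x = x\<^sup>2 - 4 * L\<^sup>2" "lo x \<ge> 1" if "x \<in> Z - S" for x
    using big[OF that] L2 that by (auto simp: lo_def S_def)
  have lo_small: "lo x = \<beta>" if "x \<in> S" for x using that by (simp add: lo_def S_def)
  have lo_pos: "lo x > 0" if "x \<in> Z" for x
    using lo_big(2)[of x] lo_small[of x] that \<beta>(1) by (cases "x \<in> S") force+
  show "mP \<ge> \<beta> ^ n"
  proof -
    have "\<beta> ^ n \<le> \<beta> ^ card S" using \<beta> Z(3) by (intro power_decreasing) (auto simp: S_def)
    also have "\<dots> = 1 * ((\<Prod>x\<in>S. lo x) * 1)" using lo_small by simp
    also have "\<dots> \<le> L ^ (2 * (card Z + m)) * ((\<Prod>x\<in>S. lo x) * (\<Prod>x\<in>Z - S. lo x))"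
      using L \<beta> lo_small lo_big(2)
      by (intro mult_mono one_le_power prod_ge_1 mult_nonneg_nonneg prod_nonneg) auto
    finally show ?thesis unfolding mP_def split .
  qed
  show "mP \<le> \<bar>\<Prod>x\<leftarrow>mirrored_roots (card Z + m) Z. t - x\<bar>"
    if t: "L \<le> t" "t \<le> 2 * L" "\<And>x. x \<in> Z \<Longrightarrow> \<bar>t - x\<bar> \<ge> d"
  proof -
    have "lo x \<le> \<bar>t\<^sup>2 - x\<^sup>2\<bar>" if x: "x \<in> Z" for x
    proof (cases "x \<in> S")
      case True
      have "\<beta> \<le> L * d" by (rule \<beta>)
      also have "\<dots> \<le> (t + x) * \<bar>t - x\<bar>"
      proof (rule order_trans)
        show "L * d \<le> L * \<bar>t - x\<bar>" using t(3)[OF x] L by (intro mult_left_mono) auto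
        show "L * \<bar>t - x\<bar> \<le> (t + x) * \<bar>t - x\<bar>" using t(1) Z(2)[OF x] by (intro mult_right_mono) auto
      qed
      also have "\<dots> = \<bar>t\<^sup>2 - x\<^sup>2\<bar>"
        using t(1) L Z(2)[OF x] by (simp add: power2_eq_square square_diff_square_factored abs_mult)
      finally show ?thesis using lo_small[OF True] by simp
    next
      case False
      hence "x \<in> Z - S" using x by simp
      moreover have "t\<^sup>2 \<le> 4 * L\<^sup>2" using power_mono[of t "2 * L" 2] t L by (simp add: power_mult_distrib)
      ultimately show ?thesis using lo_big(1)[of x] by simp
    qed
    hence "L ^ (2 * (card Z + m)) * (\<Prod>x\<in>Z. lo x) \<le> t ^ (2 * (card Z + m)) * (\<Prod>x\<in>Z. \<bar>t\<^sup>2 - x\<^sup>2\<bar>)"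
      using t(1) L lo_pos by (intro mult_mono power_mono prod_mono prod_nonneg zero_le_power) (auto intro: less_imp_le)
    also have "\<dots> = \<bar>\<Prod>x\<leftarrow>mirrored_roots (card Z + m) Z. t - of_real x\<bar>"
      unfolding prod_mirrored_roots[OF Z(1)] using t(1) L by (simp add: abs_mult abs_prod power_abs)
    finally show ?thesis unfolding mP_def by simp
  qed
  show "norm (\<Prod>x\<leftarrow>mirrored_roots (card Z + m) Z. w - of_real x) \<le> (17 * L\<^sup>2 / \<beta>) ^ n / 4 ^ m * mP"
    if w: "norm w \<le> L / 2"
  proof -
    \<comment> \<open>For roots below 4L one has x^2 \<le> 16 L^2, and \<bar>w\<bar>^2 adds at most
      L^2/4.\<close>
    define \<gamma> where "\<gamma> = 17 * L\<^sup>2 / \<beta>"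
    have \<gamma>: "\<gamma> \<ge> 1" using L2 \<beta> by (simp add: \<gamma>_def field_simps)
    have w2: "(norm w)\<^sup>2 \<le> L\<^sup>2 / 4" using power_mono[OF w, of 2] by (simp add: power_divide)
    have tri: "norm (w\<^sup>2 - of_real (x\<^sup>2)) \<le> L\<^sup>2 / 4 + x\<^sup>2" for x
      using norm_triangle_ineq4[of "w\<^sup>2" "of_real (x\<^sup>2)"] w2 by (simp add: norm_power)
    have small: "norm (w\<^sup>2 - of_real (x\<^sup>2)) \<le> \<gamma> * lo x" if "x \<in> S" for x
    proof -
      have "x\<^sup>2 \<le> 16 * L\<^sup>2" using power_mono[of x "4 * L" 2] Z(2)[of x] that by (auto simp: S_def power_mult_distrib)
      moreover have "\<gamma> * lo x = 17 * L\<^sup>2" using lo_small[OF that] \<beta> by (simp add: \<gamma>_def)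
      ultimately show ?thesis using tri[of x] L2 by linarith
    qed
    have bigx: "norm (w\<^sup>2 - of_real (x\<^sup>2)) \<le> 2 * lo x" if "x \<in> Z - S" for x
      using tri[of x] big[OF that] lo_big(1)[OF that] L2 by linarith
    have "(\<Prod>x\<in>Z. norm (w\<^sup>2 - of_real (x\<^sup>2))) \<le> (\<Prod>x\<in>S. \<gamma> * lo x) * (\<Prod>x\<in>Z - S. 2 * lo x)"
      unfolding split using small bigx \<gamma> lo_pos S(2)
      by (intro mult_mono prod_mono prod_nonneg) (auto intro!: mult_nonneg_nonneg less_imp_le[OF lo_pos])
    also have "\<dots> = \<gamma> ^ card S * 2 ^ card (Z - S) * (\<Prod>x\<in>Z. lo x)"
      unfolding split[of lo] by (simp add: prod.distrib)
    also have "\<dots> \<le> \<gamma> ^ n * 4 ^ card Z * (\<Prod>x\<in>Z. lo x)"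
    proof (intro mult_right_mono mult_mono prod_nonneg)
      show "\<gamma> ^ card S \<le> \<gamma> ^ n" using \<gamma> Z(3) by (intro power_increasing) (auto simp: S_def)
      have "card (Z - S) \<le> card Z" using Z(1) by (intro card_mono) auto
      hence "(2::real) ^ card (Z - S) \<le> 2 ^ card Z" by (intro power_increasing) auto
      also have "(2::real) ^ card Z \<le> 4 ^ card Z" by (intro power_mono) auto
      finally show "(2::real) ^ card (Z - S) \<le> 4 ^ card Z" .
    qed (use \<gamma> lo_pos in \<open>auto intro: less_imp_le\<close>)
    finally have 1: "(\<Prod>x\<in>Z. norm (w\<^sup>2 - of_real (x\<^sup>2))) \<le> \<gamma> ^ n * 4 ^ card Z * (\<Prod>x\<in>Z. lo x)" .
    have "norm (\<Prod>x\<leftarrow>mirrored_roots (card Z + m) Z. w - of_real x) = ((norm w)\<^sup>2) ^ (card Z + m) * (\<Prod>x\<in>Z. norm (w\<^sup>2 - of_real (x\<^sup>2)))"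
      unfolding prod_mirrored_roots[OF Z(1)] by (simp add: norm_mult norm_power prod_norm flip: power_mult)
    \<comment> \<open>Here the multiplicity at the origin pays: 4^(-card Z) cancels the loss at the
      roots, and 4^(-m) remains.\<close>
    also have "\<dots> \<le> (L\<^sup>2 / 4) ^ (card Z + m) * (\<gamma> ^ n * 4 ^ card Z * (\<Prod>x\<in>Z. lo x))"
      by (intro mult_mono power_mono w2 1 prod_nonneg) auto
    also have "\<dots> = \<gamma> ^ n / 4 ^ m * mP"
      by (simp add: mP_def power_divide power_add power_mult[symmetric] distrib_left)
    finally show ?thesis unfolding \<gamma>_def .
  qed
qed

section \<open>Size of the error terms\<close>

lemma inverse_pochhammer_series_growth:
  assumes "h > 0" "0 \<le> R" "R \<le> b * X + R0" "X \<ge> 1" "b \<ge> 0" "R0 \<ge> 0"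
  shows "inverse_pochhammer_series h R \<le> (1 + (b + R0) / h * exp R0) * (X * exp (b * X))"
proof -
  have "R \<le> (b + R0) * X"
    using assms mult_left_mono[of 1 X R0] by (simp add: distrib_right)
  hence 1: "R / h \<le> (b + R0) / h * X" using assms by (simp add: field_simps)
  have 2: "exp R \<le> exp R0 * exp (b * X)" using assms by (simp flip: exp_add)
  have "1 * 1 \<le> X * exp (b * X)" using assms by (intro mult_mono) auto
  moreover have "R / h * exp R \<le> ((b + R0) / h * X) * (exp R0 * exp (b * X))"
    using assms by (intro mult_mono 1 2) auto
  ultimately have "1 + R / h * exp R \<le> (1 + (b + R0) / h * exp R0) * (X * exp (b * X))"
    by (simp add: algebra_simps)
  thus ?thesis using inverse_pochhammer_series(2)[OF assms(1,2)] by linarith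
qed

text \<open>The origin of the logarithm in the theorem: a base of size X^3 to the power D is exp(3 D
  ln X), so degrees up to 2 c X / ln X cost only exp(6 c X).\<close>

lemma power_growth:
  fixes X B c :: real
  assumes "X > 1" "0 \<le> B" "B \<le> X ^ 3" "real D \<le> 2 * c * X / ln X + real n"
  shows "B ^ D \<le> exp (6 * c * X) * X ^ (3 * n)"
proof -
  have lnX: "ln X > 0" using assms by simp
  have "B ^ D \<le> (X ^ 3) ^ D" using assms by (intro power_mono) auto
  also have "\<dots> = exp (3 * (real D * ln X))"
    using assms by (simp add: powr_realpow[symmetric] powr_def mult_ac flip: power_mult)
  also have "\<dots> \<le> exp (3 * (2 * c * X + real n * ln X))"
  proof -
    have "real D * ln X \<le> (2 * c * X / ln X + real n) * ln X" using assms lnX by (intro mult_right_mono) auto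
    also have "\<dots> = 2 * c * X + real n * ln X" using lnX by (simp add: distrib_right)
    finally show ?thesis by simp
  qed
  also have "\<dots> = exp (6 * c * X) * X ^ (3 * n)"
    using assms by (simp add: exp_add distrib_left powr_realpow[symmetric] powr_def mult_ac)
  finally show ?thesis .
qed

lemma eventually_power_exp_small:
  assumes "b > 0" "\<epsilon> > 0"
  shows "eventually (\<lambda>X::real. K * X ^ k * exp (- b * X) \<le> \<epsilon>) at_top"
proof -
  have "filterlim (\<lambda>X. b * X) at_top at_top"
    using assms by (intro filterlim_tendsto_pos_mult_at_top[OF tendsto_const _ filterlim_ident]) auto
  hence "((\<lambda>X. (b * X) ^ k / exp (b * X)) \<longlongrightarrow> 0) at_top"
    by (rule filterlim_compose[OF tendsto_power_div_exp_0])
  hence "((\<lambda>X. K / b ^ k * ((b * X) ^ k / exp (b * X))) \<longlongrightarrow> 0) at_top"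
    by (rule tendsto_mult_right_zero)
  hence "((\<lambda>X. K * X ^ k * exp (- b * X)) \<longlongrightarrow> 0) at_top"
    using assms by (simp add: power_mult_distrib exp_minus field_simps)
  from order_tendstoD(2)[OF this assms(2)] show ?thesis by (rule eventually_mono) simp
qed

text \<open>Here \<delta> = A/X and T = X^2. In the moment error \<open>theta_part_sup\<close> gives
  exp(-3 b X), while the polynomial and Kummer's function each use at most exp(b X). In the tail A
  \<ge> 16 gives exp(-2 X), A \<ge> 16 y limits Kummer's function to exp(X/2), and the polynomial
  takes at most exp(X). The surplus decay beats every power of X.\<close>

lemma error_terms_small:
  fixes \<alpha> y M A b c :: real
  assumes "\<alpha> > 0" "y \<ge> 0" "M \<ge> 0" "C > 0" "\<epsilon> > 0"
    and A: "A = 16 * (1 + y)" and b: "b = pi * \<alpha> / (36 * A)" "8 * y / A \<le> b"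
    and c: "c > 0" "6 * c \<le> b" "6 * c \<le> 1"
  shows "\<forall>\<^sub>F X in at_top. \<forall>D. real D \<le> 2 * c * X / ln X + real n \<longrightarrow>
     moment_error \<alpha> y M (A / X) (X\<^sup>2) D \<le> \<epsilon> \<and>
     C / (A / X) ^ N * inverse_pochhammer_series (\<alpha> / 2) (8 * y / (A / X)) * (fact D * (8 / (A / X)) ^ D)
       * exp (- (A / X) * X\<^sup>2 / 8) * (8 / (A / X)) \<le> \<epsilon>"
proof -
  have A16: "A \<ge> 16" "A \<ge> 16 * y" using assms by auto
  have b0: "b > 0" using assms A16 by (simp add: b)
  define h where "h = \<alpha> / 2"
  have h: "h > 0" using assms by (simp add: h_def)
  define R1 where "R1 = 2 * y * (1 + \<alpha> / 4)"
  have R1: "R1 \<ge> 0" using assms by (simp add: R1_def)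
  define K1 where "K1 = exp \<alpha> * 320 powr \<alpha> * (1 + (b + R1) / h * exp R1)"
  define K2 where "K2 = C / A ^ N * (1 + (1 / 2 + 0) / h * exp 0)"
  have K: "K1 \<ge> 0" "K2 \<ge> 0" using b0 h R1 assms(4) A16 by (auto simp: K1_def K2_def)
  have ev: "\<forall>\<^sub>F X in at_top. K1 * X ^ (3 * n + 1) * exp (- b * X) \<le> \<epsilon>"
      "\<forall>\<^sub>F X in at_top. K2 * X ^ (N + 3 * n + 2) * exp (- (1 / 2) * X) \<le> \<epsilon>"
      "\<forall>\<^sub>F X in at_top. X > (1 :: real)"
      "\<forall>\<^sub>F X in at_top. 2 * c * X / ln X + real n \<le> X"
      "\<forall>\<^sub>F X in at_top. 2 * (X\<^sup>2 + M + X\<^sup>2 / 4) \<le> X ^ 3"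
    using b0 assms(5) by (auto intro!: eventually_power_exp_small) real_asymp+
  from ev show ?thesis
  proof eventually_elim
    case (elim X)
    show ?case
    proof (intro allI impI)
      fix D :: nat assume D: "real D \<le> 2 * c * X / ln X + real n"
      have X: "X > 1" by (rule elim)
      have DX: "real D \<le> X" using D elim by linarith
      have X8: "8 / (A / X) \<le> X / 2" "8 / (A / X) \<ge> 0" using A16 X by (auto simp: field_simps)
      have DX8: "real D * (8 / (A / X)) \<le> X * (X / 2)"
        using DX X8 X by (intro mult_mono) auto
      define B1 where "B1 = (X\<^sup>2 + M + 4 * real D / (A / X)) * 2"
      have "B1 \<le> X ^ 3" using DX8 elim(5) by (simp add: B1_def power2_eq_square)
      moreover have B1: "B1 \<ge> 0" using X A16 assms by (simp add: B1_def)
      ultimately have P1: "B1 ^ D \<le> exp (6 * c * X) * X ^ (3 * n)"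
        by (intro power_growth X D) auto
      have E1: "inverse_pochhammer_series h (2 * y * (4 / (A / X) + 1 + \<alpha> / 4))
           \<le> (1 + (b + R1) / h * exp R1) * (X * exp (b * X))"
      proof (rule inverse_pochhammer_series_growth)
        have "8 * y / A * X \<le> b * X" using b(2) X by (intro mult_right_mono) auto
        thus "2 * y * (4 / (A / X) + 1 + \<alpha> / 4) \<le> b * X + R1" by (simp add: R1_def algebra_simps)
        show "2 * y * (4 / (A / X) + 1 + \<alpha> / 4) \<ge> 0" using assms(1,2) X A16 by simp
      qed (use h X b0 R1 in auto)
      have "moment_error \<alpha> y M (A / X) (X\<^sup>2) D =
         exp \<alpha> * 320 powr \<alpha> * exp (- (3 * b * X)) * B1 ^ D * inverse_pochhammer_series h (2 * y * (4 / (A / X) + 1 + \<alpha> / 4))"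
      proof -
        have "pi * \<alpha> / (12 * (A / X)) = 3 * b * X" by (simp add: b(1))
        show ?thesis
          unfolding moment_error_def theta_part_sup_def h_def \<open>pi * \<alpha> / (12 * (A / X)) = 3 * b * X\<close> B1_def power_mult_distrib
          by (simp only: mult.assoc)
      qed
      also have "\<dots> \<le> exp \<alpha> * 320 powr \<alpha> * exp (- (3 * b * X)) * (exp (6 * c * X) * X ^ (3 * n)) * ((1 + (b + R1) / h * exp R1) * (X * exp (b * X)))"
        using h assms(1,2) X A16 B1 by (intro mult_mono P1 E1 order_refl mult_nonneg_nonneg inverse_pochhammer_series(3) zero_le_power) auto
      also have "\<dots> = K1 * X ^ (3 * n + 1) * exp (- (3 * b * X) + 6 * c * X + b * X)"
        unfolding K1_def exp_add by (simp only: power_add power_one_right mult_ac)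
      also have "\<dots> \<le> K1 * X ^ (3 * n + 1) * exp (- b * X)"
      proof -
        have "6 * c * X \<le> b * X" using c X by (intro mult_right_mono) auto
        hence "exp (- (3 * b * X) + 6 * c * X + b * X) \<le> exp (- b * X)" unfolding exp_le_cancel_iff by linarith
        thus ?thesis using K X by (intro mult_left_mono) auto
      qed
      finally have 1: "moment_error \<alpha> y M (A / X) (X\<^sup>2) D \<le> \<epsilon>" using elim(1) by linarith
      define G where "G = fact D * (8 / (A / X)) ^ D"
      have G0: "G \<ge> 0" using X8(2) by (simp add: G_def del: divide_divide_eq_right)
      have P2: "G \<le> exp (6 * c * X) * X ^ (3 * n)"
        unfolding G_def
      proof -
        have "fact D * (8 / (A / X)) ^ D \<le> real D ^ D * (8 / (A / X)) ^ D"
          using fact_le_power[of D, where ?'a = real] X8 by (intro mult_right_mono) auto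
        also have "\<dots> = (real D * (8 / (A / X))) ^ D" by (simp only: power_mult_distrib)
        also have "\<dots> \<le> exp (6 * c * X) * X ^ (3 * n)"
        proof (intro power_growth X D)
          have "X * (X / 2) \<le> X * (X * X)" using X by (intro mult_left_mono) auto
          thus "real D * (8 / (A / X)) \<le> X ^ 3" using DX8 by (simp add: power3_eq_cube)
        qed (intro mult_nonneg_nonneg of_nat_0_le_iff X8)
        finally show "fact D * (8 / (A / X)) ^ D \<le> exp (6 * c * X) * X ^ (3 * n)" .
      qed
      have E2: "inverse_pochhammer_series h (8 * y / (A / X)) \<le> (1 + (1 / 2 + 0) / h * exp 0) * (X * exp (1 / 2 * X))"
      proof (rule inverse_pochhammer_series_growth)
        have "16 * y * X \<le> A * X" using A16 X by (intro mult_right_mono) auto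
        thus "8 * y / (A / X) \<le> 1 / 2 * X + 0" using A16 X by (simp add: field_simps)
      qed (use h X assms(2) A16 in auto)
      have "C / (A / X) ^ N * inverse_pochhammer_series h (8 * y / (A / X)) * G
         * exp (- (A / X) * X\<^sup>2 / 8) * (8 / (A / X))
        \<le> C / (A / X) ^ N * ((1 + (1 / 2 + 0) / h * exp 0) * (X * exp (1 / 2 * X))) * (exp (6 * c * X) * X ^ (3 * n))
         * exp (- 2 * X) * X"
      proof (intro mult_mono E2 P2 G0 order_refl mult_nonneg_nonneg)
        have "16 * X \<le> A * X" using A16 X by (intro mult_right_mono) auto
        thus "exp (- (A / X) * X\<^sup>2 / 8) \<le> exp (- 2 * X)" using X by (simp add: power2_eq_square)
        show "8 / (A / X) \<le> X" using X8(1) X by linarith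
        show "inverse_pochhammer_series h (8 * y / (A / X)) \<ge> 0"
          using h assms(2) X A16 by (intro inverse_pochhammer_series(3)) auto
      qed (use X A16 h assms(4) in auto)
      also have "\<dots> = K2 * X ^ (N + 3 * n + 2) * exp (1 / 2 * X + 6 * c * X + - 2 * X)"
      proof -
        have "C / (A / X) ^ N = C / A ^ N * X ^ N" using X by (simp add: power_divide)
        thus ?thesis unfolding K2_def exp_add power_add by (simp only: power2_eq_square mult_ac)
      qed
      also have "\<dots> \<le> K2 * X ^ (N + 3 * n + 2) * exp (- (1 / 2) * X)"
      proof -
        have "6 * c * X \<le> 1 * X" using c X by (intro mult_right_mono) auto
        hence "exp (1 / 2 * X + 6 * c * X + - 2 * X) \<le> exp (- (1 / 2) * X)" unfolding exp_le_cancel_iff by linarith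
        thus ?thesis using K X by (intro mult_left_mono) auto
      qed
      finally show "moment_error \<alpha> y M (A / X) (X\<^sup>2) D \<le> \<epsilon> \<and>
         C / (A / X) ^ N * inverse_pochhammer_series (\<alpha> / 2) (8 * y / (A / X)) * (fact D * (8 / (A / X)) ^ D)
         * exp (- (A / X) * X\<^sup>2 / 8) * (8 / (A / X)) \<le> \<epsilon>"
        using 1 elim(2) unfolding h_def G_def by linarith
    qed
  qed
qed

section \<open>The window against the moment\<close>

context shifted_Phi_series
begin

text \<open>The signed integrand is at least \<kappa> m on the window, where the weight exp(\<omega>
  t) is at least 1 because t \<ge> 0; it is nonnegative on the rest of (-T, T) and small beyond. Its
  integral is at most the modulus of the moment.\<close>

lemma window_inequality:
  assumes \<delta>: "0 < \<delta>" "\<delta> \<le> 1 / 100" and T: "T \<ge> 0" "\<And>x. x \<in> set rs \<Longrightarrow> \<bar>x\<bar> \<le> T"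
    and W: "\<And>w. norm w \<le> M + \<alpha> / 4 \<Longrightarrow> norm (poly (root_poly rs) w) \<le> W"
    and H: "\<And>t. norm (F_series t) \<le> H * exp (- (pi / 2 - \<delta> / 2) * \<bar>t\<bar>)" "H \<ge> 0"
    and sgn: "\<bar>\<sigma>\<bar> = 1" "\<And>t. \<bar>t\<bar> < T \<Longrightarrow> \<sigma> * Re (F_series t) * (\<Prod>x\<leftarrow>rs. t - x) \<ge> 0"
    and win: "0 \<le> t1 - d" "t1 + d < T" "d > 0" "\<kappa> \<ge> 0" "m \<ge> 0"
      "\<And>t. \<bar>t - t1\<bar> \<le> d \<Longrightarrow> \<bar>Re (F_series t)\<bar> \<ge> \<kappa>"
      "\<And>t. \<bar>t - t1\<bar> \<le> d \<Longrightarrow> \<bar>\<Prod>x\<leftarrow>rs. t - x\<bar> \<ge> m"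
  shows "2 * d * \<kappa> * m \<le>
     c_sum * (2 * (exp (2 * M) * (8 * pi * exp y * W + 4 * pi * moment_error \<alpha> y M \<delta> T (length rs))))
     + H * (fact (length rs) * (8 / \<delta>) ^ length rs) * exp (- \<delta> * T / 8) * (8 / \<delta>) * (LINT u|lborel. exp (- \<bar>u\<bar> :: real))"
proof -
  define D where "D = length rs"
  define p where "p = (\<lambda>t::real. \<Prod>x\<leftarrow>rs. t - x)"
  define f where "f = (\<lambda>t. Re (F_series t))"
  define \<omega> where "\<omega> = pi / 2 - \<delta>"
  have \<omega>: "\<omega> \<ge> 0" using \<delta> pi_gt3 by (simp add: \<omega>_def)
  have Ff: "F_series t = of_real (f t)" for t using F_series_real[of t] by (simp add: f_def)
  have "(\<Prod>x\<leftarrow>xs. complex_of_real t - of_real x) = of_real (\<Prod>x\<leftarrow>xs. t - x)" for t xs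
    by (induction xs) auto
  hence poly: "poly (root_poly rs) (of_real t) = of_real (p t)" for t
    by (simp add: poly_root_poly p_def)
  have eq: "F_series t * (poly (root_poly rs) (of_real t) * of_real (exp ((pi / 2 - \<delta>) * t))) = of_real (f t * (p t * exp (\<omega> * t)))" for t
    by (simp add: Ff poly \<omega>_def)
  note mom = F_series_moment[OF \<delta> T W, unfolded eq]
  define g where "g = (\<lambda>t. \<sigma> * (f t * (p t * exp (\<omega> * t))))"
  have int_g: "integrable lborel g"
    using integrable_Re[OF mom(1)] unfolding g_def by (intro integrable_mult_right) simp
  have "(LINT t|lborel. g t) \<le> \<bar>\<sigma> * (LINT t|lborel. f t * (p t * exp (\<omega> * t)))\<bar>"
    unfolding g_def integral_mult_right_zero by (rule abs_ge_self)
  also have "\<dots> = norm (complex_of_real (LINT t|lborel. f t * (p t * exp (\<omega> * t))))"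
    using sgn(1) by (simp add: abs_mult)
  also have "\<dots> \<le> c_sum * (2 * (exp (2 * M) * (8 * pi * exp y * W + 4 * pi * moment_error \<alpha> y M \<delta> T (length rs))))"
    using mom(2) unfolding integral_complex_of_real .
  finally have upper: "(LINT t|lborel. g t) \<le> c_sum * (2 * (exp (2 * M) * (8 * pi * exp y * W + 4 * pi * moment_error \<alpha> y M \<delta> T (length rs))))" .
  define V where "V = H * (fact D * (8 / \<delta>) ^ D) * exp (- \<delta> * T / 8)"
  have V0: "V \<ge> 0" using H(2) \<delta> by (simp add: V_def)
  \<comment> \<open>A minorant of the integrand on the whole line whose integral is
    explicit.\<close>
  define u where "u = (\<lambda>t. \<kappa> * m * indicator {t1 - d..t1 + d} t - V * exp (- (\<delta> / 8) * \<bar>t\<bar>))"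
  have int_ind: "integrable lborel (indicator {t1 - d..t1 + d} :: real \<Rightarrow> real)"
    by (rule integrable_real_indicator) (use win(3) in auto)
  have int_u: "integrable lborel u" unfolding u_def
    using \<delta> by (intro Bochner_Integration.integrable_diff integrable_mult_right integrable_exp_abs int_ind) auto
  have gu: "u t \<le> g t" for t
  proof (cases "\<bar>t\<bar> < T")
    case True
    have fp: "\<sigma> * f t * p t \<ge> 0" using sgn(2)[OF True] by (simp add: f_def p_def)
    have V1: "V * exp (- (\<delta> / 8) * \<bar>t\<bar>) \<ge> 0" using V0 by simp
    have geq: "g t = \<sigma> * f t * p t * exp (\<omega> * t)" by (simp add: g_def)
    show ?thesis
    proof (cases "t \<in> {t1 - d..t1 + d}")
      case t: True
      hence t': "\<bar>t - t1\<bar> \<le> d" "t \<ge> 0" using win(1) by auto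
      have "\<kappa> * m * 1 \<le> (\<bar>f t\<bar> * \<bar>p t\<bar>) * exp (\<omega> * t)"
        using win(6,7)[OF t'(1)] win(4,5) \<omega> t'(2) by (intro mult_mono) (auto simp: f_def p_def)
      also have "\<bar>f t\<bar> * \<bar>p t\<bar> = \<bar>\<sigma> * f t * p t\<bar>" using sgn(1) by (simp add: abs_mult)
      also have "\<dots> = \<sigma> * f t * p t" using fp by simp
      finally show ?thesis using V1 t unfolding geq u_def by simp
    next
      case False
      thus ?thesis using V1 mult_nonneg_nonneg[OF fp, of "exp (\<omega> * t)"] unfolding geq u_def by simp
    qed
  next
    case False
    hence tT: "\<bar>t\<bar> \<ge> T" by simp
    have "t \<notin> {t1 - d..t1 + d}" using tT win(1,2) by auto
    hence ut: "u t = - (V * exp (- (\<delta> / 8) * \<bar>t\<bar>))" by (simp add: u_def)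
    have pb: "\<bar>p t\<bar> \<le> (2 * \<bar>t\<bar>) ^ D"
    proof -
      have "\<bar>\<Prod>x\<leftarrow>xs. t - x\<bar> \<le> (2 * \<bar>t\<bar>) ^ length xs" if "\<And>x. x \<in> set xs \<Longrightarrow> \<bar>x\<bar> \<le> T" for xs
        using that
      proof (induction xs)
        case (Cons x xs)
        have "\<bar>t - x\<bar> \<le> 2 * \<bar>t\<bar>" using Cons.prems[of x] tT by simp
        thus ?case using Cons by (auto simp: abs_mult intro!: mult_mono)
      qed simp
      thus ?thesis using T(2) by (simp add: p_def D_def)
    qed
    \<comment> \<open>Beyond T every factor of the polynomial is at most 2\<bar>t\<bar>; the
      resulting power is traded for exp(\<delta> \<bar>t\<bar>/4).\<close>
    have pw: "(2 * \<bar>t\<bar>) ^ D \<le> fact D * (8 / \<delta>) ^ D * exp (\<delta> / 4 * \<bar>t\<bar>)"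
    proof -
      have "(\<delta> / 4 * \<bar>t\<bar>) ^ D / fact D \<le> exp (\<delta> / 4 * \<bar>t\<bar>)" using \<delta> by (intro power_div_fact_le_exp) auto
      hence "(8 / \<delta>) ^ D * (\<delta> / 4 * \<bar>t\<bar>) ^ D \<le> (8 / \<delta>) ^ D * (fact D * exp (\<delta> / 4 * \<bar>t\<bar>))"
        using \<delta> by (intro mult_left_mono) (auto simp: field_simps)
      moreover have "(8 / \<delta>) ^ D * (\<delta> / 4 * \<bar>t\<bar>) ^ D = (2 * \<bar>t\<bar>) ^ D"
        unfolding power_mult_distrib[symmetric] using \<delta> by simp
      ultimately show ?thesis by (simp add: mult_ac)
    qed
    have "\<bar>g t\<bar> = norm (F_series t) * \<bar>p t\<bar> * exp (\<omega> * t)" using sgn(1) by (simp add: g_def abs_mult Ff)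
    also have "\<dots> \<le> (H * exp (- (pi / 2 - \<delta> / 2) * \<bar>t\<bar>)) * (fact D * (8 / \<delta>) ^ D * exp (\<delta> / 4 * \<bar>t\<bar>)) * exp (\<omega> * \<bar>t\<bar>)"
    proof (intro mult_mono H)
      show "\<bar>p t\<bar> \<le> fact D * (8 / \<delta>) ^ D * exp (\<delta> / 4 * \<bar>t\<bar>)" using pb pw by linarith
      show "exp (\<omega> * t) \<le> exp (\<omega> * \<bar>t\<bar>)" using \<omega> by (simp add: mult_left_mono)
    qed (use H(2) \<delta> in auto)
    also have "\<dots> = H * (fact D * (8 / \<delta>) ^ D) * exp (- (\<delta> / 4) * \<bar>t\<bar>)"
    proof -
      have "exp (- (pi / 2 - \<delta> / 2) * \<bar>t\<bar>) * exp (\<delta> / 4 * \<bar>t\<bar>) * exp (\<omega> * \<bar>t\<bar>) = exp (- (\<delta> / 4) * \<bar>t\<bar>)"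
        by (simp add: \<omega>_def algebra_simps flip: exp_add)
      thus ?thesis by (simp add: mult_ac)
    qed
    \<comment> \<open>The remaining decay \<delta>/4 is halved: one part is evaluated at T and makes
      the tail small, the other keeps it integrable.\<close>
    also have "\<dots> \<le> H * (fact D * (8 / \<delta>) ^ D) * (exp (- \<delta> * T / 8) * exp (- (\<delta> / 8) * \<bar>t\<bar>))"
    proof (intro mult_left_mono)
      have "\<delta> * T \<le> \<delta> * \<bar>t\<bar>" using \<delta> tT by (intro mult_left_mono) auto
      thus "exp (- (\<delta> / 4) * \<bar>t\<bar>) \<le> exp (- \<delta> * T / 8) * exp (- (\<delta> / 8) * \<bar>t\<bar>)" by (simp flip: exp_add)
    qed (use H(2) \<delta> in auto)
    finally show ?thesis unfolding ut V_def by (simp add: mult_ac)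
  qed
  have "(LINT t|lborel. u t) = \<kappa> * m * (2 * d) - V * ((LINT u|lborel. exp (- \<bar>u\<bar> :: real)) / (\<delta> / 8))"
  proof -
    have "(LINT t|lborel. u t) = (LINT t|lborel. \<kappa> * m * indicator {t1 - d..t1 + d} t) - (LINT t|lborel. V * exp (- (\<delta> / 8) * \<bar>t\<bar>))"
      unfolding u_def using \<delta> by (intro Bochner_Integration.integral_diff integrable_mult_right integrable_exp_abs int_ind) auto
    thus ?thesis using integral_exp_abs[of "\<delta> / 8"] \<delta> win(3) by simp
  qed
  moreover have "(LINT t|lborel. u t) \<le> (LINT t|lborel. g t)" by (intro integral_mono int_u int_g gu)
  ultimately have "\<kappa> * m * (2 * d) - V * ((LINT u|lborel. exp (- \<bar>u\<bar> :: real)) / (\<delta> / 8)) \<le>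
     c_sum * (2 * (exp (2 * M) * (8 * pi * exp y * W + 4 * pi * moment_error \<alpha> y M \<delta> T (length rs))))"
    using upper by linarith
  thus ?thesis by (simp add: V_def D_def mult_ac)
qed

lemma exists_nonzero_window:
  assumes "finite {t \<in> {0..2 * L}. F_series t = 0}" "L > 0"
  obtains t1 d \<kappa> where "d > 0" "\<kappa> > 0" "L \<le> t1 - d" "t1 + d \<le> 2 * L"
    "\<And>t. \<bar>t - t1\<bar> \<le> d \<Longrightarrow> \<bar>Re (F_series t)\<bar> \<ge> \<kappa>"
    "\<And>t x. \<bar>t - t1\<bar> \<le> d \<Longrightarrow> F_series x = 0 \<Longrightarrow> \<bar>t - x\<bar> \<ge> d"
proof -
  have "infinite {L<..<2 * L}" using assms(2) by (intro infinite_Ioo) auto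
  then obtain t1 where t1: "L < t1" "t1 < 2 * L" "F_series t1 \<noteq> 0"
    using finite_subset[OF _ assms(1), of "{L<..<2 * L}"] assms(2) by fastforce
  define \<kappa> where "\<kappa> = norm (F_series t1) / 2"
  have \<kappa>: "\<kappa> > 0" using t1 by (simp add: \<kappa>_def)
  obtain e where e: "e > 0" "\<And>t. \<bar>t - t1\<bar> < e \<Longrightarrow> dist (F_series t) (F_series t1) < \<kappa>"
    using continuous_F_series \<kappa> unfolding continuous_on_iff dist_real_def by (metis UNIV_I)
  have big: "norm (F_series t) \<ge> \<kappa>" if "\<bar>t - t1\<bar> < e" for t
    using e(2)[OF that] norm_triangle_ineq2[of "F_series t1" "F_series t"]
    by (simp add: \<kappa>_def dist_norm norm_minus_commute)
  \<comment> \<open>F has no zero within e of t1, so with d \<le> e/2 each point of the window is at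
    least d away from every zero.\<close>
  define d where "d = min (e / 2) (min (t1 - L) (2 * L - t1))"
  have d: "d > 0" using e(1) t1 by (simp add: d_def)
  have d': "d \<le> e / 2" "d \<le> t1 - L" "d \<le> 2 * L - t1" unfolding d_def by linarith+
  show ?thesis
  proof (rule that[of d \<kappa> t1])
    fix t assume t: "\<bar>t - t1\<bar> \<le> d"
    hence "norm (F_series t) \<ge> \<kappa>" using d'(1) e(1) by (intro big) linarith
    moreover have "norm (F_series t) = \<bar>Re (F_series t)\<bar>"
      using F_series_real[of t] by (metis norm_of_real of_real_Re)
    ultimately show "\<bar>Re (F_series t)\<bar> \<ge> \<kappa>" by simp
    fix x assume "F_series x = 0"
    hence "\<not> \<bar>x - t1\<bar> < e" using big[of x] \<kappa> by auto
    thus "\<bar>t - x\<bar> \<ge> d" using t d'(1) by linarith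
  qed (use d d' \<kappa> in linarith)+
qed

text \<open>If some bounded interval contains infinitely many zeros, the claim is vacuous for large
  T. Otherwise the window, the number of zeros below 4L and the extra multiplicity are fixed before
  T, and only the degree grows with the number of zeros up to T.\<close>

lemma many_zeros:
  assumes "y \<le> pi * \<alpha> / 288"
  shows "\<exists>c>0. \<forall>\<^sub>F T in at_top. finite {t \<in> {0..T}. F_series t = 0} \<longrightarrow>
      c * (sqrt T / ln T) \<le> real (card {t \<in> {0..T}. F_series t = 0})"
proof (cases "\<forall>T. finite {t \<in> {0..T}. F_series t = 0}")
  case False
  then obtain T0 where T0: "infinite {t \<in> {0..T0}. F_series t = 0}" by blast
  have "infinite {t \<in> {0..T}. F_series t = 0}" if "T \<ge> T0" for T
    using T0 by (rule contrapos_nn) (rule finite_subset, use that in auto)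
  hence "\<forall>\<^sub>F T in at_top. infinite {t \<in> {0..T}. F_series t = 0}"
    by (auto simp: eventually_at_top_linorder)
  hence "\<forall>\<^sub>F T in at_top. finite {t \<in> {0..T}. F_series t = 0} \<longrightarrow>
      1 * (sqrt T / ln T) \<le> real (card {t \<in> {0..T}. F_series t = 0})"
    by (rule eventually_mono) simp
  thus ?thesis using zero_less_one by blast
next
  case True
  define Zr where "Zr = (\<lambda>T. {t \<in> {0..T}. F_series t = 0})"
  have fin: "finite (Zr T)" for T using True by (simp add: Zr_def)
  \<comment> \<open>Places all evaluation points of the polynomial in the disc of radius
    L/2.\<close>
  define L where "L = max 1 (2 * (M + \<alpha> / 4))"
  have L: "L \<ge> 1" "M + \<alpha> / 4 \<le> L / 2" by (auto simp: L_def)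
  have L0: "L > 0" using L(1) by linarith
  obtain t1 d \<kappa> where w: "d > 0" "\<kappa> > 0" "L \<le> t1 - d" "t1 + d \<le> 2 * L"
    "\<And>t. \<bar>t - t1\<bar> \<le> d \<Longrightarrow> \<bar>Re (F_series t)\<bar> \<ge> \<kappa>"
    "\<And>t x. \<bar>t - t1\<bar> \<le> d \<Longrightarrow> F_series x = 0 \<Longrightarrow> \<bar>t - x\<bar> \<ge> d"
    by (rule exists_nonzero_window[OF True[rule_format] L0]) (rule that)
  define \<beta> where "\<beta> = min 1 (L * d)"
  have \<beta>: "0 < \<beta>" "\<beta> \<le> 1" "\<beta> \<le> L * d" using L w(1) by (auto simp: \<beta>_def)
  define n0 where "n0 = card (Zr (4 * L))"
  define \<gamma> where "\<gamma> = 17 * L\<^sup>2 / \<beta>"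
  define Q where "Q = c_sum * (2 * (exp (2 * M) * (8 * pi * exp y))) * \<gamma> ^ n0"
  \<comment> \<open>The main terms of the moment then take at most half of the lower bound 2 d
    \<kappa> mP from the window.\<close>
  obtain m0 where m0: "Q / (d * \<kappa>) < 4 ^ m0" using real_arch_pow[of 4] by auto
  have Q: "Q / 4 ^ m0 \<le> d * \<kappa>" using m0 w(1,2) by (simp add: field_simps)
  define K1 where "K1 = (LINT u|lborel. exp (- \<bar>u\<bar> :: real))"
  have K1: "K1 \<ge> 0" unfolding K1_def by (intro integral_nonneg_AE) auto
  define Q2 where "Q2 = c_sum * (2 * (exp (2 * M) * (4 * pi)))"
  define Q3 where "Q3 = c_sum * K1"
  have Q23: "Q2 \<ge> 0" "Q3 \<ge> 0" using c_sum_nonneg K1 by (auto simp: Q2_def Q3_def)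
  \<comment> \<open>The two error terms together stay strictly below d \<kappa> \<beta>^n0, hence
    below the other half d \<kappa> mP.\<close>
  define \<epsilon> where "\<epsilon> = d * \<kappa> * \<beta> ^ n0 / (2 * (Q2 + Q3 + 1))"
  have \<epsilon>: "\<epsilon> > 0" using w(1,2) \<beta> Q23 by (simp add: \<epsilon>_def)
  have \<epsilon>_less: "(Q2 + Q3) * (2 * \<epsilon>) < d * \<kappa> * \<beta> ^ n0"
  proof -
    have "(Q2 + Q3) * (2 * \<epsilon>) < (Q2 + Q3 + 1) * (2 * \<epsilon>)" using \<epsilon> by (intro mult_strict_right_mono) auto
    also have "\<dots> = d * \<kappa> * \<beta> ^ n0"
    proof -
      define q where "q = Q2 + Q3 + 1"
      have "q > 0" using Q23 by (simp add: q_def)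
      thus ?thesis unfolding \<epsilon>_def q_def[symmetric] by simp
    qed
    finally show ?thesis .
  qed
  have \<epsilon>': "Q2 * \<epsilon> + Q3 * \<epsilon> < d * \<kappa> * \<beta> ^ n0"
  proof -
    have "(Q2 + Q3) * (2 * \<epsilon>) = 2 * (Q2 * \<epsilon>) + 2 * (Q3 * \<epsilon>)" by (simp add: algebra_simps)
    moreover have "Q2 * \<epsilon> \<ge> 0" "Q3 * \<epsilon> \<ge> 0" using Q23 \<epsilon> by simp_all
    ultimately show ?thesis using \<epsilon>_less by linarith
  qed
  obtain C and N :: nat where C: "C > 0"
    "\<And>\<delta> t. 0 < \<delta> \<Longrightarrow> \<delta> \<le> 1 / 100 \<Longrightarrow>
       norm (F_series t) \<le> c_sum * (C / \<delta> ^ N * inverse_pochhammer_series (\<alpha> / 2) (8 * y / \<delta>)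
          * exp (- (pi / 2 - \<delta> / 2) * \<bar>t\<bar>))"
    by (rule F_series_bound) (rule that)
  define A where "A = 16 * (1 + y)"
  have A: "A > 0" using y_nonneg by (simp add: A_def)
  define b where "b = pi * \<alpha> / (36 * A)"
  have b: "b > 0" using A alpha_pos by (simp add: b_def)
  \<comment> \<open>The hypothesis on y enters here: 8 y \<le> pi \<alpha>/36, a third of the
    exponent pi \<alpha>/12 in \<open>theta_part_sup\<close>.\<close>
  have yb: "8 * y / A \<le> b" using assms A by (simp add: b_def field_simps)
  define c1 where "c1 = min 1 b / 6"
  have c1: "c1 > 0" "6 * c1 \<le> b" "6 * c1 \<le> 1" using b by (auto simp: c1_def)
  have small: "\<forall>\<^sub>F X in at_top. \<forall>D. real D \<le> 2 * c1 * X / ln X + real (2 * m0) \<longrightarrow>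
     moment_error \<alpha> y M (A / X) (X\<^sup>2) D \<le> \<epsilon> \<and>
     C / (A / X) ^ N * inverse_pochhammer_series (\<alpha> / 2) (8 * y / (A / X)) * (fact D * (8 / (A / X)) ^ D)
       * exp (- (A / X) * X\<^sup>2 / 8) * (8 / (A / X)) \<le> \<epsilon>"
    by (rule error_terms_small[OF alpha_pos y_nonneg M_nonneg C(1) \<epsilon> A_def b_def yb c1])
  have ev: "\<forall>\<^sub>F X in at_top. A / X \<le> 1 / 100" "\<forall>\<^sub>F X in at_top. X\<^sup>2 > 2 * L" "\<forall>\<^sub>F X in at_top. X > (1::real)"
    by real_asymp+
  have "\<forall>\<^sub>F X in at_top. c1 * (X / ln (X\<^sup>2)) \<le> real (card (Zr (X\<^sup>2)))"
    using small ev
  proof eventually_elim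
    case (elim X)
    show ?case
    proof (rule ccontr)
      define T where "T = X\<^sup>2"
      assume "\<not> c1 * (X / ln (X\<^sup>2)) \<le> real (card (Zr (X\<^sup>2)))"
      \<comment> \<open>ln(X^2) = 2 ln X halves the bound; the degree 4 card Z + 2 m0 is then at
        most 2 c1 X / ln X + 2 m0, as \<open>error_terms_small\<close> expects.\<close>
      hence few: "real (card (Zr T)) \<le> c1 * X / (2 * ln X)" using elim by (simp add: T_def ln_realpow)
      define \<delta> where "\<delta> = A / X"
      have \<delta>: "0 < \<delta>" "\<delta> \<le> 1 / 100" using A elim by (auto simp: \<delta>_def)
      have T: "T \<ge> 0" "T > 2 * L" using elim by (auto simp: T_def)
      have real: "F_series t = of_real (Re (F_series t))" for t using F_series_real[of t] by simp
      have Z0: "{t \<in> {0..<T}. Re (F_series t) = 0} \<subseteq> Zr T"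
        using real by (auto simp: Zr_def complex_eq_iff complex_is_Real_iff[symmetric] F_series_real)
      have "continuous_on UNIV (\<lambda>t. Re (F_series t))" by (intro continuous_intros continuous_F_series)
      from finite_zeros_sign_polynomial[OF this finite_subset[OF Z0 fin]] obtain Z \<sigma> where
        Z: "Z \<subseteq> {t \<in> {0..<T}. Re (F_series t) = 0}" "\<bar>\<sigma>\<bar> = 1"
          "\<And>t. t \<in> {0..<T} \<Longrightarrow> \<sigma> * Re (F_series t) * (\<Prod>x\<in>Z. t - x) \<ge> 0" by blast
      have ZT: "Z \<subseteq> Zr T" using Z(1) Z0 by blast
      have finZ: "finite Z" by (rule finite_subset[OF ZT fin])
      have Z0T: "Z \<subseteq> {0..T}" using ZT by (auto simp: Zr_def)
      have Zn0: "card {x \<in> Z. x < 4 * L} \<le> n0"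
        unfolding n0_def by (intro card_mono fin) (use ZT in \<open>auto simp: Zr_def\<close>)
      define rs where "rs = mirrored_roots (card Z + m0) Z"
      define mP where "mP = L ^ (2 * (card Z + m0)) * (\<Prod>x\<in>Z. if x < 4 * L then \<beta> else x\<^sup>2 - 4 * L\<^sup>2)"
      define W where "W = \<gamma> ^ n0 / 4 ^ m0 * mP"
      have Zpos: "x \<ge> 0" if "x \<in> Z" for x using that Z0T by auto
      note est = mirrored_roots_estimates[OF finZ Zpos Zn0 L(1) \<beta>]
      have mP: "mP \<ge> \<beta> ^ n0" unfolding mP_def by (rule est(1))
      hence mP0: "mP > 0" using \<beta>(1) by (metis less_le_trans zero_less_power)
      have len: "length rs = 4 * card Z + 2 * m0" by (simp add: rs_def length_mirrored_roots)
      have "real (length rs) \<le> 2 * c1 * X / ln X + real (2 * m0)"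
      proof -
        have "real (card Z) \<le> real (card (Zr T))" using ZT fin by (simp add: card_mono)
        hence "4 * real (card Z) \<le> 4 * (c1 * X / (2 * ln X))" using few by linarith
        also have "\<dots> = 2 * c1 * X / ln X" by simp
        finally show ?thesis by (simp add: len)
      qed
      with elim(1) have err: "moment_error \<alpha> y M \<delta> T (length rs) \<le> \<epsilon>"
        "C / \<delta> ^ N * inverse_pochhammer_series (\<alpha> / 2) (8 * y / \<delta>) * (fact (length rs) * (8 / \<delta>) ^ length rs)
         * exp (- \<delta> * T / 8) * (8 / \<delta>) \<le> \<epsilon>" unfolding \<delta>_def T_def by blast+
      define H where "H = c_sum * (C / \<delta> ^ N * inverse_pochhammer_series (\<alpha> / 2) (8 * y / \<delta>))"
      have "2 * d * \<kappa> * mP \<le>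
         c_sum * (2 * (exp (2 * M) * (8 * pi * exp y * W + 4 * pi * moment_error \<alpha> y M \<delta> T (length rs))))
         + H * (fact (length rs) * (8 / \<delta>) ^ length rs) * exp (- \<delta> * T / 8) * (8 / \<delta>) * (LINT u|lborel. exp (- \<bar>u\<bar> :: real))"
      proof (rule window_inequality[OF \<delta> T(1)])
        show "\<bar>x\<bar> \<le> T" if "x \<in> set rs" for x
          using that abs_mirrored_roots_le[OF finZ Z0T T(1)] by (simp add: rs_def)
        show "norm (poly (root_poly rs) w) \<le> W" if "norm w \<le> M + \<alpha> / 4" for w
          unfolding poly_root_poly W_def mP_def rs_def \<gamma>_def
          by (rule est(3)) (use that L(2) in auto)
        show "norm (F_series t) \<le> H * exp (- (pi / 2 - \<delta> / 2) * \<bar>t\<bar>)" for t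
          using C(2)[OF \<delta>, of t] by (simp add: H_def mult.assoc)
        show "H \<ge> 0" unfolding H_def using C(1) \<delta> c_sum_nonneg alpha_pos y_nonneg
          by (intro mult_nonneg_nonneg inverse_pochhammer_series(3)) auto
        show "\<bar>\<sigma>\<bar> = 1" by (rule Z(2))
        \<comment> \<open>By evenness everything is read at s = \<bar>t\<bar>. There the
          sign-matching product over \<open>Z\<close> splits off, and the cofactor, an even power
          times the product of s + x, is nonnegative.\<close>
        show "\<sigma> * Re (F_series t) * (\<Prod>x\<leftarrow>rs. t - x) \<ge> 0" if t: "\<bar>t\<bar> < T" for t
        proof -
          define s where "s = \<bar>t\<bar>"
          have s: "s \<in> {0..<T}" using t by (simp add: s_def)
          have Fs: "F_series t = F_series s" using F_series_minus[of t] by (simp add: s_def abs_if)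
          have "(\<Prod>x\<leftarrow>rs. t - of_real x) = t ^ (2 * (card Z + m0)) * (\<Prod>x\<in>Z. t\<^sup>2 - of_real (x\<^sup>2))"
            unfolding rs_def by (rule prod_mirrored_roots[OF finZ])
          also have "(\<Prod>x\<in>Z. t\<^sup>2 - of_real (x\<^sup>2)) = (\<Prod>x\<in>Z. s - x) * (\<Prod>x\<in>Z. s + x)"
            unfolding prod.distrib[symmetric] s_def
            by (intro prod.cong refl) (simp add: power2_eq_square algebra_simps flip: abs_mult)
          finally have "\<sigma> * Re (F_series t) * (\<Prod>x\<leftarrow>rs. t - x) =
             (\<sigma> * Re (F_series s) * (\<Prod>x\<in>Z. s - x)) * (t ^ (2 * (card Z + m0)) * (\<Prod>x\<in>Z. s + x))"
            by (simp add: Fs mult_ac)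
          also have "\<dots> \<ge> 0"
            by (rule mult_nonneg_nonneg[OF Z(3)[OF s]], intro mult_nonneg_nonneg zero_le_even_power prod_nonneg)
              (use s Zpos in auto)
          finally show ?thesis .
        qed
        show "mP \<le> \<bar>\<Prod>x\<leftarrow>rs. t - x\<bar>" if t: "\<bar>t - t1\<bar> \<le> d" for t
          unfolding mP_def rs_def
        proof (rule est(2))
          show "\<bar>t - x\<bar> \<ge> d" if "x \<in> Z" for x using w(6)[OF t, of x] ZT that by (auto simp: Zr_def)
        qed (use t w(3,4) in auto)
      qed (use w L T mP0 in auto)
      also have "\<dots> = Q / 4 ^ m0 * mP + Q2 * moment_error \<alpha> y M \<delta> T (length rs)
         + Q3 * (C / \<delta> ^ N * inverse_pochhammer_series (\<alpha> / 2) (8 * y / \<delta>) * (fact (length rs) * (8 / \<delta>) ^ length rs)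
         * exp (- \<delta> * T / 8) * (8 / \<delta>))"
        unfolding W_def Q_def Q2_def Q3_def H_def K1_def[symmetric] by (simp add: algebra_simps)
      finally have fin_ineq: "2 * d * \<kappa> * mP \<le> Q / 4 ^ m0 * mP + Q2 * moment_error \<alpha> y M \<delta> T (length rs)
         + Q3 * (C / \<delta> ^ N * inverse_pochhammer_series (\<alpha> / 2) (8 * y / \<delta>) * (fact (length rs) * (8 / \<delta>) ^ length rs)
         * exp (- \<delta> * T / 8) * (8 / \<delta>))" .
      have "Q / 4 ^ m0 * mP \<le> d * \<kappa> * mP" by (intro mult_right_mono Q less_imp_le[OF mP0])
      moreover have "Q2 * moment_error \<alpha> y M \<delta> T (length rs) \<le> Q2 * \<epsilon>" by (intro mult_left_mono err Q23)
      moreover have "Q3 * (C / \<delta> ^ N * inverse_pochhammer_series (\<alpha> / 2) (8 * y / \<delta>) * (fact (length rs) * (8 / \<delta>) ^ length rs)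
         * exp (- \<delta> * T / 8) * (8 / \<delta>)) \<le> Q3 * \<epsilon>" by (intro mult_left_mono err Q23)
      moreover have "d * \<kappa> * \<beta> ^ n0 \<le> d * \<kappa> * mP" using w(1,2) mP by (intro mult_left_mono) auto
      moreover have "2 * d * \<kappa> * mP = d * \<kappa> * mP + d * \<kappa> * mP" by simp
      ultimately show False using fin_ineq \<epsilon>' by linarith
    qed
  qed
  hence "\<forall>\<^sub>F T in at_top. c1 * (sqrt T / ln ((sqrt T)\<^sup>2)) \<le> real (card (Zr ((sqrt T)\<^sup>2)))"
    by (rule eventually_compose_filterlim[OF _ sqrt_at_top])
  moreover have "\<forall>\<^sub>F T in at_top. T \<ge> (0::real)" by (rule eventually_ge_at_top)
  ultimately have "\<forall>\<^sub>F T in at_top. c1 * (sqrt T / ln T) \<le> real (card (Zr T))"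
    by eventually_elim simp
  hence "\<forall>\<^sub>F T in at_top. finite {t \<in> {0..T}. F_series t = 0} \<longrightarrow>
      c1 * (sqrt T / ln T) \<le> real (card {t \<in> {0..T}. F_series t = 0})"
    by (rule eventually_mono) (simp add: Zr_def)
  thus ?thesis using c1(1) by blast
qed

end

theorem theorem1p1:
  fixes \<alpha> z :: real and c l :: "nat \<Rightarrow> real"
  assumes "\<alpha> > 0"
    and "(\<lambda>j. \<bar>c j\<bar>) summable_on {1..}"
    and "bounded (l ` {1..})"
    and "Sup (l ` {1..}) \<in> l ` {1..}"
    and "Inf (l ` {1..}) \<in> l ` {1..}"
    and "- (1 / 6) * sqrt (pi * \<alpha> / 2) \<le> z"
    and "z \<le> 1 / 6 * sqrt (pi * \<alpha> / 2)"
  shows "\<exists>C>0. Liminf at_top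
           (\<lambda>T :: real. ereal_of_enat (N_zeros c l z \<alpha> T) / ereal (sqrt T / ln T)) \<ge> ereal C"
proof -
  obtain M where "\<forall>x\<in>l ` {1..}. norm x \<le> M" using assms(3) unfolding bounded_iff by blast
  hence M: "\<bar>l (Suc n)\<bar> \<le> M" for n by auto
  have M0: "M \<ge> 0" using M[of 0] by linarith
  interpret shifted_Phi_series \<alpha> "z\<^sup>2 / 4" M "\<lambda>n. c (Suc n)" "\<lambda>n. l (Suc n)"
    by (rule F_tilde_critical_line(1)[where c = c and l = l and M = M, OF assms(1,2) M M0])
  have F: "F_tilde c l z \<alpha> (of_real (\<alpha> / 4) + \<i> * of_real t) = F_series t" for t
    by (rule F_tilde_critical_line(2)[where c = c and l = l and M = M, OF assms(1,2) M M0])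
  have "\<bar>z\<bar> \<le> 1 / 6 * sqrt (pi * \<alpha> / 2)" using assms(6,7) by auto
  hence "\<bar>z\<bar>\<^sup>2 \<le> (1 / 6 * sqrt (pi * \<alpha> / 2))\<^sup>2" by (intro power_mono) auto
  \<comment> \<open>(1/36) (pi \<alpha>/2) = pi \<alpha>/72, and a quarter of it is pi
    \<alpha>/288.\<close>
  hence "z\<^sup>2 / 4 \<le> pi * \<alpha> / 288" using assms(1) by (simp add: power_mult_distrib power_divide)
  from many_zeros[OF this] obtain C where C: "C > 0" "\<forall>\<^sub>F T in at_top. finite {t \<in> {0..T}. F_series t = 0} \<longrightarrow>
      C * (sqrt T / ln T) \<le> real (card {t \<in> {0..T}. F_series t = 0})" by blast
  define g where "g = (\<lambda>t. complex_of_real (\<alpha> / 4) + \<i> * of_real t)"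
  have inj: "inj_on g A" for A by (auto simp: inj_on_def g_def)
  have Z: "{s. F_tilde c l z \<alpha> s = 0 \<and> (\<exists>t. 0 \<le> t \<and> t \<le> T \<and> s = of_real (\<alpha> / 4) + \<i> * of_real t)}
     = g ` {t \<in> {0..T}. F_series t = 0}" for T
    using F by (auto simp: g_def)
  have N: "N_zeros c l z \<alpha> T = (if finite {t \<in> {0..T}. F_series t = 0} then enat (card {t \<in> {0..T}. F_series t = 0}) else \<infinity>)" for T
    unfolding N_zeros_def Z Let_def by (simp add: card_image[OF inj] finite_image_iff[OF inj])
  have "\<forall>\<^sub>F T in at_top. ereal_of_enat (N_zeros c l z \<alpha> T) / ereal (sqrt T / ln T) \<ge> ereal C"
    using C(2) eventually_gt_at_top[of 1]
  proof eventually_elim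
    case (elim T)
    define r where "r = sqrt T / ln T"
    have r: "r > 0" using elim(2) by (simp add: r_def)
    show ?case
    proof (cases "finite {t \<in> {0..T}. F_series t = 0}")
      case True
      define n where "n = card {t \<in> {0..T}. F_series t = 0}"
      have "N_zeros c l z \<alpha> T = enat n" by (simp only: N True if_True n_def)
      moreover have "C \<le> real n / r"
        unfolding pos_le_divide_eq[OF r] using elim(1) True unfolding r_def n_def by blast
      ultimately show ?thesis using r by (simp add: r_def[symmetric])
    next
      case False
      hence "N_zeros c l z \<alpha> T = \<infinity>" by (simp only: N if_False)
      thus ?thesis using r by (simp add: r_def[symmetric])
    qed
  qed
  hence "Liminf at_top (\<lambda>T :: real. ereal_of_enat (N_zeros c l z \<alpha> T) / ereal (sqrt T / ln T)) \<ge> ereal C"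
    by (rule Liminf_bounded)
  with C(1) show ?thesis by blast
qed

end
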